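(* Let $d\ge2$ and let $D$ be a regular simplex (respectively: a hypercube, a ball) in $\mathbb{R}^d$. For each $n\ge1$, among all simplexes (respectively: parallelepipeds, ellipsoids) of the form $T(D)$ with $T$ an invertible linear transformation of $\mathbb{R}^d$, the quantity $$Q_n(T)=\big(\lambda_1(T(D))+\dots+\lambda_n(T(D))\big)\,V(T(D))^{2/d}\cdot\frac{V\big(T^{-\dagger}(D)\big)^{1+2/d}}{I\big(T^{-\dagger}(D)\big)}$$ is maximal when $T(D)$ is a regular simplex (respectively: hypercube, ball); that is, $Q_n(T)\le Q_n(T_0)$ for every invertible linear $T$ and every invertible linear $T_0$ such that $T_0(D)$ is a regular simplex (respectively: hypercube, ball), in particular for $T_0$ the identity. The same result holds with the Dirichlet eigenvalues $\lambda_j$ replaced by the Neumann eigenvalues $\mu_j$.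
   Context: Simplexes, parallelepipeds and ellipsoids are understood as bounded open solid domains in $\mathbb{R}^d$. For a bounded domain $\Omega\subset\mathbb{R}^d$: $V(\Omega)$ is its volume; $I(\Omega)=\int_\Omega|x-\overline{x}|^2\,dx$ is its second moment of mass about the centroid $\overline{x}=\int_\Omega x\,dx/V(\Omega)$. The Dirichlet eigenvalues of the Laplacian $0<\lambda_1(\Omega)<\lambda_2(\Omega)\le\lambda_3(\Omega)\le\cdots$ are those of $-\Delta u=\lambda u$ in $\Omega$, $u=0$ on $\partial\Omega$; for $\Omega$ with Lipschitz boundary, the Neumann eigenvalues $0=\mu_1(\Omega)<\mu_2(\Omega)\le\mu_3(\Omega)\le\cdots$ are those of $-\Delta u=\mu u$ in $\Omega$, $\partial u/\partial n=0$ on $\partial\Omega$; all are repeated according to multiplicity and understood in the weak sense ($H^1_0(\Omega)$ and $H^1(\Omega)$ respectively). $M^\dagger$ denotes the transpose of a matrix $M$ and $T^{-\dagger}=(T^{-1})^\dagger$. *)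

theory Defs
  imports "HOL-Analysis.Analysis"
begin

section \<open>Volume and second moment of mass\<close>

abbreviation vol :: "(real^'n) set \<Rightarrow> real" where
  "vol \<Omega> \<equiv> measure lebesgue \<Omega>"

definition centroid :: "(real^'n) set \<Rightarrow> real^'n" where
  "centroid \<Omega> = (1 / vol \<Omega>) *\<^sub>R integral\<^sup>L (lebesgue_on \<Omega>) (\<lambda>x. x)"

definition second_moment :: "(real^'n) set \<Rightarrow> real" where
  "second_moment \<Omega> = integral\<^sup>L (lebesgue_on \<Omega>) (\<lambda>x. (norm (x - centroid \<Omega>))\<^sup>2)"


section \<open>Regular simplexes, hypercubes and balls as open solids\<close>

definition regular_simplex :: "(real^'n) set \<Rightarrow> bool" where
  "regular_simplex D \<longleftrightarrow>
     (\<exists>C s. \<not> affine_dependent C \<and> card C = CARD('n) + 1 \<and>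
        (\<forall>x\<in>C. \<forall>y\<in>C. x \<noteq> y \<longrightarrow> dist x y = s) \<and>
        D = interior (convex hull C))"

definition hypercube :: "(real^'n) set \<Rightarrow> bool" where
  "hypercube D \<longleftrightarrow>
     (\<exists>a (f :: real^'n \<Rightarrow> real^'n) s. orthogonal_transformation f \<and> s > 0 \<and>
        D = (\<lambda>x. a + f x) ` box (vec 0) (vec s))"

definition solid_ball :: "(real^'n) set \<Rightarrow> bool" where
  "solid_ball D \<longleftrightarrow> (\<exists>c r. r > 0 \<and> D = ball c r)"


section \<open>Sobolev spaces\<close>

definition partial_deriv :: "'n::finite \<Rightarrow> (real^'n \<Rightarrow> real) \<Rightarrow> real^'n \<Rightarrow> real" where
  "partial_deriv i f x = frechet_derivative f (at x) (axis i 1)"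

text \<open>Differentiability of all iterated partial derivatives makes each of them continuous,
  so the following is the usual class of infinitely differentiable functions.\<close>

definition smooth :: "(real^'n::finite \<Rightarrow> real) \<Rightarrow> bool" where
  "smooth f \<longleftrightarrow> (\<forall>is. foldr partial_deriv is f differentiable_on UNIV)"

definition test_functions :: "(real^'n::finite) set \<Rightarrow> (real^'n \<Rightarrow> real) set" where
  "test_functions \<Omega> = {\<phi>. smooth \<phi> \<and> compact (closure {x. \<phi> x \<noteq> 0}) \<and> closure {x. \<phi> x \<noteq> 0} \<subseteq> \<Omega>}"

text \<open>Elements of the function spaces below are functions on the whole space, of which only the
  restriction to \<open>\<Omega>\<close> matters; they are not quotiented by almost everywhere equality.\<close>

definition L2 :: "(real^'n::finite) set \<Rightarrow> (real^'n \<Rightarrow> 'b::real_normed_vector) set" where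
  "L2 \<Omega> = {u. u \<in> borel_measurable (lebesgue_on \<Omega>) \<and>
              integrable (lebesgue_on \<Omega>) (\<lambda>x. (norm (u x))\<^sup>2)}"

definition is_weak_grad ::
  "(real^'n::finite) set \<Rightarrow> (real^'n \<Rightarrow> real) \<Rightarrow> (real^'n \<Rightarrow> real^'n) \<Rightarrow> bool" where
  "is_weak_grad \<Omega> u g \<longleftrightarrow>
     (\<forall>\<phi>\<in>test_functions \<Omega>. \<forall>i.
        integral\<^sup>L (lebesgue_on \<Omega>) (\<lambda>x. u x * partial_deriv i \<phi> x) =
        - integral\<^sup>L (lebesgue_on \<Omega>) (\<lambda>x. g x $ i * \<phi> x))"

definition H1 :: "(real^'n::finite) set \<Rightarrow> (real^'n \<Rightarrow> real) set" where
  "H1 \<Omega> = {u \<in> L2 \<Omega>. \<exists>g\<in>L2 \<Omega>. is_weak_grad \<Omega> u g}"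

text \<open>For \<open>u \<in> H1 \<Omega>\<close> with \<open>\<Omega>\<close> open, the weak gradient is determined up to a null set, so integrals
  involving it do not depend on the choice.\<close>

definition weak_grad :: "(real^'n::finite) set \<Rightarrow> (real^'n \<Rightarrow> real) \<Rightarrow> real^'n \<Rightarrow> real^'n" where
  "weak_grad \<Omega> u = (SOME g. g \<in> L2 \<Omega> \<and> is_weak_grad \<Omega> u g)"

definition H1_norm :: "(real^'n::finite) set \<Rightarrow> (real^'n \<Rightarrow> real) \<Rightarrow> real" where
  "H1_norm \<Omega> u =
     sqrt (integral\<^sup>L (lebesgue_on \<Omega>) (\<lambda>x. (u x)\<^sup>2) +
           integral\<^sup>L (lebesgue_on \<Omega>) (\<lambda>x. (norm (weak_grad \<Omega> u x))\<^sup>2))"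

definition H10 :: "(real^'n::finite) set \<Rightarrow> (real^'n \<Rightarrow> real) set" where
  "H10 \<Omega> = {u \<in> H1 \<Omega>. \<forall>e>0. \<exists>\<phi>\<in>test_functions \<Omega>. H1_norm \<Omega> (\<lambda>x. u x - \<phi> x) < e}"


section \<open>Eigenvalues of the Laplacian\<close>

text \<open>The parameter \<open>W\<close> is the form domain, which encodes the boundary condition.  The eigenspace
  contains all almost everywhere vanishing functions.\<close>

definition weak_eigenspace ::
  "(real^'n::finite) set \<Rightarrow> (real^'n \<Rightarrow> real) set \<Rightarrow> real \<Rightarrow> (real^'n \<Rightarrow> real) set" where
  "weak_eigenspace \<Omega> W t = {u \<in> W. \<forall>v\<in>W.
     integral\<^sup>L (lebesgue_on \<Omega>) (\<lambda>x. weak_grad \<Omega> u x \<bullet> weak_grad \<Omega> v x) =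
     t * integral\<^sup>L (lebesgue_on \<Omega>) (\<lambda>x. u x * v x)}"

text \<open>\<open>E\<close>, taken modulo equality almost everywhere on \<open>\<Omega>\<close>, has a basis of \<open>m\<close> elements.\<close>

definition has_dim_AE :: "(real^'n::finite) set \<Rightarrow> (real^'n \<Rightarrow> real) set \<Rightarrow> nat \<Rightarrow> bool" where
  "has_dim_AE \<Omega> E m \<longleftrightarrow>
     (\<exists>b. (\<forall>i<m. b i \<in> E) \<and>
        (\<forall>c. (AE x in lebesgue_on \<Omega>. (\<Sum>i<m. c i * b i x) = 0) \<longrightarrow> (\<forall>i<m. c i = 0)) \<and>
        (\<forall>u\<in>E. \<exists>c. AE x in lebesgue_on \<Omega>. u x = (\<Sum>i<m. c i * b i x)))"

text \<open>The nondecreasing sequence in which every real \<open>t\<close> occurs exactly as often as the dimension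
  of its eigenspace (so not at all if \<open>t\<close> is not an eigenvalue).  There is at most one such
  sequence, and on the domains considered here there is one, as the spectrum is discrete.\<close>

definition eigenvalue_seq ::
  "(real^'n::finite) set \<Rightarrow> (real^'n \<Rightarrow> real) set \<Rightarrow> nat \<Rightarrow> real" where
  "eigenvalue_seq \<Omega> W =
     (THE l. mono l \<and>
        (\<forall>t. finite {j. l j = t} \<and> has_dim_AE \<Omega> (weak_eigenspace \<Omega> W t) (card {j. l j = t})))"

text \<open>The eigenvalues are numbered from 1.\<close>

definition dirichlet_eigenvalue :: "(real^'n::finite) set \<Rightarrow> nat \<Rightarrow> real" where
  "dirichlet_eigenvalue \<Omega> j = eigenvalue_seq \<Omega> (H10 \<Omega>) (j - 1)"

definition neumann_eigenvalue :: "(real^'n::finite) set \<Rightarrow> nat \<Rightarrow> real" where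
  "neumann_eigenvalue \<Omega> j = eigenvalue_seq \<Omega> (H1 \<Omega>) (j - 1)"


section \<open>The functional\<close>

text \<open>The argument \<open>ev\<close> is \<open>dirichlet_eigenvalue\<close> or \<open>neumann_eigenvalue\<close>.\<close>

definition Q ::
  "((real^'n::finite) set \<Rightarrow> nat \<Rightarrow> real) \<Rightarrow> (real^'n) set \<Rightarrow> nat \<Rightarrow> real^'n^'n \<Rightarrow> real" where
  "Q ev D n T =
     (let d = real CARD('n);
          TD = (*v) T ` D;
          TD' = (*v) (transpose (matrix_inv T)) ` D
      in (\<Sum>j=1..n. ev TD j) * vol TD powr (2 / d) *
         (vol TD' powr (1 + 2 / d) / second_moment TD'))"

end

theory Submission
  imports Defs "HOL-Complex_Analysis.Great_Picard"
begin

text \<open>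
  Let \<open>e j\<close> be orthonormal eigenfunctions of \<open>D\<close> and \<open>U\<close> an isometry of \<open>D\<close>.  The functions
  \<open>e j \<circ> U \<circ> T\<^sup>-\<^sup>1\<close>, up to a constant factor, are orthonormal trial functions on \<open>T(D)\<close>, so the sum of
  their Rayleigh quotients bounds the sum of the first eigenvalues of \<open>T(D)\<close> from above.
  The symmetry group of \<open>D\<close> is irreducible, so averaging over it turns the quadratic form
  \<open>|T\<^sup>-\<^sup>\<dagger> v|\<^sup>2\<close> of the gradient into \<open>\<parallel>T\<^sup>-\<^sup>1\<parallel>\<^sup>2 |v|\<^sup>2 / d\<close> with the Hilbert--Schmidt norm.  By the same symmetry
  the second moment of \<open>T\<^sup>-\<^sup>\<dagger>(D)\<close> is a multiple of \<open>|det T|\<^sup>-\<^sup>1 \<parallel>T\<^sup>-\<^sup>1\<parallel>\<^sup>2\<close>, and the two norms cancel.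

  Since the eigenvalues are defined by their multiplicities, the discreteness of the spectrum and
  the variational principle are needed first.  Eigenfunctions are found by successive minimisation of
  the Rayleigh quotient, with compactness from a Poincare inequality on the convex cells that a
  cubic grid cuts out of the domain.\<close>

section \<open>Forms with discrete spectrum\<close>

text \<open>The competitor \<open>T\<^sub>0\<close> is not assumed to be a similarity. The trace
  inequality is therefore proved once for an arbitrary symmetric body and applied with the image of
  \<open>D\<close> under \<open>T\<^sub>0\<close> as base and \<open>T ** S\<^sub>0\<close> as map,
  \<open>S\<^sub>0\<close> being the inverse of \<open>T\<^sub>0\<close>. That
  \<open>T\<^sub>0\<close> is a similarity comes out of the second moments of both bodies, and it
  makes the bound sharp at \<open>T\<^sub>0\<close>. One finite group serves each shape: the
  symmetric group for the simplex, the hyperoctahedral group for cube and ball. All averages are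
  thus finite sums, and irreducibility is used in the form that an invariant bilinear form is a
  multiple of the inner product, for gradients and for second moments alike. All domains are affine
  images of convex sets, hence convex. Convexity gives a Poincare inequality by contraction towards
  a point, with a constant that depends only on dimension and diameter. It survives cutting by a
  grid, so compactness follows for Dirichlet and Neumann forms at once. Since gradients exist only
  weakly, the estimates are obtained by duality with test functions.\<close>

lemma first_variation_eq_0:
  fixes p q :: real
  assumes "\<And>t. 0 \<le> 2 * t * p + t\<^sup>2 * q" "q \<ge> 0"
  shows "p = 0"
proof (cases "q = 0")
  case True
  then show ?thesis using assms(1)[of 1] assms(1)[of "-1"] by simp
next
  case False
  have "0 \<le> 2 * (-p/q) * p + (-p/q)\<^sup>2 * q" by (rule assms)
  also have "\<dots> = - (p\<^sup>2 / q)" using False by (simp add: power2_eq_square field_simps)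
  finally have "p\<^sup>2 / q \<le> 0" by simp
  then show ?thesis using False assms(2)
    by (smt (verit) divide_pos_pos zero_less_power2)
qed

text \<open>The form need not be definite: functions are not identified when they agree almost everywhere.\<close>

locale psd_form =
  fixes W :: "('x \<Rightarrow> real) set" and b :: "('x \<Rightarrow> real) \<Rightarrow> ('x \<Rightarrow> real) \<Rightarrow> real"
  assumes zero_in: "(\<lambda>x. 0) \<in> W"
    and lin_in: "u \<in> W \<Longrightarrow> v \<in> W \<Longrightarrow> (\<lambda>x. u x + c * v x) \<in> W"
    and sym: "u \<in> W \<Longrightarrow> v \<in> W \<Longrightarrow> b u v = b v u"
    and lin_left: "u \<in> W \<Longrightarrow> v \<in> W \<Longrightarrow> w \<in> W \<Longrightarrow> b (\<lambda>x. u x + c * v x) w = b u w + c * b v w"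
    and nonneg: "u \<in> W \<Longrightarrow> b u u \<ge> 0"
begin

lemma lin_right: "u \<in> W \<Longrightarrow> v \<in> W \<Longrightarrow> w \<in> W \<Longrightarrow> b w (\<lambda>x. u x + c * v x) = b w u + c * b w v"
  using sym[of w u] sym[of w v] sym[of w "\<lambda>x. u x + c * v x"] lin_in[of u v c] lin_left[of u v w c] by simp

lemma add_in: "u \<in> W \<Longrightarrow> v \<in> W \<Longrightarrow> (\<lambda>x. u x + v x) \<in> W"
  using lin_in[of u v 1] by simp

lemma diff_in: "u \<in> W \<Longrightarrow> v \<in> W \<Longrightarrow> (\<lambda>x. u x - v x) \<in> W"
  using lin_in[of u v "-1"] by simp

lemma scale_in: "v \<in> W \<Longrightarrow> (\<lambda>x. c * v x) \<in> W"
  using lin_in[OF zero_in, of v c] by simp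

lemma zero_left: "w \<in> W \<Longrightarrow> b (\<lambda>x. 0) w = 0"
  using lin_left[OF zero_in zero_in, of w "1"] by simp

lemma scale_left: "v \<in> W \<Longrightarrow> w \<in> W \<Longrightarrow> b (\<lambda>x. c * v x) w = c * b v w"
  using lin_left[OF zero_in, of v w c] by (simp add: zero_left)

lemma add_left: "u \<in> W \<Longrightarrow> v \<in> W \<Longrightarrow> w \<in> W \<Longrightarrow> b (\<lambda>x. u x + v x) w = b u w + b v w"
  using lin_left[of u v w 1] by simp

lemma diff_left: "u \<in> W \<Longrightarrow> v \<in> W \<Longrightarrow> w \<in> W \<Longrightarrow> b (\<lambda>x. u x - v x) w = b u w - b v w"
  using lin_left[of u v w "-1"] by simp

lemma lin_square:
  assumes "u \<in> W" "v \<in> W"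
  shows "b (\<lambda>x. u x + c * v x) (\<lambda>x. u x + c * v x) = b u u + 2 * c * b u v + c\<^sup>2 * b v v"
  using assms by (simp add: lin_left lin_right lin_in sym[of v u] algebra_simps power2_eq_square)

lemma diff_square:
  assumes "u \<in> W" "v \<in> W"
  shows "b (\<lambda>x. u x - v x) (\<lambda>x. u x - v x) = b u u - 2 * b u v + b v v"
  using lin_square[OF assms, of "-1"] by simp

lemma scale_square: "v \<in> W \<Longrightarrow> b (\<lambda>x. c * v x) (\<lambda>x. c * v x) = c\<^sup>2 * b v v"
  using lin_square[OF zero_in, of v c] by (simp add: zero_left zero_in)

lemma parallelogram:
  assumes "u \<in> W" "v \<in> W"
  shows "b (\<lambda>x. u x - v x) (\<lambda>x. u x - v x) + b (\<lambda>x. u x + v x) (\<lambda>x. u x + v x) = 2 * b u u + 2 * b v v"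
  using lin_square[OF assms, of "-1"] lin_square[OF assms, of 1] by simp

text \<open>Semidefiniteness leaves the case \<open>b v v = 0\<close> with \<open>v\<close> nonzero.
  There the square of \<open>u + c v\<close> is affine in \<open>c\<close> and nonnegative, so its
  slope vanishes; otherwise the minimising \<open>c\<close> gives the inequality.\<close>

lemma Cauchy_Schwarz:
  assumes "u \<in> W" "v \<in> W"
  shows "(b u v)\<^sup>2 \<le> b u u * b v v"
proof (cases "b v v = 0")
  case True
  have "b v u = 0"
  proof (rule ccontr)
    assume n: "b v u \<noteq> 0"
    define c where "c = - (b u u + 1) / (2 * b v u)"
    have "0 \<le> b u u + 2 * c * b u v + c\<^sup>2 * b v v"
      using nonneg[OF lin_in[OF assms, of c]] lin_square[OF assms, of c] by simp
    also have "\<dots> = -1" using n True sym[OF assms] by (simp add: c_def field_simps)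
    finally show False by simp
  qed
  then show ?thesis using True sym[OF assms] by simp
next
  case False
  define c where "c = - b u v / b v v"
  have "0 \<le> b u u + 2 * c * b u v + c\<^sup>2 * b v v"
    using nonneg[OF lin_in[OF assms, of c]] lin_square[OF assms, of c] by simp
  also have "\<dots> = b u u - (b u v)\<^sup>2 / b v v"
    using False by (simp add: c_def field_simps power2_eq_square)
  finally show ?thesis using False nonneg[OF assms(2)] by (simp add: field_simps)
qed

lemma Cauchy_Schwarz_sqrt:
  assumes "u \<in> W" "v \<in> W"
  shows "\<bar>b u v\<bar> \<le> sqrt (b u u) * sqrt (b v v)"
  using Cauchy_Schwarz[OF assms] by (metis real_sqrt_abs real_sqrt_le_mono real_sqrt_mult)

lemma add_square_le:
  assumes "u \<in> W" "v \<in> W"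
  shows "b (\<lambda>x. u x + v x) (\<lambda>x. u x + v x) \<le> 2 * b u u + 2 * b v v"
  using parallelogram[OF assms] nonneg[OF diff_in[OF assms]] by simp

lemma diff_square_le:
  assumes "u \<in> W" "v \<in> W"
  shows "b (\<lambda>x. u x - v x) (\<lambda>x. u x - v x) \<le> 2 * b u u + 2 * b v v"
  using parallelogram[OF assms] nonneg[OF add_in[OF assms]] by simp

lemma sum_in:
  assumes "finite J" "\<And>j. j \<in> J \<Longrightarrow> f j \<in> W"
  shows "(\<lambda>x. \<Sum>j\<in>J. c j * f j x) \<in> W"
  using assms
proof (induction J)
  case empty
  then show ?case using zero_in by simp
next
  case (insert j J)
  then have "(\<lambda>x. (\<Sum>j\<in>J. c j * f j x) + c j * f j x) \<in> W" by (intro lin_in) auto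
  then show ?case using insert by (simp add: add.commute)
qed

lemma sum_left:
  assumes "finite J" "\<And>j. j \<in> J \<Longrightarrow> f j \<in> W" "w \<in> W"
  shows "b (\<lambda>x. \<Sum>j\<in>J. c j * f j x) w = (\<Sum>j\<in>J. c j * b (f j) w)"
  using assms
proof (induction J)
  case empty
  then show ?case using zero_left by simp
next
  case (insert j J)
  then have "b (\<lambda>x. (\<Sum>j\<in>J. c j * f j x) + c j * f j x) w
     = b (\<lambda>x. \<Sum>j\<in>J. c j * f j x) w + c j * b (f j) w"
    by (intro lin_left sum_in) auto
  then show ?case using insert by (simp add: add.commute)
qed

lemma sum_right:
  assumes "finite J" "\<And>j. j \<in> J \<Longrightarrow> f j \<in> W" "w \<in> W"
  shows "b w (\<lambda>x. \<Sum>j\<in>J. c j * f j x) = (\<Sum>j\<in>J. c j * b w (f j))"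
proof -
  have "b w (\<lambda>x. \<Sum>j\<in>J. c j * f j x) = b (\<lambda>x. \<Sum>j\<in>J. c j * f j x) w"
    using assms by (intro sym sum_in) auto
  also have "\<dots> = (\<Sum>j\<in>J. c j * b (f j) w)" using assms by (rule sum_left)
  also have "\<dots> = (\<Sum>j\<in>J. c j * b w (f j))" using assms by (intro sum.cong) (auto simp: sym)
  finally show ?thesis .
qed

lemma tendsto_left:
  assumes f: "\<And>n. f n \<in> W" and u: "u \<in> W" and w: "w \<in> W"
    and lim: "(\<lambda>n. b (\<lambda>x. f n x - u x) (\<lambda>x. f n x - u x)) \<longlonglongrightarrow> 0"
  shows "(\<lambda>n. b (f n) w) \<longlonglongrightarrow> b u w"
proof -
  have "(\<lambda>n. b (f n) w - b u w) \<longlonglongrightarrow> 0"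
  proof (rule Lim_null_comparison)
    show "\<forall>\<^sub>F n in sequentially. norm (b (f n) w - b u w)
       \<le> sqrt (b (\<lambda>x. f n x - u x) (\<lambda>x. f n x - u x)) * sqrt (b w w)"
      using Cauchy_Schwarz_sqrt[OF diff_in[OF f u] w] by (auto simp: diff_left f u w)
    have "(\<lambda>n. sqrt (b (\<lambda>x. f n x - u x) (\<lambda>x. f n x - u x)) * sqrt (b w w)) \<longlonglongrightarrow> sqrt 0 * sqrt (b w w)"
      by (intro tendsto_intros lim)
    then show "(\<lambda>n. sqrt (b (\<lambda>x. f n x - u x) (\<lambda>x. f n x - u x)) * sqrt (b w w)) \<longlonglongrightarrow> 0" by simp
  qed
  then show ?thesis by (simp add: LIM_zero_iff)
qed

lemma tendsto_square:
  assumes f: "\<And>n. f n \<in> W" and u: "u \<in> W"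
    and lim: "(\<lambda>n. b (\<lambda>x. f n x - u x) (\<lambda>x. f n x - u x)) \<longlonglongrightarrow> 0"
  shows "(\<lambda>n. b (f n) (f n)) \<longlonglongrightarrow> b u u"
proof -
  have "(\<lambda>n. b (\<lambda>x. f n x - u x) (\<lambda>x. f n x - u x) + 2 * b (f n) u - b u u) \<longlonglongrightarrow> 0 + 2 * b u u - b u u"
    by (intro tendsto_intros lim tendsto_left f u)
  moreover have "b (\<lambda>x. f n x - u x) (\<lambda>x. f n x - u x) + 2 * b (f n) u - b u u = b (f n) (f n)" for n
    by (simp add: diff_square f u)
  ultimately show ?thesis by simp
qed

end

text \<open>A spectral setting with compact resolvent, up to null vectors: \<open>W\<close> is
  complete in the norm of \<open>a + b\<close>, sequences bounded in that norm are precompact for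
  \<open>b\<close>, and orthonormal families of every finite size exist, so that the sequence of
  eigenvalues does not stop.\<close>

locale discrete_form = B: psd_form W b + A: psd_form W a
  for W :: "('x \<Rightarrow> real) set" and a b :: "('x \<Rightarrow> real) \<Rightarrow> ('x \<Rightarrow> real) \<Rightarrow> real" +
  assumes complete: "(\<And>n. f n \<in> W) \<Longrightarrow>
      (\<And>e. e > 0 \<Longrightarrow> \<exists>N. \<forall>m\<ge>N. \<forall>n\<ge>N. a (\<lambda>x. f m x - f n x) (\<lambda>x. f m x - f n x)
         + b (\<lambda>x. f m x - f n x) (\<lambda>x. f m x - f n x) < e) \<Longrightarrow>
      \<exists>u\<in>W. (\<lambda>n. a (\<lambda>x. f n x - u x) (\<lambda>x. f n x - u x)) \<longlonglongrightarrow> 0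
         \<and> (\<lambda>n. b (\<lambda>x. f n x - u x) (\<lambda>x. f n x - u x)) \<longlonglongrightarrow> 0"
    and compact: "(\<And>n. f n \<in> W) \<Longrightarrow> (\<And>n. a (f n) (f n) + b (f n) (f n) \<le> C) \<Longrightarrow>
      \<exists>r. strict_mono (r :: nat \<Rightarrow> nat) \<and> (\<forall>e>0. \<exists>N. \<forall>m\<ge>N. \<forall>n\<ge>N.
         b (\<lambda>x. f (r m) x - f (r n) x) (\<lambda>x. f (r m) x - f (r n) x) < e)"
    and infinite_dim: "\<exists>v. \<forall>i<(n::nat). v i \<in> W \<and> (\<forall>j<n. b (v i) (v j) = of_bool (i = j))"
begin

text \<open>The direct method without weak limits: compactness makes a minimising sequence Cauchy
  for \<open>b\<close>, and the parallelogram law together with minimality of \<open>l\<close>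
  carries this over to \<open>a\<close>. The limit stays in \<open>V\<close>, which is cut out by
  functionals continuous for \<open>b\<close>.\<close>

lemma minimizer:
  fixes e :: "nat \<Rightarrow> 'x \<Rightarrow> real" and k :: nat
  assumes e: "\<And>j. j < k \<Longrightarrow> e j \<in> W"
  defines "V \<equiv> {v \<in> W. \<forall>j<k. b v (e j) = 0}"
  assumes ex: "v0 \<in> V" "b v0 v0 > 0"
  shows "\<exists>u\<in>V. b u u = 1 \<and> (\<forall>v\<in>V. a u u * b v v \<le> a v v)"
proof -
  define S where "S = {a v v |v. v \<in> V \<and> b v v = 1}"
  have VW: "v \<in> W" if "v \<in> V" for v using that by (simp add: V_def)
  have V_add: "(\<lambda>x. u x + v x) \<in> V" if "u \<in> V" "v \<in> V" for u v
    using that e by (auto simp: V_def B.add_in B.add_left)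
  have V_scale: "(\<lambda>x. c * v x) \<in> V" if "v \<in> V" for v c
    using that e by (auto simp: V_def B.scale_in B.scale_left)
  have normalize: "(\<lambda>x. (1 / sqrt (b v v)) * v x) \<in> V \<and>
     b (\<lambda>x. (1 / sqrt (b v v)) * v x) (\<lambda>x. (1 / sqrt (b v v)) * v x) = 1 \<and>
     a (\<lambda>x. (1 / sqrt (b v v)) * v x) (\<lambda>x. (1 / sqrt (b v v)) * v x) = a v v / b v v"
    if "v \<in> V" "b v v > 0" for v
    using that V_scale[OF that(1), of "1 / sqrt (b v v)"]
    by (simp add: B.scale_square A.scale_square VW power_divide del: times_divide_eq_left) simp
  have Sne: "S \<noteq> {}" using normalize[OF ex] unfolding S_def by blast
  have Sbdd: "bdd_below S" unfolding S_def by (rule bdd_belowI[of _ 0]) (auto simp: A.nonneg VW)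
  define l where "l = Inf S"
  have l_nonneg: "l \<ge> 0" unfolding l_def by (rule cInf_greatest[OF Sne]) (auto simp: S_def A.nonneg VW)
  have l_le: "l * b v v \<le> a v v" if "v \<in> V" for v
  proof (cases "b v v > 0")
    case True
    have "a v v / b v v \<in> S" using normalize[OF that True] unfolding S_def by force
    then have "l \<le> a v v / b v v" unfolding l_def using Sbdd by (rule cInf_lower)
    then show ?thesis using True by (simp add: field_simps)
  next
    case False
    then have "b v v = 0" using B.nonneg[OF VW[OF that]] by simp
    then show ?thesis using A.nonneg[OF VW[OF that]] by simp
  qed
  have "\<exists>v. v \<in> V \<and> b v v = 1 \<and> a v v < l + 1 / Suc n" for n
  proof -
    have "l < l + 1 / real (Suc n)" by simp
    then obtain s where "s \<in> S" "s < l + 1 / real (Suc n)"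
      using cInf_lessD[OF Sne] unfolding l_def by blast
    then show ?thesis by (auto simp: S_def)
  qed
  then obtain f where fV: "\<And>n. f n \<in> V" and fb: "\<And>n. b (f n) (f n) = 1"
    and fa: "\<And>n. a (f n) (f n) < l + 1 / Suc n" by metis
  have fa1: "a (f n) (f n) + b (f n) (f n) \<le> l + 2" for n
  proof -
    have "1 / real (Suc n) \<le> 1" by simp
    then show ?thesis using fa[of n] fb[of n] by linarith
  qed
  obtain r where "strict_mono (r :: nat \<Rightarrow> nat) \<and> (\<forall>e>0. \<exists>N. \<forall>m\<ge>N. \<forall>n\<ge>N.
      b (\<lambda>x. f (r m) x - f (r n) x) (\<lambda>x. f (r m) x - f (r n) x) < e)"
    using compact[of f, OF VW[OF fV] fa1] ..
  then have r: "strict_mono r" and rC: "\<And>e. e > 0 \<Longrightarrow> \<exists>N. \<forall>m\<ge>N. \<forall>n\<ge>N.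
      b (\<lambda>x. f (r m) x - f (r n) x) (\<lambda>x. f (r m) x - f (r n) x) < e" by simp_all
  have key: "a (\<lambda>x. f (r m) x - f (r n) x) (\<lambda>x. f (r m) x - f (r n) x)
     \<le> 2 / Suc m + 2 / Suc n + l * b (\<lambda>x. f (r m) x - f (r n) x) (\<lambda>x. f (r m) x - f (r n) x)" for m n
  proof -
    let ?d = "\<lambda>x. f (r m) x - f (r n) x" and ?s = "\<lambda>x. f (r m) x + f (r n) x"
    have 1: "a ?d ?d + a ?s ?s = 2 * a (f (r m)) (f (r m)) + 2 * a (f (r n)) (f (r n))"
      by (intro A.parallelogram VW fV)
    have 2: "b ?d ?d + b ?s ?s = 4" using B.parallelogram[OF VW[OF fV] VW[OF fV], of "r m" "r n"] by (simp add: fb)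
    have 3: "l * b ?s ?s \<le> a ?s ?s" by (intro l_le V_add fV)
    have "1 / real (Suc (r m)) \<le> 1 / Suc m" "1 / real (Suc (r n)) \<le> 1 / Suc n"
      using seq_suble[OF r] by (auto intro!: divide_left_mono)
    then have 4: "a (f (r m)) (f (r m)) \<le> l + 1 / Suc m" "a (f (r n)) (f (r n)) \<le> l + 1 / Suc n"
      using fa[of "r m"] fa[of "r n"] by linarith+
    \<comment> \<open>The sum lies in \<open>V\<close> and has \<open>b\<close>-square
      \<open>4 - b ?d ?d\<close>, so its energy is at least \<open>l\<close> times that.\<close>
    have "l * (4 - b ?d ?d) \<le> a ?s ?s" using 2 3 by (smt (verit))
    then have "a ?d ?d \<le> 2 * a (f (r m)) (f (r m)) + 2 * a (f (r n)) (f (r n)) - 4 * l + l * b ?d ?d"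
      using 1 by (simp add: algebra_simps)
    then show ?thesis using 4 by simp
  qed
  have "\<exists>u\<in>W. (\<lambda>n. a (\<lambda>x. f (r n) x - u x) (\<lambda>x. f (r n) x - u x)) \<longlonglongrightarrow> 0
         \<and> (\<lambda>n. b (\<lambda>x. f (r n) x - u x) (\<lambda>x. f (r n) x - u x)) \<longlonglongrightarrow> 0"
  proof (rule complete)
    show "f (r n) \<in> W" for n by (rule VW[OF fV])
    fix e :: real assume "e > 0"
    \<comment> \<open>One third of \<open>e\<close> is for \<open>(l + 1) * b ?d ?d\<close>; the
      terms \<open>2 / Suc m\<close> and \<open>2 / Suc n\<close> of \<open>key\<close> take the
      other two, whence \<open>6 / e\<close> below. Adding 1 keeps the divisor positive when
      \<open>l = 0\<close>.\<close>
    define e' where "e' = e / (3 * (l + 1))"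
    have e': "e' > 0" using \<open>e > 0\<close> l_nonneg by (simp add: e'_def)
    obtain N1 where N1: "\<forall>m\<ge>N1. \<forall>n\<ge>N1. b (\<lambda>x. f (r m) x - f (r n) x) (\<lambda>x. f (r m) x - f (r n) x) < e'"
      using rC[OF e'] by blast
    obtain N2 :: nat where N2: "N2 > 6 / e" using reals_Archimedean2 by blast
    show "\<exists>N. \<forall>m\<ge>N. \<forall>n\<ge>N. a (\<lambda>x. f (r m) x - f (r n) x) (\<lambda>x. f (r m) x - f (r n) x)
         + b (\<lambda>x. f (r m) x - f (r n) x) (\<lambda>x. f (r m) x - f (r n) x) < e"
    proof (intro exI allI impI)
      fix m n assume m: "m \<ge> max N1 N2" and n: "n \<ge> max N1 N2"
      let ?d = "\<lambda>x. f (r m) x - f (r n) x"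
      have small: "2 / real (Suc k) < e / 3" if "k \<ge> max N1 N2" for k
      proof -
        have "6 / e < Suc k" using N2 that by linarith
        then show ?thesis using \<open>e > 0\<close> by (simp add: field_simps)
      qed
      have "b ?d ?d < e'" using N1 m n by simp
      then have "(l + 1) * b ?d ?d < (l + 1) * e'" using l_nonneg by simp
      also have "\<dots> = e / 3" using l_nonneg by (simp add: e'_def divide_simps)
      finally have "(l + 1) * b ?d ?d < e / 3" .
      then show "a ?d ?d + b ?d ?d < e" using key[of m n] small[OF m] small[OF n]
        by (simp add: algebra_simps)
    qed
  qed
  then obtain u where u: "u \<in> W" and ua: "(\<lambda>n. a (\<lambda>x. f (r n) x - u x) (\<lambda>x. f (r n) x - u x)) \<longlonglongrightarrow> 0"
    and ub: "(\<lambda>n. b (\<lambda>x. f (r n) x - u x) (\<lambda>x. f (r n) x - u x)) \<longlonglongrightarrow> 0" by blast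
  have frW: "f (r n) \<in> W" for n by (rule VW[OF fV])
  have "b u (e j) = 0" if "j < k" for j
  proof -
    have "(\<lambda>n. b (f (r n)) (e j)) \<longlonglongrightarrow> b u (e j)"
      by (rule B.tendsto_left[OF frW u e[OF that] ub])
    moreover have "b (f (r n)) (e j) = 0" for n using fV[of "r n"] that by (simp add: V_def)
    ultimately show ?thesis by (simp add: LIMSEQ_const_iff)
  qed
  then have uV: "u \<in> V" using u by (simp add: V_def)
  have "(\<lambda>n. b (f (r n)) (f (r n))) \<longlonglongrightarrow> b u u" by (rule B.tendsto_square[OF frW u ub])
  then have bu: "b u u = 1" by (simp add: fb LIMSEQ_const_iff)
  have "(\<lambda>n. a (f (r n)) (f (r n))) \<longlonglongrightarrow> a u u" by (rule A.tendsto_square[OF frW u ua])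
  moreover have "(\<lambda>n. l + 1 / real (Suc n)) \<longlonglongrightarrow> l + 0"
    using LIMSEQ_inverse_real_of_nat by (intro tendsto_intros) (simp add: inverse_eq_divide)
  moreover have "a (f (r n)) (f (r n)) \<le> l + 1 / real (Suc n)" for n
  proof -
    have "1 / real (Suc (r n)) \<le> 1 / Suc n" using seq_suble[OF r] by (auto intro!: divide_left_mono)
    then show ?thesis using fa[of "r n"] by linarith
  qed
  ultimately have "a u u \<le> l + 0" by (intro LIMSEQ_le) auto
  then have "a u u \<le> l" by simp
  then have "a u u * b v v \<le> a v v" if "v \<in> V" for v
    using l_le[OF that] B.nonneg[OF VW[OF that]] mult_right_mono[of "a u u" l "b v v"] by linarith
  then show ?thesis using uV bu by blast
qed

text \<open>Pythagoras for any form \<open>F\<close> that the \<open>e j\<close> diagonalise along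
  with \<open>b\<close>. It is used with \<open>F = b\<close>, all \<open>l j\<close> being 1, and
  with \<open>F = a\<close> and the eigenvalues.\<close>

lemma residual_square:
  assumes J: "finite J" and e: "\<And>j. j \<in> J \<Longrightarrow> e j \<in> W"
    and on: "\<And>i j. i \<in> J \<Longrightarrow> j \<in> J \<Longrightarrow> b (e i) (e j) = of_bool (i = j)"
    and v: "v \<in> W" and F: "psd_form W F" and eig: "\<And>i w. i \<in> J \<Longrightarrow> w \<in> W \<Longrightarrow> F (e i) w = l i * b (e i) w"
  shows "F (\<lambda>x. v x - (\<Sum>j\<in>J. b v (e j) * e j x)) (\<lambda>x. v x - (\<Sum>j\<in>J. b v (e j) * e j x))
    = F v v - (\<Sum>j\<in>J. l j * (b v (e j))\<^sup>2)"
proof -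
  interpret F: psd_form W F by (rule F)
  let ?p = "\<lambda>x. \<Sum>j\<in>J. b v (e j) * e j x"
  have p: "?p \<in> W" by (rule F.sum_in[OF J e])
  have Fve: "F v (e j) = l j * b v (e j)" if "j \<in> J" for j
    using eig[OF that v] F.sym[OF v e[OF that]] B.sym[OF v e[OF that]] by simp
  have vp: "F v ?p = (\<Sum>j\<in>J. l j * (b v (e j))\<^sup>2)"
    using F.sum_right[of J e v "\<lambda>j. b v (e j)", OF J e v]
    by (simp add: Fve power2_eq_square mult.left_commute cong: sum.cong)
  have bep: "b (e i) ?p = b v (e i)" if "i \<in> J" for i
    using B.sum_right[of J e "e i" "\<lambda>j. b v (e j)", OF J e e[OF that]] that J
    by (simp add: on of_bool_def if_distrib cong: sum.cong if_cong)
  have pp: "F ?p ?p = (\<Sum>j\<in>J. l j * (b v (e j))\<^sup>2)"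
    using F.sum_left[of J e ?p "\<lambda>j. b v (e j)", OF J e p]
    by (simp add: eig p bep power2_eq_square mult.left_commute cong: sum.cong)
  show ?thesis using F.diff_square[OF v p] vp pp by simp
qed

lemma residual_in:
  assumes "finite J" "\<And>j. j \<in> J \<Longrightarrow> e j \<in> W" "v \<in> W"
  shows "(\<lambda>x. v x - (\<Sum>j\<in>J. b v (e j) * e j x)) \<in> W"
  using assms by (intro B.diff_in B.sum_in) auto

lemma residual_orthogonal:
  assumes J: "finite J" and e: "\<And>j. j \<in> J \<Longrightarrow> e j \<in> W"
    and on: "\<And>i j. i \<in> J \<Longrightarrow> j \<in> J \<Longrightarrow> b (e i) (e j) = of_bool (i = j)"
    and v: "v \<in> W" and i: "i \<in> J"
  shows "b (\<lambda>x. v x - (\<Sum>j\<in>J. b v (e j) * e j x)) (e i) = 0"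
  using B.sum_left[of J e "e i" "\<lambda>j. b v (e j)", OF J e e[OF i]] i J
  by (simp add: B.diff_left B.sum_in J e v i on of_bool_def if_distrib cong: sum.cong if_cong)

lemma residual_square_b:
  assumes J: "finite J" and e: "\<And>j. j \<in> J \<Longrightarrow> e j \<in> W"
    and on: "\<And>i j. i \<in> J \<Longrightarrow> j \<in> J \<Longrightarrow> b (e i) (e j) = of_bool (i = j)"
    and v: "v \<in> W"
  shows "b (\<lambda>x. v x - (\<Sum>j\<in>J. b v (e j) * e j x)) (\<lambda>x. v x - (\<Sum>j\<in>J. b v (e j) * e j x))
    = b v v - (\<Sum>j\<in>J. (b v (e j))\<^sup>2)"
  using residual_square[OF J e on v B.psd_form_axioms, of "\<lambda>_. 1"] by simp

lemma Bessel:
  assumes J: "finite J" and e: "\<And>j. j \<in> J \<Longrightarrow> e j \<in> W"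
    and on: "\<And>i j. i \<in> J \<Longrightarrow> j \<in> J \<Longrightarrow> b (e i) (e j) = of_bool (i = j)"
    and v: "v \<in> W"
  shows "(\<Sum>j\<in>J. (b v (e j))\<^sup>2) \<le> b v v"
  using B.nonneg[OF residual_in[of J e v, OF J e v]] residual_square_b[OF J e on v] by simp

text \<open>Otherwise each of \<open>k + 1\<close> orthonormal vectors lies in the span of the
  \<open>k\<close> given ones up to a null vector. The sum of all squared coefficients is then
  \<open>k + 1\<close>, while Bessel's inequality with the roles exchanged bounds it by
  \<open>k\<close>.\<close>

lemma ex_orthogonal:
  fixes e :: "nat \<Rightarrow> 'x \<Rightarrow> real" and k :: nat
  assumes e: "\<And>j. j < k \<Longrightarrow> e j \<in> W"
    and on: "\<And>i j. i < k \<Longrightarrow> j < k \<Longrightarrow> b (e i) (e j) = of_bool (i = j)"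
  shows "\<exists>v\<in>W. (\<forall>j<k. b v (e j) = 0) \<and> b v v > 0"
proof (rule ccontr)
  assume no: "\<not> ?thesis"
  obtain v where v: "\<And>i. i < Suc k \<Longrightarrow> v i \<in> W"
    and von: "\<And>i j. i < Suc k \<Longrightarrow> j < Suc k \<Longrightarrow> b (v i) (v j) = of_bool (i = j)"
    using infinite_dim[of "Suc k"] by metis
  have *: "(\<Sum>j<k. (b (v i) (e j))\<^sup>2) = 1" if "i < Suc k" for i
  proof -
    let ?r = "\<lambda>x. v i x - (\<Sum>j<k. b (v i) (e j) * e j x)"
    have "?r \<in> W" by (rule residual_in) (auto simp: e v that)
    moreover have "b ?r (e j) = 0" if "j < k" for j
      by (rule residual_orthogonal) (use \<open>i < Suc k\<close> that in \<open>auto simp: e on v\<close>)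
    ultimately have "b ?r ?r = 0" using no B.nonneg[of ?r] by force
    moreover have "b ?r ?r = b (v i) (v i) - (\<Sum>j<k. (b (v i) (e j))\<^sup>2)"
      by (rule residual_square_b) (use that in \<open>auto simp: e on v\<close>)
    ultimately show ?thesis using von[OF that that] by simp
  qed
  have "real (Suc k) = (\<Sum>i<Suc k. \<Sum>j<k. (b (v i) (e j))\<^sup>2)"
    using * by simp
  also have "\<dots> = (\<Sum>j<k. \<Sum>i<Suc k. (b (e j) (v i))\<^sup>2)"
    by (subst sum.swap) (intro sum.cong refl, simp add: B.sym e v)
  also have "\<dots> \<le> (\<Sum>j<k. b (e j) (e j))"
    by (intro sum_mono Bessel) (auto simp: e v von)
  also have "\<dots> = real k" by (simp add: on)
  finally show False by simp
qed

text \<open>Each \<open>e k\<close> is only required to minimise on the complement of its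
  predecessors. That it solves the eigenvalue equation against all of \<open>W\<close>, and that no
  eigenfunction is missed, are consequences.\<close>

definition is_eigenbasis :: "(nat \<Rightarrow> 'x \<Rightarrow> real) \<Rightarrow> bool" where
  "is_eigenbasis e \<longleftrightarrow> (\<forall>k. e k \<in> W \<and> (\<forall>j<k. b (e k) (e j) = 0) \<and> b (e k) (e k) = 1 \<and>
     (\<forall>v\<in>W. (\<forall>j<k. b v (e j) = 0) \<longrightarrow> a (e k) (e k) * b v v \<le> a v v))"

lemma ex_eigenbasis: "\<exists>e. is_eigenbasis e"
proof -
  define P where "P e k u \<longleftrightarrow> u \<in> W \<and> (\<forall>j<k. b u (e j) = 0) \<and> b u u = 1 \<and>
     (\<forall>v\<in>W. (\<forall>j<k. b v (e j) = 0) \<longrightarrow> a u u * b v v \<le> a v v)"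
    for e :: "nat \<Rightarrow> 'x \<Rightarrow> real" and k u
  have "\<exists>e. \<forall>k. P e k (e k)"
  proof (rule dependent_wellorder_choice)
    show "P f k u = P g k u" if "\<And>j. j < k \<Longrightarrow> f j = g j" for u f g k
      using that by (simp add: P_def cong: conj_cong)
    fix k and e :: "nat \<Rightarrow> 'x \<Rightarrow> real"
    assume IH: "\<And>j. j < k \<Longrightarrow> P e j (e j)"
    have eW: "e j \<in> W" if "j < k" for j using IH[OF that] by (simp add: P_def)
    have on: "b (e i) (e j) = of_bool (i = j)" if "i < k" "j < k" for i j
    proof -
      consider "i < j" | "j < i" | "i = j" by linarith
      then show ?thesis using IH that B.sym[OF eW[OF that(1)] eW[OF that(2)]]
        by cases (auto simp: P_def)
    qed
    obtain v where v: "v \<in> W" "\<forall>j<k. b v (e j) = 0" "b v v > 0"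
      using ex_orthogonal[OF eW on] by blast
    then have "v \<in> {v \<in> W. \<forall>j<k. b v (e j) = 0}" by simp
    from minimizer[OF eW this v(3)] show "\<exists>u. P e k u" unfolding P_def by blast
  qed
  then show ?thesis unfolding P_def is_eigenbasis_def .
qed

section \<open>Properties of a sequence of successive minimisers\<close>

context
  fixes e :: "nat \<Rightarrow> 'x \<Rightarrow> real"
  assumes e: "is_eigenbasis e"
begin

definition ev :: "nat \<Rightarrow> real" where "ev k = a (e k) (e k)"

lemma e_in: "e k \<in> W"
  using e by (simp add: is_eigenbasis_def)

lemma e_on: "b (e i) (e j) = of_bool (i = j)"
proof -
  consider "i < j" | "j < i" | "i = j" by linarith
  then show ?thesis using e B.sym[OF e_in e_in, of i j] by cases (auto simp: is_eigenbasis_def)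
qed

lemma ev_le: "v \<in> W \<Longrightarrow> (\<And>j. j < k \<Longrightarrow> b v (e j) = 0) \<Longrightarrow> ev k * b v v \<le> a v v"
  using e by (simp add: is_eigenbasis_def ev_def)

lemma mono_ev: "mono ev"
proof (rule monoI)
  fix i k :: nat assume "i \<le> k"
  have "ev i * b (e k) (e k) \<le> a (e k) (e k)"
    by (rule ev_le[OF e_in]) (use \<open>i \<le> k\<close> in \<open>auto simp: e_on\<close>)
  then show "ev i \<le> ev k" by (simp add: e_on ev_def)
qed

text \<open>The Euler equation of the minimisation, for variations that respect the
  constraints.\<close>

lemma eigen_orth:
  assumes v: "v \<in> W" "\<And>j. j < k \<Longrightarrow> b v (e j) = 0"
  shows "a (e k) v = ev k * b (e k) v"
proof -
  have "a (e k) v - ev k * b (e k) v = 0"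
  proof (rule first_variation_eq_0)
    fix t
    let ?w = "\<lambda>x. e k x + t * v x"
    have "ev k * b ?w ?w \<le> a ?w ?w"
      by (rule ev_le) (use v in \<open>auto simp: B.lin_in B.lin_left e_in e_on\<close>)
    then show "0 \<le> 2 * t * (a (e k) v - ev k * b (e k) v) + t\<^sup>2 * (a v v - ev k * b v v)"
      using v by (simp add: A.lin_square B.lin_square e_in e_on algebra_simps flip: ev_def)
    show "0 \<le> a v v - ev k * b v v" using ev_le[OF v] by simp
  qed
  then show ?thesis by simp
qed

text \<open>The constraints are lifted by splitting off the projection onto the earlier
  \<open>e j\<close>: on it both forms vanish against \<open>e k\<close>, for \<open>a\<close> by
  \<open>eigen_orth\<close> at the smaller index and symmetry.\<close>

lemma eigen:
  assumes v: "v \<in> W"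
  shows "a (e k) v = ev k * b (e k) v"
proof -
  have ae: "a (e i) (e j) = ev i * of_bool (i = j)" for i j
  proof -
    have lt: "a (e i) (e j) = 0" if "i < j" for i j
      using eigen_orth[OF e_in[of j], of i] that by (simp add: e_on)
    consider "i < j" | "j < i" | "i = j" by linarith
    then show ?thesis using lt A.sym[OF e_in e_in, of i j] by cases (auto simp: ev_def)
  qed
  let ?p = "\<lambda>x. \<Sum>j<k. b v (e j) * e j x" and ?r = "\<lambda>x. v x - (\<Sum>j<k. b v (e j) * e j x)"
  have p: "?p \<in> W" by (rule B.sum_in) (auto simp: e_in)
  have r: "?r \<in> W" by (rule residual_in) (auto simp: e_in v)
  have 1: "a (e k) ?r = ev k * b (e k) ?r"
    by (rule eigen_orth[OF r]) (auto intro!: residual_orthogonal simp: e_in e_on v)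
  have 2: "a (e k) ?p = 0" "b (e k) ?p = 0"
    by (simp_all add: A.sum_right B.sum_right e_in ae e_on)
  have "a (e k) ?r = a (e k) v - a (e k) ?p" "b (e k) ?r = b (e k) v - b (e k) ?p"
    using A.lin_right[OF v p e_in[of k], where c = "-1"] B.lin_right[OF v p e_in[of k], where c = "-1"] by simp_all
  then show ?thesis using 1 2 by simp
qed

text \<open>Orthonormal vectors have mutual squared distance 2, so bounded energies would contradict
  compactness.\<close>

lemma ev_unbounded: "\<exists>k. ev k > C"
proof (rule ccontr)
  assume "\<not> ?thesis"
  then have le: "ev k \<le> C" for k by (meson not_le)
  have "a (e n) (e n) + b (e n) (e n) \<le> C + 1" for n
    using le[of n] by (simp add: e_on ev_def)
  then have "\<exists>r. strict_mono (r :: nat \<Rightarrow> nat) \<and> (\<forall>e'>0. \<exists>N. \<forall>m\<ge>N. \<forall>n\<ge>N.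
      b (\<lambda>x. e (r m) x - e (r n) x) (\<lambda>x. e (r m) x - e (r n) x) < e')"
    by (rule compact[of e, OF e_in])
  then obtain r where "strict_mono (r :: nat \<Rightarrow> nat) \<and> (\<forall>e'>0. \<exists>N. \<forall>m\<ge>N. \<forall>n\<ge>N.
      b (\<lambda>x. e (r m) x - e (r n) x) (\<lambda>x. e (r m) x - e (r n) x) < e')" ..
  then have r: "strict_mono r" and rC: "\<forall>e'>0. \<exists>N. \<forall>m\<ge>N. \<forall>n\<ge>N.
      b (\<lambda>x. e (r m) x - e (r n) x) (\<lambda>x. e (r m) x - e (r n) x) < e'" by simp_all
  obtain N where N: "\<forall>m\<ge>N. \<forall>n\<ge>N. b (\<lambda>x. e (r m) x - e (r n) x) (\<lambda>x. e (r m) x - e (r n) x) < 1"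
    using rC zero_less_one by blast
  have "b (\<lambda>x. e (r N) x - e (r (Suc N)) x) (\<lambda>x. e (r N) x - e (r (Suc N)) x) < 1"
    using N by simp
  moreover have "r N \<noteq> r (Suc N)" using strict_monoD[OF r, of N "Suc N"] by simp
  ultimately show False by (simp add: B.diff_square e_in e_on)
qed

lemma finite_ev: "finite {j. ev j = t}"
proof -
  obtain k where "ev k > t" using ev_unbounded by blast
  then have "j < k" if "ev j = t" for j
    using monoD[OF mono_ev, of k j] that by (cases "j < k") auto
  then have "{j. ev j = t} \<subseteq> {..<k}" by auto
  then show ?thesis by (rule finite_subset) simp
qed

text \<open>The residual is orthogonal to every \<open>e k\<close> and, were it not null, would have
  Rayleigh quotient \<open>t\<close>; but orthogonality to all \<open>e j\<close> with
  \<open>j < k\<close> forces a quotient of at least \<open>ev k\<close>, and \<open>ev\<close> is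
  unbounded. Hence the \<open>e j\<close> exhaust each eigenspace.\<close>

lemma eigenspace_residual:
  assumes u: "u \<in> W" "\<And>v. v \<in> W \<Longrightarrow> a u v = t * b u v"
  defines "r \<equiv> \<lambda>x. u x - (\<Sum>j | ev j = t. b u (e j) * e j x)"
  shows "b r r = 0"
proof (rule ccontr)
  assume n: "b r r \<noteq> 0"
  have r: "r \<in> W" unfolding r_def by (rule residual_in) (auto simp: finite_ev e_in u)
  have bn: "b r r > 0" using n B.nonneg[OF r] by simp
  have u0: "b u (e j) = 0" if "ev j \<noteq> t" for j
  proof -
    have "t * b u (e j) = ev j * b (e j) u"
      using u(2)[OF e_in, of j] eigen[OF u(1), of j] A.sym[OF e_in u(1)] by simp
    then show ?thesis using that B.sym[OF e_in u(1), of j] by simp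
  qed
  have orth: "b r (e k) = 0" for k
  proof (cases "ev k = t")
    case True
    then show ?thesis unfolding r_def
      by (intro residual_orthogonal) (auto simp: finite_ev e_in u e_on)
  next
    case False
    then have "b r (e k) = b u (e k) - (\<Sum>j | ev j = t. b u (e j) * b (e j) (e k))"
      unfolding r_def by (simp add: B.diff_left B.sum_left B.sum_in finite_ev e_in u)
    also have "\<dots> = 0" using u0[OF False] False by (simp add: e_on) (smt (verit) mem_Collect_eq mult_eq_0_iff of_bool_eq(1) sum.neutral)
    finally show ?thesis .
  qed
  have "a r r = a u u - (\<Sum>j | ev j = t. ev j * (b u (e j))\<^sup>2)"
    unfolding r_def by (rule residual_square) (auto simp: finite_ev e_in u e_on A.psd_form_axioms eigen)
  also have "\<dots> = t * (b u u - (\<Sum>j | ev j = t. (b u (e j))\<^sup>2))"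
    using u(2)[OF u(1)] by (simp add: sum_distrib_left right_diff_distrib)
  also have "\<dots> = t * b r r"
    unfolding r_def by (subst residual_square_b) (auto simp: finite_ev e_in u e_on)
  finally have ar: "a r r = t * b r r" .
  obtain k where "ev k > t" using ev_unbounded by blast
  moreover have "ev k * b r r \<le> a r r" by (rule ev_le[OF r orth])
  ultimately show False using ar bn by simp
qed

text \<open>Ky Fan's trace inequality. Subtracting \<open>ev n\<close> makes the weights
  \<open>ev j - ev n\<close> nonpositive, so that Bessel's inequality for the \<open>v i\<close>, an
  upper bound on squared coefficients, works in the right direction; the part beyond the first
  \<open>n\<close> vectors is bounded below by \<open>ev n\<close>.\<close>

lemma sum_ev_le:
  assumes v: "\<And>i. i < n \<Longrightarrow> v i \<in> W"
    and on: "\<And>i j. i < n \<Longrightarrow> j < n \<Longrightarrow> b (v i) (v j) = of_bool (i = j)"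
  shows "(\<Sum>j<n. ev j) \<le> (\<Sum>i<n. a (v i) (v i))"
proof -
  have 1: "(\<Sum>j<n. (ev j - ev n) * (b w (e j))\<^sup>2) + ev n * b w w \<le> a w w" if w: "w \<in> W" for w
  proof -
    let ?r = "\<lambda>x. w x - (\<Sum>j<n. b w (e j) * e j x)"
    have "ev n * b ?r ?r \<le> a ?r ?r"
      by (rule ev_le) (auto intro!: residual_in residual_orthogonal simp: e_in e_on w)
    moreover have "b ?r ?r = b w w - (\<Sum>j<n. (b w (e j))\<^sup>2)"
      by (rule residual_square_b) (auto simp: e_in e_on w)
    moreover have "a ?r ?r = a w w - (\<Sum>j<n. ev j * (b w (e j))\<^sup>2)"
      by (rule residual_square) (auto simp: e_in e_on w A.psd_form_axioms eigen)
    moreover have "(\<Sum>j<n. (ev j - ev n) * (b w (e j))\<^sup>2) =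
        (\<Sum>j<n. ev j * (b w (e j))\<^sup>2) - ev n * (\<Sum>j<n. (b w (e j))\<^sup>2)"
      by (simp add: left_diff_distrib sum_subtractf sum_distrib_left)
    ultimately show ?thesis by (simp add: right_diff_distrib)
  qed
  have "(\<Sum>j<n. ev j) = (\<Sum>j<n. (ev j - ev n) * 1) + (\<Sum>i<n. ev n * b (v i) (v i))"
    by (simp add: on sum_subtractf)
  also have "\<dots> \<le> (\<Sum>j<n. (ev j - ev n) * (\<Sum>i<n. (b (v i) (e j))\<^sup>2)) + (\<Sum>i<n. ev n * b (v i) (v i))"
  proof (intro add_right_mono sum_mono mult_left_mono_neg)
    fix j assume "j \<in> {..<n}"
    then show "ev j - ev n \<le> 0" using monoD[OF mono_ev, of j n] by simp
    have "(\<Sum>i<n. (b (v i) (e j))\<^sup>2) = (\<Sum>i<n. (b (e j) (v i))\<^sup>2)"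
      by (intro sum.cong) (auto simp: B.sym e_in v)
    also have "\<dots> \<le> b (e j) (e j)" by (rule Bessel) (auto simp: v on e_in)
    finally show "(\<Sum>i<n. (b (v i) (e j))\<^sup>2) \<le> 1" by (simp add: e_on)
  qed
  also have "\<dots> = (\<Sum>i<n. (\<Sum>j<n. (ev j - ev n) * (b (v i) (e j))\<^sup>2) + ev n * b (v i) (v i))"
    by (simp add: sum.distrib sum_distrib_left) (rule sum.swap)
  also have "\<dots> \<le> (\<Sum>i<n. a (v i) (v i))"
    by (intro sum_mono 1) (auto simp: v)
  finally show ?thesis .
qed

end

end

section \<open>Smooth functions and test functions\<close>

lemma frechet_derivative_eq_sum_partial_deriv:
  fixes f :: "real^'n::finite \<Rightarrow> real"
  assumes "f differentiable (at x)"
  shows "frechet_derivative f (at x) h = (\<Sum>i\<in>UNIV. h $ i * partial_deriv i f x)"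
proof -
  have lin: "linear (frechet_derivative f (at x))"
    using assms by (rule linear_frechet_derivative)
  have "h = (\<Sum>i\<in>UNIV. h $ i *\<^sub>R axis i 1)"
    by (metis (mono_tags, lifting) basis_expansion scalar_mult_eq_scaleR sum.cong)
  then have "frechet_derivative f (at x) h = frechet_derivative f (at x) (\<Sum>i\<in>UNIV. h $ i *\<^sub>R axis i 1)"
    by simp
  also have "\<dots> = (\<Sum>i\<in>UNIV. h $ i * partial_deriv i f x)"
    by (simp add: linear_sum[OF lin] linear_scale[OF lin] partial_deriv_def)
  finally show ?thesis .
qed

lemma partial_derivI:
  assumes "(f has_derivative f') (at x)"
  shows "partial_deriv i f x = f' (axis i 1)"
  using frechet_derivative_at[OF assms] by (simp add: partial_deriv_def)

lemma has_derivative_partial_deriv: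
  fixes f :: "real^'n::finite \<Rightarrow> real"
  assumes "f differentiable (at x)"
  shows "(f has_derivative (\<lambda>h. \<Sum>i\<in>UNIV. h $ i * partial_deriv i f x)) (at x)"
  using frechet_derivative_works[THEN iffD1, OF assms] frechet_derivative_eq_sum_partial_deriv[OF assms]
  by (metis (no_types, lifting) ext)

lemma smooth_differentiable: "smooth f \<Longrightarrow> f differentiable (at x)"
  unfolding smooth_def differentiable_on_def by (drule spec[of _ "[]"]) simp

lemma smooth_partial_deriv: "smooth f \<Longrightarrow> smooth (partial_deriv i f)"
  unfolding smooth_def
proof
  fix "is" assume "\<forall>is. foldr partial_deriv is f differentiable_on UNIV"
  then have "foldr partial_deriv (is @ [i]) f differentiable_on UNIV" by blast
  then show "foldr partial_deriv is (partial_deriv i f) differentiable_on UNIV" by simp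
qed

lemma smooth_continuous_on: "smooth f \<Longrightarrow> continuous_on A f"
  by (meson continuous_at_imp_continuous_on differentiable_imp_continuous_within smooth_differentiable)

text \<open>\<open>smooth\<close> describes the largest class of everywhere differentiable functions
  that is closed under partial derivatives, which gives a coinduction rule.\<close>

lemma smooth_coinduct:
  assumes "f \<in> S" "\<And>f x. f \<in> S \<Longrightarrow> f differentiable (at x)" "\<And>f i. f \<in> S \<Longrightarrow> partial_deriv i f \<in> S"
  shows "smooth f"
  unfolding smooth_def
proof
  fix "is"
  have "foldr partial_deriv is f \<in> S" by (induction "is") (auto simp: assms)
  then show "foldr partial_deriv is f differentiable_on UNIV"
    using assms(2) by (simp add: differentiable_on_def)
qed

inductive_set alg :: "(real^'n::finite \<Rightarrow> real) set \<Rightarrow> (real^'n \<Rightarrow> real) set"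
  for S where
  alg_base: "f \<in> S \<Longrightarrow> f \<in> alg S"
| alg_const: "(\<lambda>x. c) \<in> alg S"
| alg_add: "f \<in> alg S \<Longrightarrow> g \<in> alg S \<Longrightarrow> (\<lambda>x. f x + g x) \<in> alg S"
| alg_mult: "f \<in> alg S \<Longrightarrow> g \<in> alg S \<Longrightarrow> (\<lambda>x. f x * g x) \<in> alg S"

lemma alg_sum:
  assumes "finite J" "\<And>j. j \<in> J \<Longrightarrow> f j \<in> alg S"
  shows "(\<lambda>x. \<Sum>j\<in>J. f j x) \<in> alg S"
  using assms by (induction J) (auto intro: alg_const alg_add)

lemma alg_prod:
  assumes "finite J" "\<And>j. j \<in> J \<Longrightarrow> f j \<in> alg S"
  shows "(\<lambda>x. \<Prod>j\<in>J. f j x) \<in> alg S"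
  using assms by (induction J) (auto intro: alg_const alg_mult)

lemma partial_deriv_add:
  assumes "f differentiable (at x)" "g differentiable (at x)"
  shows "partial_deriv i (\<lambda>x. f x + g x) x = partial_deriv i f x + partial_deriv i g x"
  using partial_derivI[OF has_derivative_add[OF frechet_derivative_works[THEN iffD1, OF assms(1)] frechet_derivative_works[THEN iffD1, OF assms(2)]]]
  by (simp add: partial_deriv_def)

lemma partial_deriv_mult:
  assumes "f differentiable (at x)" "g differentiable (at x)"
  shows "partial_deriv i (\<lambda>x. f x * g x) x = f x * partial_deriv i g x + partial_deriv i f x * g x"
  using partial_derivI[OF has_derivative_mult[OF frechet_derivative_works[THEN iffD1, OF assms(1)] frechet_derivative_works[THEN iffD1, OF assms(2)]]]
  by (simp add: partial_deriv_def)

lemma partial_deriv_const [simp]: "partial_deriv i (\<lambda>x. c) = (\<lambda>x. 0)"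
  by (rule ext) (simp add: partial_derivI[OF has_derivative_const])

text \<open>By the sum and product rules an algebra is closed under differentiation as soon as the
  derivatives of its generators belong to it, so smoothness has to be verified on generators
  only.\<close>

lemma alg_smooth:
  assumes S: "\<And>f x. f \<in> S \<Longrightarrow> f differentiable (at x)" "\<And>f i. f \<in> S \<Longrightarrow> partial_deriv i f \<in> alg S"
    and f: "f \<in> alg S"
  shows "smooth f"
proof (rule smooth_coinduct[OF f])
  show diff: "f differentiable (at x)" if "f \<in> alg S" for f x
    using that by induction (auto simp: S)
  show "partial_deriv i f \<in> alg S" if "f \<in> alg S" for f i
    using that
  proof induction
    case (alg_base f)
    then show ?case by (rule S)
  next
    case (alg_const c)
    then show ?case by (simp add: alg.alg_const)
  next
    case (alg_add f g)
    then have "partial_deriv i (\<lambda>x. f x + g x) = (\<lambda>x. partial_deriv i f x + partial_deriv i g x)"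
      by (intro ext partial_deriv_add diff)
    then show ?case using alg_add by (auto intro: alg.alg_add)
  next
    case (alg_mult f g)
    then have "partial_deriv i (\<lambda>x. f x * g x) = (\<lambda>x. f x * partial_deriv i g x + partial_deriv i f x * g x)"
      by (intro ext partial_deriv_mult diff)
    then show ?case using alg_mult by (auto intro!: alg.alg_add alg.alg_mult)
  qed
qed

lemma alg_Collect_smooth: "f \<in> alg (Collect smooth) \<Longrightarrow> smooth f"
  by (rule alg_smooth[of "Collect smooth"]) (auto simp: smooth_differentiable smooth_partial_deriv intro: alg_base)

lemma smooth_const: "smooth (\<lambda>x. c)"
  by (rule alg_Collect_smooth) (rule alg_const)

lemma smooth_add: "smooth f \<Longrightarrow> smooth g \<Longrightarrow> smooth (\<lambda>x. f x + g x)"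
  by (rule alg_Collect_smooth) (auto intro: alg_base alg_add)

lemma smooth_mult: "smooth f \<Longrightarrow> smooth g \<Longrightarrow> smooth (\<lambda>x. f x * g x)"
  by (rule alg_Collect_smooth) (auto intro: alg_base alg_mult)

lemma smooth_cmult: "smooth g \<Longrightarrow> smooth (\<lambda>x. c * g x)"
  by (intro smooth_mult smooth_const)

lemma smooth_diff: "smooth f \<Longrightarrow> smooth g \<Longrightarrow> smooth (\<lambda>x. f x - g x)"
  using smooth_add[of f "\<lambda>x. (-1) * g x"] smooth_cmult[of g "-1"] by simp

lemma smooth_prod: "finite J \<Longrightarrow> (\<And>j. j \<in> J \<Longrightarrow> smooth (f j)) \<Longrightarrow> smooth (\<lambda>x. \<Prod>j\<in>J. f j x)"
  by (rule alg_Collect_smooth) (auto intro: alg_base alg_prod)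

lemma smooth_bounded_linear:
  assumes "bounded_linear f"
  shows "smooth f"
proof (rule alg_smooth[of "{f}"])
  have d: "(f has_derivative f) (at x)" for x using assms by (rule bounded_linear_imp_has_derivative)
  show "g differentiable at x" if "g \<in> {f}" for g x using d that by (auto simp: differentiable_def)
  show "partial_deriv i g \<in> alg {f}" if "g \<in> {f}" for g i
  proof -
    have "partial_deriv i g = (\<lambda>x. f (axis i 1))" using that partial_derivI[OF d] by auto
    then show ?thesis by (simp add: alg_const)
  qed
qed (simp add: alg_base)

lemma smooth_coordinate: "smooth (\<lambda>x. x $ i)"
  by (rule smooth_bounded_linear) (rule bounded_linear_vec_nth)

lemma smooth_real_polynomial_function:
  "real_polynomial_function f \<Longrightarrow> smooth f"
  by (induction rule: real_polynomial_function.induct)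
    (auto intro: smooth_bounded_linear smooth_const smooth_add smooth_mult)

lemma partial_deriv_affine:
  fixes f :: "real^'n::finite \<Rightarrow> real" and A :: "real^'n \<Rightarrow> real^'n"
  assumes f: "smooth f" and A: "linear A"
  shows "partial_deriv i (\<lambda>x. f (A x + b)) x = (\<Sum>j\<in>UNIV. A (axis i 1) $ j * partial_deriv j f (A x + b))"
    and "(\<lambda>x. f (A x + b)) differentiable (at x)"
proof -
  have "((\<lambda>x. A x + b) has_derivative A) (at x)"
    using bounded_linear_imp_has_derivative[OF linear_conv_bounded_linear[THEN iffD1, OF A]]
    by (auto intro!: derivative_eq_intros)
  from has_derivative_compose[OF this has_derivative_partial_deriv[OF smooth_differentiable[OF f]]]
  have d: "((\<lambda>x. f (A x + b)) has_derivative (\<lambda>h. \<Sum>j\<in>UNIV. A h $ j * partial_deriv j f (A x + b))) (at x)" .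
  show "partial_deriv i (\<lambda>x. f (A x + b)) x = (\<Sum>j\<in>UNIV. A (axis i 1) $ j * partial_deriv j f (A x + b))"
    by (rule partial_derivI[OF d])
  show "(\<lambda>x. f (A x + b)) differentiable (at x)" using d by (auto simp: differentiable_def)
qed

lemma smooth_affine:
  fixes f :: "real^'n::finite \<Rightarrow> real" and A :: "real^'n \<Rightarrow> real^'n"
  assumes f: "smooth f" and A: "linear A"
  shows "smooth (\<lambda>x. f (A x + b))"
proof (rule alg_smooth[of "{\<lambda>x. f (A x + b) |f. smooth f}"])
  fix g x assume "g \<in> {\<lambda>x. f (A x + b) |f. smooth f}"
  then show "g differentiable at x" using partial_deriv_affine(2)[OF _ A] by auto
next
  fix g i assume "g \<in> {\<lambda>x. f (A x + b) |f. smooth f}"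
  then obtain f where g: "g = (\<lambda>x. f (A x + b))" "smooth f" by blast
  have "partial_deriv i g = (\<lambda>x. \<Sum>j\<in>UNIV. A (axis i 1) $ j * partial_deriv j f (A x + b))"
    unfolding g(1) by (rule ext) (rule partial_deriv_affine(1)[OF g(2) A])
  moreover have "\<dots> \<in> alg {\<lambda>x. f (A x + b) |f. smooth f}"
    by (intro alg_sum alg_mult alg_const alg_base) (use smooth_partial_deriv[OF g(2)] in auto)
  ultimately show "partial_deriv i g \<in> alg {\<lambda>x. f (A x + b) |f. smooth f}" by simp
qed (use f in \<open>auto intro: alg_base\<close>)

text \<open>The derivatives of \<open>t \<mapsto> exp (-1/t)\<close>, extended by \<open>0\<close>, are combinations of these functions.\<close>

definition expm :: "nat \<Rightarrow> real \<Rightarrow> real" where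
  "expm k t = (if t > 0 then (1 / t) ^ k * exp (- 1 / t) else 0)"

lemma expm_tendsto_0: "expm k \<midarrow>0\<rightarrow> 0"
proof -
  have "((\<lambda>t::real. inverse t ^ k / exp (inverse t)) \<longlongrightarrow> 0) (at_right 0)"
    by (rule filterlim_compose[OF tendsto_power_div_exp_0 filterlim_inverse_at_top_right])
  then have r: "(expm k \<longlongrightarrow> 0) (at_right 0)"
    by (rule Lim_transform_eventually)
      (auto simp: eventually_at_filter expm_def exp_minus divide_inverse power_inverse)
  have l: "(expm k \<longlongrightarrow> 0) (at_left 0)"
    by (rule tendsto_eventually) (auto simp: eventually_at_filter expm_def)
  show ?thesis using filterlim_split_at[OF l r] .
qed

lemma expm_deriv: "(expm k has_real_derivative expm (k + 2) t - k * expm (k + 1) t) (at t)"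
proof -
  consider "t < 0" | "t = 0" | "t > 0" by linarith
  then show ?thesis
  proof cases
    case 1
    have "((\<lambda>t. 0) has_real_derivative 0) (at t)" by simp
    then have "(expm k has_real_derivative 0) (at t)"
      by (rule has_field_derivative_transform_within_open[of _ _ _ "{..<0}"]) (use 1 in \<open>auto simp: expm_def\<close>)
    then show ?thesis using 1 by (simp add: expm_def)
  next
    case 2
    \<comment> \<open>The difference quotient at 0 is again a function of the family, so its limit
      is known. For \<open>h \<le> 0\<close> both sides are 0, the value at \<open>h = 0\<close>
      coming from division by zero.\<close>
    have "(\<lambda>h. (expm k (0 + h) - expm k 0) / h) = expm (k + 1)"
      by (rule ext) (simp add: expm_def)
    then have "(expm k has_real_derivative 0) (at 0)"
      using expm_tendsto_0[of "k + 1"] by (simp add: DERIV_def)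
    then show ?thesis using 2 by (simp add: expm_def)
  next
    case 3
    have d: "((\<lambda>t. 1 / t) has_real_derivative - ((1 / t)\<^sup>2)) (at t)"
      using 3 by (auto intro!: derivative_eq_intros simp: power2_eq_square)
    have "((\<lambda>t. (1 / t) ^ k) has_real_derivative of_nat k * (- ((1 / t)\<^sup>2) * (1 / t) ^ (k - Suc 0))) (at t)"
      by (rule DERIV_power[OF d])
    moreover have "of_nat k * (- ((1 / t)\<^sup>2) * (1 / t) ^ (k - Suc 0)) = - (k * (1 / t) ^ (k + 1))"
      by (cases k) (simp_all add: power2_eq_square)
    ultimately have dk: "((\<lambda>t. (1 / t) ^ k) has_real_derivative - (k * (1 / t) ^ (k + 1))) (at t)" by simp
    have de: "((\<lambda>t. exp (- (1 / t))) has_real_derivative exp (- (1 / t)) * (- (- ((1 / t)\<^sup>2)))) (at t)"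
      by (intro DERIV_fun_exp DERIV_minus d)
    have "((\<lambda>t. (1 / t) ^ k * exp (- 1 / t)) has_real_derivative
        (1 / t) ^ (k + 2) * exp (- 1 / t) - k * ((1 / t) ^ (k + 1) * exp (- 1 / t))) (at t)"
      using DERIV_mult[OF dk de] by (simp add: algebra_simps power_add power2_eq_square)
    then have "(expm k has_real_derivative
        (1 / t) ^ (k + 2) * exp (- 1 / t) - k * ((1 / t) ^ (k + 1) * exp (- 1 / t))) (at t)"
      by (rule has_field_derivative_transform_within_open[of _ _ _ "{0<..}"]) (use 3 in \<open>auto simp: expm_def\<close>)
    then show ?thesis using 3 by (simp add: expm_def)
  qed
qed

lemma smooth_expm: "smooth (\<lambda>x :: real^'n::finite. expm k (c * (x $ i) + d))"
proof -
  define S :: "(real^'n \<Rightarrow> real) set" where "S = {\<lambda>x. expm k (c * (x $ i) + d) |k. True}"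
  have d: "((\<lambda>x. expm k (c * (x $ i) + d)) has_derivative
      (\<lambda>h. (expm (k + 2) (c * (x $ i) + d) - k * expm (k + 1) (c * (x $ i) + d)) * (c * (h $ i)))) (at x)"
    for k and x :: "real^'n"
  proof -
    have "((\<lambda>x :: real^'n. c * (x $ i) + d) has_derivative (\<lambda>h. c * (h $ i))) (at x)"
      by (auto intro!: derivative_eq_intros bounded_linear_imp_has_derivative bounded_linear_vec_nth)
    from has_derivative_compose[OF this expm_deriv[unfolded has_field_derivative_def]]
    show ?thesis by simp
  qed
  show ?thesis
  proof (rule alg_smooth[of S])
    show "f differentiable at x" if "f \<in> S" for f x using that d by (auto simp: S_def differentiable_def)
    show "partial_deriv j f \<in> alg S" if fS: "f \<in> S" for f j
    proof -
      obtain k where f: "f = (\<lambda>x. expm k (c * (x $ i) + d))" using fS by (auto simp: S_def)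
      have "partial_deriv j f = (\<lambda>x. (expm (k + 2) (c * (x $ i) + d) + (- real k) * expm (k + 1) (c * (x $ i) + d)) * (c * (axis j 1 $ i)))"
        by (rule ext) (simp add: f partial_derivI[OF d])
      moreover have "\<dots> \<in> alg S"
        by (intro alg_mult alg_add alg_const alg_base) (auto simp: S_def)
      ultimately show ?thesis by simp
    qed
    show "(\<lambda>x. expm k (c * (x $ i) + d)) \<in> alg S" by (rule alg_base) (auto simp: S_def)
  qed
qed

lemma test_functionsI:
  assumes "smooth \<phi>" "compact K" "K \<subseteq> \<Omega>" "\<And>x. x \<notin> K \<Longrightarrow> \<phi> x = 0"
  shows "\<phi> \<in> test_functions \<Omega>"
proof -
  have "closure {x. \<phi> x \<noteq> 0} \<subseteq> K"
    by (rule closure_minimal) (use assms in \<open>auto intro: compact_imp_closed\<close>)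
  moreover from this have "compact (closure {x. \<phi> x \<noteq> 0})"
    using assms(2) by (metis closed_Int_compact closed_closure inf.absorb1)
  ultimately show ?thesis using assms(1,3) by (auto simp: test_functions_def)
qed

lemma test_functionsE:
  assumes "\<phi> \<in> test_functions \<Omega>"
  obtains K where "smooth \<phi>" "compact K" "K \<subseteq> \<Omega>" "\<And>x. x \<notin> K \<Longrightarrow> \<phi> x = 0"
proof (rule that)
  show "smooth \<phi>" "compact (closure {x. \<phi> x \<noteq> 0})" "closure {x. \<phi> x \<noteq> 0} \<subseteq> \<Omega>"
    using assms by (simp_all add: test_functions_def)
  show "\<phi> x = 0" if "x \<notin> closure {x. \<phi> x \<noteq> 0}" for x
    using that closure_subset[of "{x. \<phi> x \<noteq> 0}"] by blast
qed

lemma test_functions_mono: "\<Omega> \<subseteq> \<Omega>' \<Longrightarrow> test_functions \<Omega> \<subseteq> test_functions \<Omega>'"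
  by (auto simp: test_functions_def)

lemma test_functions_smooth: "\<phi> \<in> test_functions \<Omega> \<Longrightarrow> smooth \<phi>"
  by (auto simp: test_functions_def)

lemma test_functions_eq_0: "\<phi> \<in> test_functions \<Omega> \<Longrightarrow> x \<notin> \<Omega> \<Longrightarrow> \<phi> x = 0"
  by (metis subsetD test_functionsE)

lemma test_functions_add: "\<phi> \<in> test_functions \<Omega> \<Longrightarrow> \<psi> \<in> test_functions \<Omega> \<Longrightarrow> (\<lambda>x. \<phi> x + \<psi> x) \<in> test_functions \<Omega>"
proof (elim test_functionsE)
  fix K L assume "smooth \<phi>" "compact K" "K \<subseteq> \<Omega>" "\<And>x. x \<notin> K \<Longrightarrow> \<phi> x = 0"
    "smooth \<psi>" "compact L" "L \<subseteq> \<Omega>" "\<And>x. x \<notin> L \<Longrightarrow> \<psi> x = 0"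
  then show ?thesis by (intro test_functionsI[of _ "K \<union> L"] smooth_add) auto
qed

lemma test_functions_mult: "\<phi> \<in> test_functions \<Omega> \<Longrightarrow> smooth \<psi> \<Longrightarrow> (\<lambda>x. \<psi> x * \<phi> x) \<in> test_functions \<Omega>"
proof (elim test_functionsE)
  fix K assume "smooth \<phi>" "compact K" "K \<subseteq> \<Omega>" "\<And>x. x \<notin> K \<Longrightarrow> \<phi> x = 0" "smooth \<psi>"
  then show ?thesis by (intro test_functionsI[of _ K] smooth_mult) auto
qed

lemma test_functions_cmult: "\<phi> \<in> test_functions \<Omega> \<Longrightarrow> (\<lambda>x. c * \<phi> x) \<in> test_functions \<Omega>"
  by (rule test_functions_mult[OF _ smooth_const])

lemma test_functions_0: "(\<lambda>x. 0) \<in> test_functions \<Omega>"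
  by (rule test_functionsI[of _ "{}"]) (auto intro: smooth_const)

lemma test_functions_partial_deriv:
  assumes "\<phi> \<in> test_functions \<Omega>"
  shows "partial_deriv i \<phi> \<in> test_functions \<Omega>"
  using assms
proof (elim test_functionsE)
  fix K assume K: "smooth \<phi>" "compact K" "K \<subseteq> \<Omega>" "\<And>x. x \<notin> K \<Longrightarrow> \<phi> x = 0"
  have "partial_deriv i \<phi> x = 0" if "x \<notin> K" for x
  proof -
    have "((\<lambda>x. 0) has_derivative (\<lambda>h. 0)) (at x)" by simp
    then have "(\<phi> has_derivative (\<lambda>h. 0)) (at x)"
      by (rule has_derivative_transform_within_open[of _ _ _ _ "- K"])
        (use K that in \<open>auto simp: compact_imp_closed open_Compl\<close>)
    then show ?thesis by (simp add: partial_derivI)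
  qed
  then show ?thesis using K by (intro test_functionsI smooth_partial_deriv)
qed

lemma test_functions_bounded:
  assumes "\<phi> \<in> test_functions \<Omega>"
  obtains M where "M \<ge> 0" "\<And>x. \<bar>\<phi> x\<bar> \<le> M"
  using assms
proof (elim test_functionsE)
  fix K assume K: "smooth \<phi>" "compact K" "K \<subseteq> \<Omega>" "\<And>x. x \<notin> K \<Longrightarrow> \<phi> x = 0"
  have "bounded (\<phi> ` K)"
    by (intro compact_imp_bounded compact_continuous_image smooth_continuous_on K)
  then obtain M where M: "\<And>x. x \<in> K \<Longrightarrow> \<bar>\<phi> x\<bar> \<le> M" unfolding bounded_iff by auto
  show thesis
  proof (rule that)
    show "max 0 M \<ge> 0" by simp
    show "\<bar>\<phi> x\<bar> \<le> max 0 M" for x using M[of x] K(4)[of x] by (cases "x \<in> K") auto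
  qed
qed

lemma test_functions_continuous: "\<phi> \<in> test_functions \<Omega> \<Longrightarrow> continuous_on A \<phi>"
  by (auto simp: test_functions_def smooth_continuous_on)

lemma test_functions_measurable: "\<phi> \<in> test_functions \<Omega> \<Longrightarrow> \<phi> \<in> borel_measurable borel"
  by (intro borel_measurable_continuous_onI test_functions_continuous)

section \<open>Smooth cutoffs and approximation by test functions\<close>

definition bump :: "real^'n::finite \<Rightarrow> real^'n \<Rightarrow> real \<Rightarrow> real^'n \<Rightarrow> real" where
  "bump a b k x = (\<Prod>i\<in>UNIV. expm 0 (k * (x $ i) + - k * a $ i) * expm 0 (- k * (x $ i) + k * b $ i))"

lemma smooth_bump: "smooth (bump a b k)"
  unfolding bump_def[abs_def] by (intro smooth_prod smooth_mult smooth_expm) auto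

lemma expm_0_bounds: "0 \<le> expm 0 t" "expm 0 t \<le> 1"
  by (auto simp: expm_def)

lemma bump_bounds: "0 \<le> bump a b k x" "bump a b k x \<le> 1"
  unfolding bump_def by (auto intro!: prod_nonneg prod_le_1 mult_nonneg_nonneg mult_le_one expm_0_bounds)

lemma bump_eq_0:
  assumes "x \<notin> box a b" "k > 0"
  shows "bump a b k x = 0"
proof -
  obtain i where "x $ i \<le> a $ i \<or> b $ i \<le> x $ i" using assms(1) by (auto simp: mem_box_cart not_less)
  then have "expm 0 (k * (x $ i) + - k * a $ i) * expm 0 (- k * (x $ i) + k * b $ i) = 0"
    using assms(2) by (auto simp: expm_def zero_less_mult_iff simp flip: right_diff_distrib)
  then show ?thesis unfolding bump_def by (intro prod_zero) auto
qed

lemma bump_pos: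
  assumes "x \<in> box a b" "k > 0"
  shows "bump a b k x > 0"
  using assms unfolding bump_def
  by (auto intro!: prod_pos mult_pos_pos simp: mem_box_cart expm_def)

lemma bump_test:
  assumes "cbox a b \<subseteq> \<Omega>" "k > 0"
  shows "bump a b k \<in> test_functions \<Omega>"
  by (rule test_functionsI[of _ "cbox a b"])
    (use assms in \<open>auto intro!: smooth_bump bump_eq_0 simp: box_subset_cbox[THEN subsetD]\<close>)

text \<open>\<open>k\<close> is a steepness: inside the box each factor is
  \<open>exp (- 1 / (k s))\<close> with \<open>s\<close> the distance to the hyperplane of a face,
  and this tends to 1 as \<open>k\<close> grows.\<close>

lemma bump_tendsto_1:
  assumes "x \<in> box a b"
  shows "(\<lambda>k. bump a b (real (Suc k)) x) \<longlonglongrightarrow> 1"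
proof -
  have *: "(\<lambda>k. expm 0 (real (Suc k) * s)) \<longlonglongrightarrow> 1" if "s > 0" for s
  proof -
    have "(\<lambda>k. - (1 / s) * (1 / real (Suc k))) \<longlonglongrightarrow> - (1 / s) * 0"
      using LIMSEQ_inverse_real_of_nat by (intro tendsto_intros) (simp add: inverse_eq_divide)
    then have "(\<lambda>k. exp (- (1 / s) * (1 / real (Suc k)))) \<longlonglongrightarrow> exp 0"
      by (intro tendsto_intros) simp
    moreover have "expm 0 (real (Suc k) * s) = exp (- (1 / s) * (1 / real (Suc k)))" for k
      using that by (simp add: expm_def)
    ultimately show ?thesis by simp
  qed
  have "(\<lambda>k. bump a b (real (Suc k)) x) \<longlonglongrightarrow> (\<Prod>i\<in>(UNIV::'a set). 1 * 1)"
    unfolding bump_def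
  proof (intro tendsto_prod tendsto_mult)
    fix i
    show "(\<lambda>k. expm 0 (real (Suc k) * x $ i + - real (Suc k) * a $ i)) \<longlonglongrightarrow> 1"
      using *[of "x $ i - a $ i"] assms by (simp add: mem_box_cart algebra_simps)
    show "(\<lambda>k. expm 0 (- real (Suc k) * x $ i + real (Suc k) * b $ i)) \<longlonglongrightarrow> 1"
      using *[of "b $ i - x $ i"] assms by (simp add: mem_box_cart algebra_simps)
  qed
  then show ?thesis by simp
qed

lemma AE_lebesgue_onI:
  assumes "negligible N" "\<Omega> \<in> sets lebesgue" "\<And>x. x \<in> \<Omega> \<Longrightarrow> x \<notin> N \<Longrightarrow> P x"
  shows "AE x in lebesgue_on \<Omega>. P x"
proof -
  have "AE x in lebesgue. x \<in> \<Omega> \<longrightarrow> P x"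
    by (rule AE_I'[of N]) (use assms in \<open>auto simp: negligible_iff_null_sets\<close>)
  then show ?thesis using assms(2) by (simp add: AE_restrict_space_iff)
qed

text \<open>For the first \<open>j\<close> of countably many boxes covering \<Omega>, one minus the
  product of the \<open>1 - bump\<close> is a smooth version of the indicator of their union. As the
  steepness grows with \<open>j\<close>, it tends to 1 off the box frontiers, which are
  negligible.\<close>

lemma ex_cutoff:
  fixes \<Omega> :: "(real^'n::finite) set"
  assumes "open \<Omega>"
  obtains \<eta> :: "nat \<Rightarrow> real^'n \<Rightarrow> real" where "\<And>j. \<eta> j \<in> test_functions \<Omega>"
    "\<And>j x. 0 \<le> \<eta> j x" "\<And>j x. \<eta> j x \<le> 1" "AE x in lebesgue_on \<Omega>. (\<lambda>j. \<eta> j x) \<longlonglongrightarrow> 1"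
proof -
  obtain \<D> where \<D>: "countable \<D>" "\<D> \<subseteq> Pow \<Omega>" "\<And>X. X \<in> \<D> \<Longrightarrow> \<exists>a b. X = cbox a b" "\<Union>\<D> = \<Omega>"
    using open_countable_Union_open_cbox[OF assms] by metis
  \<comment> \<open>The empty box keeps the enumeration meaningful when \<Omega> is empty.\<close>
  define \<D>' where "\<D>' = insert {} \<D>"
  have \<D>': "countable \<D>'" "\<D>' \<noteq> {}" "\<Union>\<D>' = \<Omega>" using \<D> by (auto simp: \<D>'_def)
  have "{} = cbox (1::real^'n) 0" by (auto simp: mem_box_cart) (metis not_one_le_zero order_trans)
  then have box: "\<exists>a b. X = cbox a b" if "X \<in> \<D>'" for X using that \<D>(3) by (auto simp: \<D>'_def)
  define X where "X = from_nat_into \<D>'"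
  have rX: "range X = \<D>'" unfolding X_def using \<D>' by (simp add: range_from_nat_into)
  then have "\<exists>a b. X m = cbox a b" for m using box by auto
  then obtain a b where ab: "\<And>m. X m = cbox (a m) (b m)" by metis
  have sub: "cbox (a m) (b m) \<subseteq> \<Omega>" for m using ab rX \<D>'(3) by (metis Union_upper rangeI)
  define \<eta> where "\<eta> j x = 1 - (\<Prod>m<j. 1 - bump (a m) (b m) (real (Suc j)) x)" for j x
  define N where "N = (\<Union>m. frontier (cbox (a m) (b m)))"
  show thesis
  proof (rule that)
    show "\<eta> j \<in> test_functions \<Omega>" for j
    proof (rule test_functionsI)
      show "smooth (\<eta> j)" unfolding \<eta>_def[abs_def]
        by (intro smooth_diff smooth_prod smooth_const smooth_bump) auto
      show "compact (\<Union>m<j. cbox (a m) (b m))" by (intro compact_UN) auto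
      show "(\<Union>m<j. cbox (a m) (b m)) \<subseteq> \<Omega>" using sub by blast
      show "\<eta> j x = 0" if "x \<notin> (\<Union>m<j. cbox (a m) (b m))" for x
      proof -
        have "bump (a m) (b m) (real (Suc j)) x = 0" if "m < j" for m
          by (rule bump_eq_0) (use that \<open>x \<notin> _\<close> box_subset_cbox in blast, simp)
        then show ?thesis by (simp add: \<eta>_def)
      qed
    qed
    have p: "0 \<le> (\<Prod>m<j. 1 - bump (a m) (b m) k x)" "(\<Prod>m<j. 1 - bump (a m) (b m) k x) \<le> 1" for j k x
      by (auto intro!: prod_nonneg prod_le_1 simp: bump_bounds)
    show "0 \<le> \<eta> j x" "\<eta> j x \<le> 1" for j x using p by (simp_all add: \<eta>_def)
    show "AE x in lebesgue_on \<Omega>. (\<lambda>j. \<eta> j x) \<longlonglongrightarrow> 1"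
    proof (rule AE_lebesgue_onI)
      show "negligible N" unfolding N_def
        by (rule negligible_countable_Union) (auto intro: negligible_convex_frontier)
      show "\<Omega> \<in> sets lebesgue" using assms by simp
      fix x assume "x \<in> \<Omega>" "x \<notin> N"
      then obtain m where "x \<in> cbox (a m) (b m)" using \<D>'(3) rX ab by auto
      then have m: "x \<in> box (a m) (b m)" using \<open>x \<notin> N\<close>
        by (auto simp: N_def frontier_def interior_cbox)
      have "(\<lambda>j. \<Prod>m<j. 1 - bump (a m) (b m) (real (Suc j)) x) \<longlonglongrightarrow> 0"
      proof (rule tendsto_sandwich)
        show "\<forall>\<^sub>F j in sequentially. 0 \<le> (\<Prod>m<j. 1 - bump (a m) (b m) (real (Suc j)) x)" by (simp add: p)
        show "\<forall>\<^sub>F j in sequentially. (\<Prod>m<j. 1 - bump (a m) (b m) (real (Suc j)) x) \<le> 1 - bump (a m) (b m) (real (Suc j)) x"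
        proof (rule eventually_sequentiallyI[of "Suc m"])
          fix j assume "Suc m \<le> j"
          then have "(\<Prod>m<j. 1 - bump (a m) (b m) (real (Suc j)) x) =
             (1 - bump (a m) (b m) (real (Suc j)) x) * (\<Prod>m\<in>{..<j} - {m}. 1 - bump (a m) (b m) (real (Suc j)) x)"
            by (intro prod.remove) auto
          also have "\<dots> \<le> (1 - bump (a m) (b m) (real (Suc j)) x) * 1"
            by (intro mult_left_mono prod_le_1) (auto simp: bump_bounds)
          finally show "(\<Prod>m<j. 1 - bump (a m) (b m) (real (Suc j)) x) \<le> 1 - bump (a m) (b m) (real (Suc j)) x" by simp
        qed
        have "(\<lambda>j. 1 - bump (a m) (b m) (real (Suc j)) x) \<longlonglongrightarrow> 1 - 1"
          by (intro tendsto_intros bump_tendsto_1 m)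
        then show "(\<lambda>j. 1 - bump (a m) (b m) (real (Suc j)) x) \<longlonglongrightarrow> 0" by simp
      qed simp
      then have "(\<lambda>j. \<eta> j x) \<longlonglongrightarrow> 1 - 0" unfolding \<eta>_def by (intro tendsto_intros)
      then show "(\<lambda>j. \<eta> j x) \<longlonglongrightarrow> 1" by simp
    qed
  qed
qed

text \<open>Continuous approximations are clipped to \<open>[-M, M]\<close>, replaced by polynomials
  on the compact closure, and cut off. Polynomials being smooth, Stone-Weierstrass stands in for
  mollification; its error of at most 1 explains the bound \<open>M + 1\<close>.\<close>

lemma ex_test_approximation:
  fixes f :: "real^'n::finite \<Rightarrow> real"
  assumes \<Omega>: "open \<Omega>" "bounded \<Omega>" and f: "f \<in> borel_measurable (lebesgue_on \<Omega>)"
    and M: "\<And>x. x \<in> \<Omega> \<Longrightarrow> \<bar>f x\<bar> \<le> M" and M0: "M \<ge> 0"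
  obtains \<phi> :: "nat \<Rightarrow> real^'n \<Rightarrow> real" where "\<And>j. \<phi> j \<in> test_functions \<Omega>"
    "\<And>j x. x \<in> \<Omega> \<Longrightarrow> \<bar>\<phi> j x\<bar> \<le> M + 1" "AE x in lebesgue_on \<Omega>. (\<lambda>j. \<phi> j x) \<longlonglongrightarrow> f x"
proof -
  have \<Omega>s: "\<Omega> \<in> sets lebesgue" using \<Omega> by simp
  obtain N g where N: "negligible N" and g: "\<And>n. continuous_on UNIV (g n)"
    and lim: "\<And>x. x \<notin> N \<Longrightarrow> (\<lambda>n. g n x) \<longlonglongrightarrow> (if x \<in> \<Omega> then f x else 0)"
    using f[folded measurable_on_iff_borel_measurable[OF \<Omega>s]] unfolding measurable_on_def by metis
  define c where "c n x = max (-M) (min M (g n x))" for n x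
  have c: "continuous_on (closure \<Omega>) (c n)" for n
    unfolding c_def[abs_def] by (intro continuous_intros continuous_on_subset[OF g]) auto
  have "\<exists>p. real_polynomial_function p \<and> (\<forall>x\<in>closure \<Omega>. \<bar>c n x - p x\<bar> < 1 / Suc n)" for n
  proof -
    have "compact (closure \<Omega>)" using \<Omega> by (simp add: compact_closure)
    then obtain p where "real_polynomial_function p" "\<And>x. x \<in> closure \<Omega> \<Longrightarrow> \<bar>c n x - p x\<bar> < 1 / Suc n"
      using Stone_Weierstrass_real_polynomial_function[OF _ c, of "1 / Suc n" n]
      by (metis of_nat_0_less_iff zero_less_Suc zero_less_divide_1_iff)
    then show ?thesis by blast
  qed
  then obtain p where p: "\<And>n. real_polynomial_function (p n)"
    and pc: "\<And>n x. x \<in> \<Omega> \<Longrightarrow> \<bar>c n x - p n x\<bar> < 1 / Suc n" by (metis closure_subset subsetD)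
  obtain \<eta> :: "nat \<Rightarrow> real^'n \<Rightarrow> real" where \<eta>: "\<And>j. \<eta> j \<in> test_functions \<Omega>"
    "\<And>j x. 0 \<le> \<eta> j x" "\<And>j x. \<eta> j x \<le> 1" "AE x in lebesgue_on \<Omega>. (\<lambda>j. \<eta> j x) \<longlonglongrightarrow> 1"
    using ex_cutoff[OF \<Omega>(1)] by blast
  show thesis
  proof (rule that)
    show "(\<lambda>x. p j x * \<eta> j x) \<in> test_functions \<Omega>" for j
      by (intro test_functions_mult \<eta> smooth_real_polynomial_function p)
    show "\<bar>p j x * \<eta> j x\<bar> \<le> M + 1" if "x \<in> \<Omega>" for j x
    proof -
      have "1 / real (Suc j) \<le> 1" by simp
      moreover have "\<bar>c j x\<bar> \<le> M" using M0 by (auto simp: c_def)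
      ultimately have "\<bar>p j x\<bar> \<le> M + 1" using pc[OF that, of j] by linarith
      then have "\<bar>p j x\<bar> * \<bar>\<eta> j x\<bar> \<le> (M + 1) * 1" using \<eta>(2,3)[of j x] M0 by (intro mult_mono) auto
      then show ?thesis by (simp add: abs_mult)
    qed
    have "AE x in lebesgue_on \<Omega>. x \<in> \<Omega> \<and> x \<notin> N" by (rule AE_lebesgue_onI[OF N \<Omega>s]) auto
    with \<eta>(4) show "AE x in lebesgue_on \<Omega>. (\<lambda>j. p j x * \<eta> j x) \<longlonglongrightarrow> f x"
    proof eventually_elim
      case (elim x)
      have "(\<lambda>n. c n x) \<longlonglongrightarrow> max (-M) (min M (f x))"
        unfolding c_def using lim[of x] elim by (intro tendsto_intros) auto
      then have cl: "(\<lambda>n. c n x) \<longlonglongrightarrow> f x" using M[of x] elim by (auto simp: abs_le_iff min_absorb2 max_absorb2)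
      have "(\<lambda>n. c n x - p n x) \<longlonglongrightarrow> 0"
        by (rule Lim_null_comparison[OF _ LIMSEQ_inverse_real_of_nat])
          (use pc[of x] elim in \<open>auto intro!: always_eventually less_imp_le simp: inverse_eq_divide\<close>)
      then have "(\<lambda>n. c n x - (c n x - p n x)) \<longlonglongrightarrow> f x - 0" by (intro tendsto_intros cl)
      then have "(\<lambda>n. p n x * \<eta> n x) \<longlonglongrightarrow> f x * 1" using elim by (intro tendsto_intros) auto
      then show ?case by simp
    qed
  qed
qed

section \<open>Change of variables under affine maps\<close>

definition scales :: "real^'n::finite^'n \<Rightarrow> real \<Rightarrow> bool" where
  "scales A c \<longleftrightarrow> (\<forall>S\<in>lmeasurable. (*v) A ` S \<in> lmeasurable \<and> vol ((*v) A ` S) = c * vol S)"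

lemma scales_mult:
  assumes "scales A c" "scales B d"
  shows "scales (A ** B) (c * d)"
proof -
  have "(*v) (A ** B) ` S = (*v) A ` (*v) B ` S" for S
    by (simp add: image_comp o_def matrix_vector_mul_assoc)
  then show ?thesis using assms by (simp add: scales_def)
qed

lemma scalesI:
  assumes "\<And>a b. vol ((*v) A ` cbox a b) = c * vol (cbox a b)"
  shows "scales A c"
  using measure_linear_sufficient[OF matrix_vector_mul_linear _ assms] by (simp add: scales_def)

lemma scales_diagonal:
  fixes A :: "real^'n::finite^'n"
  assumes "\<And>i j. i \<noteq> j \<Longrightarrow> A $ i $ j = 0"
  shows "scales A \<bar>det A\<bar>"
proof -
  have "(*v) A = (\<lambda>x. \<chi> k. A $ k $ k * x $ k)"
  proof (intro ext, simp add: vec_eq_iff matrix_vector_mult_def, intro allI)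
    fix x :: "real^'n" and i
    have "(\<Sum>j\<in>UNIV. A $ i $ j * x $ j) = (\<Sum>j\<in>{i}. A $ i $ j * x $ j)"
      using assms by (intro sum.mono_neutral_right) auto
    then show "(\<Sum>j\<in>UNIV. A $ i $ j * x $ j) = A $ i $ i * x $ i" by simp
  qed
  then show ?thesis
    using assms by (simp add: scales_def measurable_stretch measure_stretch det_diagonal)
qed

lemma scales_swap:
  fixes m n :: "'n::finite"
  assumes "m \<noteq> n"
  shows "scales (\<chi> i j. mat 1 $ i $ Transposition.transpose m n j) 1"
proof (rule scalesI)
  fix a b :: "real^'n"
  let ?t = "Transposition.transpose m n"
  let ?A = "(\<chi> i j. mat 1 $ i $ ?t j) :: real^'n^'n"
  have A: "(?A *v x) $ i = x $ ?t i" for x :: "real^'n" and i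
  proof -
    have "i = ?t j \<longleftrightarrow> j = ?t i" for j by (metis transpose_involutory)
    then have "(?A *v x) $ i = (\<Sum>j\<in>UNIV. (if j = ?t i then 1 else 0) * x $ j)"
      by (simp add: matrix_vector_mult_def mat_def)
    then show ?thesis by (simp add: if_distrib[of "\<lambda>u. u * y" for y] cong: if_cong)
  qed
  have inv: "?A *v (?A *v x) = x" for x :: "real^'n" by (simp add: vec_eq_iff A)
  have mem: "?A *v x \<in> cbox (?A *v a) (?A *v b) \<longleftrightarrow> x \<in> cbox a b" for x
    unfolding mem_box_cart A by (metis transpose_involutory)
  have "(*v) ?A ` cbox a b = cbox (?A *v a) (?A *v b)"
  proof (intro set_eqI iffI)
    fix x assume "x \<in> cbox (?A *v a) (?A *v b)"
    then have "?A *v x \<in> cbox a b" using mem[of "?A *v x"] by (simp add: inv)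
    then have "?A *v (?A *v x) \<in> (*v) ?A ` cbox a b" by (rule imageI)
    then show "x \<in> (*v) ?A ` cbox a b" by (simp only: inv)
  qed (use mem in auto)
  moreover have "(\<Prod>i\<in>UNIV. b $ ?t i - a $ ?t i) = (\<Prod>i\<in>UNIV. b $ i - a $ i)"
    by (rule prod.reindex_bij_betw) (simp add: bij_betw_def)
  moreover have "(cbox (?A *v a) (?A *v b) = {}) = (cbox a b = {})"
    using calculation(1) by (simp flip: calculation(1))
  ultimately show "vol ((*v) ?A ` cbox a b) = 1 * vol (cbox a b)"
    by (cases "cbox a b = {}") (simp_all add: content_cbox_cart A)
qed

lemma scales_shear:
  fixes m n :: "'n::finite"
  assumes mn: "m \<noteq> n"
  shows "scales (\<chi> i j. of_bool (i = m \<and> j = n \<or> i = j)) 1"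
proof (rule scalesI)
  fix a b :: "real^'n"
  let ?A = "(\<chi> i j. of_bool (i = m \<and> j = n \<or> i = j)) :: real^'n^'n"
  have A: "(*v) ?A = (\<lambda>x. \<chi> i. if i = m then x $ m + x $ n else x $ i)"
  proof
    fix x :: "real^'n"
    have "(?A *v x) $ i = (if i = m then x $ m + x $ n else x $ i)" for i
    proof (cases "i = m")
      case True
      have "(?A *v x) $ i = (\<Sum>j\<in>UNIV. of_bool (j = n \<or> m = j) * x $ j)"
        by (simp add: True matrix_vector_mult_def)
      also have "\<dots> = (\<Sum>j\<in>{m, n}. of_bool (j = n \<or> m = j) * x $ j)"
        by (intro sum.mono_neutral_right) auto
      finally show ?thesis using mn True by simp
    next
      case False
      then have "(?A *v x) $ i = (\<Sum>j\<in>UNIV. of_bool (i = j) * x $ j)"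
        by (simp add: matrix_vector_mult_def)
      also have "\<dots> = (\<Sum>j\<in>{i}. of_bool (i = j) * x $ j)"
        by (intro sum.mono_neutral_right) auto
      finally show ?thesis using False by simp
    qed
    then show "?A *v x = (\<chi> i. if i = m then x $ m + x $ n else x $ i)"
      by (simp add: vec_eq_iff)
  qed
  show "vol ((*v) ?A ` cbox a b) = 1 * vol (cbox a b)"
  proof (cases "cbox a b = {}")
    case False
    \<comment> \<open>The translation brings the \<open>n\<close>-th lower bound to 0, because the
      formula for sheared boxes asks for a nonnegative one.\<close>
    define v where "v = axis n (- a $ n)"
    have "(*v) ?A ` cbox a b = (+) (- (?A *v v)) ` (*v) ?A ` cbox (v + a) (v + b)"
      unfolding cbox_translation image_comp o_def by (simp add: matrix_vector_right_distrib)
    then have "vol ((*v) ?A ` cbox a b) = vol ((*v) ?A ` cbox (v + a) (v + b))"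
      by (simp only: measure_translation)
    also have "\<dots> = vol (cbox (v + a) (v + b))"
      unfolding A by (rule measure_shear_interval[OF mn]) (use False in \<open>auto simp: cbox_translation v_def axis_def\<close>)
    also have "\<dots> = vol (cbox a b)" unfolding cbox_translation by (rule measure_translation)
    finally show ?thesis by simp
  qed simp
qed

text \<open>Induction over products of elementary matrices. The transpose is carried along because
  transposing an elementary matrix gives one of the same kind with the same factor; this is how a
  matrix and its transpose come to scale volumes equally.\<close>

lemma ex_scales:
  fixes A :: "real^'n::finite^'n"
  assumes "invertible A"
  shows "\<exists>c>0. scales A c \<and> scales (transpose A) c"
proof -
  have "invertible A \<longrightarrow> ?thesis"
  proof (rule induct_matrix_elementary_alt[of "\<lambda>A. invertible A \<longrightarrow> (\<exists>c>0. scales A c \<and> scales (transpose A) c)"])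
    fix A B :: "real^'n^'n"
    assume A: "invertible A \<longrightarrow> (\<exists>c>0. scales A c \<and> scales (transpose A) c)"
      and B: "invertible B \<longrightarrow> (\<exists>c>0. scales B c \<and> scales (transpose B) c)"
    show "invertible (A ** B) \<longrightarrow> (\<exists>c>0. scales (A ** B) c \<and> scales (transpose (A ** B)) c)"
    proof
      assume "invertible (A ** B)"
      then have "invertible A" "invertible B" by (auto simp: invertible_det_nz det_mul)
      with A B obtain c d where "c > 0" "scales A c" "scales (transpose A) c" "d > 0" "scales B d" "scales (transpose B) d"
        by blast
      then show "\<exists>c>0. scales (A ** B) c \<and> scales (transpose (A ** B)) c"
        using scales_mult[of A c B d] scales_mult[of "transpose B" d "transpose A" c]
        by (intro exI[of _ "c * d"]) (simp add: matrix_transpose_mul mult.commute)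
    qed
  next
    fix A :: "real^'n^'n" and i assume "row i A = 0"
    then show "invertible A \<longrightarrow> (\<exists>c>0. scales A c \<and> scales (transpose A) c)"
      by (simp add: invertible_det_nz det_zero_row)
  next
    fix A :: "real^'n^'n" assume 0: "\<And>i j. i \<noteq> j \<Longrightarrow> A $ i $ j = 0"
    have "transpose A = A" using 0 by (simp add: vec_eq_iff transpose_def) metis
    then show "invertible A \<longrightarrow> (\<exists>c>0. scales A c \<and> scales (transpose A) c)"
      using scales_diagonal[OF 0] by (auto simp: invertible_det_nz intro!: exI[of _ "\<bar>det A\<bar>"])
  next
    fix m n :: 'n assume "m \<noteq> n"
    let ?A = "(\<chi> i j. mat 1 $ i $ Transposition.transpose m n j) :: real^'n^'n"
    have "transpose ?A = ?A"
      by (simp add: vec_eq_iff transpose_def mat_def)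
    then show "invertible ?A \<longrightarrow> (\<exists>c>0. scales ?A c \<and> scales (transpose ?A) c)"
      using scales_swap[OF \<open>m \<noteq> n\<close>] by (intro impI exI[of _ 1]) simp
  next
    fix m n :: 'n assume mn: "m \<noteq> n"
    let ?A = "\<lambda>m n :: 'n. (\<chi> i j. of_bool (i = m \<and> j = n \<or> i = j)) :: real^'n^'n"
    have tr: "transpose (?A m n) = ?A n m"
      by (auto simp: vec_eq_iff transpose_def)
    show "invertible (?A m n) \<longrightarrow> (\<exists>c>0. scales (?A m n) c \<and> scales (transpose (?A m n)) c)"
      unfolding tr using scales_shear[OF mn] scales_shear[OF mn[symmetric]] by (intro impI exI[of _ 1]) simp
  qed
  then show ?thesis using assms by blast
qed

text \<open>The absolute value of the determinant; the change of variables formula of the library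
  is restricted to a well-ordered index type.\<close>

definition vscale :: "real^'n::finite^'n \<Rightarrow> real" where
  "vscale A = vol ((*v) A ` cbox 0 One)"

lemma scales_unique: "scales A c \<Longrightarrow> c = vscale A"
  by (simp add: scales_def vscale_def)

lemma
  assumes "invertible A"
  shows vscale_pos: "vscale A > 0" and scales_vscale: "scales A (vscale A)"
    and vscale_transpose: "vscale (transpose A) = vscale A"
  using ex_scales[OF assms] scales_unique by metis+

lemma vscale_mult:
  assumes "invertible A" "invertible B"
  shows "vscale (A ** B) = vscale A * vscale B"
  using scales_unique[OF scales_mult[OF scales_vscale[OF assms(1)] scales_vscale[OF assms(2)]]] by simp

lemma vscale_mat_1: "vscale (mat 1) = 1"
  by (rule scales_unique[symmetric]) (simp add: scales_def)

lemma invertible_matrix_inv: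
  fixes A :: "real^'n::finite^'n"
  assumes "invertible A"
  shows "invertible (matrix_inv A)" "A ** matrix_inv A = mat 1" "matrix_inv A ** A = mat 1"
proof -
  have "A ** matrix_inv A = mat 1 \<and> matrix_inv A ** A = mat 1"
    using assms unfolding invertible_def matrix_inv_def by (rule someI_ex)
  then show "invertible (matrix_inv A)" "A ** matrix_inv A = mat 1" "matrix_inv A ** A = mat 1"
    by (auto simp: invertible_def)
qed

lemma vscale_matrix_inv:
  assumes "invertible A"
  shows "vscale (matrix_inv A) = 1 / vscale A"
proof -
  have "vscale A * vscale (matrix_inv A) = 1"
    using vscale_mult[OF assms invertible_matrix_inv(1)[OF assms]]
    unfolding invertible_matrix_inv(2)[OF assms] vscale_mat_1 ..
  then show ?thesis using vscale_pos[OF assms] by (simp add: field_simps)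
qed

lemma vscale_orthogonal:
  assumes "orthogonal_matrix U"
  shows "vscale U = 1"
proof -
  have U: "invertible U" "transpose U ** U = mat 1"
    using assms by (auto simp: orthogonal_matrix_def invertible_def)
  have "vscale U * vscale U = 1"
    using vscale_mult[of "transpose U" U] U
    by (simp add: vscale_mat_1 vscale_transpose transpose_invertible) 
  then show ?thesis using vscale_pos[OF U(1)] by (metis abs_of_pos power2_eq_1_iff power2_eq_square real_sqrt_abs real_sqrt_one)
qed

section \<open>Affine maps acting on Lebesgue measure and integrals\<close>

definition aff :: "real^'n^'n \<Rightarrow> real^'n \<Rightarrow> real^'n::finite \<Rightarrow> real^'n" where
  "aff A b x = A *v x + b"

lemma aff_inverse:
  assumes "invertible A"
  shows "aff (matrix_inv A) (- (matrix_inv A *v b)) (aff A b x) = x"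
    and "aff A b (aff (matrix_inv A) (- (matrix_inv A *v b)) x) = x"
  using invertible_matrix_inv[OF assms]
  by (simp_all add: aff_def matrix_vector_right_distrib matrix_vector_mul_assoc
      matrix_vector_mult_diff_distrib)

lemma ex_aff_inverse:
  fixes A :: "real^'n::finite^'n"
  assumes "invertible A"
  obtains B c where "invertible B" "vscale B = 1 / vscale A"
    "\<And>x. aff B c (aff A b x) = x" "\<And>x. aff A b (aff B c x) = x"
  using aff_inverse[OF assms] invertible_matrix_inv(1)[OF assms] vscale_matrix_inv[OF assms] that by metis

lemma aff_image_lebesgue:
  assumes "S \<in> sets lebesgue"
  shows "aff A b ` S \<in> sets lebesgue"
proof (rule differentiable_image_in_sets_lebesgue[OF assms order_refl])
  show "aff A b differentiable_on S"
    unfolding differentiable_on_def differentiable_def aff_def[abs_def]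
    by (auto intro!: exI derivative_eq_intros bounded_linear_imp_has_derivative)
qed

lemma aff_vimage:
  assumes "\<And>x. aff B c (aff A b x) = x" "\<And>x. aff A b (aff B c x) = x"
  shows "aff A b -` S = aff B c ` S"
  using assms by (auto simp: image_iff) metis

lemma measurable_aff:
  assumes "invertible A"
  shows "aff A b \<in> lebesgue \<rightarrow>\<^sub>M lebesgue"
proof (rule measurableI)
  fix S :: "(real^'a) set" assume S: "S \<in> sets lebesgue"
  obtain B c where B: "\<And>x. aff B c (aff A b x) = x" "\<And>x. aff A b (aff B c x) = x"
    using ex_aff_inverse[OF assms] by metis
  then show "aff A b -` S \<inter> space lebesgue \<in> sets lebesgue"
    using aff_image_lebesgue[OF S] by (simp add: aff_vimage[OF B])
qed simp

lemma emeasure_aff_image: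
  fixes A :: "real^'n::finite^'n"
  assumes A: "invertible A" and S: "S \<in> sets lebesgue"
  shows "emeasure lebesgue (aff A b ` S) = ennreal (vscale A) * emeasure lebesgue S"
proof -
  have inj: "inj (aff A b)" using ex_aff_inverse[OF A] by (metis injI)
  have fin: "emeasure lebesgue (aff A b ` S) = ennreal (vscale A) * emeasure lebesgue S" if "S \<in> lmeasurable" for S
  proof -
    have im: "aff A b ` S = (+) b ` (*v) A ` S" by (auto simp: aff_def image_comp add.commute)
    have "(*v) A ` S \<in> lmeasurable" "vol ((*v) A ` S) = vscale A * vol S"
      using scales_vscale[OF A] that by (auto simp: scales_def)
    then have "aff A b ` S \<in> lmeasurable" "vol (aff A b ` S) = vscale A * vol S"
      unfolding im by (simp_all add: measurable_translation measure_translation)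
    then show ?thesis using that vscale_pos[OF A]
      by (simp add: emeasure_eq_measure2 ennreal_mult')
  qed
  \<comment> \<open>\<open>scales\<close> speaks of sets of finite measure only; balls exhaust the
    general case.\<close>
  define T where "T k = S \<inter> cball 0 (real k)" for k :: nat
  have T: "T k \<in> lmeasurable" for k using fmeasurable_Int_fmeasurable[OF lmeasurable_cball S] by (simp add: T_def Int_commute)
  then have T': "T k \<in> sets lebesgue" for k by blast
  have inc: "incseq T" unfolding T_def incseq_def by auto
  have "x \<in> (\<Union>k. cball 0 (real k))" for x :: "real^'n" using real_arch_simple[of "norm x"] by auto
  then have U: "(\<Union>k. T k) = S" unfolding T_def by auto
  have "emeasure lebesgue (aff A b ` S) = emeasure lebesgue (\<Union>k. aff A b ` T k)"
    using U by (metis image_UN)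
  also have "\<dots> = (SUP k. emeasure lebesgue (aff A b ` T k))"
    by (rule SUP_emeasure_incseq[symmetric])
      (use inc T' in \<open>auto simp: incseq_def intro!: aff_image_lebesgue\<close>)
  also have "\<dots> = (SUP k. ennreal (vscale A) * emeasure lebesgue (T k))" by (simp add: fin T)
  also have "\<dots> = ennreal (vscale A) * (SUP k. emeasure lebesgue (T k))"
    by (rule SUP_mult_left_ennreal[symmetric])
  also have "(SUP k. emeasure lebesgue (T k)) = emeasure lebesgue S"
    using SUP_emeasure_incseq[of T lebesgue] inc T' U by auto
  finally show ?thesis .
qed

lemma distr_aff:
  assumes A: "invertible A" and B: "invertible B"
    "\<And>x. aff B c (aff A b x) = x" "\<And>x. aff A b (aff B c x) = x"
  shows "distr lebesgue lebesgue (aff B c) = density lebesgue (\<lambda>_. ennreal (vscale A))"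
proof (rule measure_eqI)
  fix S assume "S \<in> sets (distr lebesgue lebesgue (aff B c))"
  then have S: "S \<in> sets lebesgue" by simp
  have "emeasure (distr lebesgue lebesgue (aff B c)) S = emeasure lebesgue (aff A b ` S)"
    using S measurable_aff[OF B(1)] by (simp add: emeasure_distr aff_vimage[OF B(3,2)])
  also have "\<dots> = ennreal (vscale A) * emeasure lebesgue S" by (rule emeasure_aff_image[OF A S])
  also have "\<dots> = emeasure (density lebesgue (\<lambda>_. ennreal (vscale A))) S"
    using S by (simp add: emeasure_density_const)
  finally show "emeasure (distr lebesgue lebesgue (aff B c)) S = emeasure (density lebesgue (\<lambda>_. ennreal (vscale A))) S" .
qed simp

lemma measurable_aff_on:
  assumes "invertible A" "aff A b ` \<Omega> \<subseteq> \<Omega>'"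
  shows "aff A b \<in> lebesgue_on \<Omega> \<rightarrow>\<^sub>M lebesgue_on \<Omega>'"
  using measurable_aff[OF assms(1)] assms(2)
  by (intro measurable_restrict_space2 measurable_restrict_space1) auto

context
  fixes A :: "real^'n::finite^'n" and b :: "real^'n" and \<Omega> :: "(real^'n) set"
  assumes A: "invertible A" and \<Omega>: "\<Omega> \<in> sets lebesgue"
begin

lemma measurable_aff_iff:
  "f \<in> borel_measurable (lebesgue_on (aff A b ` \<Omega>)) \<longleftrightarrow> (\<lambda>x. f (aff A b x)) \<in> borel_measurable (lebesgue_on \<Omega>)"
proof
  assume "f \<in> borel_measurable (lebesgue_on (aff A b ` \<Omega>))"
  then show "(\<lambda>x. f (aff A b x)) \<in> borel_measurable (lebesgue_on \<Omega>)"
    using measurable_compose[OF measurable_aff_on[OF A order_refl]] by blast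
next
  obtain B c where B: "invertible B" "\<And>x. aff B c (aff A b x) = x" "\<And>x. aff A b (aff B c x) = x"
    using ex_aff_inverse[OF A] by metis
  assume f: "(\<lambda>x. f (aff A b x)) \<in> borel_measurable (lebesgue_on \<Omega>)"
  have "aff B c ` aff A b ` \<Omega> \<subseteq> \<Omega>" using B by auto
  from measurable_compose[OF measurable_aff_on[OF B(1) this] f]
  show "f \<in> borel_measurable (lebesgue_on (aff A b ` \<Omega>))" by (simp add: B)
qed

text \<open>No integrability is assumed: measurability passes in both directions, and if one side
  fails to be integrable so does the other, both integrals then being 0 by convention.\<close>

lemma
  fixes f :: "real^'n \<Rightarrow> 'b::{banach, second_countable_topology}"
  shows integrable_aff_iff: "integrable (lebesgue_on (aff A b ` \<Omega>)) f \<longleftrightarrow> integrable (lebesgue_on \<Omega>) (\<lambda>x. f (aff A b x))"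
      (is ?I)
    and integral_aff: "integral\<^sup>L (lebesgue_on (aff A b ` \<Omega>)) f = vscale A *\<^sub>R integral\<^sup>L (lebesgue_on \<Omega>) (\<lambda>x. f (aff A b x))"
      (is ?E)
proof -
  have "?I \<and> ?E"
  proof (cases "f \<in> borel_measurable (lebesgue_on (aff A b ` \<Omega>))")
    case False
    then have "\<not> integrable (lebesgue_on (aff A b ` \<Omega>)) f" "\<not> integrable (lebesgue_on \<Omega>) (\<lambda>x. f (aff A b x))"
      using measurable_aff_iff[of f] by auto
    then show ?thesis by (simp add: not_integrable_integral_eq)
  next
    case True
    obtain B c where B: "invertible B" "\<And>x. aff B c (aff A b x) = x" "\<And>x. aff A b (aff B c x) = x"
      using ex_aff_inverse[OF A] by metis
    have im: "aff A b ` \<Omega> \<in> sets lebesgue" by (rule aff_image_lebesgue[OF \<Omega>])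
    define h where "h x = indicator \<Omega> x *\<^sub>R f (aff A b x)" for x
    have hB: "h (aff B c y) = indicator (aff A b ` \<Omega>) y *\<^sub>R f y" for y
    proof -
      have "aff B c y \<in> \<Omega> \<longleftrightarrow> y \<in> aff A b ` \<Omega>" using B by (auto simp: image_iff) metis
      then show ?thesis by (simp add: h_def indicator_def B)
    qed
    have h: "h \<in> borel_measurable lebesgue"
      using True \<Omega> unfolding measurable_aff_iff h_def[abs_def] by (simp add: borel_measurable_restrict_space_iff)
    have d: "distr lebesgue lebesgue (aff B c) = density lebesgue (\<lambda>_. ennreal (vscale A))"
      by (rule distr_aff[OF A B])
    have p: "vscale A > 0" by (rule vscale_pos[OF A])
    have i1: "integrable (lebesgue_on (aff A b ` \<Omega>)) f \<longleftrightarrow> integrable lebesgue (\<lambda>y. h (aff B c y))"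
      using im by (simp add: integrable_restrict_space hB)
    also have "\<dots> \<longleftrightarrow> integrable (density lebesgue (\<lambda>_. ennreal (vscale A))) h"
      unfolding d[symmetric] by (rule integrable_distr_eq[symmetric, OF measurable_aff[OF B(1)] h])
    also have "\<dots> \<longleftrightarrow> integrable lebesgue (\<lambda>x. vscale A *\<^sub>R h x)"
      using h p by (intro integrable_density) auto
    also have "\<dots> \<longleftrightarrow> integrable lebesgue h"
    proof
      assume "integrable lebesgue (\<lambda>x. vscale A *\<^sub>R h x)"
      then have "integrable lebesgue (\<lambda>x. inverse (vscale A) *\<^sub>R (vscale A *\<^sub>R h x))"
        by (rule integrable_scaleR_right)
      then show "integrable lebesgue h" using p by simp
    qed simp
    also have "\<dots> \<longleftrightarrow> integrable (lebesgue_on \<Omega>) (\<lambda>x. f (aff A b x))"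
      using \<Omega> by (simp add: integrable_restrict_space h_def[abs_def])
    finally have ?I .
    have "integral\<^sup>L (lebesgue_on (aff A b ` \<Omega>)) f = integral\<^sup>L lebesgue (\<lambda>y. h (aff B c y))"
      using im by (simp add: integral_restrict_space hB)
    also have "\<dots> = integral\<^sup>L (density lebesgue (\<lambda>_. ennreal (vscale A))) h"
      unfolding d[symmetric] by (rule integral_distr[symmetric, OF measurable_aff[OF B(1)] h])
    also have "\<dots> = integral\<^sup>L lebesgue (\<lambda>x. vscale A *\<^sub>R h x)"
      using h p by (intro integral_density) auto
    also have "\<dots> = vscale A *\<^sub>R integral\<^sup>L lebesgue h" by simp
    also have "integral\<^sup>L lebesgue h = integral\<^sup>L (lebesgue_on \<Omega>) (\<lambda>x. f (aff A b x))"
      using \<Omega> by (simp add: integral_restrict_space h_def[abs_def])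
    finally show ?thesis using \<open>?I\<close> by simp
  qed
  then show ?I ?E by simp_all
qed

lemma vol_aff: "vol (aff A b ` \<Omega>) = vscale A * vol \<Omega>"
  using emeasure_aff_image[OF A \<Omega>] vscale_pos[OF A]
  by (simp add: measure_def enn2real_mult)

end

section \<open>Square integrable functions\<close>

lemma square_sum_le: "(a + b)\<^sup>2 \<le> 2 * a\<^sup>2 + 2 * b\<^sup>2" for a b :: real
  using sum_squares_bound[of a b] by (simp add: power2_sum)

text \<open>By the mean value inequality \<open>w\<close> dominates every difference quotient, so
  dominated convergence applies along each null sequence.\<close>

lemma DERIV_integral:
  fixes h h' :: "real \<Rightarrow> 'a \<Rightarrow> real"
  assumes r0: "r0 \<in> {lo<..<hi}" and int: "\<And>r. r \<in> {lo<..<hi} \<Longrightarrow> integrable M (h r)"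
    and d: "\<And>r x. r \<in> {lo<..<hi} \<Longrightarrow> x \<in> space M \<Longrightarrow> ((\<lambda>r. h r x) has_real_derivative h' r x) (at r)"
    and w: "\<And>r x. r \<in> {lo<..<hi} \<Longrightarrow> x \<in> space M \<Longrightarrow> \<bar>h' r x\<bar> \<le> w x" "integrable M w"
    and m: "h' r0 \<in> borel_measurable M"
  shows "((\<lambda>r. integral\<^sup>L M (h r)) has_real_derivative integral\<^sup>L M (h' r0)) (at r0)"
  unfolding DERIV_def LIMSEQ_SEQ_conv[symmetric]
proof (intro allI impI, elim conjE)
  fix X :: "nat \<Rightarrow> real" assume X0: "\<forall>n. X n \<noteq> 0" and X: "X \<longlonglongrightarrow> 0"
  have "(\<lambda>n. r0 + X n) \<longlonglongrightarrow> r0 + 0" by (intro tendsto_intros X)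
  then have "\<forall>\<^sub>F n in sequentially. r0 + X n \<in> {lo<..<hi}"
    using r0 by (intro topological_tendstoD) auto
  then obtain N where N: "\<And>n. n \<ge> N \<Longrightarrow> r0 + X n \<in> {lo<..<hi}" by (auto simp: eventually_sequentially)
  define Y where "Y n = X (n + N)" for n
  have Y: "r0 + Y n \<in> {lo<..<hi}" "Y n \<noteq> 0" for n using N X0 by (auto simp: Y_def)
  have Ylim: "Y \<longlonglongrightarrow> 0" unfolding Y_def[abs_def] by (rule LIMSEQ_ignore_initial_segment[OF X])
  have "(\<lambda>n. integral\<^sup>L M (\<lambda>x. (h (r0 + Y n) x - h r0 x) / Y n)) \<longlonglongrightarrow> integral\<^sup>L M (h' r0)"
  proof (rule integral_dominated_convergence[OF m _ w(2)])
    show "(\<lambda>x. (h (r0 + Y n) x - h r0 x) / Y n) \<in> borel_measurable M" for n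
      using int[OF Y(1)[of n]] int[OF r0] by (intro borel_measurable_divide borel_measurable_diff) auto
    show "AE x in M. (\<lambda>n. (h (r0 + Y n) x - h r0 x) / Y n) \<longlonglongrightarrow> h' r0 x"
    proof (rule AE_I2)
      fix x assume "x \<in> space M"
      from d[OF r0 this] have "(\<lambda>t. (h (r0 + t) x - h r0 x) / t) \<midarrow>0\<rightarrow> h' r0 x" by (simp add: DERIV_def)
      then show "(\<lambda>n. (h (r0 + Y n) x - h r0 x) / Y n) \<longlonglongrightarrow> h' r0 x"
        unfolding LIMSEQ_SEQ_conv[symmetric] using Ylim Y(2) by blast
    qed
    show "AE x in M. norm ((h (r0 + Y n) x - h r0 x) / Y n) \<le> w x" for n
    proof (rule AE_I2)
      fix x assume x: "x \<in> space M"
      have "norm (h (r0 + Y n) x - h r0 x) \<le> w x * norm (r0 + Y n - r0)"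
        by (rule field_differentiable_bound[of "{lo<..<hi}" _ "\<lambda>r. h' r x"])
          (use d[OF _ x] w(1)[OF _ x] Y r0 in \<open>auto intro: has_field_derivative_at_within\<close>)
      then show "norm ((h (r0 + Y n) x - h r0 x) / Y n) \<le> w x"
        using Y(2)[of n] by (simp add: divide_le_eq)
    qed
  qed
  moreover have "integral\<^sup>L M (\<lambda>x. (h (r0 + Y n) x - h r0 x) / Y n)
      = (integral\<^sup>L M (h (r0 + Y n)) - integral\<^sup>L M (h r0)) / Y n" for n
    using int[OF Y(1)[of n]] int[OF r0] by simp
  ultimately have "(\<lambda>n. (integral\<^sup>L M (h (r0 + X (n + N))) - integral\<^sup>L M (h r0)) / X (n + N)) \<longlonglongrightarrow> integral\<^sup>L M (h' r0)"
    by (simp only: Y_def)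
  then show "(\<lambda>n. (integral\<^sup>L M (h (r0 + X n)) - integral\<^sup>L M (h r0)) / X n) \<longlonglongrightarrow> integral\<^sup>L M (h' r0)"
    by (rule LIMSEQ_offset)
qed

lemma test_functions_lebesgue_measurable: "\<phi> \<in> test_functions \<Omega> \<Longrightarrow> \<phi> \<in> borel_measurable (lebesgue_on S)"
  by (intro measurable_restrict_space1 measurable_completion) (simp add: test_functions_measurable)

text \<open>The integral of a translate does not depend on the translation, and its derivative at 0
  in direction \<open>e\<close> is the integral of the partial derivative.\<close>

lemma integral_partial_deriv_eq_0:
  fixes \<phi> :: "real^'n::finite \<Rightarrow> real"
  assumes \<phi>: "\<phi> \<in> test_functions \<Omega>" and \<Omega>: "bounded \<Omega>"
  shows "integral\<^sup>L lebesgue (partial_deriv i \<phi>) = 0"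
proof -
  obtain R where R: "\<And>x. x \<in> \<Omega> \<Longrightarrow> norm x \<le> R" using \<Omega> by (auto simp: bounded_iff)
  have i\<phi>: "partial_deriv i \<phi> \<in> test_functions \<Omega>" by (rule test_functions_partial_deriv[OF \<phi>])
  obtain M where M: "M \<ge> 0" "\<And>x. \<bar>partial_deriv i \<phi> x\<bar> \<le> M" using test_functions_bounded[OF i\<phi>] by blast
  obtain M' where M': "M' \<ge> 0" "\<And>x. \<bar>\<phi> x\<bar> \<le> M'" using test_functions_bounded[OF \<phi>] by blast
  define e :: "real^'n" where "e = axis i 1"
  have ne: "norm e = 1" by (simp add: e_def)
  define h where "h t x = \<phi> (x + t *\<^sub>R e)" for t x
  define h' where "h' t x = partial_deriv i \<phi> (x + t *\<^sub>R e)" for t x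
  \<comment> \<open>Radius \<open>R + 1\<close> catches the supports of all translates by less than
    1, so one integrable majorant serves them all.\<close>
  define B where "B = cball (0 :: real^'n) (R + 1)"
  have out: "x + t *\<^sub>R e \<notin> \<Omega>" if "t \<in> {-1<..<1}" "x \<notin> B" for t x
  proof
    assume "x + t *\<^sub>R e \<in> \<Omega>"
    have "norm x \<le> norm (x + t *\<^sub>R e) + norm (t *\<^sub>R e)" by (metis add_diff_cancel_right' norm_triangle_ineq4)
    moreover have "\<bar>t\<bar> \<le> 1" using that(1) by auto
    then have "norm (x + t *\<^sub>R e) + norm (t *\<^sub>R e) \<le> R + 1"
      using R[OF \<open>x + t *\<^sub>R e \<in> \<Omega>\<close>] ne by simp
    ultimately show False using that(2) by (simp add: B_def)
  qed
  have iB: "integrable lebesgue (\<lambda>x. C * indicator B x)" for C :: real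
    unfolding B_def by (intro integrable_mult_right integrable_real_indicator) (use emeasure_bounded_finite[OF bounded_cball] in \<open>auto simp: less_top\<close>)
  have cont: "continuous_on UNIV (\<lambda>x. f (x + t *\<^sub>R e))" if "f \<in> test_functions \<Omega>" for f t
    by (rule continuous_on_compose2[OF test_functions_continuous[OF that, of UNIV]]) (auto intro!: continuous_intros)
  have meas: "(\<lambda>x. f (x + t *\<^sub>R e)) \<in> borel_measurable lebesgue" if "f \<in> test_functions \<Omega>" for f t
    using borel_measurable_continuous_onI[OF cont[OF that]] by (intro measurable_completion) simp
  have ih: "integrable lebesgue (h t)" if t: "t \<in> {-1<..<1}" for t
  proof (rule Bochner_Integration.integrable_bound[OF iB])
    show "h t \<in> borel_measurable lebesgue" unfolding h_def[abs_def] by (rule meas[OF \<phi>])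
    show "AE x in lebesgue. norm (h t x) \<le> norm (M' * indicator B x)"
      using out[OF t] M' test_functions_eq_0[OF \<phi>] by (auto simp: h_def indicator_def)
  qed
  have "((\<lambda>t. integral\<^sup>L lebesgue (h t)) has_real_derivative integral\<^sup>L lebesgue (h' 0)) (at 0)"
  proof (rule DERIV_integral[where lo = "-1" and hi = 1 and w = "\<lambda>x. M * indicator B x"])
    show "h' 0 \<in> borel_measurable lebesgue" unfolding h'_def[abs_def] by (rule meas[OF i\<phi>])
    show "\<bar>h' t x\<bar> \<le> M * indicator B x" if "t \<in> {-1<..<1}" for t x
      using out[OF that, of x] M test_functions_eq_0[OF i\<phi>] by (auto simp: h'_def indicator_def)
    fix t x
    have "((\<lambda>t. x + t *\<^sub>R e) has_derivative (\<lambda>t. t *\<^sub>R e)) (at t)"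
      by (auto intro!: derivative_eq_intros)
    from has_derivative_compose[OF this has_derivative_partial_deriv[OF smooth_differentiable[OF test_functions_smooth[OF \<phi>]]]]
    have "((\<lambda>t. h t x) has_derivative (\<lambda>s. \<Sum>j\<in>UNIV. (s *\<^sub>R e) $ j * partial_deriv j \<phi> (x + t *\<^sub>R e))) (at t)"
      unfolding h_def .
    also have "(\<lambda>s. \<Sum>j\<in>UNIV. (s *\<^sub>R e) $ j * partial_deriv j \<phi> (x + t *\<^sub>R e)) = (\<lambda>s. h' t x * s)"
    proof
      fix s
      have "(\<Sum>j\<in>UNIV. (s *\<^sub>R e) $ j * partial_deriv j \<phi> (x + t *\<^sub>R e)) = (\<Sum>j\<in>{i}. (s *\<^sub>R e) $ j * partial_deriv j \<phi> (x + t *\<^sub>R e))"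
        by (intro sum.mono_neutral_right) (auto simp: e_def axis_def)
      then show "(\<Sum>j\<in>UNIV. (s *\<^sub>R e) $ j * partial_deriv j \<phi> (x + t *\<^sub>R e)) = h' t x * s"
        by (simp add: h'_def e_def)
    qed
    finally show "((\<lambda>t. h t x) has_real_derivative h' t x) (at t)" by (simp add: has_field_derivative_def)
  qed (use ih iB in auto)
  moreover have "integral\<^sup>L lebesgue (h t) = integral\<^sup>L lebesgue \<phi>" for t
  proof -
    have I: "invertible (mat 1 :: real^'n^'n)" by (auto simp: invertible_def intro!: exI[of _ "mat 1"])
    have "range (aff (mat 1) (t *\<^sub>R e)) = UNIV"
      by (rule surjI[where f = "\<lambda>x. x - t *\<^sub>R e"]) (simp add: aff_def)
    then show ?thesis using integral_aff[OF I, of UNIV "t *\<^sub>R e" \<phi>]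
      by (simp add: lebesgue_on_UNIV_eq vscale_mat_1 aff_def h_def[abs_def])
  qed
  ultimately have "((\<lambda>t. integral\<^sup>L lebesgue \<phi>) has_real_derivative integral\<^sup>L lebesgue (h' 0)) (at 0)" by simp
  then have "integral\<^sup>L lebesgue (h' 0) = 0" using DERIV_const DERIV_unique by blast
  then show ?thesis by (simp add: h'_def[abs_def])
qed

lemma sets_lebesgue_on_subset: "K \<subseteq> \<Omega> \<Longrightarrow> K \<in> sets lebesgue \<Longrightarrow> \<Omega> \<in> sets lebesgue \<Longrightarrow>
    lebesgue_on K = restrict_space (lebesgue_on \<Omega>) K"
  by (subst restrict_restrict_space) (auto simp: Int_absorb1)

locale bdd_open =
  fixes \<Omega> :: "(real^'n::finite) set"
  assumes op: "open \<Omega>" and bd: "bounded \<Omega>"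
begin

lemma lm: "\<Omega> \<in> lmeasurable"
  by (rule lmeasurable_open[OF bd op])

lemma sets_lebesgue: "\<Omega> \<in> sets lebesgue"
  using lm by blast

sublocale finite_measure "lebesgue_on \<Omega>"
  by (rule finite_measure_lebesgue_on[OF lm])

lemma L2D: "u \<in> L2 \<Omega> \<Longrightarrow> u \<in> borel_measurable (lebesgue_on \<Omega>)"
  "u \<in> L2 \<Omega> \<Longrightarrow> integrable (lebesgue_on \<Omega>) (\<lambda>x. (norm (u x))\<^sup>2)"
  by (auto simp: L2_def)

lemma L2_lin:
  fixes u v :: "real^'n \<Rightarrow> 'b::euclidean_space"
  assumes "u \<in> L2 \<Omega>" "v \<in> L2 \<Omega>"
  shows "(\<lambda>x. u x + c *\<^sub>R v x) \<in> L2 \<Omega>"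
proof -
  have m: "(\<lambda>x. u x + c *\<^sub>R v x) \<in> borel_measurable (lebesgue_on \<Omega>)"
    using assms by (intro borel_measurable_add borel_measurable_scaleR) (auto dest: L2D)
  have "integrable (lebesgue_on \<Omega>) (\<lambda>x. (norm (u x + c *\<^sub>R v x))\<^sup>2)"
  proof (rule Bochner_Integration.integrable_bound)
    show "integrable (lebesgue_on \<Omega>) (\<lambda>x. 2 * (norm (u x))\<^sup>2 + 2 * c\<^sup>2 * (norm (v x))\<^sup>2)"
      using assms by (intro Bochner_Integration.integrable_add integrable_mult_right) (auto dest: L2D)
    show "AE x in lebesgue_on \<Omega>. norm ((norm (u x + c *\<^sub>R v x))\<^sup>2) \<le> norm (2 * (norm (u x))\<^sup>2 + 2 * c\<^sup>2 * (norm (v x))\<^sup>2)"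
    proof (rule AE_I2)
      fix x
      have "(norm (u x + c *\<^sub>R v x))\<^sup>2 \<le> (norm (u x) + \<bar>c\<bar> * norm (v x))\<^sup>2"
        by (intro power_mono) (metis norm_scaleR norm_triangle_ineq, simp)
      also have "\<dots> \<le> 2 * (norm (u x))\<^sup>2 + 2 * (\<bar>c\<bar> * norm (v x))\<^sup>2" by (rule square_sum_le)
      finally show "norm ((norm (u x + c *\<^sub>R v x))\<^sup>2) \<le> norm (2 * (norm (u x))\<^sup>2 + 2 * c\<^sup>2 * (norm (v x))\<^sup>2)"
        by (simp add: power_mult_distrib)
    qed
  qed (use m in measurable)
  then show ?thesis using m by (simp add: L2_def)
qed

lemma L2_inner:
  fixes u v :: "real^'n \<Rightarrow> 'b::euclidean_space"
  assumes "u \<in> L2 \<Omega>" "v \<in> L2 \<Omega>"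
  shows "integrable (lebesgue_on \<Omega>) (\<lambda>x. u x \<bullet> v x)"
proof (rule Bochner_Integration.integrable_bound)
  show "integrable (lebesgue_on \<Omega>) (\<lambda>x. (norm (u x))\<^sup>2 + (norm (v x))\<^sup>2)"
    using assms by (intro Bochner_Integration.integrable_add) (auto dest: L2D)
  show "AE x in lebesgue_on \<Omega>. norm (u x \<bullet> v x) \<le> norm ((norm (u x))\<^sup>2 + (norm (v x))\<^sup>2)"
  proof (rule AE_I2)
    fix x
    have "\<bar>u x \<bullet> v x\<bar> \<le> norm (u x) * norm (v x)" by (rule Cauchy_Schwarz_ineq2)
    also have "\<dots> \<le> (norm (u x))\<^sup>2 + (norm (v x))\<^sup>2"
      using sum_squares_bound[of "norm (u x)" "norm (v x)"]
        mult_nonneg_nonneg[OF norm_ge_zero norm_ge_zero, of "u x" "v x"] by linarith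
    finally show "norm (u x \<bullet> v x) \<le> norm ((norm (u x))\<^sup>2 + (norm (v x))\<^sup>2)" by simp
  qed
qed (use assms in \<open>auto intro!: borel_measurable_inner dest: L2D\<close>)

lemma L2_mult:
  fixes u v :: "real^'n \<Rightarrow> real"
  assumes "u \<in> L2 \<Omega>" "v \<in> L2 \<Omega>"
  shows "integrable (lebesgue_on \<Omega>) (\<lambda>x. u x * v x)"
  using L2_inner[OF assms] by simp

lemma L2_bounded:
  fixes u :: "real^'n \<Rightarrow> 'b::euclidean_space"
  assumes "u \<in> borel_measurable (lebesgue_on \<Omega>)" "\<And>x. x \<in> \<Omega> \<Longrightarrow> norm (u x) \<le> M"
  shows "u \<in> L2 \<Omega>"
proof -
  have "integrable (lebesgue_on \<Omega>) (\<lambda>x. (norm (u x))\<^sup>2)"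
    by (rule integrable_const_bound[of _ "M\<^sup>2"]) (use assms in \<open>auto intro!: power_mono AE_I2\<close>)
  then show ?thesis using assms(1) by (simp add: L2_def)
qed

lemma L2_const: "(\<lambda>x. c :: 'b::euclidean_space) \<in> L2 \<Omega>"
  by (rule L2_bounded) auto

lemma L2_integrable:
  fixes u :: "real^'n \<Rightarrow> 'b::euclidean_space"
  assumes "u \<in> L2 \<Omega>"
  shows "integrable (lebesgue_on \<Omega>) u"
proof (rule Bochner_Integration.integrable_bound)
  show "integrable (lebesgue_on \<Omega>) (\<lambda>x. 1 + (norm (u x))\<^sup>2)"
    using assms by (intro Bochner_Integration.integrable_add) (auto dest: L2D)
  show "AE x in lebesgue_on \<Omega>. norm (u x) \<le> norm (1 + (norm (u x))\<^sup>2)"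
  proof (rule AE_I2)
    fix x
    have "norm (u x) \<le> 1 + (norm (u x))\<^sup>2"
      using sum_squares_bound[of "norm (u x)" 1, simplified] norm_ge_zero[of "u x"] by linarith
    then show "norm (u x) \<le> norm (1 + (norm (u x))\<^sup>2)" by simp
  qed
qed (use assms in \<open>auto dest: L2D\<close>)

lemma L2_component: "g \<in> L2 \<Omega> \<Longrightarrow> (\<lambda>x. g x $ i) \<in> L2 \<Omega>" for g :: "real^'n \<Rightarrow> real^'m::finite"
proof -
  assume g: "g \<in> L2 \<Omega>"
  have m: "(\<lambda>x. g x $ i) \<in> borel_measurable (lebesgue_on \<Omega>)"
    using borel_measurable_inner[OF L2D(1)[OF g] borel_measurable_const[of "axis i 1"]]
    by (simp add: inner_axis)
  have "integrable (lebesgue_on \<Omega>) (\<lambda>x. (norm (g x $ i))\<^sup>2)"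
  proof (rule Bochner_Integration.integrable_bound[OF L2D(2)[OF g]])
    show "AE x in lebesgue_on \<Omega>. norm ((norm (g x $ i))\<^sup>2) \<le> norm ((norm (g x))\<^sup>2)"
    proof (rule AE_I2)
      fix x
      show "norm ((norm (g x $ i))\<^sup>2) \<le> norm ((norm (g x))\<^sup>2)"
        using power_mono[OF component_le_norm_cart abs_ge_zero, of "g x" i 2] by simp
    qed
  qed (use m in measurable)
  then show ?thesis using m by (simp add: L2_def)
qed

lemma test_L2: "\<phi> \<in> test_functions \<Omega>' \<Longrightarrow> \<phi> \<in> L2 \<Omega>"
proof -
  assume \<phi>: "\<phi> \<in> test_functions \<Omega>'"
  then obtain M where "\<And>x. \<bar>\<phi> x\<bar> \<le> M" using test_functions_bounded by blast
  then show ?thesis using test_functions_lebesgue_measurable[OF \<phi>] by (intro L2_bounded) auto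
qed

lemma L2_lin_real: "u \<in> L2 \<Omega> \<Longrightarrow> v \<in> L2 \<Omega> \<Longrightarrow> (\<lambda>x. u x + c * v x) \<in> L2 \<Omega>" for u v :: "real^'n \<Rightarrow> real"
  using L2_lin[of u v c] by simp

lemma L2_diff: "u \<in> L2 \<Omega> \<Longrightarrow> v \<in> L2 \<Omega> \<Longrightarrow> (\<lambda>x. u x - v x) \<in> L2 \<Omega>" for u v :: "real^'n \<Rightarrow> 'b::euclidean_space"
  using L2_lin[of u v "-1"] by simp

lemma L2_restrict:
  fixes u :: "real^'n \<Rightarrow> 'b::euclidean_space"
  assumes u: "u \<in> L2 \<Omega>" and K: "K \<subseteq> \<Omega>" "K \<in> sets lebesgue"
  shows "u \<in> L2 K"
proof -
  have e: "lebesgue_on K = restrict_space (lebesgue_on \<Omega>) K"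
    by (rule sets_lebesgue_on_subset[OF K sets_lebesgue])
  have Ks: "K \<in> sets (lebesgue_on \<Omega>)" using K sets_lebesgue by (auto simp: sets_restrict_space_iff)
  have "u \<in> borel_measurable (lebesgue_on K)" unfolding e by (rule measurable_restrict_space1[OF L2D(1)[OF u]])
  moreover have "integrable (lebesgue_on K) (\<lambda>x. (norm (u x))\<^sup>2)"
    unfolding e using integrable_mult_indicator[OF Ks L2D(2)[OF u]] Ks K by (simp add: integrable_restrict_space Int_absorb2)
  ultimately show ?thesis by (simp add: L2_def)
qed

text \<open>Riesz-Fischer. A subsequence with squared gaps at most \<open>(1/4)^k\<close> converges
  almost everywhere, and Fatou's lemma turns the Cauchy estimates into estimates of the distance to
  the limit.\<close>

lemma L2_complete:
  fixes f :: "nat \<Rightarrow> real^'n \<Rightarrow> 'b::euclidean_space"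
  assumes f: "\<And>n. f n \<in> L2 \<Omega>"
    and cauchy: "\<And>e. e > 0 \<Longrightarrow> \<exists>N. \<forall>m\<ge>N. \<forall>n\<ge>N. integral\<^sup>L (lebesgue_on \<Omega>) (\<lambda>x. (norm (f m x - f n x))\<^sup>2) < e"
  shows "\<exists>u\<in>L2 \<Omega>. (\<lambda>n. integral\<^sup>L (lebesgue_on \<Omega>) (\<lambda>x. (norm (f n x - u x))\<^sup>2)) \<longlonglongrightarrow> 0"
proof -
  let ?M = "lebesgue_on \<Omega>"
  have "\<exists>r. \<forall>k. (\<forall>m\<ge>r k. \<forall>n\<ge>r k. integral\<^sup>L ?M (\<lambda>x. (norm (f m x - f n x))\<^sup>2) < (1/4)^k) \<and> r k < r (Suc k)"
  proof (rule dependent_nat_choice)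
    show "\<exists>x. \<forall>m\<ge>x. \<forall>n\<ge>x. integral\<^sup>L ?M (\<lambda>x. (norm (f m x - f n x))\<^sup>2) < (1/4)^0"
      using cauchy[of "(1/4)^0"] by simp
  next
    fix x :: nat and k :: nat
    obtain N where N: "\<forall>m\<ge>N. \<forall>n\<ge>N. integral\<^sup>L ?M (\<lambda>x. (norm (f m x - f n x))\<^sup>2) < (1/4)^Suc k"
      using cauchy[of "(1/4)^Suc k"] by auto
    then show "\<exists>y. (\<forall>m\<ge>y. \<forall>n\<ge>y. integral\<^sup>L ?M (\<lambda>x. (norm (f m x - f n x))\<^sup>2) < (1/4)^Suc k) \<and> x < y"
      by (intro exI[of _ "max N (Suc x)"]) auto
  qed
  then obtain r where r: "\<And>k m n. m \<ge> r k \<Longrightarrow> n \<ge> r k \<Longrightarrow> integral\<^sup>L ?M (\<lambda>x. (norm (f m x - f n x))\<^sup>2) < (1/4)^k"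
    and r_less: "\<And>k. r k < r (Suc k)" by blast
  have smr: "strict_mono r" using r_less by (rule strict_monoI_Suc)
  define d where "d k x = f (r (Suc k)) x - f (r k) x" for k x
  have dL: "d k \<in> L2 \<Omega>" for k unfolding d_def[abs_def] by (intro L2_diff f)
  have d2: "integral\<^sup>L ?M (\<lambda>x. (norm (d k x))\<^sup>2) \<le> (1/4)^k" for k
    using r[of k "r (Suc k)" "r k"] r_less[of k] by (simp add: d_def less_imp_le)
  define V where "V = measure ?M \<Omega>"
  have V0: "V \<ge> 0" by (simp add: V_def)
  have d1: "integral\<^sup>L ?M (\<lambda>x. norm (d k x)) \<le> (V + 1) * (1/2)^k" for k
  proof -
    have "integral\<^sup>L ?M (\<lambda>x. norm (d k x)) \<le> integral\<^sup>L ?M (\<lambda>x. (1/2)^k + 2^k * (norm (d k x))\<^sup>2)"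
    proof (rule integral_mono)
      show "integrable ?M (\<lambda>x. norm (d k x))" using L2_integrable[OF dL] by simp
      show "integrable ?M (\<lambda>x. (1/2)^k + 2^k * (norm (d k x))\<^sup>2)"
        using L2D(2)[OF dL] by (intro Bochner_Integration.integrable_add integrable_mult_right) auto
      fix x
      \<comment> \<open>From the nonnegative square of \<open>2^k * norm (d k x) - 1\<close>. On a
        space of finite measure it converts the squared bound \<open>(1/4)^k\<close> into a summable
        bound of order \<open>(1/2)^k\<close> for the integral of
        \<open>norm (d k x)\<close>.\<close>
      have "norm (d k x) * 1 \<le> (1/2)^k + 2^k * (norm (d k x))\<^sup>2"
      proof -
        define s :: real where "s = 2^k"
        have s: "s > 0" "(1/2)^k = 1 / s" by (simp_all add: s_def power_divide)
        have "0 \<le> (s * norm (d k x) - 1)\<^sup>2 / s" using s by simp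
        also have "\<dots> = s * (norm (d k x))\<^sup>2 - 2 * norm (d k x) + 1 / s"
          using s by (simp add: power2_eq_square field_simps)
        finally show ?thesis unfolding s(2) s_def[symmetric] using norm_ge_zero[of "d k x"] by linarith
      qed
      then show "norm (d k x) \<le> (1/2)^k + 2^k * (norm (d k x))\<^sup>2" by simp
    qed
    also have "\<dots> = V * (1/2)^k + 2^k * integral\<^sup>L ?M (\<lambda>x. (norm (d k x))\<^sup>2)"
      using L2D(2)[OF dL[of k]] by (simp add: V_def)
    also have "\<dots> \<le> V * (1/2)^k + 2^k * (1/4)^k" using d2[of k] by simp
    also have "2^k * (1/4)^k = (1/2::real)^k" by (simp flip: power_mult_distrib)
    finally show ?thesis by (simp add: algebra_simps)
  qed
  have AEsum: "AE x in ?M. summable (\<lambda>k. d k x)"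
  proof -
    have m: "(\<lambda>x. ennreal (norm (d k x))) \<in> borel_measurable ?M" for k using L2D(1)[OF dL[of k]] by measurable
    have i: "(\<integral>\<^sup>+x. ennreal (norm (d k x)) \<partial>?M) \<le> ennreal ((V + 1) * (1/2)^k)" for k
      using L2_integrable[OF dL[of k]] d1[of k] by (subst nn_integral_eq_integral) (auto intro: ennreal_leI)
    have "(\<integral>\<^sup>+x. (\<Sum>k. ennreal (norm (d k x))) \<partial>?M) = (\<Sum>k. \<integral>\<^sup>+x. ennreal (norm (d k x)) \<partial>?M)"
      by (rule nn_integral_suminf[OF m])
    also have "\<dots> \<le> (\<Sum>k. ennreal ((V + 1) * (1/2)^k))" by (rule suminf_le[OF i]) auto
    also have "\<dots> = ennreal (\<Sum>k. (V + 1) * (1/2)^k)"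
      by (rule suminf_ennreal2) (use V0 in \<open>auto intro!: summable_mult summable_geometric\<close>)
    also have "\<dots> < \<infinity>" by simp
    finally have "(\<integral>\<^sup>+x. (\<Sum>k. ennreal (norm (d k x))) \<partial>?M) \<noteq> \<infinity>" by simp
    then have "AE x in ?M. (\<Sum>k. ennreal (norm (d k x))) \<noteq> \<infinity>"
      using m by (intro nn_integral_PInf_AE borel_measurable_suminf) auto
    then show ?thesis
    proof eventually_elim
      case (elim x)
      then have "summable (\<lambda>k. norm (d k x))" by (intro summable_suminf_not_top) auto
      then show ?case by (rule summable_norm_cancel)
    qed
  qed
  \<comment> \<open>\<open>lim\<close> is arbitrary where the sequence diverges, which happens on a
    null set only, and it yields a measurable function.\<close>
  define u where "u x = lim (\<lambda>k. f (r k) x)" for x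
  have um: "u \<in> borel_measurable ?M" unfolding u_def[abs_def]
    by (rule borel_measurable_lim_metric) (rule L2D(1)[OF f])
  have AEu: "AE x in ?M. (\<lambda>k. f (r k) x) \<longlonglongrightarrow> u x"
    using AEsum
  proof eventually_elim
    case (elim x)
    have eq: "f (r k) x = f (r 0) x + (\<Sum>i<k. d i x)" for k by (induction k) (auto simp: d_def)
    have "(\<lambda>k. f (r 0) x + (\<Sum>i<k. d i x)) \<longlonglongrightarrow> f (r 0) x + (\<Sum>k. d k x)"
      by (intro tendsto_intros summable_LIMSEQ elim)
    then have "(\<lambda>k. f (r k) x) \<longlonglongrightarrow> f (r 0) x + (\<Sum>k. d k x)" by (simp flip: eq)
    then show ?case unfolding u_def by (metis limI)
  qed
  have key: "(\<integral>\<^sup>+x. ennreal ((norm (f m x - u x))\<^sup>2) \<partial>?M) \<le> ennreal ((1/4)^k)" if "m \<ge> r k" for m k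
  proof -
    have "(\<integral>\<^sup>+x. ennreal ((norm (f m x - u x))\<^sup>2) \<partial>?M) = (\<integral>\<^sup>+x. liminf (\<lambda>j. ennreal ((norm (f m x - f (r j) x))\<^sup>2)) \<partial>?M)"
    proof (rule nn_integral_cong_AE)
      show "AE x in ?M. ennreal ((norm (f m x - u x))\<^sup>2) = liminf (\<lambda>j. ennreal ((norm (f m x - f (r j) x))\<^sup>2))"
        using AEu
      proof eventually_elim
        case (elim x)
        then have "(\<lambda>j. ennreal ((norm (f m x - f (r j) x))\<^sup>2)) \<longlonglongrightarrow> ennreal ((norm (f m x - u x))\<^sup>2)"
          by (intro tendsto_intros) auto
        then show ?case by (rule lim_imp_Liminf[OF trivial_limit_sequentially, symmetric])
      qed
    qed
    also have "\<dots> \<le> liminf (\<lambda>j. \<integral>\<^sup>+x. ennreal ((norm (f m x - f (r j) x))\<^sup>2) \<partial>?M)"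
    proof (rule nn_integral_liminf)
      show "(\<lambda>x. ennreal ((norm (f m x - f (r j) x))\<^sup>2)) \<in> borel_measurable ?M" for j
        using L2D(1)[OF f[of m]] L2D(1)[OF f[of "r j"]] by measurable
    qed
    also have "\<dots> \<le> liminf (\<lambda>j. ennreal ((1/4)^k))"
    proof (rule Liminf_mono)
      show "\<forall>\<^sub>F j in sequentially. (\<integral>\<^sup>+x. ennreal ((norm (f m x - f (r j) x))\<^sup>2) \<partial>?M) \<le> ennreal ((1/4)^k)"
      proof (rule eventually_sequentiallyI[of k])
        fix j assume "k \<le> j"
        then have "r k \<le> r j" using smr by (simp add: strict_mono_less_eq)
        then have "integral\<^sup>L ?M (\<lambda>x. (norm (f m x - f (r j) x))\<^sup>2) \<le> (1/4)^k" using r[OF that] by (simp add: less_imp_le)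
        then show "(\<integral>\<^sup>+x. ennreal ((norm (f m x - f (r j) x))\<^sup>2) \<partial>?M) \<le> ennreal ((1/4)^k)"
          using L2D(2)[OF L2_diff[OF f[of m] f[of "r j"]]]
          by (subst nn_integral_eq_integral) (auto intro: ennreal_leI)
      qed
    qed
    finally show ?thesis by (simp add: Liminf_const)
  qed
  have m2: "(\<lambda>x. (norm (f m x - u x))\<^sup>2) \<in> borel_measurable ?M" for m
    using L2D(1)[OF f[of m]] um by measurable
  have int: "integrable ?M (\<lambda>x. (norm (f m x - u x))\<^sup>2)" if "m \<ge> r 0" for m
    by (rule integrableI_bounded[OF m2]) (use le_less_trans[OF key[OF that] ennreal_less_top] in simp)
  have "(\<lambda>x. f (r 0) x - u x) \<in> L2 \<Omega>"
    using int[of "r 0"] um L2D(1)[OF f[of "r 0"]] by (auto simp: L2_def)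
  then have "(\<lambda>x. f (r 0) x - (f (r 0) x - u x)) \<in> L2 \<Omega>" by (rule L2_diff[OF f])
  then have uL: "u \<in> L2 \<Omega>" by simp
  have "(\<lambda>n. integral\<^sup>L ?M (\<lambda>x. (norm (f n x - u x))\<^sup>2)) \<longlonglongrightarrow> 0"
  proof (rule LIMSEQ_I)
    fix e :: real assume "e > 0"
    then obtain k where k: "(1/4::real)^k < e" using real_arch_pow_inv[of e "1/4"] by auto
    show "\<exists>N. \<forall>n\<ge>N. norm (integral\<^sup>L ?M (\<lambda>x. (norm (f n x - u x))\<^sup>2) - 0) < e"
    proof (intro exI allI impI)
      fix n assume n: "r k \<le> n"
      have "ennreal (integral\<^sup>L ?M (\<lambda>x. (norm (f n x - u x))\<^sup>2)) \<le> ennreal ((1/4)^k)"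
        using key[OF n] L2D(2)[OF L2_diff[OF f uL]] by (subst (asm) nn_integral_eq_integral) auto
      then have "integral\<^sup>L ?M (\<lambda>x. (norm (f n x - u x))\<^sup>2) \<le> (1/4)^k" by (simp add: ennreal_le_iff)
      moreover have "0 \<le> integral\<^sup>L ?M (\<lambda>x. (norm (f n x - u x))\<^sup>2)" by simp
      ultimately show "norm (integral\<^sup>L ?M (\<lambda>x. (norm (f n x - u x))\<^sup>2) - 0) < e" using k by simp
    qed
  qed
  then show ?thesis using uL by blast
qed

end

section \<open>Weak gradients\<close>

definition mass :: "(real^'n::finite) set \<Rightarrow> (real^'n \<Rightarrow> real) \<Rightarrow> (real^'n \<Rightarrow> real) \<Rightarrow> real" where
  "mass \<Omega> u v = integral\<^sup>L (lebesgue_on \<Omega>) (\<lambda>x. u x * v x)"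

definition energy :: "(real^'n::finite) set \<Rightarrow> (real^'n \<Rightarrow> real) \<Rightarrow> (real^'n \<Rightarrow> real) \<Rightarrow> real" where
  "energy \<Omega> u v = integral\<^sup>L (lebesgue_on \<Omega>) (\<lambda>x. weak_grad \<Omega> u x \<bullet> weak_grad \<Omega> v x)"

definition grad :: "(real^'n::finite \<Rightarrow> real) \<Rightarrow> real^'n \<Rightarrow> real^'n" where
  "grad f x = (\<chi> i. partial_deriv i f x)"

lemma psd_form_subset: "psd_form W b \<Longrightarrow> V \<subseteq> W \<Longrightarrow> (\<lambda>x. 0) \<in> V \<Longrightarrow>
    (\<And>u v c. u \<in> V \<Longrightarrow> v \<in> V \<Longrightarrow> (\<lambda>x. u x + c * v x) \<in> V) \<Longrightarrow> psd_form V b"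
proof -
  assume "psd_form W b"
  then interpret psd_form W b .
  assume "V \<subseteq> W" "(\<lambda>x. 0) \<in> V" "\<And>u v c. u \<in> V \<Longrightarrow> v \<in> V \<Longrightarrow> (\<lambda>x. u x + c * v x) \<in> V"
  then show ?thesis by (intro psd_form.intro sym lin_left nonneg) auto
qed

context bdd_open
begin

abbreviation M where "M \<equiv> lebesgue_on \<Omega>"

sublocale L: psd_form "L2 \<Omega>" "mass \<Omega>"
proof
  show "(\<lambda>x. 0 :: real) \<in> L2 \<Omega>" by (rule L2_const)
  show "mass \<Omega> u u \<ge> 0" for u by (simp add: mass_def)
  show "mass \<Omega> u v = mass \<Omega> v u" for u v by (simp add: mass_def mult.commute)
  fix u v w :: "real^'n \<Rightarrow> real" and c
  assume *: "u \<in> L2 \<Omega>" "v \<in> L2 \<Omega>"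
  then show "(\<lambda>x. u x + c * v x) \<in> L2 \<Omega>" by (rule L2_lin_real)
  assume w: "w \<in> L2 \<Omega>"
  have "(\<lambda>x. (u x + c * v x) * w x) = (\<lambda>x. u x * w x + c * (v x * w x))" by (simp add: algebra_simps)
  then show "mass \<Omega> (\<lambda>x. u x + c * v x) w = mass \<Omega> u w + c * mass \<Omega> v w"
    using L2_mult[OF *(1) w] L2_mult[OF *(2) w] by (simp add: mass_def)
qed

lemma mass_square: "mass \<Omega> u u = integral\<^sup>L M (\<lambda>x. (norm (u x))\<^sup>2)"
  by (simp add: mass_def power2_eq_square)

text \<open>Fundamental lemma of the calculus of variations: uniformly bounded test functions
  approximating the sign of \<open>w\<close> turn the hypothesis into a vanishing integral of the
  absolute value of \<open>w\<close>.\<close>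

lemma AE_eq_0_if_test:
  assumes w: "w \<in> L2 \<Omega>" and 0: "\<And>\<phi>. \<phi> \<in> test_functions \<Omega> \<Longrightarrow> integral\<^sup>L M (\<lambda>x. w x * \<phi> x) = 0"
  shows "AE x in M. w x = 0"
proof -
  have wm: "w \<in> borel_measurable M" by (rule L2D[OF w])
  have "(\<lambda>x. sgn (w x)) \<in> borel_measurable M" using wm by measurable
  then obtain \<phi> where \<phi>: "\<And>j. \<phi> j \<in> test_functions \<Omega>"
    "\<And>j x. x \<in> \<Omega> \<Longrightarrow> \<bar>\<phi> j x\<bar> \<le> 1 + 1" "AE x in M. (\<lambda>j. \<phi> j x) \<longlonglongrightarrow> sgn (w x)"
    using ex_test_approximation[OF op bd, of "\<lambda>x. sgn (w x)" 1] by (auto simp: abs_sgn_eq)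
  have int: "integrable M (\<lambda>x. \<bar>w x\<bar>)" using L2_integrable[OF w] by simp
  have "(\<lambda>j. integral\<^sup>L M (\<lambda>x. w x * \<phi> j x)) \<longlonglongrightarrow> integral\<^sup>L M (\<lambda>x. \<bar>w x\<bar>)"
  proof (rule integral_dominated_convergence[where w = "\<lambda>x. 2 * \<bar>w x\<bar>"])
    show "AE x in M. (\<lambda>j. w x * \<phi> j x) \<longlonglongrightarrow> \<bar>w x\<bar>"
      using \<phi>(3)
    proof eventually_elim
      case (elim x)
      then have "(\<lambda>j. w x * \<phi> j x) \<longlonglongrightarrow> w x * sgn (w x)" by (intro tendsto_intros)
      then show ?case by (simp add: abs_sgn)
    qed
    show "AE x in M. norm (w x * \<phi> j x) \<le> 2 * \<bar>w x\<bar>" for j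
      using mult_left_mono[OF \<phi>(2)[of _ j] abs_ge_zero] by (auto simp: abs_mult mult.commute)
  qed (use wm int test_functions_lebesgue_measurable[OF \<phi>(1)] in \<open>auto intro!: borel_measurable_times\<close>)
  then have "integral\<^sup>L M (\<lambda>x. \<bar>w x\<bar>) = 0" using 0[OF \<phi>(1)] by (simp add: LIMSEQ_const_iff)
  then show ?thesis using integral_nonneg_eq_0_iff_AE[OF int] by simp
qed

text \<open>Duality for the \<open>L2\<close> norm. Test functions approximate bounded functions, so
  \<open>w\<close> is replaced by its truncations \<open>f k\<close>. Since the square of
  \<open>f k\<close> is at most \<open>w * f k\<close>, the mass of \<open>f k\<close> is at most
  \<open>C\<close> times its own root.\<close>

lemma mass_le_if_test:
  assumes w: "w \<in> L2 \<Omega>" and C: "C \<ge> 0"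
    and le: "\<And>\<phi>. \<phi> \<in> test_functions \<Omega> \<Longrightarrow> \<bar>mass \<Omega> w \<phi>\<bar> \<le> C * sqrt (mass \<Omega> \<phi> \<phi>)"
  shows "mass \<Omega> w w \<le> C\<^sup>2"
proof -
  have wm: "w \<in> borel_measurable M" by (rule L2D[OF w])
  define f where "f k x = max (- real k) (min (real k) (w x))" for k :: nat and x
  have fm: "f k \<in> borel_measurable M" for k unfolding f_def[abs_def] using wm by measurable
  have fk: "\<bar>f k x\<bar> \<le> real k" for k x by (auto simp: f_def)
  have fw: "(f k x)\<^sup>2 \<le> w x * f k x" "(f k x)\<^sup>2 \<le> (w x)\<^sup>2" for k x
  proof -
    have "w x > k \<or> w x < - real k \<or> f k x = w x" by (auto simp: f_def min_def max_def)
    then consider "w x > k" | "w x < - real k" | "f k x = w x" by blast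
    then show "(f k x)\<^sup>2 \<le> w x * f k x"
    proof cases
      case 1
      then show ?thesis by (auto simp: f_def power2_eq_square intro!: mult_right_mono)
    next
      case 2
      then have "f k x = - real k" by (auto simp: f_def)
      then show ?thesis using 2 by (simp add: power2_eq_square) (metis less_eq_real_def minus_le_iff mult_right_mono of_nat_0_le_iff minus_mult_left neg_le_iff_le)
    qed (simp add: power2_eq_square)
    have "\<bar>f k x\<bar> \<le> \<bar>w x\<bar>" by (auto simp: f_def min_def max_def)
    then show "(f k x)\<^sup>2 \<le> (w x)\<^sup>2" by (simp add: abs_le_square_iff)
  qed
  have fL: "f k \<in> L2 \<Omega>" for k by (rule L2_bounded[OF fm]) (use fk in auto)
  have bound: "mass \<Omega> (f k) (f k) \<le> C\<^sup>2" for k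
  proof -
    obtain \<phi> where \<phi>: "\<And>j. \<phi> j \<in> test_functions \<Omega>"
      "\<And>j x. x \<in> \<Omega> \<Longrightarrow> \<bar>\<phi> j x\<bar> \<le> real k + 1" "AE x in M. (\<lambda>j. \<phi> j x) \<longlonglongrightarrow> f k x"
      using ex_test_approximation[OF op bd fm, of k k] fk by auto
    have \<phi>m: "\<phi> j \<in> borel_measurable M" for j by (rule test_functions_lebesgue_measurable[OF \<phi>(1)])
    have l1: "(\<lambda>j. mass \<Omega> w (\<phi> j)) \<longlonglongrightarrow> mass \<Omega> w (f k)"
      unfolding mass_def
    proof (rule integral_dominated_convergence[where w = "\<lambda>x. (real k + 1) * \<bar>w x\<bar>"])
      show "AE x in M. (\<lambda>j. w x * \<phi> j x) \<longlonglongrightarrow> w x * f k x"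
        using \<phi>(3) by eventually_elim (intro tendsto_intros)
      show "AE x in M. norm (w x * \<phi> j x) \<le> (real k + 1) * \<bar>w x\<bar>" for j
        using mult_left_mono[OF \<phi>(2)[of _ j] abs_ge_zero] by (auto simp: abs_mult mult.commute)
    qed (use wm fm \<phi>m L2_integrable[OF w] in \<open>auto intro!: borel_measurable_times\<close>)
    have l2: "(\<lambda>j. mass \<Omega> (\<phi> j) (\<phi> j)) \<longlonglongrightarrow> mass \<Omega> (f k) (f k)"
      unfolding mass_def
    proof (rule integral_dominated_convergence[where w = "\<lambda>x. (real k + 1) * (real k + 1)"])
      show "AE x in M. (\<lambda>j. \<phi> j x * \<phi> j x) \<longlonglongrightarrow> f k x * f k x"
        using \<phi>(3) by eventually_elim (intro tendsto_intros)
      show "AE x in M. norm (\<phi> j x * \<phi> j x) \<le> (real k + 1) * (real k + 1)" for j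
      proof (rule AE_I2)
        fix x assume "x \<in> space M"
        then have "\<bar>\<phi> j x\<bar> * \<bar>\<phi> j x\<bar> \<le> (real k + 1) * (real k + 1)"
          by (intro mult_mono \<phi>(2)) auto
        then show "norm (\<phi> j x * \<phi> j x) \<le> (real k + 1) * (real k + 1)" by (simp add: abs_mult)
      qed
    qed (use fm \<phi>m in \<open>auto intro!: borel_measurable_times\<close>)
    have "\<bar>mass \<Omega> w (f k)\<bar> \<le> C * sqrt (mass \<Omega> (f k) (f k))"
      by (rule LIMSEQ_le[OF tendsto_rabs[OF l1] tendsto_mult[OF tendsto_const tendsto_real_sqrt[OF l2]]])
        (use le[OF \<phi>(1)] in auto)
    moreover have "mass \<Omega> (f k) (f k) \<le> mass \<Omega> w (f k)"
      unfolding mass_def using L2_mult[OF fL fL] L2_mult[OF w fL] fw(1)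
      by (intro integral_mono) (auto simp: power2_eq_square)
    ultimately have *: "sqrt (mass \<Omega> (f k) (f k)) * sqrt (mass \<Omega> (f k) (f k)) \<le> C * sqrt (mass \<Omega> (f k) (f k))"
      using L.nonneg[OF fL] by simp
    have "sqrt (mass \<Omega> (f k) (f k)) \<le> C"
    proof (cases "mass \<Omega> (f k) (f k) = 0")
      case False
      then have "sqrt (mass \<Omega> (f k) (f k)) > 0" using L.nonneg[OF fL, of k] by simp
      then show ?thesis using * by (simp only: mult_le_cancel_right_pos)
    qed (use C in simp)
    then have "(sqrt (mass \<Omega> (f k) (f k)))\<^sup>2 \<le> C\<^sup>2" by (intro power_mono) (auto simp: L.nonneg[OF fL])
    then show ?thesis using L.nonneg[OF fL, of k] by simp
  qed
  have "(\<lambda>k. mass \<Omega> (f k) (f k)) \<longlonglongrightarrow> mass \<Omega> w w"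
    unfolding mass_def
  proof (rule integral_dominated_convergence[where w = "\<lambda>x. (norm (w x))\<^sup>2"])
    show "AE x in M. (\<lambda>k. f k x * f k x) \<longlonglongrightarrow> w x * w x"
    proof (rule AE_I2)
      fix x
      obtain N :: nat where N: "\<bar>w x\<bar> \<le> N" using real_arch_simple by blast
      have "\<forall>\<^sub>F k in sequentially. f k x * f k x = w x * w x"
      proof (rule eventually_sequentiallyI[of N])
        fix k assume "N \<le> k"
        then have "\<bar>w x\<bar> \<le> real k" using N by linarith
        then have "f k x = w x" by (auto simp: f_def)
        then show "f k x * f k x = w x * w x" by simp
      qed
      then show "(\<lambda>k. f k x * f k x) \<longlonglongrightarrow> w x * w x" by (rule tendsto_eventually)
    qed
    show "AE x in M. norm (f k x * f k x) \<le> (norm (w x))\<^sup>2" for k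
      using fw(2)[of k] by (auto simp: power2_eq_square)
  qed (use fm wm L2D(2)[OF w] in \<open>auto intro!: borel_measurable_times\<close>)
  then show ?thesis by (rule LIMSEQ_le_const2) (use bound in auto)
qed

lemma weak_grad_unique:
  assumes g: "g \<in> L2 \<Omega>" "is_weak_grad \<Omega> u g" and h: "h \<in> L2 \<Omega>" "is_weak_grad \<Omega> u h"
  shows "AE x in M. g x = h x"
proof -
  have "AE x in M. \<forall>i\<in>UNIV. g x $ i - h x $ i = 0"
  proof (rule AE_finite_allI)
    fix i
    show "AE x in M. g x $ i - h x $ i = 0"
    proof (rule AE_eq_0_if_test)
      show "(\<lambda>x. g x $ i - h x $ i) \<in> L2 \<Omega>" by (intro L2_diff L2_component g h)
      fix \<phi> assume \<phi>: "\<phi> \<in> test_functions \<Omega>"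
      have "integrable M (\<lambda>x. g x $ i * \<phi> x)" "integrable M (\<lambda>x. h x $ i * \<phi> x)"
        by (intro L2_mult L2_component g h test_L2[OF \<phi>])+
      moreover have "integral\<^sup>L M (\<lambda>x. g x $ i * \<phi> x) = integral\<^sup>L M (\<lambda>x. h x $ i * \<phi> x)"
        using spec[OF bspec[OF g(2)[unfolded is_weak_grad_def] \<phi>], of i]
          spec[OF bspec[OF h(2)[unfolded is_weak_grad_def] \<phi>], of i] by simp
      ultimately show "integral\<^sup>L M (\<lambda>x. (g x $ i - h x $ i) * \<phi> x) = 0"
        by (simp add: left_diff_distrib)
    qed
  qed simp
  then show ?thesis by eventually_elim (simp add: vec_eq_iff)
qed

section \<open>H1 and H10 as spaces with semidefinite forms\<close>

lemma H1I: "u \<in> L2 \<Omega> \<Longrightarrow> g \<in> L2 \<Omega> \<Longrightarrow> is_weak_grad \<Omega> u g \<Longrightarrow> u \<in> H1 \<Omega>"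
  by (auto simp: H1_def)

lemma H1_L2: "u \<in> H1 \<Omega> \<Longrightarrow> u \<in> L2 \<Omega>"
  by (simp add: H1_def)

lemma weak_grad:
  assumes "u \<in> H1 \<Omega>"
  shows "weak_grad \<Omega> u \<in> L2 \<Omega>" "is_weak_grad \<Omega> u (weak_grad \<Omega> u)"
proof -
  have "\<exists>g. g \<in> L2 \<Omega> \<and> is_weak_grad \<Omega> u g" using assms by (auto simp: H1_def)
  then have "weak_grad \<Omega> u \<in> L2 \<Omega> \<and> is_weak_grad \<Omega> u (weak_grad \<Omega> u)"
    unfolding weak_grad_def by (rule someI_ex)
  then show "weak_grad \<Omega> u \<in> L2 \<Omega>" "is_weak_grad \<Omega> u (weak_grad \<Omega> u)" by auto
qed

text \<open>This removes the arbitrary choice in \<open>weak_grad\<close>: the energy may be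
  computed with whichever weak gradients are at hand.\<close>

lemma energy_eq:
  assumes "g \<in> L2 \<Omega>" "is_weak_grad \<Omega> u g" "h \<in> L2 \<Omega>" "is_weak_grad \<Omega> v h" "u \<in> L2 \<Omega>" "v \<in> L2 \<Omega>"
  shows "energy \<Omega> u v = integral\<^sup>L M (\<lambda>x. g x \<bullet> h x)"
proof -
  note wu = weak_grad[OF H1I[OF assms(5,1,2)]] and wv = weak_grad[OF H1I[OF assms(6,3,4)]]
  have "AE x in M. weak_grad \<Omega> u x = g x" "AE x in M. weak_grad \<Omega> v x = h x"
    by (rule weak_grad_unique[OF wu assms(1,2)]) (rule weak_grad_unique[OF wv assms(3,4)])
  then have "AE x in M. weak_grad \<Omega> u x \<bullet> weak_grad \<Omega> v x = g x \<bullet> h x"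
    by eventually_elim simp
  then show ?thesis unfolding energy_def
    using wu(1) wv(1) assms(1,3) by (intro integral_cong_AE borel_measurable_inner) (auto dest: L2D)
qed

lemma is_weak_grad_lin:
  assumes u: "u \<in> L2 \<Omega>" "g \<in> L2 \<Omega>" "is_weak_grad \<Omega> u g" and v: "v \<in> L2 \<Omega>" "h \<in> L2 \<Omega>" "is_weak_grad \<Omega> v h"
  shows "is_weak_grad \<Omega> (\<lambda>x. u x + c * v x) (\<lambda>x. g x + c *\<^sub>R h x)"
  unfolding is_weak_grad_def
proof (intro ballI allI)
  fix \<phi> i assume \<phi>: "\<phi> \<in> test_functions \<Omega>"
  note i\<phi> = test_functions_partial_deriv[OF \<phi>, of i]
  have 1: "integrable M (\<lambda>x. u x * partial_deriv i \<phi> x)" "integrable M (\<lambda>x. v x * partial_deriv i \<phi> x)"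
    by (intro L2_mult u v test_L2[OF i\<phi>])+
  have 2: "integrable M (\<lambda>x. g x $ i * \<phi> x)" "integrable M (\<lambda>x. h x $ i * \<phi> x)"
    by (intro L2_mult L2_component u v test_L2[OF \<phi>])+
  have "integral\<^sup>L M (\<lambda>x. (u x + c * v x) * partial_deriv i \<phi> x) =
     integral\<^sup>L M (\<lambda>x. u x * partial_deriv i \<phi> x) + c * integral\<^sup>L M (\<lambda>x. v x * partial_deriv i \<phi> x)"
    using 1 by (simp add: distrib_right mult.assoc)
  also have "\<dots> = - integral\<^sup>L M (\<lambda>x. g x $ i * \<phi> x) + c * (- integral\<^sup>L M (\<lambda>x. h x $ i * \<phi> x))"
    using u(3) v(3) \<phi> by (simp add: is_weak_grad_def)
  also have "\<dots> = - integral\<^sup>L M (\<lambda>x. (g x + c *\<^sub>R h x) $ i * \<phi> x)"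
    using 2 by (simp add: distrib_right mult.assoc)
  finally show "integral\<^sup>L M (\<lambda>x. (u x + c * v x) * partial_deriv i \<phi> x) = - integral\<^sup>L M (\<lambda>x. (g x + c *\<^sub>R h x) $ i * \<phi> x)" .
qed

lemma H1_lin:
  assumes "u \<in> H1 \<Omega>" "v \<in> H1 \<Omega>"
  shows "(\<lambda>x. u x + c * v x) \<in> H1 \<Omega>"
proof -
  note u = H1_L2[OF assms(1)] weak_grad[OF assms(1)] and v = H1_L2[OF assms(2)] weak_grad[OF assms(2)]
  show ?thesis by (rule H1I[OF L2_lin_real[OF u(1) v(1)] L2_lin[OF u(2) v(2)] is_weak_grad_lin[OF u v]])
qed

lemma grad_L2: "\<phi> \<in> test_functions \<Omega>' \<Longrightarrow> grad \<phi> \<in> L2 \<Omega>"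
proof -
  assume \<phi>: "\<phi> \<in> test_functions \<Omega>'"
  have c: "partial_deriv i \<phi> \<in> L2 \<Omega>" for i by (rule test_L2[OF test_functions_partial_deriv[OF \<phi>]])
  have m: "grad \<phi> \<in> borel_measurable M"
  proof (subst borel_measurable_euclidean_space, safe)
    fix b :: "real^'n" assume "b \<in> Basis"
    then obtain i where "b = axis i 1" by (auto simp: Basis_vec_def)
    then have "(\<lambda>x. grad \<phi> x \<bullet> b) = partial_deriv i \<phi>" by (auto simp: grad_def inner_axis)
    then show "(\<lambda>x. grad \<phi> x \<bullet> b) \<in> borel_measurable M" using L2D(1)[OF c] by simp
  qed
  have "integrable M (\<lambda>x. (norm (grad \<phi> x))\<^sup>2)"
    using L2_mult[OF c c]
    by (simp add: power2_norm_eq_inner inner_vec_def grad_def)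
  then show ?thesis using m by (simp add: L2_def)
qed

text \<open>Integration by parts: a partial derivative of the product of two test functions has
  integral 0.\<close>

lemma is_weak_grad_grad:
  assumes \<phi>: "\<phi> \<in> test_functions \<Omega>"
  shows "is_weak_grad \<Omega> \<phi> (grad \<phi>)"
  unfolding is_weak_grad_def
proof (intro ballI allI)
  fix \<psi> i assume \<psi>: "\<psi> \<in> test_functions \<Omega>"
  have p: "(\<lambda>x. \<phi> x * \<psi> x) \<in> test_functions \<Omega>"
    by (rule test_functions_mult[OF \<psi> test_functions_smooth[OF \<phi>]])
  have d: "partial_deriv i (\<lambda>x. \<phi> x * \<psi> x) = (\<lambda>x. \<phi> x * partial_deriv i \<psi> x + partial_deriv i \<phi> x * \<psi> x)"
    by (rule ext) (intro partial_deriv_mult smooth_differentiable test_functions_smooth[OF \<phi>] test_functions_smooth[OF \<psi>])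
  have "indicator \<Omega> x *\<^sub>R partial_deriv i (\<lambda>x. \<phi> x * \<psi> x) x = partial_deriv i (\<lambda>x. \<phi> x * \<psi> x) x" for x
    using test_functions_eq_0[OF test_functions_partial_deriv[OF p]] by (auto simp: indicator_def)
  then have "integral\<^sup>L M (partial_deriv i (\<lambda>x. \<phi> x * \<psi> x)) = integral\<^sup>L lebesgue (partial_deriv i (\<lambda>x. \<phi> x * \<psi> x))"
    by (subst integral_restrict_space) (simp_all only: sets_lebesgue Int_UNIV_right space_completion space_lborel space_borel)
  then have "integral\<^sup>L M (partial_deriv i (\<lambda>x. \<phi> x * \<psi> x)) = 0"
    by (simp only: integral_partial_deriv_eq_0[OF p bd])
  moreover have "integrable M (\<lambda>x. \<phi> x * partial_deriv i \<psi> x)" "integrable M (\<lambda>x. partial_deriv i \<phi> x * \<psi> x)"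
    by (intro L2_mult test_L2[OF \<phi>] test_L2[OF \<psi>] test_L2[OF test_functions_partial_deriv[OF \<phi>]]
      test_L2[OF test_functions_partial_deriv[OF \<psi>]])+
  ultimately show "integral\<^sup>L M (\<lambda>x. \<phi> x * partial_deriv i \<psi> x) = - integral\<^sup>L M (\<lambda>x. grad \<phi> x $ i * \<psi> x)"
    by (simp add: d grad_def)
qed

lemma test_H1: "\<phi> \<in> test_functions \<Omega> \<Longrightarrow> \<phi> \<in> H1 \<Omega>"
  by (rule H1I[OF test_L2 grad_L2 is_weak_grad_grad])

lemma H1_0: "(\<lambda>x. 0) \<in> H1 \<Omega>"
  by (rule test_H1[OF test_functions_0])

lemma energy_lin:
  assumes "u \<in> H1 \<Omega>" "v \<in> H1 \<Omega>" "w \<in> H1 \<Omega>"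
  shows "energy \<Omega> (\<lambda>x. u x + c * v x) w = energy \<Omega> u w + c * energy \<Omega> v w"
proof -
  note u = H1_L2[OF assms(1)] weak_grad[OF assms(1)] and v = H1_L2[OF assms(2)] weak_grad[OF assms(2)]
    and w = H1_L2[OF assms(3)] weak_grad[OF assms(3)]
  have "energy \<Omega> (\<lambda>x. u x + c * v x) w = integral\<^sup>L M (\<lambda>x. (weak_grad \<Omega> u x + c *\<^sub>R weak_grad \<Omega> v x) \<bullet> weak_grad \<Omega> w x)"
    by (intro energy_eq L2_lin L2_lin_real is_weak_grad_lin u v w)
  then show ?thesis using L2_inner[OF u(2) w(2)] L2_inner[OF v(2) w(2)]
    by (simp add: energy_def inner_add_left)
qed

sublocale E: psd_form "H1 \<Omega>" "energy \<Omega>"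
proof
  show "energy \<Omega> u v = energy \<Omega> v u" for u v by (simp add: energy_def inner_commute)
  show "energy \<Omega> u u \<ge> 0" for u by (simp add: energy_def)
qed (auto intro: H1_0 H1_lin energy_lin)

sublocale MH: psd_form "H1 \<Omega>" "mass \<Omega>"
  by (rule psd_form_subset[OF L.psd_form_axioms]) (auto intro: H1_0 H1_lin H1_L2)

sublocale N: psd_form "H1 \<Omega>" "\<lambda>u v. energy \<Omega> u v + mass \<Omega> u v"
  by unfold_locales
    (auto intro: H1_0 H1_lin simp: E.sym MH.sym E.lin_left MH.lin_left E.nonneg MH.nonneg algebra_simps)

lemma energy_square: "energy \<Omega> u u = integral\<^sup>L M (\<lambda>x. (norm (weak_grad \<Omega> u x))\<^sup>2)"
  by (simp add: energy_def power2_norm_eq_inner)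

lemma H1_norm_eq: "H1_norm \<Omega> u = sqrt (energy \<Omega> u u + mass \<Omega> u u)"
  by (simp add: H1_norm_def energy_square mass_square add.commute)

text \<open>The squared norm is the value of a form, so the rules of \<open>psd_form\<close> become
  applicable to the approximation.\<close>

lemma H10_iff:
  "u \<in> H10 \<Omega> \<longleftrightarrow> u \<in> H1 \<Omega> \<and> (\<forall>e>0. \<exists>\<phi>\<in>test_functions \<Omega>.
     energy \<Omega> (\<lambda>x. u x - \<phi> x) (\<lambda>x. u x - \<phi> x) + mass \<Omega> (\<lambda>x. u x - \<phi> x) (\<lambda>x. u x - \<phi> x) < e)"
  (is "_ \<longleftrightarrow> _ \<and> (\<forall>e>0. \<exists>\<phi>\<in>_. ?N \<phi> < e)")
proof -
  have "(\<forall>e>0. \<exists>\<phi>\<in>test_functions \<Omega>. sqrt (?N \<phi>) < e) \<longleftrightarrow> (\<forall>e>0. \<exists>\<phi>\<in>test_functions \<Omega>. ?N \<phi> < e)"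
  proof (intro iffI allI impI)
    fix e :: real assume *: "\<forall>e>0. \<exists>\<phi>\<in>test_functions \<Omega>. sqrt (?N \<phi>) < e" and "e > 0"
    then obtain \<phi> where "\<phi> \<in> test_functions \<Omega>" "sqrt (?N \<phi>) < sqrt e" by (metis real_sqrt_gt_zero)
    then show "\<exists>\<phi>\<in>test_functions \<Omega>. ?N \<phi> < e" by auto
  next
    fix e :: real assume *: "\<forall>e>0. \<exists>\<phi>\<in>test_functions \<Omega>. ?N \<phi> < e" and "e > 0"
    obtain \<phi> where \<phi>: "\<phi> \<in> test_functions \<Omega>" "?N \<phi> < e\<^sup>2"
      by (rule bexE[OF *[rule_format, OF zero_less_power[OF \<open>e > 0\<close>, of 2]]])
    have "sqrt (?N \<phi>) < sqrt (e\<^sup>2)" by (rule real_sqrt_less_mono[OF \<phi>(2)])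
    then show "\<exists>\<phi>\<in>test_functions \<Omega>. sqrt (?N \<phi>) < e" using \<open>e > 0\<close> \<phi>(1) by auto
  qed
  then show ?thesis by (simp add: H10_def H1_norm_eq)
qed

lemma H10_approx:
  assumes "u \<in> H10 \<Omega>" "e > 0"
  obtains \<phi> where "\<phi> \<in> test_functions \<Omega>"
    "energy \<Omega> (\<lambda>x. u x - \<phi> x) (\<lambda>x. u x - \<phi> x) + mass \<Omega> (\<lambda>x. u x - \<phi> x) (\<lambda>x. u x - \<phi> x) < e"
  using assms(1)[unfolded H10_iff, THEN conjunct2, rule_format, OF assms(2)] by blast

lemma test_H10: "\<phi> \<in> test_functions \<Omega> \<Longrightarrow> \<phi> \<in> H10 \<Omega>"
  by (auto simp: H10_iff test_H1 E.zero_left MH.zero_left H1_0 intro!: bexI[of _ \<phi>])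

lemma H10_H1: "H10 \<Omega> \<subseteq> H1 \<Omega>"
  by (auto simp: H10_def)

lemma H10_lin:
  assumes u: "u \<in> H10 \<Omega>" and v: "v \<in> H10 \<Omega>"
  shows "(\<lambda>x. u x + c * v x) \<in> H10 \<Omega>"
  unfolding H10_iff
proof (intro conjI allI impI)
  note uv = H10_H1[THEN subsetD, OF u] H10_H1[THEN subsetD, OF v]
  show "(\<lambda>x. u x + c * v x) \<in> H1 \<Omega>" by (intro H1_lin uv)
  fix e :: real assume "e > 0"
  let ?N = "\<lambda>u. energy \<Omega> u u + mass \<Omega> u u"
  obtain \<phi> where \<phi>: "\<phi> \<in> test_functions \<Omega>" "?N (\<lambda>x. u x - \<phi> x) < e / 4"
    using H10_approx[OF u, of "e / 4"] \<open>e > 0\<close> by auto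
  \<comment> \<open>The divisor has \<open>c\<^sup>2 + 1\<close> in place of
    \<open>c\<^sup>2\<close> so that it stays positive for \<open>c = 0\<close>.\<close>
  have "e / (4 * (c\<^sup>2 + 1)) > 0" using \<open>e > 0\<close> by (simp add: sum_power2_gt_zero_iff add_nonneg_pos)
  then obtain \<psi> where \<psi>: "\<psi> \<in> test_functions \<Omega>" "?N (\<lambda>x. v x - \<psi> x) < e / (4 * (c\<^sup>2 + 1))"
    using H10_approx[OF v] by blast
  have d: "(\<lambda>x. u x - \<phi> x) \<in> H1 \<Omega>" "(\<lambda>x. v x - \<psi> x) \<in> H1 \<Omega>"
    by (intro E.diff_in uv test_H1 \<phi> \<psi>)+
  have "?N (\<lambda>x. u x + c * v x - (\<phi> x + c * \<psi> x)) = ?N (\<lambda>x. (u x - \<phi> x) + c * (v x - \<psi> x))"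
    by (simp add: algebra_simps)
  also have "\<dots> \<le> 2 * ?N (\<lambda>x. u x - \<phi> x) + 2 * ?N (\<lambda>x. c * (v x - \<psi> x))"
    using N.add_square_le[OF d(1) N.scale_in[OF d(2), of c]] by simp
  also have "?N (\<lambda>x. c * (v x - \<psi> x)) = c\<^sup>2 * ?N (\<lambda>x. v x - \<psi> x)"
    using N.scale_square[OF d(2), of c] by simp
  also have "c\<^sup>2 * ?N (\<lambda>x. v x - \<psi> x) \<le> (c\<^sup>2 + 1) * (e / (4 * (c\<^sup>2 + 1)))"
    using \<psi>(2) N.nonneg[OF d(2)] by (intro mult_mono) auto
  also have "\<dots> = e / 4"
  proof -
    have K: "K * (e / (4 * K)) = e / 4" if "K > 0" for K :: real using that by simp
    show ?thesis by (rule K) (simp add: add_nonneg_pos)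
  qed
  finally have "?N (\<lambda>x. u x + c * v x - (\<phi> x + c * \<psi> x)) < e" using \<phi>(2) by simp
  moreover have "(\<lambda>x. \<phi> x + c * \<psi> x) \<in> test_functions \<Omega>"
    by (intro test_functions_add test_functions_cmult \<phi> \<psi>)
  ultimately show "\<exists>\<phi>\<in>test_functions \<Omega>. ?N (\<lambda>x. u x + c * v x - \<phi> x) < e"
    by (rule bexI[where x = "\<lambda>x. \<phi> x + c * \<psi> x"])
qed

text \<open>For a fixed test function both sides of the defining identity are continuous in
  \<open>L2\<close>.\<close>

lemma is_weak_grad_closed:
  assumes f: "\<And>n. f n \<in> L2 \<Omega>" "\<And>n. g n \<in> L2 \<Omega>" "\<And>n. is_weak_grad \<Omega> (f n) (g n)"
    and u: "u \<in> L2 \<Omega>" "h \<in> L2 \<Omega>"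
    and lu: "(\<lambda>n. mass \<Omega> (\<lambda>x. f n x - u x) (\<lambda>x. f n x - u x)) \<longlonglongrightarrow> 0"
    and lh: "(\<lambda>n. integral\<^sup>L M (\<lambda>x. (norm (g n x - h x))\<^sup>2)) \<longlonglongrightarrow> 0"
  shows "is_weak_grad \<Omega> u h"
  unfolding is_weak_grad_def
proof (intro ballI allI)
  fix \<phi> i assume \<phi>: "\<phi> \<in> test_functions \<Omega>"
  note i\<phi> = test_functions_partial_deriv[OF \<phi>, of i]
  have gi: "(\<lambda>x. g n x $ i) \<in> L2 \<Omega>" for n by (intro L2_component f)
  have hi: "(\<lambda>x. h x $ i) \<in> L2 \<Omega>" by (intro L2_component u)
  have l1: "(\<lambda>n. mass \<Omega> (f n) (partial_deriv i \<phi>)) \<longlonglongrightarrow> mass \<Omega> u (partial_deriv i \<phi>)"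
    by (rule L.tendsto_left[OF f(1) u(1) test_L2[OF i\<phi>] lu])
  have "(\<lambda>n. mass \<Omega> (\<lambda>x. g n x $ i - h x $ i) (\<lambda>x. g n x $ i - h x $ i)) \<longlonglongrightarrow> 0"
  proof (rule tendsto_sandwich[OF _ _ tendsto_const lh])
    show "\<forall>\<^sub>F n in sequentially. 0 \<le> mass \<Omega> (\<lambda>x. g n x $ i - h x $ i) (\<lambda>x. g n x $ i - h x $ i)"
      by (intro always_eventually allI L.nonneg L2_diff gi hi)
    show "\<forall>\<^sub>F n in sequentially. mass \<Omega> (\<lambda>x. g n x $ i - h x $ i) (\<lambda>x. g n x $ i - h x $ i) \<le> integral\<^sup>L M (\<lambda>x. (norm (g n x - h x))\<^sup>2)"
    proof (intro always_eventually allI)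
      fix n
      show "mass \<Omega> (\<lambda>x. g n x $ i - h x $ i) (\<lambda>x. g n x $ i - h x $ i) \<le> integral\<^sup>L M (\<lambda>x. (norm (g n x - h x))\<^sup>2)"
        unfolding mass_def
      proof (rule integral_mono)
        show "integrable M (\<lambda>x. (g n x $ i - h x $ i) * (g n x $ i - h x $ i))"
          by (intro L2_mult L2_diff gi hi)
        show "integrable M (\<lambda>x. (norm (g n x - h x))\<^sup>2)" by (intro L2D(2) L2_diff f u)
        show "(g n x $ i - h x $ i) * (g n x $ i - h x $ i) \<le> (norm (g n x - h x))\<^sup>2" for x
          using power_mono[OF component_le_norm_cart abs_ge_zero, of "g n x - h x" i 2]
          by (simp add: power2_eq_square)
      qed
    qed
  qed
  then have l2: "(\<lambda>n. mass \<Omega> (\<lambda>x. g n x $ i) \<phi>) \<longlonglongrightarrow> mass \<Omega> (\<lambda>x. h x $ i) \<phi>"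
    by (rule L.tendsto_left[OF gi hi test_L2[OF \<phi>]])
  have "mass \<Omega> (f n) (partial_deriv i \<phi>) = - mass \<Omega> (\<lambda>x. g n x $ i) \<phi>" for n
    using f(3)[of n] \<phi> by (simp add: is_weak_grad_def mass_def)
  then have "(\<lambda>n. - mass \<Omega> (\<lambda>x. g n x $ i) \<phi>) \<longlonglongrightarrow> mass \<Omega> u (partial_deriv i \<phi>)" using l1 by simp
  from LIMSEQ_unique[OF this tendsto_minus[OF l2]]
  show "integral\<^sup>L M (\<lambda>x. u x * partial_deriv i \<phi> x) = - integral\<^sup>L M (\<lambda>x. h x $ i * \<phi> x)"
    by (simp add: mass_def)
qed

lemma energy_diff_eq:
  assumes u: "u \<in> L2 \<Omega>" "g \<in> L2 \<Omega>" "is_weak_grad \<Omega> u g" and v: "v \<in> L2 \<Omega>" "h \<in> L2 \<Omega>" "is_weak_grad \<Omega> v h"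
  shows "energy \<Omega> (\<lambda>x. u x - v x) (\<lambda>x. u x - v x) = integral\<^sup>L M (\<lambda>x. (norm (g x - h x))\<^sup>2)"
proof -
  have w: "is_weak_grad \<Omega> (\<lambda>x. u x - v x) (\<lambda>x. g x - h x)"
    using is_weak_grad_lin[OF u v, of "-1"] by (simp add: scaleR_minus1_left)
  note d = L2_diff[OF u(1) v(1)] and dg = L2_diff[OF u(2) v(2)]
  show ?thesis unfolding energy_eq[OF dg w dg w d d] power2_norm_eq_inner ..
qed

lemma H1_complete:
  assumes f: "\<And>n. f n \<in> H1 \<Omega>"
    and cauchy: "\<And>e. e > 0 \<Longrightarrow> \<exists>N. \<forall>m\<ge>N. \<forall>n\<ge>N. energy \<Omega> (\<lambda>x. f m x - f n x) (\<lambda>x. f m x - f n x)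
         + mass \<Omega> (\<lambda>x. f m x - f n x) (\<lambda>x. f m x - f n x) < e"
  shows "\<exists>u\<in>H1 \<Omega>. (\<lambda>n. energy \<Omega> (\<lambda>x. f n x - u x) (\<lambda>x. f n x - u x)) \<longlonglongrightarrow> 0
         \<and> (\<lambda>n. mass \<Omega> (\<lambda>x. f n x - u x) (\<lambda>x. f n x - u x)) \<longlonglongrightarrow> 0"
proof -
  note fw = H1_L2[OF f] weak_grad[OF f]
  have d: "(\<lambda>x. f m x - f n x) \<in> H1 \<Omega>" for m n by (intro E.diff_in f)
  have "\<exists>u\<in>L2 \<Omega>. (\<lambda>n. integral\<^sup>L M (\<lambda>x. (norm (f n x - u x))\<^sup>2)) \<longlonglongrightarrow> 0"
  proof (rule L2_complete[OF fw(1)])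
    fix e :: real assume "e > 0"
    from cauchy[OF this] obtain N where N: "\<forall>m\<ge>N. \<forall>n\<ge>N. energy \<Omega> (\<lambda>x. f m x - f n x) (\<lambda>x. f m x - f n x)
         + mass \<Omega> (\<lambda>x. f m x - f n x) (\<lambda>x. f m x - f n x) < e" by blast
    show "\<exists>N. \<forall>m\<ge>N. \<forall>n\<ge>N. integral\<^sup>L M (\<lambda>x. (norm (f m x - f n x))\<^sup>2) < e"
    proof (intro exI allI impI)
      fix m n assume "N \<le> m" "N \<le> n"
      with N have "energy \<Omega> (\<lambda>x. f m x - f n x) (\<lambda>x. f m x - f n x)
         + mass \<Omega> (\<lambda>x. f m x - f n x) (\<lambda>x. f m x - f n x) < e" by blast
      then show "integral\<^sup>L M (\<lambda>x. (norm (f m x - f n x))\<^sup>2) < e"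
        using E.nonneg[OF d, of m n] by (simp add: mass_square[of "\<lambda>x. f m x - f n x"])
    qed
  qed
  then obtain u where u: "u \<in> L2 \<Omega>" "(\<lambda>n. integral\<^sup>L M (\<lambda>x. (norm (f n x - u x))\<^sup>2)) \<longlonglongrightarrow> 0" by blast
  have "\<exists>g\<in>L2 \<Omega>. (\<lambda>n. integral\<^sup>L M (\<lambda>x. (norm (weak_grad \<Omega> (f n) x - g x))\<^sup>2)) \<longlonglongrightarrow> 0"
  proof (rule L2_complete[OF fw(2)])
    fix e :: real assume "e > 0"
    from cauchy[OF this] obtain N where N: "\<forall>m\<ge>N. \<forall>n\<ge>N. energy \<Omega> (\<lambda>x. f m x - f n x) (\<lambda>x. f m x - f n x)
         + mass \<Omega> (\<lambda>x. f m x - f n x) (\<lambda>x. f m x - f n x) < e" by blast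
    show "\<exists>N. \<forall>m\<ge>N. \<forall>n\<ge>N. integral\<^sup>L M (\<lambda>x. (norm (weak_grad \<Omega> (f m) x - weak_grad \<Omega> (f n) x))\<^sup>2) < e"
    proof (intro exI allI impI)
      fix m n assume "N \<le> m" "N \<le> n"
      with N have "energy \<Omega> (\<lambda>x. f m x - f n x) (\<lambda>x. f m x - f n x)
         + mass \<Omega> (\<lambda>x. f m x - f n x) (\<lambda>x. f m x - f n x) < e" by blast
      then show "integral\<^sup>L M (\<lambda>x. (norm (weak_grad \<Omega> (f m) x - weak_grad \<Omega> (f n) x))\<^sup>2) < e"
        using MH.nonneg[OF d, of m n] energy_diff_eq[OF fw(1)[of m] fw(2,3)[of m] fw(1)[of n] fw(2,3)[of n]] by simp
    qed
  qed
  then obtain g where g: "g \<in> L2 \<Omega>" "(\<lambda>n. integral\<^sup>L M (\<lambda>x. (norm (weak_grad \<Omega> (f n) x - g x))\<^sup>2)) \<longlonglongrightarrow> 0" by blast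
  have mu: "(\<lambda>n. mass \<Omega> (\<lambda>x. f n x - u x) (\<lambda>x. f n x - u x)) \<longlonglongrightarrow> 0"
    using u(2) by (simp add: mass_square[of "\<lambda>x. f _ x - u x"])
  have wg: "is_weak_grad \<Omega> u g" by (rule is_weak_grad_closed[OF fw u(1) g(1) mu g(2)])
  have "(\<lambda>n. energy \<Omega> (\<lambda>x. f n x - u x) (\<lambda>x. f n x - u x)) \<longlonglongrightarrow> 0"
    using g(2) by (simp add: energy_diff_eq[OF fw u(1) g(1) wg])
  then show ?thesis using mu H1I[OF u(1) g(1) wg] by blast
qed

lemma H10_closed:
  assumes f: "\<And>n. f n \<in> H10 \<Omega>" and u: "u \<in> H1 \<Omega>"
    and le: "(\<lambda>n. energy \<Omega> (\<lambda>x. f n x - u x) (\<lambda>x. f n x - u x)) \<longlonglongrightarrow> 0"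
    and lm: "(\<lambda>n. mass \<Omega> (\<lambda>x. f n x - u x) (\<lambda>x. f n x - u x)) \<longlonglongrightarrow> 0"
  shows "u \<in> H10 \<Omega>"
  unfolding H10_iff
proof (intro conjI allI impI u)
  let ?N = "\<lambda>u. energy \<Omega> u u + mass \<Omega> u u"
  fix e :: real assume "e > 0"
  have "(\<lambda>n. ?N (\<lambda>x. f n x - u x)) \<longlonglongrightarrow> 0 + 0" by (intro tendsto_add le lm)
  then have "\<forall>\<^sub>F n in sequentially. ?N (\<lambda>x. f n x - u x) < e / 4"
    using \<open>e > 0\<close> by (intro order_tendstoD) auto
  then obtain n where n: "?N (\<lambda>x. f n x - u x) < e / 4" by (auto simp: eventually_sequentially)
  obtain \<phi> where \<phi>: "\<phi> \<in> test_functions \<Omega>" "?N (\<lambda>x. f n x - \<phi> x) < e / 4"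
    using H10_approx[OF f[of n], of "e / 4"] \<open>e > 0\<close> by auto
  have fn: "f n \<in> H1 \<Omega>" using f H10_H1 by blast
  have d: "(\<lambda>x. f n x - \<phi> x) \<in> H1 \<Omega>" "(\<lambda>x. f n x - u x) \<in> H1 \<Omega>"
    by (intro E.diff_in fn test_H1 \<phi> u)+
  have "?N (\<lambda>x. u x - \<phi> x) = ?N (\<lambda>x. (f n x - \<phi> x) - (f n x - u x))" by simp
  also have "\<dots> \<le> 2 * ?N (\<lambda>x. f n x - \<phi> x) + 2 * ?N (\<lambda>x. f n x - u x)"
    by (rule N.diff_square_le[OF d])
  also have "\<dots> < e" using n \<phi>(2) by simp
  finally show "\<exists>\<phi>\<in>test_functions \<Omega>. ?N (\<lambda>x. u x - \<phi> x) < e"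
    using \<phi>(1) by (rule bexI[where x = \<phi>])
qed

end

section \<open>Affine invariance of the Sobolev spaces\<close>

lemma image_aff_inverse:
  assumes "\<And>x. aff B c (aff A b x) = x"
  shows "aff B c ` aff A b ` \<Omega> = \<Omega>"
  using assms by (simp add: image_comp o_def)

lemma test_functions_aff:
  fixes \<Omega> :: "(real^'n::finite) set"
  assumes A: "invertible A" and \<phi>: "\<phi> \<in> test_functions (aff A b ` \<Omega>)"
  shows "(\<lambda>x. \<phi> (aff A b x)) \<in> test_functions \<Omega>"
proof -
  obtain B c where B: "\<And>x. aff B c (aff A b x) = x" "\<And>x. aff A b (aff B c x) = x"
    using ex_aff_inverse[OF A] by metis
  obtain K where K: "smooth \<phi>" "compact K" "K \<subseteq> aff A b ` \<Omega>" "\<And>x. x \<notin> K \<Longrightarrow> \<phi> x = 0"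
    using test_functionsE[OF \<phi>] by blast
  show ?thesis
  proof (rule test_functionsI)
    show "smooth (\<lambda>x. \<phi> (aff A b x))" unfolding aff_def
      by (rule smooth_affine[OF K(1)]) (rule matrix_vector_mul_linear)
    show "compact (aff B c ` K)" unfolding aff_def
      by (intro compact_continuous_image K continuous_intros matrix_vector_mult_linear_continuous_on)
    show "aff B c ` K \<subseteq> \<Omega>" using K(3) B(1) by force
    show "\<phi> (aff A b x) = 0" if "x \<notin> aff B c ` K" for x
      by (rule K(4)) (use that B in \<open>metis imageI\<close>)
  qed
qed

lemma partial_deriv_aff:
  assumes "smooth f"
  shows "partial_deriv i (\<lambda>x. f (aff A b x)) x = (\<Sum>j\<in>UNIV. A $ j $ i * partial_deriv j f (aff A b x))"
proof -
  have "(A *v axis i 1) $ j = A $ j $ i" for j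
    by (simp add: matrix_vector_mult_basis column_def)
  then show ?thesis
    unfolding aff_def using partial_deriv_affine(1)[OF assms matrix_vector_mul_linear, of i A b x] by simp
qed

lemma bdd_open_aff:
  fixes \<Omega> :: "(real^'n::finite) set"
  assumes "bdd_open \<Omega>" "invertible A"
  shows "bdd_open (aff A b ` \<Omega>)"
proof
  interpret bdd_open \<Omega> by fact
  obtain B c where B: "\<And>x. aff B c (aff A b x) = x" "\<And>x. aff A b (aff B c x) = x"
    using ex_aff_inverse[OF assms(2)] by metis
  have cont: "continuous_on UNIV (aff A b)" for A :: "real^'n^'n" and b
    unfolding aff_def[abs_def] by (intro continuous_intros matrix_vector_mult_linear_continuous_on)
  have "aff A b ` \<Omega> = aff B c -` \<Omega>" using aff_vimage[OF B(2,1)] by simp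
  then show "open (aff A b ` \<Omega>)" using open_vimage[OF op cont[of B c]] by simp
  have "compact (aff A b ` closure \<Omega>)"
    by (intro compact_continuous_image continuous_on_subset[OF cont]) (use bd in \<open>auto simp: compact_closure\<close>)
  then show "bounded (aff A b ` \<Omega>)"
    by (meson bounded_subset closure_subset compact_imp_bounded image_mono)
qed

lemma (in bdd_open) L2_matrix:
  fixes g :: "real^'n \<Rightarrow> real^'n" and B :: "real^'n^'n"
  assumes "g \<in> L2 \<Omega>"
  shows "(\<lambda>x. B *v g x) \<in> L2 \<Omega>"
proof -
  obtain C where C: "C > 0" "\<And>x. norm (B *v x) \<le> norm x * C"
    using bounded_linear.pos_bounded[OF matrix_vector_mul_bounded_linear] by blast
  have "continuous_on UNIV ((*v) B)" by (rule matrix_vector_mult_linear_continuous_on)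
  then have m: "(\<lambda>x. B *v g x) \<in> borel_measurable (lebesgue_on \<Omega>)"
    using L2D(1)[OF assms] by (rule borel_measurable_continuous_on)
  have "integrable (lebesgue_on \<Omega>) (\<lambda>x. (norm (B *v g x))\<^sup>2)"
  proof (rule Bochner_Integration.integrable_bound)
    show "integrable (lebesgue_on \<Omega>) (\<lambda>x. C\<^sup>2 * (norm (g x))\<^sup>2)" using L2D(2)[OF assms] by simp
    show "AE x in lebesgue_on \<Omega>. norm ((norm (B *v g x))\<^sup>2) \<le> norm (C\<^sup>2 * (norm (g x))\<^sup>2)"
      using C(2) by (auto intro!: AE_I2 power_mono simp: mult.commute simp flip: power_mult_distrib)
  qed (use m in measurable)
  then show ?thesis using m by (simp add: L2_def)
qed

context
  fixes \<Omega> :: "(real^'n::finite) set" and A :: "real^'n^'n" and b :: "real^'n"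
  assumes \<Omega>: "bdd_open \<Omega>" and A: "invertible A"
begin

interpretation bdd_open \<Omega> by (rule \<Omega>)
interpretation I: bdd_open "aff A b ` \<Omega>" by (rule bdd_open_aff[OF \<Omega> A])

lemma L2_aff:
  fixes u :: "real^'n \<Rightarrow> 'b::euclidean_space"
  shows "u \<in> L2 (aff A b ` \<Omega>) \<longleftrightarrow> (\<lambda>x. u (aff A b x)) \<in> L2 \<Omega>"
  by (simp add: L2_def measurable_aff_iff[OF A sets_lebesgue] integrable_aff_iff[OF A sets_lebesgue])

lemma mass_aff: "mass (aff A b ` \<Omega>) u v = vscale A * mass \<Omega> (\<lambda>x. u (aff A b x)) (\<lambda>x. v (aff A b x))"
  by (simp add: mass_def integral_aff[OF A sets_lebesgue])

text \<open>Test functions on \<Omega> are transported to the image by the inverse map, so that the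
  chain rule is applied to them and not to \<open>u\<close>; the factor \<open>vscale A\<close>
  appears on both sides and cancels.\<close>

lemma is_weak_grad_aff:
  assumes u: "u \<in> L2 (aff A b ` \<Omega>)" "g \<in> L2 (aff A b ` \<Omega>)" "is_weak_grad (aff A b ` \<Omega>) u g"
  shows "is_weak_grad \<Omega> (\<lambda>x. u (aff A b x)) (\<lambda>x. transpose A *v g (aff A b x))"
  unfolding is_weak_grad_def
proof (intro ballI allI)
  fix \<phi> i assume \<phi>: "\<phi> \<in> test_functions \<Omega>"
  obtain B c where B: "invertible B" "\<And>x. aff B c (aff A b x) = x" "\<And>x. aff A b (aff B c x) = x"
    using ex_aff_inverse[OF A] by metis
  define \<psi> where "\<psi> y = \<phi> (aff B c y)" for y
  have \<psi>: "\<psi> \<in> test_functions (aff A b ` \<Omega>)" unfolding \<psi>_def[abs_def]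
    by (rule test_functions_aff[OF B(1)]) (use \<phi> in \<open>simp add: image_aff_inverse[OF B(2)]\<close>)
  have \<phi>\<psi>: "\<phi> = (\<lambda>x. \<psi> (aff A b x))" by (simp add: \<psi>_def B)
  have p: "partial_deriv i \<phi> x = (\<Sum>j\<in>UNIV. A $ j $ i * partial_deriv j \<psi> (aff A b x))" for x
    unfolding \<phi>\<psi> by (rule partial_deriv_aff[OF test_functions_smooth[OF \<psi>]])
  have s: "vscale A \<noteq> 0" using vscale_pos[OF A] by simp
  have i1: "integrable (lebesgue_on \<Omega>) (\<lambda>x. u (aff A b x) * partial_deriv j \<psi> (aff A b x))" for j
    by (rule I.L2_mult[OF u(1) I.test_L2[OF test_functions_partial_deriv[OF \<psi>]],
          unfolded integrable_aff_iff[OF A sets_lebesgue]])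
  have i2: "integrable (lebesgue_on \<Omega>) (\<lambda>x. g (aff A b x) $ j * \<psi> (aff A b x))" for j
    by (rule I.L2_mult[OF I.L2_component[OF u(2)] I.test_L2[OF \<psi>],
          unfolded integrable_aff_iff[OF A sets_lebesgue]])
  have key: "integral\<^sup>L (lebesgue_on \<Omega>) (\<lambda>x. u (aff A b x) * partial_deriv j \<psi> (aff A b x))
      = - integral\<^sup>L (lebesgue_on \<Omega>) (\<lambda>x. g (aff A b x) $ j * \<psi> (aff A b x))" for j
  proof -
    have "vscale A * integral\<^sup>L (lebesgue_on \<Omega>) (\<lambda>x. u (aff A b x) * partial_deriv j \<psi> (aff A b x))
      = vscale A * - integral\<^sup>L (lebesgue_on \<Omega>) (\<lambda>x. g (aff A b x) $ j * \<psi> (aff A b x))"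
      using u(3) \<psi> integral_aff[OF A sets_lebesgue, of b "\<lambda>y. u y * partial_deriv j \<psi> y"]
        integral_aff[OF A sets_lebesgue, of b "\<lambda>y. g y $ j * \<psi> y"]
      by (simp add: is_weak_grad_def)
    then show ?thesis using mult_left_cancel[OF s] by (simp only:)
  qed
  have "integral\<^sup>L (lebesgue_on \<Omega>) (\<lambda>x. u (aff A b x) * partial_deriv i \<phi> x)
     = integral\<^sup>L (lebesgue_on \<Omega>) (\<lambda>x. \<Sum>j\<in>UNIV. A $ j $ i * (u (aff A b x) * partial_deriv j \<psi> (aff A b x)))"
    by (simp add: p sum_distrib_left mult.left_commute)
  also have "\<dots> = (\<Sum>j\<in>UNIV. A $ j $ i * integral\<^sup>L (lebesgue_on \<Omega>) (\<lambda>x. u (aff A b x) * partial_deriv j \<psi> (aff A b x)))"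
    using i1 by (subst Bochner_Integration.integral_sum) auto
  also have "\<dots> = - (\<Sum>j\<in>UNIV. A $ j $ i * integral\<^sup>L (lebesgue_on \<Omega>) (\<lambda>x. g (aff A b x) $ j * \<psi> (aff A b x)))"
    by (simp add: key sum_negf)
  also have "(\<Sum>j\<in>UNIV. A $ j $ i * integral\<^sup>L (lebesgue_on \<Omega>) (\<lambda>x. g (aff A b x) $ j * \<psi> (aff A b x)))
     = integral\<^sup>L (lebesgue_on \<Omega>) (\<lambda>x. \<Sum>j\<in>UNIV. A $ j $ i * (g (aff A b x) $ j * \<psi> (aff A b x)))"
    using i2 by (subst Bochner_Integration.integral_sum) auto
  also have "\<dots> = integral\<^sup>L (lebesgue_on \<Omega>) (\<lambda>x. (transpose A *v g (aff A b x)) $ i * \<phi> x)"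
    by (simp add: \<phi>\<psi> matrix_vector_mult_def transpose_def sum_distrib_right mult.assoc)
  finally show "integral\<^sup>L (lebesgue_on \<Omega>) (\<lambda>x. u (aff A b x) * partial_deriv i \<phi> x) =
     - integral\<^sup>L (lebesgue_on \<Omega>) (\<lambda>x. (transpose A *v g (aff A b x)) $ i * \<phi> x)" .
qed

text \<open>The Dirichlet integral is left on the image domain. In the transplantation the image is
  the symmetric body itself, so all trial functions are measured by the gradients of the same
  eigenfunctions over one fixed domain.\<close>

lemma H1_aff:
  assumes "u \<in> H1 (aff A b ` \<Omega>)"
  shows "(\<lambda>x. u (aff A b x)) \<in> H1 \<Omega>"
    and "energy \<Omega> (\<lambda>x. u (aff A b x)) (\<lambda>x. u (aff A b x)) = (1 / vscale A) *
      integral\<^sup>L (lebesgue_on (aff A b ` \<Omega>)) (\<lambda>y. (norm (transpose A *v weak_grad (aff A b ` \<Omega>) u y))\<^sup>2)"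
proof -
  note u = I.H1_L2[OF assms] I.weak_grad[OF assms]
  have g: "(\<lambda>x. transpose A *v weak_grad (aff A b ` \<Omega>) u (aff A b x)) \<in> L2 \<Omega>"
    using u(2) by (intro L2_matrix) (simp add: L2_aff)
  have uL: "(\<lambda>x. u (aff A b x)) \<in> L2 \<Omega>" using u(1) by (simp add: L2_aff)
  note w = is_weak_grad_aff[OF u]
  show "(\<lambda>x. u (aff A b x)) \<in> H1 \<Omega>" by (rule H1I[OF uL g w])
  show "energy \<Omega> (\<lambda>x. u (aff A b x)) (\<lambda>x. u (aff A b x)) = (1 / vscale A) *
      integral\<^sup>L (lebesgue_on (aff A b ` \<Omega>)) (\<lambda>y. (norm (transpose A *v weak_grad (aff A b ` \<Omega>) u y))\<^sup>2)"
    using energy_eq[OF g w g w uL uL] integral_aff[OF A sets_lebesgue, of b "\<lambda>y. (norm (transpose A *v weak_grad (aff A b ` \<Omega>) u y))\<^sup>2"]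
      vscale_pos[OF A]
    by (simp add: power2_norm_eq_inner)
qed

lemma H10_aff:
  assumes u: "u \<in> H10 (aff A b ` \<Omega>)"
  shows "(\<lambda>x. u (aff A b x)) \<in> H10 \<Omega>"
  unfolding H10_iff
proof (intro conjI allI impI)
  have uH: "u \<in> H1 (aff A b ` \<Omega>)" using u I.H10_H1 by blast
  show "(\<lambda>x. u (aff A b x)) \<in> H1 \<Omega>" by (rule H1_aff(1)[OF uH])
  fix e :: real assume "e > 0"
  obtain C where C: "C > 0" "\<And>x. norm (transpose A *v x) \<le> norm x * C"
    using bounded_linear.pos_bounded[OF matrix_vector_mul_bounded_linear] by blast
  define s where "s = vscale A"
  have s: "s > 0" by (simp add: s_def vscale_pos[OF A])
  \<comment> \<open>\<open>K\<close> dominates both the distortion \<open>C\<^sup>2\<close> of the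
    gradient term and the factor 1 of the mass term, so that the two are estimated together.\<close>
  define K where "K = max 1 (C\<^sup>2)"
  have K: "K \<ge> 1" "C\<^sup>2 \<le> K" by (auto simp: K_def)
  have "e * s / K > 0" using \<open>e > 0\<close> s K by simp
  then obtain \<phi> where \<phi>: "\<phi> \<in> test_functions (aff A b ` \<Omega>)"
    and le: "energy (aff A b ` \<Omega>) (\<lambda>x. u x - \<phi> x) (\<lambda>x. u x - \<phi> x) + mass (aff A b ` \<Omega>) (\<lambda>x. u x - \<phi> x) (\<lambda>x. u x - \<phi> x) < e * s / K"
    using I.H10_approx[OF u] by blast
  define w where "w x = u x - \<phi> x" for x
  have w: "w \<in> H1 (aff A b ` \<Omega>)" unfolding w_def[abs_def] by (intro I.E.diff_in uH I.test_H1 \<phi>)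
  let ?E = "energy (aff A b ` \<Omega>) w w" and ?m = "mass (aff A b ` \<Omega>) w w"
  have le: "?E + ?m < e * s / K" using le by (simp add: w_def[abs_def])
  have "integral\<^sup>L (lebesgue_on (aff A b ` \<Omega>)) (\<lambda>y. (norm (transpose A *v weak_grad (aff A b ` \<Omega>) w y))\<^sup>2)
     \<le> integral\<^sup>L (lebesgue_on (aff A b ` \<Omega>)) (\<lambda>y. C\<^sup>2 * (norm (weak_grad (aff A b ` \<Omega>) w y))\<^sup>2)"
  proof (rule integral_mono)
    show "integrable (lebesgue_on (aff A b ` \<Omega>)) (\<lambda>y. (norm (transpose A *v weak_grad (aff A b ` \<Omega>) w y))\<^sup>2)"
      using L2D(2)[OF L2_matrix[OF L2_aff[THEN iffD1, OF I.weak_grad(1)[OF w]]], of "transpose A"]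
      by (simp add: integrable_aff_iff[OF A sets_lebesgue])
    show "integrable (lebesgue_on (aff A b ` \<Omega>)) (\<lambda>y. C\<^sup>2 * (norm (weak_grad (aff A b ` \<Omega>) w y))\<^sup>2)"
      using I.L2D(2)[OF I.weak_grad(1)[OF w]] by simp
    show "(norm (transpose A *v weak_grad (aff A b ` \<Omega>) w y))\<^sup>2 \<le> C\<^sup>2 * (norm (weak_grad (aff A b ` \<Omega>) w y))\<^sup>2" for y
      using power_mono[OF C(2) norm_ge_zero, of "weak_grad (aff A b ` \<Omega>) w y" 2] by (simp add: power_mult_distrib mult.commute)
  qed
  also have "\<dots> = C\<^sup>2 * ?E" by (simp add: I.energy_square)
  also have "\<dots> \<le> K * ?E" using K I.E.nonneg[OF w] by (intro mult_right_mono) auto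
  finally have "energy \<Omega> (\<lambda>x. w (aff A b x)) (\<lambda>x. w (aff A b x)) \<le> (1 / s) * (K * ?E)"
    unfolding H1_aff(2)[OF w] s_def[symmetric] using s by (intro mult_left_mono) auto
  moreover have "mass \<Omega> (\<lambda>x. w (aff A b x)) (\<lambda>x. w (aff A b x)) = (1 / s) * ?m"
    using s by (simp add: mass_aff s_def)
  moreover have "(1 / s) * ?m \<le> (1 / s) * (K * ?m)"
    using s K I.MH.nonneg[OF w] mult_right_mono[of 1 K ?m] by (intro mult_left_mono) auto
  ultimately have "energy \<Omega> (\<lambda>x. w (aff A b x)) (\<lambda>x. w (aff A b x)) + mass \<Omega> (\<lambda>x. w (aff A b x)) (\<lambda>x. w (aff A b x))
     \<le> (1 / s) * (K * (?E + ?m))" by (simp add: distrib_left)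
  also have "\<dots> < (1 / s) * (K * (e * s / K))"
    using s K le by (intro mult_strict_left_mono) auto
  also have "\<dots> = e" using s K by simp
  finally have "energy \<Omega> (\<lambda>x. u (aff A b x) - \<phi> (aff A b x)) (\<lambda>x. u (aff A b x) - \<phi> (aff A b x))
     + mass \<Omega> (\<lambda>x. u (aff A b x) - \<phi> (aff A b x)) (\<lambda>x. u (aff A b x) - \<phi> (aff A b x)) < e"
    by (simp only: w_def)
  then show "\<exists>\<phi>\<in>test_functions \<Omega>. energy \<Omega> (\<lambda>x. u (aff A b x) - \<phi> x) (\<lambda>x. u (aff A b x) - \<phi> x)
     + mass \<Omega> (\<lambda>x. u (aff A b x) - \<phi> x) (\<lambda>x. u (aff A b x) - \<phi> x) < e"
    using test_functions_aff[OF A \<phi>] by (rule bexI[where x = "\<lambda>x. \<phi> (aff A b x)"])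
qed

end

section \<open>Poincare inequality and compactness on convex domains\<close>

lemma mat_scalar: "mat s *v x = s *\<^sub>R (x :: real^'n::finite)"
  by (simp add: vec_eq_iff matrix_vector_mult_def mat_def if_distrib[of "\<lambda>u. u * y" for y] cong: if_cong)

lemma
  assumes "s > 0"
  shows invertible_mat: "invertible (mat s :: real^'n::finite^'n)"
    and vscale_mat: "vscale (mat s :: real^'n^'n) = s ^ CARD('n)"
proof -
  have d: "det (mat s :: real^'n^'n) = s ^ CARD('n)"
    by (subst det_diagonal) (auto simp: mat_def)
  then show "invertible (mat s :: real^'n^'n)" using assms by (simp add: invertible_det_nz)
  have "scales (mat s :: real^'n^'n) \<bar>det (mat s :: real^'n^'n)\<bar>"
    by (rule scales_diagonal) (simp add: mat_def)
  then show "vscale (mat s :: real^'n^'n) = s ^ CARD('n)"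
    using scales_unique assms d by fastforce
qed

lemma integral_lebesgue_on_eq:
  fixes f :: "real^'n::finite \<Rightarrow> real"
  assumes "\<Omega> \<in> sets lebesgue" "\<And>x. x \<notin> \<Omega> \<Longrightarrow> f x = 0"
  shows "integral\<^sup>L (lebesgue_on \<Omega>) f = integral\<^sup>L lebesgue f"
proof -
  have "indicator \<Omega> x *\<^sub>R f x = f x" for x using assms(2) by (auto simp: indicator_def)
  then show ?thesis using assms(1) by (subst integral_restrict_space) (simp_all only: Int_UNIV_right space_completion space_lborel space_borel)
qed

locale convex_open = bdd_open \<Omega> for \<Omega> :: "(real^'n::finite) set" +
  assumes cv: "convex \<Omega>"
begin

text \<open>Tested against \<open>\<phi>\<close>, the function \<open>w\<close> gives the difference of the values at \<open>s = 1\<close> and \<open>s = 2\<close> of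
  \<open>H s = \<integral> u (y + (x - y) / s) \<phi> x dx\<close>.  After substitution only the test function depends on \<open>s\<close>, and
  \<open>H'\<close> is expressed by the weak gradient.\<close>

lemma contraction_bound:
  assumes u: "u \<in> L2 \<Omega>" and g: "g \<in> L2 \<Omega>" "is_weak_grad \<Omega> u g" and y: "y \<in> \<Omega>"
    and \<delta>: "\<And>x z. x \<in> \<Omega> \<Longrightarrow> z \<in> \<Omega> \<Longrightarrow> norm (x - z) \<le> \<delta>"
  defines "w \<equiv> \<lambda>x. u x - u ((1/2) *\<^sub>R x + (1/2) *\<^sub>R y)"
  shows "w \<in> L2 \<Omega>"
    and "mass \<Omega> w w \<le> (2 ^ CARD('n) * \<delta>)\<^sup>2 * integral\<^sup>L M (\<lambda>x. (norm (g x))\<^sup>2)"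
proof -
  have \<delta>0: "\<delta> \<ge> 0" using \<delta>[OF y y] by simp
  define d where "d = CARD('n)"
  have d1: "d \<ge> 1" using zero_less_card_finite[where 'a = 'n] by (simp add: d_def Suc_le_eq del: zero_less_card_finite)
  \<comment> \<open>Writing the dimension as \<open>Suc e\<close> expresses the power with exponent
    \<open>d - 1\<close> as \<open>s ^ e\<close>.\<close>
  obtain e where de: "d = Suc e" using d1 by (cases d) auto
  have half: "invertible (mat (1/2) :: real^'n^'n)" by (rule invertible_mat) simp
  define a where "a = aff (mat (1/2)) ((1/2) *\<^sub>R y)"
  have a: "a x = (1/2) *\<^sub>R x + (1/2) *\<^sub>R y" for x by (simp add: a_def aff_def mat_scalar)
  have asub: "a ` \<Omega> \<subseteq> \<Omega>" using cv y by (auto simp: a convex_def)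
  have as: "a ` \<Omega> \<in> sets lebesgue" unfolding a_def by (rule aff_image_lebesgue[OF sets_lebesgue])
  have "(\<lambda>x. u (a x)) \<in> L2 \<Omega>"
    using L2_restrict[OF u asub as] unfolding a_def by (rule L2_aff[OF bdd_open_axioms half, THEN iffD1])
  then have uaL: "(\<lambda>x. u ((1/2) *\<^sub>R x + (1/2) *\<^sub>R y)) \<in> L2 \<Omega>" by (simp add: a)
  then show wL: "w \<in> L2 \<Omega>" unfolding w_def by (rule L2_diff[OF u])
  have gn: "(\<lambda>x. norm (g x)) \<in> L2 \<Omega>" using g(1) by (auto simp: L2_def)
  define G where "G = integral\<^sup>L M (\<lambda>x. (norm (g x))\<^sup>2)"
  have G: "G = mass \<Omega> (\<lambda>x. norm (g x)) (\<lambda>x. norm (g x))" by (simp add: G_def mass_square)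
  have G0: "G \<ge> 0" by (simp add: G_def)
  have "mass \<Omega> w w \<le> (2 ^ d * \<delta> * sqrt G)\<^sup>2"
  proof (rule mass_le_if_test[OF wL])
    show "0 \<le> 2 ^ d * \<delta> * sqrt G" using \<delta>0 G0 by simp
    fix \<phi> assume \<phi>: "\<phi> \<in> test_functions \<Omega>"
    note s\<phi> = test_functions_smooth[OF \<phi>]
    obtain M0 where M0: "M0 \<ge> 0" "\<And>x. \<bar>\<phi> x\<bar> \<le> M0" using test_functions_bounded[OF \<phi>] by blast
    have "\<exists>m. m \<ge> 0 \<and> (\<forall>x. \<bar>partial_deriv i \<phi> x\<bar> \<le> m)" for i
      using test_functions_bounded[OF test_functions_partial_deriv[OF \<phi>, of i]] by blast
    then obtain m where m: "\<And>i. m i \<ge> 0" "\<And>i x. \<bar>partial_deriv i \<phi> x\<bar> \<le> m i" by metis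
    \<comment> \<open>Dilation by \<open>s\<close> about \<open>y\<close>, the inverse of
      \<open>x \<mapsto> y + (x - y) / s\<close>; its Jacobian \<open>s ^ d\<close> is the factor
      that accompanies \<open>F s\<close> below.\<close>
    define p where "p s z = s *\<^sub>R z + (y - s *\<^sub>R y)" for s :: real and z
    define F where "F s z = \<phi> (p s z)" for s z
    define D where "D s z = (\<Sum>i\<in>UNIV. (z - y) $ i * partial_deriv i \<phi> (p s z))" for s z
    define \<Phi>' where "\<Phi>' s z = real d * s ^ e * F s z + s ^ d * D s z" for s z
    have lin: "linear ((*\<^sub>R) s :: real^'n \<Rightarrow> real^'n)" for s :: real by (rule linear_scaleR)
    have sF: "smooth (F s)" for s unfolding F_def[abs_def] p_def by (rule smooth_affine[OF s\<phi> lin])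
    have pF: "partial_deriv i (F s) z = s * partial_deriv i \<phi> (p s z)" for i s z
    proof -
      have "partial_deriv i (F s) z = (\<Sum>j\<in>UNIV. (s *\<^sub>R axis i 1) $ j * partial_deriv j \<phi> (p s z))"
        unfolding F_def[abs_def] p_def by (rule partial_deriv_affine(1)[OF s\<phi> lin])
      also have "\<dots> = (\<Sum>j\<in>{i}. (s *\<^sub>R axis i 1) $ j * partial_deriv j \<phi> (p s z))"
        by (intro sum.mono_neutral_right) (auto simp: axis_def)
      finally show ?thesis by simp
    qed
    have dF: "((\<lambda>s. F s z) has_real_derivative D s z) (at s)" for s z
    proof -
      have "((\<lambda>s. p s z) has_derivative (\<lambda>t. t *\<^sub>R (z - y))) (at s)"
        unfolding p_def by (auto intro!: derivative_eq_intros simp: scaleR_diff_right)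
      note chain = has_derivative_compose[OF this has_derivative_partial_deriv[OF smooth_differentiable[OF s\<phi>]]]
      have "(\<lambda>t. \<Sum>i\<in>UNIV. (t *\<^sub>R (z - y)) $ i * partial_deriv i \<phi> (p s z)) = (*) (D s z)"
        by (rule ext) (simp add: D_def sum_distrib_left sum_distrib_right mult_ac)
      then show ?thesis using chain unfolding has_field_derivative_def F_def by (simp only:)
    qed
    have d\<Phi>: "((\<lambda>s. s ^ d * F s z) has_real_derivative \<Phi>' s z) (at s)" for s z
    proof -
      have "((\<lambda>s. s ^ d) has_real_derivative real d * s ^ e) (at s)"
        using DERIV_pow[of d s UNIV] by (simp add: de)
      from DERIV_mult[OF this dF[of z s]] show ?thesis
        unfolding \<Phi>'_def by (simp add: mult_ac)
    qed
    \<comment> \<open>Components of a vector field whose divergence is the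
      \<open>s\<close>-derivative of \<open>s ^ d * F s\<close>. Through this identity the
      derivative of \<open>H\<close> becomes an integral against the weak gradient.\<close>
    define \<psi> where "\<psi> s i z = (z $ i - y $ i) * (s ^ e * F s z)" for s i z
    have p\<psi>: "(\<Sum>i\<in>UNIV. partial_deriv i (\<psi> s i) z) = \<Phi>' s z" for s z
    proof -
      have 1: "smooth (\<lambda>z :: real^'n. z $ i - y $ i)" for i by (intro smooth_diff smooth_coordinate smooth_const)
      have 2: "partial_deriv i (\<lambda>z. z $ i - y $ i) z = 1" for i
      proof -
        have "((\<lambda>z. z $ i - y $ i) has_derivative (\<lambda>h. h $ i)) (at z)"
          by (auto intro!: derivative_eq_intros bounded_linear_imp_has_derivative bounded_linear_vec_nth)
        then show ?thesis by (simp add: partial_derivI)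
      qed
      have 3: "partial_deriv i (\<lambda>z. s ^ e * F s z) z = s ^ e * (s * partial_deriv i \<phi> (p s z))" for i
        by (subst partial_deriv_mult) (simp_all add: smooth_differentiable sF pF)
      have "partial_deriv i (\<psi> s i) z = s ^ e * F s z + s ^ d * ((z - y) $ i * partial_deriv i \<phi> (p s z))" for i
      proof -
        have "s ^ d = s ^ e * s" by (simp add: de)
        moreover have "partial_deriv i (\<psi> s i) z = (z $ i - y $ i) * (s ^ e * (s * partial_deriv i \<phi> (p s z))) + 1 * (s ^ e * F s z)"
          unfolding \<psi>_def[abs_def] by (subst partial_deriv_mult) (simp_all add: smooth_differentiable smooth_cmult sF 1 2 3)
        ultimately show ?thesis by simp
      qed
      then show ?thesis by (simp add: sum.distrib sum_distrib_left \<Phi>'_def D_def d_def)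
    qed
    have pinv: "(1/s) *\<^sub>R p s z + (1 - 1/s) *\<^sub>R y = z" "p s ((1/s) *\<^sub>R z + (1 - 1/s) *\<^sub>R y) = z"
      if "s \<ge> 1" for s z
      using that by (simp_all add: p_def vec_eq_iff field_simps)
    \<comment> \<open>For \<open>s \<ge> 1\<close> the point \<open>z\<close> lies between
      \<open>y\<close> and \<open>p s z\<close>. By convexity the support of \<open>F s\<close>
      stays inside \<Omega>, and \<open>\<psi> s i\<close> is an admissible test function.\<close>
    have F_nz: "z \<in> \<Omega>" if "s \<ge> 1" "p s z \<in> \<Omega>" for s z
    proof -
      have "(1/s) *\<^sub>R p s z + (1 - 1/s) *\<^sub>R y \<in> \<Omega>" using cv y that by (intro convexD) auto
      also have "(1/s) *\<^sub>R p s z + (1 - 1/s) *\<^sub>R y = z" by (rule pinv(1)[OF that(1)])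
      finally show ?thesis .
    qed
    have \<psi>T: "\<psi> s i \<in> test_functions \<Omega>" if s: "s \<ge> 1" for s i
    proof -
      obtain K where "smooth \<phi>" and K: "compact K" "K \<subseteq> \<Omega>" "\<And>x. x \<notin> K \<Longrightarrow> \<phi> x = 0"
        using test_functionsE[OF \<phi>] by blast
      have "F s \<in> test_functions \<Omega>"
      proof (rule test_functionsI[OF sF])
        show "compact ((\<lambda>x. (1/s) *\<^sub>R x + (1 - 1/s) *\<^sub>R y) ` K)"
          by (intro compact_continuous_image K continuous_intros)
        show "(\<lambda>x. (1/s) *\<^sub>R x + (1 - 1/s) *\<^sub>R y) ` K \<subseteq> \<Omega>"
          using K(2) F_nz[OF s] pinv(2)[OF s] by auto
        show "F s z = 0" if "z \<notin> (\<lambda>x. (1/s) *\<^sub>R x + (1 - 1/s) *\<^sub>R y) ` K" for z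
        proof -
          have "p s z \<notin> K"
          proof
            assume "p s z \<in> K"
            then have "(1/s) *\<^sub>R p s z + (1 - 1/s) *\<^sub>R y \<in> (\<lambda>x. (1/s) *\<^sub>R x + (1 - 1/s) *\<^sub>R y) ` K" by (rule imageI)
            then show False using that by (simp only: pinv(1)[OF s])
          qed
          then show ?thesis unfolding F_def by (rule K(3))
        qed
      qed
      then show ?thesis unfolding \<psi>_def[abs_def]
        by (intro test_functions_mult test_functions_cmult smooth_diff smooth_coordinate smooth_const)
    qed
    have mF: "F s \<in> borel_measurable M" for s
      by (intro measurable_restrict_space1 measurable_completion) (simp add: borel_measurable_continuous_onI smooth_continuous_on[OF sF])
    have FL: "F s \<in> L2 \<Omega>" for s by (rule L2_bounded[OF mF, of _ M0]) (simp add: F_def M0)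
    have \<Phi>m: "\<Phi>' s \<in> borel_measurable M" for s
    proof -
      have "(\<lambda>z. \<Sum>i\<in>UNIV. partial_deriv i (\<psi> s i) z) \<in> borel_measurable borel"
        unfolding \<psi>_def[abs_def]
        by (intro borel_measurable_sum borel_measurable_continuous_onI smooth_continuous_on smooth_partial_deriv
            smooth_mult smooth_diff smooth_coordinate smooth_const sF)
      then have "\<Phi>' s \<in> borel_measurable borel" by (simp add: p\<psi>)
      then show ?thesis by (intro measurable_restrict_space1 measurable_completion) simp
    qed
    \<comment> \<open>A crude majorant on an open interval around \<open>[1, 2]\<close>, serving to
      differentiate under the integral.\<close>
    define B where "B = real d * 3 ^ e * M0 + 3 ^ d * (\<Sum>i\<in>(UNIV::'n set). \<delta> * m i)"
    have B: "\<bar>\<Phi>' s z\<bar> \<le> B" if "s \<in> {1/2<..<3}" "z \<in> \<Omega>" for s z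
    proof -
      have s: "s \<ge> 0" "s \<le> 3" using that by auto
      have "\<bar>D s z\<bar> \<le> (\<Sum>i\<in>UNIV. \<bar>(z - y) $ i * partial_deriv i \<phi> (p s z)\<bar>)" unfolding D_def by (rule sum_abs)
      also have "\<dots> \<le> (\<Sum>i\<in>UNIV. \<delta> * m i)"
      proof (rule sum_mono)
        fix i
        have "\<bar>(z - y) $ i\<bar> \<le> \<delta>" using component_le_norm_cart[of "z - y" i] \<delta>[OF that(2) y] by linarith
        then show "\<bar>(z - y) $ i * partial_deriv i \<phi> (p s z)\<bar> \<le> \<delta> * m i"
          using m \<delta>0 by (simp add: abs_mult mult_mono)
      qed
      finally have D: "\<bar>D s z\<bar> \<le> (\<Sum>i\<in>UNIV. \<delta> * m i)" .
      have "\<bar>\<Phi>' s z\<bar> \<le> \<bar>real d * s ^ e * F s z\<bar> + \<bar>s ^ d * D s z\<bar>"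
        unfolding \<Phi>'_def by (rule abs_triangle_ineq)
      also have "\<dots> = real d * s ^ e * \<bar>F s z\<bar> + s ^ d * \<bar>D s z\<bar>" using s by (simp add: abs_mult)
      also have "\<dots> \<le> B" unfolding B_def using s D M0
        by (intro add_mono mult_mono power_mono) (auto simp: F_def intro!: mult_nonneg_nonneg)
      finally show ?thesis .
    qed
    define H where "H s = integral\<^sup>L M (\<lambda>z. u z * (s ^ d * F s z))" for s
    define H' where "H' s = integral\<^sup>L M (\<lambda>z. u z * \<Phi>' s z)" for s
    have dH: "(H has_real_derivative H' s) (at s)" if "s \<in> {1/2<..<3}" for s
      unfolding H_def[abs_def] H'_def
    proof (rule DERIV_integral[where w = "\<lambda>z. \<bar>u z\<bar> * B", OF that])
      show "integrable M (\<lambda>z. u z * (r ^ d * F r z))" for r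
        by (intro L2_mult u L.scale_in FL)
      show "((\<lambda>r. u z * (r ^ d * F r z)) has_real_derivative u z * \<Phi>' r z) (at r)" for r z
        by (rule DERIV_cmult[OF d\<Phi>])
      show "\<bar>u z * \<Phi>' r z\<bar> \<le> \<bar>u z\<bar> * B" if "r \<in> {1/2<..<3}" "z \<in> space M" for r z
        using B[of r z] that by (simp add: abs_mult mult_left_mono)
      show "integrable M (\<lambda>z. \<bar>u z\<bar> * B)" using L2_integrable[OF u] by simp
      show "(\<lambda>z. u z * \<Phi>' s z) \<in> borel_measurable M" using L2D(1)[OF u] \<Phi>m by (intro borel_measurable_times)
    qed
    have H'eq: "H' s = - integral\<^sup>L M (\<lambda>z. (g z \<bullet> (z - y)) * (s ^ e * F s z))" if s: "s \<ge> 1" for s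
    proof -
      note T = \<psi>T[OF s]
      have "H' s = integral\<^sup>L M (\<lambda>z. \<Sum>i\<in>UNIV. u z * partial_deriv i (\<psi> s i) z)"
        by (simp add: H'_def flip: p\<psi> sum_distrib_left)
      also have "\<dots> = (\<Sum>i\<in>UNIV. integral\<^sup>L M (\<lambda>z. u z * partial_deriv i (\<psi> s i) z))"
        by (rule Bochner_Integration.integral_sum) (intro L2_mult u test_L2[OF test_functions_partial_deriv[OF T]])
      also have "\<dots> = (\<Sum>i\<in>UNIV. - integral\<^sup>L M (\<lambda>z. g z $ i * \<psi> s i z))"
        using g(2) T by (simp add: is_weak_grad_def)
      also have "\<dots> = - (\<Sum>i\<in>UNIV. integral\<^sup>L M (\<lambda>z. g z $ i * \<psi> s i z))"
        by (rule sum_negf)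
      also have "(\<Sum>i\<in>UNIV. integral\<^sup>L M (\<lambda>z. g z $ i * \<psi> s i z)) = integral\<^sup>L M (\<lambda>z. \<Sum>i\<in>UNIV. g z $ i * \<psi> s i z)"
        by (rule Bochner_Integration.integral_sum[symmetric]) (intro L2_mult L2_component g test_L2[OF T])
      also have "(\<lambda>z. \<Sum>i\<in>UNIV. g z $ i * \<psi> s i z) = (\<lambda>z. (g z \<bullet> (z - y)) * (s ^ e * F s z))"
        by (simp add: inner_vec_def \<psi>_def sum_distrib_right mult.assoc)
      finally show ?thesis .
    qed
    have massF: "mass \<Omega> (F s) (F s) \<le> mass \<Omega> \<phi> \<phi>" if s: "s \<ge> 1" for s
    proof -
      have inv: "invertible (mat s :: real^'n^'n)" using s by (intro invertible_mat) simp
      have pa: "p s = aff (mat s) (y - s *\<^sub>R y)" by (simp add: p_def aff_def mat_scalar fun_eq_iff)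
      have sub: "\<Omega> \<subseteq> p s ` \<Omega>"
      proof
        fix x assume x: "x \<in> \<Omega>"
        have e: "p s ((1/s) *\<^sub>R x + (1 - 1/s) *\<^sub>R y) = x" by (rule pinv(2)[OF s])
        then have "(1/s) *\<^sub>R x + (1 - 1/s) *\<^sub>R y \<in> \<Omega>" using F_nz[OF s] x by simp
        then have "p s ((1/s) *\<^sub>R x + (1 - 1/s) *\<^sub>R y) \<in> p s ` \<Omega>" by (rule imageI)
        then show "x \<in> p s ` \<Omega>" by (simp only: e)
      qed
      have ps: "p s ` \<Omega> \<in> sets lebesgue" unfolding pa by (rule aff_image_lebesgue[OF sets_lebesgue])
      have "mass (p s ` \<Omega>) \<phi> \<phi> = s ^ d * mass \<Omega> (F s) (F s)"
        unfolding F_def[abs_def] pa using mass_aff[OF bdd_open_axioms inv] s by (simp add: vscale_mat d_def)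
      moreover have "mass (p s ` \<Omega>) \<phi> \<phi> = mass \<Omega> \<phi> \<phi>"
        unfolding mass_def using test_functions_eq_0[OF \<phi>] sub
        by (subst (1 2) integral_lebesgue_on_eq) (auto simp: ps sets_lebesgue)
      ultimately have "s ^ d * mass \<Omega> (F s) (F s) = mass \<Omega> \<phi> \<phi>" by simp
      moreover have "1 * mass \<Omega> (F s) (F s) \<le> s ^ d * mass \<Omega> (F s) (F s)"
        using s L.nonneg[OF FL] by (intro mult_right_mono one_le_power) auto
      ultimately show ?thesis by simp
    qed
    have H'le: "norm (H' s) \<le> 2 ^ d * \<delta> * sqrt G * sqrt (mass \<Omega> \<phi> \<phi>)" if s: "s \<in> {1..2}" for s
    proof -
      have s12: "s \<ge> 1" "s \<le> 2" using s by auto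
      have Fa: "(\<lambda>x. \<bar>F s x\<bar>) \<in> L2 \<Omega>" using FL[of s] by (auto simp: L2_def)
      have i1: "integrable M (\<lambda>z. norm (g z) * \<bar>F s z\<bar>)" by (rule L2_mult[OF gn Fa])
      have "norm (H' s) = \<bar>integral\<^sup>L M (\<lambda>z. (g z \<bullet> (z - y)) * (s ^ e * F s z))\<bar>"
        by (simp add: H'eq[OF s12(1)])
      also have "\<dots> \<le> integral\<^sup>L M (\<lambda>z. \<bar>(g z \<bullet> (z - y)) * (s ^ e * F s z)\<bar>)"
        by (rule integral_abs_bound)
      also have "\<dots> \<le> integral\<^sup>L M (\<lambda>z. (2 ^ d * \<delta>) * (norm (g z) * \<bar>F s z\<bar>))"
      proof (rule integral_mono')
        show "integrable M (\<lambda>z. (2 ^ d * \<delta>) * (norm (g z) * \<bar>F s z\<bar>))" using i1 by simp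
        fix z assume z: "z \<in> space M"
        have "\<bar>g z \<bullet> (z - y)\<bar> \<le> norm (g z) * norm (z - y)" by (rule Cauchy_Schwarz_ineq2)
        also have "\<dots> \<le> norm (g z) * \<delta>" using \<delta>[of z y] z y by (intro mult_left_mono) auto
        finally have 1: "\<bar>g z \<bullet> (z - y)\<bar> \<le> norm (g z) * \<delta>" .
        have "s ^ e \<le> 2 ^ e" using s12 by (intro power_mono) auto
        also have "\<dots> \<le> 2 ^ d" by (rule power_increasing) (auto simp: de)
        finally have 2: "s ^ e * \<bar>F s z\<bar> \<le> 2 ^ d * \<bar>F s z\<bar>" by (intro mult_right_mono) auto
        have "\<bar>(g z \<bullet> (z - y)) * (s ^ e * F s z)\<bar> = \<bar>g z \<bullet> (z - y)\<bar> * (s ^ e * \<bar>F s z\<bar>)"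
          using s12 by (simp add: abs_mult)
        also have "\<dots> \<le> (norm (g z) * \<delta>) * (2 ^ d * \<bar>F s z\<bar>)"
          using s12 \<delta>0 by (intro mult_mono 1 2) auto
        finally show "\<bar>(g z \<bullet> (z - y)) * (s ^ e * F s z)\<bar> \<le> (2 ^ d * \<delta>) * (norm (g z) * \<bar>F s z\<bar>)"
          by (simp add: mult_ac)
        show "0 \<le> (2 ^ d * \<delta>) * (norm (g z) * \<bar>F s z\<bar>)" using \<delta>0 by simp
      qed
      also have "\<dots> = (2 ^ d * \<delta>) * mass \<Omega> (\<lambda>z. norm (g z)) (\<lambda>z. \<bar>F s z\<bar>)" by (simp add: mass_def)
      also have "\<dots> \<le> (2 ^ d * \<delta>) * (sqrt G * sqrt (mass \<Omega> \<phi> \<phi>))"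
      proof (rule mult_left_mono)
        have "mass \<Omega> (\<lambda>z. norm (g z)) (\<lambda>z. \<bar>F s z\<bar>) \<le> sqrt G * sqrt (mass \<Omega> (\<lambda>z. \<bar>F s z\<bar>) (\<lambda>z. \<bar>F s z\<bar>))"
          using L.Cauchy_Schwarz_sqrt[OF gn Fa] unfolding G by linarith
        also have "mass \<Omega> (\<lambda>z. \<bar>F s z\<bar>) (\<lambda>z. \<bar>F s z\<bar>) = mass \<Omega> (F s) (F s)" by (simp add: mass_def)
        also have "sqrt G * sqrt (mass \<Omega> (F s) (F s)) \<le> sqrt G * sqrt (mass \<Omega> \<phi> \<phi>)"
          using massF[OF s12(1)] G0 by (intro mult_left_mono) auto
        finally show "mass \<Omega> (\<lambda>z. norm (g z)) (\<lambda>z. \<bar>F s z\<bar>) \<le> sqrt G * sqrt (mass \<Omega> \<phi> \<phi>)" .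
      qed (use \<delta>0 in simp)
      finally show ?thesis by (simp add: mult_ac)
    qed
    have "norm (H 1 - H 2) \<le> 2 ^ d * \<delta> * sqrt G * sqrt (mass \<Omega> \<phi> \<phi>) * norm (1 - 2 :: real)"
      by (rule field_differentiable_bound[of "{1..2}" H H'])
        (use dH H'le in \<open>auto intro: has_field_derivative_at_within\<close>)
    moreover have "H 1 = mass \<Omega> u \<phi>" by (simp add: H_def mass_def F_def p_def)
    \<comment> \<open>Under the substitution \<open>z = a x\<close>, with \<open>a\<close> the
      inverse of \<open>p 2\<close>, the Jacobian cancels \<open>2 ^ d\<close>.\<close>
    moreover have "H 2 = mass \<Omega> (\<lambda>x. u ((1/2) *\<^sub>R x + (1/2) *\<^sub>R y)) \<phi>"
    proof -
      have pa: "p 2 (a x) = x" "a (p 2 x) = x" for x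
        by (simp_all add: p_def a vec_eq_iff field_simps)
      have z: "F 2 z = 0" if "z \<notin> a ` \<Omega>" for z
      proof -
        have "p 2 z \<notin> \<Omega>"
        proof
          assume "p 2 z \<in> \<Omega>"
          then have "a (p 2 z) \<in> a ` \<Omega>" by (rule imageI)
          then show False using that by (simp only: pa)
        qed
        then show ?thesis unfolding F_def by (rule test_functions_eq_0[OF \<phi>])
      qed
      have "H 2 = integral\<^sup>L (lebesgue_on (a ` \<Omega>)) (\<lambda>z. u z * (2 ^ d * F 2 z))"
        unfolding H_def using z asub
        by (subst (1 2) integral_lebesgue_on_eq) (auto simp: as sets_lebesgue)
      also have "\<dots> = vscale (mat (1/2) :: real^'n^'n) * integral\<^sup>L M (\<lambda>x. u (a x) * (2 ^ d * F 2 (a x)))"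
        unfolding a_def by (subst integral_aff[OF half sets_lebesgue]) simp
      also have "\<dots> = integral\<^sup>L M (\<lambda>x. u (a x) * \<phi> x)"
      proof -
        have "(\<lambda>x. u (a x) * (2 ^ d * F 2 (a x))) = (\<lambda>x. 2 ^ d * (u (a x) * \<phi> x))"
          by (simp add: F_def pa fun_eq_iff)
        then show ?thesis by (simp add: vscale_mat d_def power_one_over)
      qed
      finally show ?thesis by (simp add: mass_def a)
    qed
    moreover have "mass \<Omega> w \<phi> = mass \<Omega> u \<phi> - mass \<Omega> (\<lambda>x. u ((1/2) *\<^sub>R x + (1/2) *\<^sub>R y)) \<phi>"
      unfolding w_def by (rule L.diff_left[OF u uaL test_L2[OF \<phi>]])
    ultimately show "\<bar>mass \<Omega> w \<phi>\<bar> \<le> 2 ^ d * \<delta> * sqrt G * sqrt (mass \<Omega> \<phi> \<phi>)" by simp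
  qed
  also have "(2 ^ d * \<delta> * sqrt G)\<^sup>2 = (2 ^ d * \<delta>)\<^sup>2 * G" using G0 by (simp add: power_mult_distrib)
  finally show "mass \<Omega> w w \<le> (2 ^ CARD('n) * \<delta>)\<^sup>2 * integral\<^sup>L M (\<lambda>x. (norm (g x))\<^sup>2)"
    by (simp add: d_def G_def)
qed

lemma nn_integral_on: "(\<integral>\<^sup>+x. f x \<partial>M) = (\<integral>\<^sup>+x. f x * indicator \<Omega> x \<partial>lborel)"
  using sets_lebesgue by (subst nn_integral_restrict_space) (simp_all add: nn_integral_completion)

lemma nn_integral_on_swap:
  fixes f :: "real^'n \<Rightarrow> real^'n \<Rightarrow> ennreal"
  assumes f: "case_prod f \<in> borel_measurable (borel \<Otimes>\<^sub>M borel)"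
  shows "(\<integral>\<^sup>+x. (\<integral>\<^sup>+y. f x y \<partial>M) \<partial>M) = (\<integral>\<^sup>+y. (\<integral>\<^sup>+x. f x y \<partial>M) \<partial>M)"
proof -
  have \<Omega>b[measurable]: "\<Omega> \<in> sets borel" using op by simp
  have f'[measurable]: "(\<lambda>(x, y). f x y) \<in> borel_measurable (borel \<Otimes>\<^sub>M borel)" using f by simp
  have m: "(\<lambda>y. f x y * indicator \<Omega> y) \<in> borel_measurable lborel" "(\<lambda>x. f x y * indicator \<Omega> x) \<in> borel_measurable lborel" for x y
    by measurable
  have "(\<integral>\<^sup>+x. (\<integral>\<^sup>+y. f x y \<partial>M) \<partial>M) = (\<integral>\<^sup>+x. (\<integral>\<^sup>+y. f x y * indicator \<Omega> y * indicator \<Omega> x \<partial>lborel) \<partial>lborel)"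
    unfolding nn_integral_on by (subst nn_integral_multc) (auto simp: m)
  also have "\<dots> = (\<integral>\<^sup>+y. (\<integral>\<^sup>+x. f x y * indicator \<Omega> y * indicator \<Omega> x \<partial>lborel) \<partial>lborel)"
    by (rule lborel_pair.Fubini'[symmetric]) measurable
  also have "\<dots> = (\<integral>\<^sup>+y. (\<integral>\<^sup>+x. f x y * indicator \<Omega> x * indicator \<Omega> y \<partial>lborel) \<partial>lborel)"
    by (simp add: mult_ac)
  also have "\<dots> = (\<integral>\<^sup>+y. (\<integral>\<^sup>+x. f x y \<partial>M) \<partial>M)"
    unfolding nn_integral_on by (subst nn_integral_multc) (auto simp: m)
  finally show ?thesis .
qed

text \<open>Integrate \<open>(u x - u y)\<^sup>2 \<le> 2 (u x - u m)\<^sup>2 + 2 (u y - u m)\<^sup>2\<close> with the midpoint \<open>m\<close> of \<open>x\<close> and \<open>y\<close>.\<close>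

lemma Poincare_borel:
  assumes ub: "u \<in> borel_measurable borel"
    and u: "u \<in> L2 \<Omega>" and g: "g \<in> L2 \<Omega>" "is_weak_grad \<Omega> u g"
    and \<delta>: "\<And>x z. x \<in> \<Omega> \<Longrightarrow> z \<in> \<Omega> \<Longrightarrow> norm (x - z) \<le> \<delta>"
  shows "vol \<Omega> * mass \<Omega> u u \<le> (integral\<^sup>L M u)\<^sup>2
     + 2 * vol \<Omega> * (2 ^ CARD('n) * \<delta>)\<^sup>2 * integral\<^sup>L M (\<lambda>x. (norm (g x))\<^sup>2)"
proof -
  note [measurable] = ub
  have [measurable]: "\<Omega> \<in> sets borel" using op by simp
  define B where "B = (2 ^ CARD('n) * \<delta>)\<^sup>2 * integral\<^sup>L M (\<lambda>x. (norm (g x))\<^sup>2)"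
  have B0: "B \<ge> 0" by (simp add: B_def)
  define V where "V = vol \<Omega>"
  have V0: "V \<ge> 0" by (simp add: V_def)
  have VM: "measure M \<Omega> = V" using sets_lebesgue by (simp add: measure_restrict_space V_def)
  have emM: "emeasure M \<Omega> = ennreal V" using emeasure_eq_measure[of \<Omega>] by (simp add: VM)
  define m where "m x y = u ((1/2) *\<^sub>R x + (1/2) *\<^sub>R y)" for x y :: "real^'n"
  have mm[measurable]: "case_prod m \<in> borel_measurable (borel \<Otimes>\<^sub>M borel)"
    unfolding m_def[abs_def] by measurable
  have mM: "f \<in> borel_measurable borel \<Longrightarrow> f \<in> borel_measurable M" for f :: "real^'n \<Rightarrow> ennreal"
    by (intro measurable_restrict_space1 measurable_completion) simp
  have one: "(\<integral>\<^sup>+x. ennreal ((u x - m x y)\<^sup>2) \<partial>M) \<le> ennreal B" if y: "y \<in> \<Omega>" for y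
  proof -
    note c = contraction_bound[OF u g y \<delta>]
    have w: "(\<lambda>x. u x - m x y) \<in> L2 \<Omega>" unfolding m_def by (rule c(1))
    have "(\<integral>\<^sup>+x. ennreal ((u x - m x y)\<^sup>2) \<partial>M) = ennreal (integral\<^sup>L M (\<lambda>x. (u x - m x y)\<^sup>2))"
      using L2D(2)[OF w] by (intro nn_integral_eq_integral) auto
    also have "integral\<^sup>L M (\<lambda>x. (u x - m x y)\<^sup>2) = mass \<Omega> (\<lambda>x. u x - m x y) (\<lambda>x. u x - m x y)"
      by (simp add: mass_square)
    also have "\<dots> \<le> B" unfolding m_def B_def by (rule c(2))
    finally show ?thesis by (simp add: ennreal_leI)
  qed
  have m_sym: "m x y = m y x" for x y by (simp add: m_def add.commute)
  define J where "J = (\<integral>\<^sup>+x. (\<integral>\<^sup>+y. ennreal ((u x - u y)\<^sup>2) \<partial>M) \<partial>M)"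
  have "J \<le> (\<integral>\<^sup>+x. (\<integral>\<^sup>+y. 2 * ennreal ((u x - m x y)\<^sup>2) + 2 * ennreal ((u y - m y x)\<^sup>2) \<partial>M) \<partial>M)"
    unfolding J_def
  proof (intro nn_integral_mono)
    fix x y
    have "(u x - u y)\<^sup>2 \<le> 2 * (u x - m x y)\<^sup>2 + 2 * (u y - m y x)\<^sup>2"
      using square_sum_le[of "u x - m x y" "m x y - u y"] m_sym[of x y] by (simp add: power2_commute)
    then have "ennreal ((u x - u y)\<^sup>2) \<le> ennreal (2 * (u x - m x y)\<^sup>2 + 2 * (u y - m y x)\<^sup>2)" by (rule ennreal_leI)
    also have "\<dots> = 2 * ennreal ((u x - m x y)\<^sup>2) + 2 * ennreal ((u y - m y x)\<^sup>2)"
      by (simp add: ennreal_plus ennreal_mult'')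
    finally show "ennreal ((u x - u y)\<^sup>2) \<le> 2 * ennreal ((u x - m x y)\<^sup>2) + 2 * ennreal ((u y - m y x)\<^sup>2)" .
  qed
  also have "\<dots> = (\<integral>\<^sup>+x. 2 * (\<integral>\<^sup>+y. ennreal ((u x - m x y)\<^sup>2) \<partial>M) + 2 * (\<integral>\<^sup>+y. ennreal ((u y - m y x)\<^sup>2) \<partial>M) \<partial>M)"
  proof (intro nn_integral_cong)
    fix x
    have "(\<lambda>y. ennreal ((u x - m x y)\<^sup>2)) \<in> borel_measurable M"
      unfolding m_def by (rule mM) measurable
    moreover have "(\<lambda>y. ennreal ((u y - m y x)\<^sup>2)) \<in> borel_measurable M"
      unfolding m_def by (rule mM) measurable
    ultimately show "(\<integral>\<^sup>+y. 2 * ennreal ((u x - m x y)\<^sup>2) + 2 * ennreal ((u y - m y x)\<^sup>2) \<partial>M)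
      = 2 * (\<integral>\<^sup>+y. ennreal ((u x - m x y)\<^sup>2) \<partial>M) + 2 * (\<integral>\<^sup>+y. ennreal ((u y - m y x)\<^sup>2) \<partial>M)"
      by (simp add: nn_integral_add nn_integral_cmult)
  qed
  also have "\<dots> = 2 * (\<integral>\<^sup>+x. (\<integral>\<^sup>+y. ennreal ((u x - m x y)\<^sup>2) \<partial>M) \<partial>M) + 2 * (\<integral>\<^sup>+x. (\<integral>\<^sup>+y. ennreal ((u y - m y x)\<^sup>2) \<partial>M) \<partial>M)"
  proof -
    have "(\<lambda>x. \<integral>\<^sup>+y. ennreal ((u x - m x y)\<^sup>2) \<partial>M) \<in> borel_measurable M"
      unfolding nn_integral_on m_def by (rule mM) measurable
    moreover have "(\<lambda>x. \<integral>\<^sup>+y. ennreal ((u y - m y x)\<^sup>2) \<partial>M) \<in> borel_measurable M"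
      unfolding nn_integral_on m_def by (rule mM) measurable
    ultimately show ?thesis by (simp add: nn_integral_add nn_integral_cmult)
  qed
  also have "(\<integral>\<^sup>+x. (\<integral>\<^sup>+y. ennreal ((u x - m x y)\<^sup>2) \<partial>M) \<partial>M) = (\<integral>\<^sup>+y. (\<integral>\<^sup>+x. ennreal ((u x - m x y)\<^sup>2) \<partial>M) \<partial>M)"
    by (rule nn_integral_on_swap) measurable
  also have "(\<integral>\<^sup>+y. (\<integral>\<^sup>+x. ennreal ((u x - m x y)\<^sup>2) \<partial>M) \<partial>M) \<le> (\<integral>\<^sup>+y. ennreal B \<partial>M)"
    by (intro nn_integral_mono one) simp
  finally have "J \<le> 2 * (\<integral>\<^sup>+y. ennreal B \<partial>M) + 2 * (\<integral>\<^sup>+y. ennreal B \<partial>M)"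
    by (simp add: add_mono mult_left_mono)
  also have "\<dots> = ennreal (4 * V * B)"
    using B0 V0 by (simp add: emM ennreal_mult' mult_ac flip: distrib_left ennreal_plus) (simp flip: ennreal_plus ennreal_mult' add: mult_ac ennreal_numeral[symmetric])?
  finally have J_le: "J \<le> ennreal (4 * V * B)" .
  define U where "U = integral\<^sup>L M u"
  define S where "S = mass \<Omega> u u"
  have S: "S = integral\<^sup>L M (\<lambda>x. (u x)\<^sup>2)" by (simp add: S_def mass_square)
  have iu: "integrable M u" by (rule L2_integrable[OF u])
  have iu2: "integrable M (\<lambda>x. (u x)\<^sup>2)" using L2D(2)[OF u] by simp
  \<comment> \<open>Expanding the square evaluates the double integral as
    \<open>2 * V * S - 2 * U\<^sup>2\<close>, which is then compared with
    \<open>4 * V * B\<close>.\<close>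
  have exp: "(u x - u y)\<^sup>2 = (u x)\<^sup>2 - 2 * u x * u y + (u y)\<^sup>2" for x y by (simp add: power2_diff)
  define q where "q x = V * (u x)\<^sup>2 - 2 * u x * U + S" for x
  have inner: "integrable M (\<lambda>y. (u x - u y)\<^sup>2)" "integral\<^sup>L M (\<lambda>y. (u x - u y)\<^sup>2) = q x" for x
    unfolding exp using iu iu2 by (simp_all add: q_def U_def S VM)
  have "J = (\<integral>\<^sup>+x. ennreal (q x) \<partial>M)"
    unfolding J_def using inner by (simp add: nn_integral_eq_integral)
  also have "\<dots> = ennreal (integral\<^sup>L M q)"
  proof (rule nn_integral_eq_integral)
    show "integrable M q" unfolding q_def[abs_def] using iu iu2 by simp
    have "q x \<ge> 0" for x unfolding inner(2)[symmetric] by simp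
    then show "AE x in M. 0 \<le> q x" by simp
  qed
  also have "integral\<^sup>L M q = V * S - 2 * U * U + S * V"
    unfolding q_def[abs_def] using iu iu2 by (simp add: U_def S VM)
  finally have "ennreal (V * S - 2 * U * U + S * V) \<le> ennreal (4 * V * B)" using J_le by simp
  then have "V * S - 2 * U * U + S * V \<le> 4 * V * B" using B0 V0 by (simp add: ennreal_le_iff)
  then show ?thesis by (simp add: V_def S_def U_def B_def power2_eq_square mult_ac)
qed

text \<open>Interchanging the integrals over \<open>x\<close> and \<open>y\<close> asks for joint
  Borel measurability of \<open>u\<close> at the midpoint. A Borel representative supplies it, and
  every term of the inequality is insensitive to a change on a null set.\<close>

lemma ex_borel_rep:
  fixes u :: "real^'n \<Rightarrow> real"
  assumes u: "u \<in> borel_measurable M"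
  obtains u' where "u' \<in> borel_measurable borel" "AE x in M. u x = u' x"
proof -
  have "(\<lambda>x. indicator \<Omega> x *\<^sub>R u x) \<in> borel_measurable lebesgue"
    using u sets_lebesgue by (simp add: borel_measurable_restrict_space_iff)
  then obtain u' where u': "u' \<in> borel_measurable lborel" "AE x in lborel. indicator \<Omega> x *\<^sub>R u x = u' x"
    using completion_ex_borel_measurable_real by blast
  have "AE x in lebesgue. indicator \<Omega> x *\<^sub>R u x = u' x" by (rule AE_completion[OF u'(2)])
  then have "AE x in lebesgue. x \<in> \<Omega> \<longrightarrow> u x = u' x" by eventually_elim (auto simp: indicator_def)
  then have "AE x in M. u x = u' x" using sets_lebesgue by (simp add: AE_restrict_space_iff)
  then show thesis using that u'(1) by simp
qed

lemma Poincare: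
  assumes u: "u \<in> L2 \<Omega>" and g: "g \<in> L2 \<Omega>" "is_weak_grad \<Omega> u g"
    and \<delta>: "\<And>x z. x \<in> \<Omega> \<Longrightarrow> z \<in> \<Omega> \<Longrightarrow> norm (x - z) \<le> \<delta>"
  shows "vol \<Omega> * mass \<Omega> u u \<le> (integral\<^sup>L M u)\<^sup>2
     + 2 * vol \<Omega> * (2 ^ CARD('n) * \<delta>)\<^sup>2 * integral\<^sup>L M (\<lambda>x. (norm (g x))\<^sup>2)"
proof -
  obtain u' where u': "u' \<in> borel_measurable borel" "AE x in M. u x = u' x"
    using ex_borel_rep[OF L2D(1)[OF u]] by blast
  have u'M: "u' \<in> borel_measurable M"
    by (intro measurable_restrict_space1 measurable_completion) (simp add: u'(1))
  have uM: "u \<in> borel_measurable M" by (rule L2D(1)[OF u])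
  have "integrable M (\<lambda>x. (norm (u' x))\<^sup>2)"
  proof (rule integrable_cong_AE_imp[OF L2D(2)[OF u]])
    show "AE x in M. (norm (u x))\<^sup>2 = (norm (u' x))\<^sup>2" using u'(2) by eventually_elim simp
  qed (use u'M in measurable)
  then have u'L: "u' \<in> L2 \<Omega>" using u'M by (simp add: L2_def)
  have eq: "integral\<^sup>L M (\<lambda>x. u' x * h x) = integral\<^sup>L M (\<lambda>x. u x * h x)" if "h \<in> borel_measurable M" for h
  proof (rule integral_cong_AE)
    show "AE x in M. u' x * h x = u x * h x" using u'(2) by eventually_elim simp
  qed (use uM u'M that in \<open>auto intro!: borel_measurable_times\<close>)
  have "is_weak_grad \<Omega> u' g"
    using g(2) eq[OF test_functions_lebesgue_measurable[OF test_functions_partial_deriv]]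
    by (simp add: is_weak_grad_def)
  note P = Poincare_borel[OF u'(1) u'L g(1) this \<delta>]
  have "mass \<Omega> u' u' = mass \<Omega> u u"
    unfolding mass_def
  proof (rule integral_cong_AE)
    show "AE x in M. u' x * u' x = u x * u x" using u'(2) by eventually_elim simp
  qed (use uM u'M in \<open>auto intro!: borel_measurable_times\<close>)
  moreover have "integral\<^sup>L M u' = integral\<^sup>L M u" using eq[of "\<lambda>_. 1"] by simp
  ultimately show ?thesis using P by simp
qed

section \<open>Localisation to grid cells and compactness\<close>

lemma is_weak_grad_restrict:
  assumes K: "K \<subseteq> \<Omega>" "open K" and w: "is_weak_grad \<Omega> u g"
  shows "is_weak_grad K u g"
  unfolding is_weak_grad_def
proof (intro ballI allI)
  fix \<phi> i assume \<phi>: "\<phi> \<in> test_functions K"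
  then have \<phi>': "\<phi> \<in> test_functions \<Omega>" using test_functions_mono[OF K(1)] by blast
  have Ks: "K \<in> sets lebesgue" using K by simp
  note z1 = test_functions_eq_0[OF test_functions_partial_deriv[OF \<phi>, of i]] test_functions_eq_0[OF \<phi>]
  have "integral\<^sup>L (lebesgue_on K) (\<lambda>x. u x * partial_deriv i \<phi> x) = integral\<^sup>L M (\<lambda>x. u x * partial_deriv i \<phi> x)"
    using z1 K by (subst (1 2) integral_lebesgue_on_eq) (auto simp: Ks sets_lebesgue)
  moreover have "integral\<^sup>L (lebesgue_on K) (\<lambda>x. g x $ i * \<phi> x) = integral\<^sup>L M (\<lambda>x. g x $ i * \<phi> x)"
    using z1 K by (subst (1 2) integral_lebesgue_on_eq) (auto simp: Ks sets_lebesgue)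
  ultimately show "integral\<^sup>L (lebesgue_on K) (\<lambda>x. u x * partial_deriv i \<phi> x) = - integral\<^sup>L (lebesgue_on K) (\<lambda>x. g x $ i * \<phi> x)"
    using w \<phi>' by (simp add: is_weak_grad_def)
qed

text \<open>Intersecting with open cubes of side \<open>1 / Suc k\<close> keeps the pieces convex,
  also those at the boundary of \<Omega>, and lets their diameters shrink uniformly.\<close>

definition cell :: "nat \<Rightarrow> ('n \<Rightarrow> int) \<Rightarrow> (real^'n) set" where
  "cell k z = \<Omega> \<inter> box (\<chi> i. z i / Suc k) (\<chi> i. (z i + 1) / Suc k)"

lemma cell_subset: "cell k z \<subseteq> \<Omega>" and cell_open: "open (cell k z)"
  using op by (auto simp: cell_def)

lemma cell_convex_open: "convex_open (cell k z)"
proof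
  show "bounded (cell k z)" using bd by (rule bounded_subset[OF _ cell_subset])
  show "convex (cell k z)" unfolding cell_def by (intro convex_Int cv convex_box)
qed (rule cell_open)

lemma cell_diameter:
  assumes "x \<in> cell k z" "y \<in> cell k z"
  shows "norm (x - y) \<le> CARD('n) / Suc k"
proof -
  have "\<bar>(x - y) $ i\<bar> \<le> 1 / Suc k" for i
  proof -
    have "z i / Suc k < x $ i" "x $ i < (z i + 1) / Suc k" "z i / Suc k < y $ i" "y $ i < (z i + 1) / Suc k"
      using assms by (auto simp: cell_def mem_box_cart)
    moreover have "(z i + 1) / Suc k = z i / Suc k + 1 / Suc k" by (simp add: add_divide_distrib)
    ultimately show ?thesis by (simp only: vector_minus_component)
  qed
  then have "(\<Sum>i\<in>UNIV. \<bar>(x - y) $ i\<bar>) \<le> (\<Sum>i\<in>(UNIV :: 'n set). 1 / Suc k)" by (rule sum_mono)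
  then show ?thesis using norm_le_l1_cart[of "x - y"] by simp
qed

text \<open>Off the countably many grid hyperplanes, a null set, every point lies in exactly one
  open cell, and boundedness of \<Omega> leaves finitely many indices.\<close>

lemma cells_finite_cover:
  obtains Z where "finite Z"
    "AE x in M. \<exists>z\<in>Z. x \<in> cell k z \<and> (\<forall>z'. x \<in> cell k z' \<longrightarrow> z' = z)"
proof -
  obtain R where R: "\<And>x. x \<in> \<Omega> \<Longrightarrow> norm x \<le> R" using bd by (auto simp: bounded_iff)
  define c where "c = \<lceil>R * Suc k\<rceil> + 1"
  define Z where "Z = PiE (UNIV :: 'n set) (\<lambda>_. {-c..c})"
  define N where "N = (\<Union>i\<in>UNIV. \<Union>m :: int. {x :: real^'n. x $ i = m / Suc k})"
  show thesis
  proof (rule that)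
    show "finite Z" unfolding Z_def by (intro finite_PiE) auto
    show "AE x in M. \<exists>z\<in>Z. x \<in> cell k z \<and> (\<forall>z'. x \<in> cell k z' \<longrightarrow> z' = z)"
    proof (rule AE_lebesgue_onI[OF _ sets_lebesgue])
      show "negligible N" unfolding N_def
        unfolding negligible_iff_null_sets
        by (intro null_sets_UN' null_sets_UN)
          (auto simp: cart_eq_inner_axis inner_commute simp flip: negligible_iff_null_sets
            intro!: negligible_hyperplane disjI1)
      fix x assume x: "x \<in> \<Omega>" "x \<notin> N"
      define z where "z i = \<lfloor>x $ i * Suc k\<rfloor>" for i
      have zl: "z i / Suc k < x $ i" "x $ i < (z i + 1) / Suc k" for i
      proof -
        have "of_int (z i) \<le> x $ i * Suc k" by (simp add: z_def)
        then have "z i / Suc k \<le> x $ i" by (simp add: pos_divide_le_eq)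
        moreover have "x $ i \<noteq> z i / Suc k" using x(2) by (auto simp: N_def)
        ultimately show "z i / Suc k < x $ i" by simp
        have "x $ i * Suc k < of_int (z i) + 1" unfolding z_def by linarith
        then show "x $ i < (z i + 1) / Suc k" by (simp add: pos_less_divide_eq)
      qed
      have "z i \<in> {-c..c}" for i
      proof -
        have "\<bar>x $ i\<bar> \<le> R" using component_le_norm_cart[of x i] R[OF x(1)] by linarith
        then have "\<bar>x $ i * Suc k\<bar> \<le> R * Suc k" by (simp add: abs_mult mult_right_mono)
        then have "x $ i * Suc k \<le> R * Suc k" "- (R * Suc k) \<le> x $ i * Suc k" by (auto simp: abs_le_iff)
        then show ?thesis unfolding z_def c_def by (simp only: atLeastAtMost_iff) linarith
      qed
      then have "z \<in> Z" by (auto simp: Z_def)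
      moreover have "x \<in> cell k z" using x(1) zl by (simp add: cell_def mem_box_cart)
      moreover have "z' = z" if "x \<in> cell k z'" for z'
      proof
        fix i
        have "z' i / Suc k < x $ i" "x $ i < (z' i + 1) / Suc k" using that by (auto simp: cell_def mem_box_cart)
        then have "z' i < x $ i * Suc k" "x $ i * Suc k < z' i + 1"
          by (simp_all add: pos_divide_less_eq pos_less_divide_eq)
        then show "z' i = z i" unfolding z_def by linarith
      qed
      ultimately show "\<exists>z\<in>Z. x \<in> cell k z \<and> (\<forall>z'. x \<in> cell k z' \<longrightarrow> z' = z)" by blast
    qed
  qed
qed

lemma integral_cell:
  fixes f :: "real^'n \<Rightarrow> real"
  shows "integral\<^sup>L (lebesgue_on (cell k z)) f = integral\<^sup>L M (\<lambda>x. indicator (cell k z) x * f x)"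
proof -
  have c: "cell k z \<in> sets lebesgue" using cell_open by simp
  have "integral\<^sup>L (lebesgue_on (cell k z)) f = integral\<^sup>L lebesgue (\<lambda>x. indicator (cell k z) x * f x)"
    using c by (subst integral_restrict_space) auto
  also have "\<dots> = integral\<^sup>L M (\<lambda>x. indicator (cell k z) x * f x)"
    using cell_subset by (subst integral_lebesgue_on_eq[OF sets_lebesgue]) (auto simp: indicator_def)
  finally show ?thesis .
qed

lemma integrable_cell:
  fixes f :: "real^'n \<Rightarrow> real"
  assumes "integrable M f"
  shows "integrable M (\<lambda>x. indicator (cell k z) x * f x)"
proof -
  have "cell k z \<in> sets M" using cell_open[of k z] cell_subset[of k z] sets_lebesgue by (auto simp: sets_restrict_space_iff)
  from integrable_mult_indicator[OF this assms] show ?thesis by simp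
qed

lemma integral_sum_cells:
  fixes f :: "real^'n \<Rightarrow> real"
  assumes f: "integrable M f" and Z: "finite Z"
    "AE x in M. \<exists>z\<in>Z. x \<in> cell k z \<and> (\<forall>z'. x \<in> cell k z' \<longrightarrow> z' = z)"
  shows "integral\<^sup>L M f = (\<Sum>z\<in>Z. integral\<^sup>L (lebesgue_on (cell k z)) f)"
proof -
  have "AE x in M. f x = (\<Sum>z\<in>Z. indicator (cell k z) x * f x)"
    using Z(2)
  proof eventually_elim
    case (elim x)
    then obtain z where z: "z \<in> Z" "x \<in> cell k z" "\<And>z'. x \<in> cell k z' \<Longrightarrow> z' = z" by blast
    have "indicator (cell k z') x * f x = 0" if "z' \<in> Z - {z}" for z'
    proof -
      have "x \<notin> cell k z'" using z(3)[of z'] that by blast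
      then show ?thesis by simp
    qed
    then have "(\<Sum>z\<in>Z. indicator (cell k z) x * f x) = (\<Sum>z'\<in>{z}. indicator (cell k z') x * f x)"
      using Z(1) z(1) by (intro sum.mono_neutral_right) simp_all
    then show ?case using z(2) by simp
  qed
  then have "integral\<^sup>L M f = integral\<^sup>L M (\<lambda>x. \<Sum>z\<in>Z. indicator (cell k z) x * f x)"
    using f integrable_cell[OF f] by (intro integral_cong_AE borel_measurable_sum) auto
  also have "\<dots> = (\<Sum>z\<in>Z. integral\<^sup>L (lebesgue_on (cell k z)) f)"
    using integrable_cell[OF f] by (simp add: integral_cell)
  finally show ?thesis .
qed

text \<open>The energy is multiplied by the square of the diameter bound, so refining the grid makes
  the gradient term small and leaves finitely many cell integrals to control.\<close>

lemma mass_le_cells: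
  assumes Z: "finite Z" "AE x in M. \<exists>z\<in>Z. x \<in> cell k z \<and> (\<forall>z'. x \<in> cell k z' \<longrightarrow> z' = z)"
    and u: "u \<in> H1 \<Omega>"
  shows "mass \<Omega> u u \<le> (\<Sum>z\<in>Z. (integral\<^sup>L (lebesgue_on (cell k z)) u)\<^sup>2 / vol (cell k z))
     + 2 * (2 ^ CARD('n) * (CARD('n) / Suc k))\<^sup>2 * energy \<Omega> u u"
proof -
  define C where "C = 2 * (2 ^ CARD('n) * (real CARD('n) / real (Suc k)))\<^sup>2"
  have C0: "C \<ge> 0" by (simp add: C_def)
  let ?g = "weak_grad \<Omega> u"
  let ?G = "\<lambda>z. integral\<^sup>L (lebesgue_on (cell k z)) (\<lambda>x. (norm (?g x))\<^sup>2)"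
  have uL: "u \<in> L2 \<Omega>" by (rule H1_L2[OF u])
  note g = weak_grad[OF u]
  have cellm: "mass (cell k z) u u \<le> (integral\<^sup>L (lebesgue_on (cell k z)) u)\<^sup>2 / vol (cell k z) + C * ?G z" for z
  \<comment> \<open>A null cell carries no mass, and its quotient by the volume is 0 by
    convention.\<close>
  proof (cases "vol (cell k z) = 0")
    case True
    interpret K: convex_open "cell k z" by (rule cell_convex_open)
    have "negligible (cell k z)" using True K.lm negligible_iff_measure0 by blast
    then have "AE x in lebesgue_on (cell k z). u x * u x = 0"
      using K.sets_lebesgue by (rule AE_lebesgue_onI) simp
    then have "mass (cell k z) u u = 0" unfolding mass_def by (rule integral_eq_zero_AE)
    then show ?thesis using True C0 by simp
  next
    case False
    then have V: "vol (cell k z) > 0" using measure_nonneg[of lebesgue "cell k z"] by linarith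
    interpret K: convex_open "cell k z" by (rule cell_convex_open)
    have "vol (cell k z) * mass (cell k z) u u \<le> (integral\<^sup>L (lebesgue_on (cell k z)) u)\<^sup>2
       + 2 * vol (cell k z) * (2 ^ CARD('n) * (real CARD('n) / real (Suc k)))\<^sup>2 * ?G z"
      by (rule K.Poincare[OF L2_restrict[OF uL cell_subset K.sets_lebesgue]
            L2_restrict[OF g(1) cell_subset K.sets_lebesgue]
            is_weak_grad_restrict[OF cell_subset cell_open g(2)] cell_diameter])
    also have "\<dots> = vol (cell k z) * ((integral\<^sup>L (lebesgue_on (cell k z)) u)\<^sup>2 / vol (cell k z) + C * ?G z)"
      using V by (simp add: C_def distrib_left)
    finally show ?thesis using V by simp
  qed
  have "mass \<Omega> u u = (\<Sum>z\<in>Z. mass (cell k z) u u)"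
    unfolding mass_def by (rule integral_sum_cells[OF L2_mult[OF uL uL] Z])
  also have "\<dots> \<le> (\<Sum>z\<in>Z. (integral\<^sup>L (lebesgue_on (cell k z)) u)\<^sup>2 / vol (cell k z) + C * ?G z)"
    by (rule sum_mono) (rule cellm)
  also have "\<dots> = (\<Sum>z\<in>Z. (integral\<^sup>L (lebesgue_on (cell k z)) u)\<^sup>2 / vol (cell k z)) + C * (\<Sum>z\<in>Z. ?G z)"
    by (simp add: sum.distrib sum_distrib_left)
  also have "(\<Sum>z\<in>Z. ?G z) = energy \<Omega> u u"
    unfolding energy_square by (rule integral_sum_cells[OF L2D(2)[OF g(1)] Z, symmetric])
  finally show ?thesis by (simp add: C_def)
qed

text \<open>Rellich's theorem: by the Poincare inequality on the cells, the cell averages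
  determine an element of a bounded subset of \<open>H1\<close> up to a small error in \<open>L2\<close>.\<close>

theorem Rellich:
  assumes f: "\<And>n. f n \<in> H1 \<Omega>" and C: "\<And>n. energy \<Omega> (f n) (f n) + mass \<Omega> (f n) (f n) \<le> C"
  shows "\<exists>r. strict_mono (r :: nat \<Rightarrow> nat) \<and> (\<forall>e>0. \<exists>N. \<forall>m\<ge>N. \<forall>n\<ge>N.
         mass \<Omega> (\<lambda>x. f (r m) x - f (r n) x) (\<lambda>x. f (r m) x - f (r n) x) < e)"
proof -
  have fL: "f n \<in> L2 \<Omega>" for n by (rule H1_L2[OF f])
  define avg where "avg n p = integral\<^sup>L (lebesgue_on (cell (fst p) (snd p))) (f n)" for n p
  have bound: "norm (avg n p) \<le> vol \<Omega> + C" for n p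
  proof -
    obtain k z where p: "p = (k, z)" by (cases p)
    have "norm (avg n p) = \<bar>integral\<^sup>L M (\<lambda>x. indicator (cell k z) x * f n x)\<bar>"
      by (simp add: avg_def p integral_cell)
    also have "\<dots> \<le> integral\<^sup>L M (\<lambda>x. \<bar>indicator (cell k z) x * f n x\<bar>)" by (rule integral_abs_bound)
    also have "\<dots> \<le> integral\<^sup>L M (\<lambda>x. 1 + (norm (f n x))\<^sup>2)"
    proof (rule integral_mono')
      show "integrable M (\<lambda>x. 1 + (norm (f n x))\<^sup>2)"
        using L2D(2)[OF fL] by (intro Bochner_Integration.integrable_add) auto
      fix x
      have "\<bar>f n x\<bar> \<le> 1 + (norm (f n x))\<^sup>2"
        using sum_squares_bound[of "\<bar>f n x\<bar>" 1, simplified] abs_ge_zero[of "f n x"] by simp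
      then show "\<bar>indicator (cell k z) x * f n x\<bar> \<le> 1 + (norm (f n x))\<^sup>2" by (auto simp: indicator_def)
    qed auto
    also have "\<dots> = vol \<Omega> + mass \<Omega> (f n) (f n)"
      using L2D(2)[OF fL, of n] sets_lebesgue by (simp add: mass_square measure_restrict_space)
    also have "\<dots> \<le> vol \<Omega> + C" using C[of n] E.nonneg[OF f, of n] by simp
    finally show ?thesis .
  qed
  \<comment> \<open>A diagonal argument over the countable set of all pairs of mesh and cell; the
    subsequence is thus fixed before \<open>e\<close> and the mesh are chosen.\<close>
  obtain r where r: "strict_mono (r :: nat \<Rightarrow> nat)" "\<And>p. \<exists>l. (\<lambda>n. avg (r n) p) \<longlonglongrightarrow> l"
    using function_convergent_subsequence[of "UNIV :: (nat \<times> ('n \<Rightarrow> int)) set" avg "vol \<Omega> + C"] bound by auto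
  have "\<exists>N. \<forall>m\<ge>N. \<forall>n\<ge>N. mass \<Omega> (\<lambda>x. f (r m) x - f (r n) x) (\<lambda>x. f (r m) x - f (r n) x) < e" if e: "e > 0" for e
  proof -
    define d where "d = real CARD('n)"
    \<comment> \<open>\<open>4 * C\<close> bounds the energy of a difference of two members. The
      mesh index \<open>k\<close> is then taken so large that the gradient term is at most
      \<open>e / 2\<close>.\<close>
    define K where "K = 2 * (2 ^ CARD('n) * d)\<^sup>2 * (4 * C)"
    obtain k :: nat where k: "2 * K / e < k" using reals_Archimedean2 by blast
    have C0: "C \<ge> 0" using C[of 0] N.nonneg[OF f, of 0] by simp
    have K0: "K \<ge> 0" using C0 by (simp add: K_def)
    have small: "2 * (2 ^ CARD('n) * (CARD('n) / Suc k))\<^sup>2 * (4 * C) \<le> e / 2"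
    proof -
      have "2 * (2 ^ CARD('n) * (CARD('n) / Suc k))\<^sup>2 * (4 * C) = K / (real (Suc k))\<^sup>2"
        by (simp add: K_def d_def power_divide power_mult_distrib)
      also have "\<dots> \<le> K / real (Suc k)"
      proof (rule divide_left_mono[OF _ K0])
        show "real (Suc k) \<le> (real (Suc k))\<^sup>2" by (simp add: power2_eq_square)
      qed simp
      also have "\<dots> \<le> e / 2"
      proof -
        have "2 * K / e < Suc k" using k by simp
        then have "2 * K < e * Suc k" using e by (simp add: pos_divide_less_eq mult.commute)
        then show ?thesis by (simp add: divide_le_eq)
      qed
      finally show ?thesis .
    qed
    obtain Z where Z: "finite Z" "AE x in M. \<exists>z\<in>Z. x \<in> cell k z \<and> (\<forall>z'. x \<in> cell k z' \<longrightarrow> z' = z)"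
      using cells_finite_cover by blast
    have "\<forall>p. \<exists>l. (\<lambda>n. avg (r n) p) \<longlonglongrightarrow> l" using r(2) by blast
    then obtain l where l: "\<And>p. (\<lambda>n. avg (r n) p) \<longlonglongrightarrow> l p" by metis
    define A where "A n = (\<Sum>z\<in>Z. (avg (r n) (k, z) - l (k, z))\<^sup>2 / vol (cell k z))" for n
    have "A \<longlonglongrightarrow> (\<Sum>z\<in>Z. (l (k, z) - l (k, z))\<^sup>2 * inverse (vol (cell k z)))"
      unfolding A_def[abs_def] divide_inverse
      by (intro tendsto_sum tendsto_mult tendsto_power tendsto_diff l tendsto_const)
    then have "A \<longlonglongrightarrow> 0" by simp
    \<comment> \<open>With this bound \<open>2 * A m + 2 * A n\<close> stays below the remaining
      \<open>e / 2\<close>.\<close>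
    then have "\<forall>\<^sub>F n in sequentially. A n < e / 8" using e by (intro order_tendstoD) auto
    then obtain N where N: "\<And>n. n \<ge> N \<Longrightarrow> A n < e / 8" by (auto simp: eventually_sequentially)
    show ?thesis
    proof (intro exI allI impI)
      fix m n assume m: "m \<ge> N" and n: "n \<ge> N"
      define w where "w x = f (r m) x - f (r n) x" for x
      have w: "w \<in> H1 \<Omega>" unfolding w_def[abs_def] by (intro E.diff_in f)
      have "energy \<Omega> w w \<le> 2 * energy \<Omega> (f (r m)) (f (r m)) + 2 * energy \<Omega> (f (r n)) (f (r n))"
        unfolding w_def[abs_def] by (rule E.diff_square_le[OF f f])
      also have "\<dots> \<le> 4 * C"
        using C[of "r m"] C[of "r n"] MH.nonneg[OF f, of "r m"] MH.nonneg[OF f, of "r n"] by simp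
      finally have Ew: "energy \<Omega> w w \<le> 4 * C" .
      have avgw: "integral\<^sup>L (lebesgue_on (cell k z)) w = avg (r m) (k, z) - avg (r n) (k, z)" for z
      proof -
        interpret K: convex_open "cell k z" by (rule cell_convex_open)
        have "integrable (lebesgue_on (cell k z)) (f n)" for n
          by (intro K.L2_integrable L2_restrict[OF fL cell_subset] K.sets_lebesgue)
        then show ?thesis by (simp add: w_def[abs_def] avg_def)
      qed
      have "mass \<Omega> w w \<le> (\<Sum>z\<in>Z. (integral\<^sup>L (lebesgue_on (cell k z)) w)\<^sup>2 / vol (cell k z))
         + 2 * (2 ^ CARD('n) * (CARD('n) / Suc k))\<^sup>2 * energy \<Omega> w w"
        by (rule mass_le_cells[OF Z w])
      also have "(\<Sum>z\<in>Z. (integral\<^sup>L (lebesgue_on (cell k z)) w)\<^sup>2 / vol (cell k z)) \<le> 2 * A m + 2 * A n"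
        unfolding A_def sum_distrib_left sum.distrib[symmetric]
      proof (rule sum_mono)
        fix z
        have "(integral\<^sup>L (lebesgue_on (cell k z)) w)\<^sup>2 \<le> 2 * (avg (r m) (k, z) - l (k, z))\<^sup>2 + 2 * (avg (r n) (k, z) - l (k, z))\<^sup>2"
          using square_sum_le[of "avg (r m) (k, z) - l (k, z)" "l (k, z) - avg (r n) (k, z)"]
          by (simp add: avgw power2_commute)
        then have "(integral\<^sup>L (lebesgue_on (cell k z)) w)\<^sup>2 / vol (cell k z) \<le>
           (2 * (avg (r m) (k, z) - l (k, z))\<^sup>2 + 2 * (avg (r n) (k, z) - l (k, z))\<^sup>2) / vol (cell k z)"
          by (intro divide_right_mono) auto
        then show "(integral\<^sup>L (lebesgue_on (cell k z)) w)\<^sup>2 / vol (cell k z) \<le>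
           2 * ((avg (r m) (k, z) - l (k, z))\<^sup>2 / vol (cell k z)) + 2 * ((avg (r n) (k, z) - l (k, z))\<^sup>2 / vol (cell k z))"
          by (simp add: add_divide_distrib)
      qed
      also have "2 * (2 ^ CARD('n) * (CARD('n) / Suc k))\<^sup>2 * energy \<Omega> w w \<le> 2 * (2 ^ CARD('n) * (CARD('n) / Suc k))\<^sup>2 * (4 * C)"
        by (intro mult_left_mono Ew) auto
      also note small
      finally have "mass \<Omega> w w \<le> 2 * A m + 2 * A n + e / 2" by simp
      then have "mass \<Omega> w w < e" using N[OF m] N[OF n] by simp
      then show "mass \<Omega> (\<lambda>x. f (r m) x - f (r n) x) (\<lambda>x. f (r m) x - f (r n) x) < e"
        by (simp only: w_def[abs_def])
    qed
  qed
  then show ?thesis using r(1) by blast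
qed

end

section \<open>Existence and trace principle for the eigenvalues\<close>

text \<open>Gaussian elimination: a pivot \<open>p\<close> removes the last equation and one
  unknown. It is stated for coefficients because the functions they belong to are identified only
  almost everywhere.\<close>

lemma underdetermined_system:
  fixes c :: "'i \<Rightarrow> nat \<Rightarrow> real"
  assumes "finite I" "m < card I"
  shows "\<exists>d. (\<exists>i\<in>I. d i \<noteq> 0) \<and> (\<forall>j<m. (\<Sum>i\<in>I. d i * c i j) = 0)"
  using assms
proof (induction m arbitrary: I c)
  case 0
  then have "I \<noteq> {}" by auto
  then show ?case by (intro exI[of _ "\<lambda>_. 1"]) auto
next
  case (Suc m)
  show ?case
  proof (cases "\<forall>i\<in>I. c i m = 0")
    case True
    obtain d where d: "\<exists>i\<in>I. d i \<noteq> 0" "\<forall>j<m. (\<Sum>i\<in>I. d i * c i j) = 0"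
      using Suc.IH[of I c] Suc.prems by auto
    have "(\<Sum>i\<in>I. d i * c i j) = 0" if "j < Suc m" for j
      using that d(2) True by (cases "j = m") auto
    then show ?thesis using d(1) by blast
  next
    case False
    then obtain p where p: "p \<in> I" "c p m \<noteq> 0" by blast
    define I' where "I' = I - {p}"
    have I': "finite I'" "p \<notin> I'" "I = insert p I'" "m < card I'"
      using Suc.prems p by (auto simp: I'_def)
    define c' where "c' i j = c i j - c i m / c p m * c p j" for i j
    obtain d where d: "\<exists>i\<in>I'. d i \<noteq> 0" "\<And>j. j < m \<Longrightarrow> (\<Sum>i\<in>I'. d i * c' i j) = 0"
      using Suc.IH[OF I'(1,4), of c'] by blast
    \<comment> \<open>The coefficient at \<open>p\<close> is dictated by the last equation.\<close>
    define s where "s = (\<Sum>i\<in>I'. d i * c i m) / c p m"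
    define d' where "d' i = (if i = p then - s else d i)" for i
    have sum: "(\<Sum>i\<in>I. d' i * c i j) = (\<Sum>i\<in>I'. d i * c i j) - s * c p j" for j
    proof -
      have "(\<Sum>i\<in>I'. d' i * c i j) = (\<Sum>i\<in>I'. d i * c i j)"
        using I'(2) by (intro sum.cong) (auto simp: d'_def)
      then show ?thesis using I'(1,2) by (simp add: I'(3) d'_def)
    qed
    have "(\<Sum>i\<in>I. d' i * c i j) = 0" if "j < Suc m" for j
    proof (cases "j = m")
      case True
      then show ?thesis using p by (simp add: sum s_def)
    next
      case False
      then have "0 = (\<Sum>i\<in>I'. d i * c' i j)" using d(2)[of j] that by simp
      also have "\<dots> = (\<Sum>i\<in>I'. d i * c i j) - s * c p j"
        by (simp add: c'_def s_def right_diff_distrib sum_subtractf sum_distrib_right sum_divide_distrib mult.assoc)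
      finally show ?thesis by (simp add: sum)
    qed
    moreover have "\<exists>i\<in>I. d' i \<noteq> 0" using d(1) I'(2,3) by (auto simp: d'_def)
    ultimately show ?thesis by blast
  qed
qed

lemma has_dim_AE_le:
  assumes m: "has_dim_AE \<Omega> E m" and m': "has_dim_AE \<Omega> E m'"
  shows "m' \<le> m"
proof (rule ccontr)
  assume "\<not> m' \<le> m"
  then have lt: "m < card {..<m'}" by simp
  let ?M = "lebesgue_on \<Omega>"
  obtain b where b: "\<And>u. u \<in> E \<Longrightarrow> \<exists>c. AE x in ?M. u x = (\<Sum>i<m. c i * b i x)"
    using m unfolding has_dim_AE_def by blast
  obtain b' where b': "\<And>i. i < m' \<Longrightarrow> b' i \<in> E"
    "\<And>c. (AE x in ?M. (\<Sum>i<m'. c i * b' i x) = 0) \<Longrightarrow> (\<forall>i<m'. c i = 0)"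
    using m' unfolding has_dim_AE_def by blast
  have "\<forall>i. \<exists>c. i < m' \<longrightarrow> (AE x in ?M. b' i x = (\<Sum>j<m. c j * b j x))"
    using b[OF b'(1)] by blast
  then obtain c where c: "\<And>i. i < m' \<Longrightarrow> AE x in ?M. b' i x = (\<Sum>j<m. c i j * b j x)" by metis
  obtain d where d: "\<exists>i\<in>{..<m'}. d i \<noteq> 0" "\<forall>j<m. (\<Sum>i<m'. d i * c i j) = 0"
    using underdetermined_system[OF _ lt, of c] by auto
  have "AE x in ?M. \<forall>i\<in>{..<m'}. b' i x = (\<Sum>j<m. c i j * b j x)"
    by (rule AE_finite_allI) (auto intro: c)
  then have "AE x in ?M. (\<Sum>i<m'. d i * b' i x) = 0"
  proof eventually_elim
    case (elim x)
    then have "(\<Sum>i<m'. d i * b' i x) = (\<Sum>i<m'. \<Sum>j<m. d i * c i j * b j x)"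
      by (simp add: sum_distrib_left mult.assoc)
    also have "\<dots> = (\<Sum>j<m. (\<Sum>i<m'. d i * c i j) * b j x)"
      by (subst sum.swap) (simp add: sum_distrib_right)
    finally show ?case using d(2) by simp
  qed
  from b'(2)[OF this] show False using d(1) by auto
qed

lemma has_dim_AE_unique: "has_dim_AE \<Omega> E m \<Longrightarrow> has_dim_AE \<Omega> E m' \<Longrightarrow> m = m'"
  using has_dim_AE_le by (metis le_antisym)

text \<open>At the first disagreement, say \<open>l k < l' k\<close>, the value \<open>l k\<close>
  is attained by \<open>l'\<close> only at indices below \<open>k\<close>, where both sequences
  agree, but by \<open>l\<close> at \<open>k\<close> as well; the fibres then differ in
  size.\<close>

lemma mono_eqI_card_fibers:
  fixes l l' :: "nat \<Rightarrow> real"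
  assumes "mono l" "mono l'" and fin: "\<And>t. finite {j. l j = t}" "\<And>t. finite {j. l' j = t}"
    and card: "\<And>t. card {j. l j = t} = card {j. l' j = t}"
  shows "l = l'"
proof
  fix k
  have lt: "\<not> l k < l' k"
    if ml': "mono l'" and fin: "\<And>t. finite {j. l j = t}"
      and card: "\<And>t. card {j. l j = t} = card {j. l' j = t}" and IH: "\<And>i. i < k \<Longrightarrow> l i = l' i"
    for l l' :: "nat \<Rightarrow> real" and k
  proof
    assume lt: "l k < l' k"
    have "{j. l' j = l k} \<subset> {j. l j = l k}"
    proof
      show "{j. l' j = l k} \<subseteq> {j. l j = l k}"
      proof
        fix j assume "j \<in> {j. l' j = l k}"
        then have j: "l' j = l k" by simp
        then have "j < k" using lt monoD[OF ml', of k j] by (cases "j < k") auto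
        then show "j \<in> {j. l j = l k}" using IH[of j] j by simp
      qed
      show "{j. l' j = l k} \<noteq> {j. l j = l k}"
      proof
        assume eq: "{j. l' j = l k} = {j. l j = l k}"
        have "k \<in> {j. l' j = l k}" unfolding eq by simp
        then show False using lt by simp
      qed
    qed
    from psubset_card_mono[OF fin this] show False using card[of "l k"] by simp
  qed
  show "l k = l' k"
  proof (induction k rule: less_induct)
    case (less k)
    have "\<not> l k < l' k" by (rule lt[OF assms(2) fin(1) card less])
    moreover have "\<not> l' k < l k" by (rule lt[OF assms(1) fin(2) card[symmetric] less[symmetric]])
    ultimately show ?case by simp
  qed
qed

text \<open>What the spectral argument needs of a form domain, so that Dirichlet and Neumann
  conditions are treated together: test functions make it infinite-dimensional, and closedness in
  \<open>H1\<close> makes it complete.\<close>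

locale form_domain = convex_open \<Omega> for \<Omega> :: "(real^'n::finite) set" +
  fixes W :: "(real^'n \<Rightarrow> real) set"
  assumes ne: "\<Omega> \<noteq> {}"
    and W_H1: "W \<subseteq> H1 \<Omega>" and test_W: "test_functions \<Omega> \<subseteq> W"
    and W_lin: "u \<in> W \<Longrightarrow> v \<in> W \<Longrightarrow> (\<lambda>x. u x + c * v x) \<in> W"
    and W_closed: "(\<And>n. f n \<in> W) \<Longrightarrow> u \<in> H1 \<Omega> \<Longrightarrow>
       (\<lambda>n. energy \<Omega> (\<lambda>x. f n x - u x) (\<lambda>x. f n x - u x)) \<longlonglongrightarrow> 0 \<Longrightarrow>
       (\<lambda>n. mass \<Omega> (\<lambda>x. f n x - u x) (\<lambda>x. f n x - u x)) \<longlonglongrightarrow> 0 \<Longrightarrow> u \<in> W"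

lemma (in convex_open) form_domain_H1: "\<Omega> \<noteq> {} \<Longrightarrow> form_domain \<Omega> (H1 \<Omega>)"
  by unfold_locales (auto intro: test_H1 H1_lin)

lemma (in convex_open) form_domain_H10: "\<Omega> \<noteq> {} \<Longrightarrow> form_domain \<Omega> (H10 \<Omega>)"
  by unfold_locales (auto intro: test_H10 H10_lin H10_closed dest: H10_H1[THEN subsetD])

context form_domain
begin

lemma W_0: "(\<lambda>x. 0) \<in> W"
  using test_W test_functions_0 by blast

lemma AE_0_if_mass_0:
  assumes "u \<in> L2 \<Omega>" "mass \<Omega> u u = 0"
  shows "AE x in M. u x = 0"
  using integral_nonneg_eq_0_iff_AE[OF L2_mult[OF assms(1,1)]] assms(2) by (simp add: mass_def)

text \<open>Bumps on \<open>n\<close> disjoint slices of a box inside \<Omega>, cut along one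
  arbitrary coordinate, are orthogonal and can be normalised.\<close>

lemma ex_disjoint_tests:
  "\<exists>v. \<forall>i<(n::nat). v i \<in> test_functions \<Omega> \<and> (\<forall>j<n. mass \<Omega> (v i) (v j) = of_bool (i = j))"
proof -
  obtain x0 where "x0 \<in> \<Omega>" using ne by blast
  obtain p q where "cbox p q \<subseteq> \<Omega>" "x0 \<in> box p q"
    using open_contains_cbox[OF op \<open>x0 \<in> \<Omega>\<close>] by metis
  then have pq: "x0 \<in> box p q" "cbox p q \<subseteq> \<Omega>" by simp_all
  obtain i0 :: 'n where True by simp
  \<comment> \<open>The divisor \<open>Suc n\<close> leaves room for \<open>n\<close> slices and
    stays nonzero for \<open>n = 0\<close>.\<close>
  define h where "h = (q $ i0 - p $ i0) / Suc n"
  have pq_less: "p $ i < q $ i" for i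
  proof -
    have "p $ i < x0 $ i" "x0 $ i < q $ i" using pq(1) by (auto simp: mem_box_cart)
    then show ?thesis by linarith
  qed
  have h: "h > 0" using pq_less[of i0] by (simp add: h_def)
  define a where "a j = (\<chi> i. if i = i0 then p $ i0 + real j * h else p $ i)" for j :: nat
  define b where "b j = (\<chi> i. if i = i0 then p $ i0 + real (Suc j) * h else q $ i)" for j :: nat
  have sub: "cbox (a j) (b j) \<subseteq> \<Omega>" if "j < n" for j
  proof -
    have "real (Suc j) * h \<le> real (Suc n) * h" using that h by (intro mult_right_mono) auto
    also have "\<dots> = q $ i0 - p $ i0" by (simp add: h_def)
    finally have "b j $ i \<le> q $ i" for i by (simp add: b_def)
    moreover have "p $ i \<le> a j $ i" for i using h by (simp add: a_def)
    ultimately have "cbox (a j) (b j) \<subseteq> cbox p q"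
      unfolding subset_iff mem_box_cart by (meson order_trans)
    then show ?thesis using pq(2) by blast
  qed
  have nonempty: "box (a j) (b j) \<noteq> {}" if "j < n" for j
  proof -
    have "a j $ i < b j $ i" for i
      using pq_less[of i] h by (cases "i = i0") (simp_all add: a_def b_def distrib_right)
    then show ?thesis by (simp add: interval_ne_empty_cart)
  qed
  define \<phi> where "\<phi> j = bump (a j) (b j) 1" for j
  have \<phi>T: "\<phi> j \<in> test_functions \<Omega>" if "j < n" for j
    unfolding \<phi>_def by (rule bump_test[OF sub[OF that]]) simp
  have pos: "mass \<Omega> (\<phi> j) (\<phi> j) > 0" if j: "j < n" for j
  proof (rule ccontr)
    assume "\<not> ?thesis"
    then have "mass \<Omega> (\<phi> j) (\<phi> j) = 0" using L.nonneg[OF test_L2[OF \<phi>T[OF j]]] by simp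
    then have "AE x in M. \<phi> j x = 0" by (rule AE_0_if_mass_0[OF test_L2[OF \<phi>T[OF j]]])
    then have "AE x in lebesgue. x \<in> \<Omega> \<longrightarrow> \<phi> j x = 0" using sets_lebesgue by (simp add: AE_restrict_space_iff)
    then have "AE x in lebesgue. x \<notin> box (a j) (b j)"
    proof eventually_elim
      case (elim x)
      show ?case
      proof
        assume x: "x \<in> box (a j) (b j)"
        then have "x \<in> \<Omega>" using sub[OF j] box_subset_cbox by blast
        then show False using elim bump_pos[OF x, of 1] by (simp add: \<phi>_def)
      qed
    qed
    then have "negligible (box (a j) (b j))"
      by (subst (asm) AE_iff_null_sets[symmetric]) (simp_all add: negligible_iff_null_sets)
    then show False using open_not_negligible[OF open_box nonempty[OF j]] by blast
  qed
  have disj: "mass \<Omega> (\<phi> i) (\<phi> j) = 0" if "i < j" for i j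
  proof -
    have "\<phi> i x * \<phi> j x = 0" for x
    proof (rule ccontr)
      assume "\<phi> i x * \<phi> j x \<noteq> 0"
      then have "x \<in> box (a i) (b i)" "x \<in> box (a j) (b j)"
        using bump_eq_0[of x _ _ 1] by (auto simp: \<phi>_def)
      then have "a j $ i0 < x $ i0" "x $ i0 < b i $ i0" by (auto simp: mem_box_cart)
      then have "a j $ i0 < b i $ i0" by linarith
      then have "real j * h < real (Suc i) * h" by (simp add: a_def b_def)
      then have "j < Suc i" using h by (simp del: of_nat_Suc)
      then show False using that by simp
    qed
    then have "(\<lambda>x. \<phi> i x * \<phi> j x) = (\<lambda>x. 0)" by (rule ext)
    then show ?thesis unfolding mass_def by (simp only: Bochner_Integration.integral_zero)
  qed
  define v where "v j x = (1 / sqrt (mass \<Omega> (\<phi> j) (\<phi> j))) * \<phi> j x" for j x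
  show ?thesis
  proof (intro exI[of _ v] allI impI conjI)
    fix i assume i: "i < n"
    show "v i \<in> test_functions \<Omega>" unfolding v_def[abs_def] by (rule test_functions_cmult[OF \<phi>T[OF i]])
    fix j assume j: "j < n"
    let ?m = "\<lambda>j. mass \<Omega> (\<phi> j) (\<phi> j)"
    have L: "\<phi> i \<in> L2 \<Omega>" "\<phi> j \<in> L2 \<Omega>" by (intro test_L2[OF \<phi>T] i j)+
    have "mass \<Omega> (v i) (v j) = (1 / sqrt (?m i)) * ((1 / sqrt (?m j)) * mass \<Omega> (\<phi> j) (\<phi> i))"
      unfolding v_def[abs_def]
      by (simp only: L.scale_left[OF L(1) L.scale_in[OF L(2)]] L.sym[OF L(1) L.scale_in[OF L(2)]] L.scale_left[OF L(2,1)])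
    also have "\<dots> = of_bool (i = j)"
    proof -
      consider "i = j" | "i < j" | "j < i" by linarith
      then show ?thesis
      proof cases
        case 1
        then show ?thesis using pos[OF i] by (simp add: real_div_sqrt)
      qed (use disj[of i j] disj[of j i] L.sym[OF L] in auto)
    qed
    finally show "mass \<Omega> (v i) (v j) = of_bool (i = j)" .
  qed
qed

sublocale D: discrete_form W "energy \<Omega>" "mass \<Omega>"
proof (intro discrete_form.intro discrete_form_axioms.intro)
  show "psd_form W (mass \<Omega>)" by (rule psd_form_subset[OF MH.psd_form_axioms W_H1 W_0 W_lin])
  show "psd_form W (energy \<Omega>)" by (rule psd_form_subset[OF E.psd_form_axioms W_H1 W_0 W_lin])
  show "\<exists>u\<in>W. (\<lambda>n. energy \<Omega> (\<lambda>x. f n x - u x) (\<lambda>x. f n x - u x)) \<longlonglongrightarrow> 0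
      \<and> (\<lambda>n. mass \<Omega> (\<lambda>x. f n x - u x) (\<lambda>x. f n x - u x)) \<longlonglongrightarrow> 0"
    if f: "\<And>n. f n \<in> W" and c: "\<And>e. e > 0 \<Longrightarrow> \<exists>N. \<forall>m\<ge>N. \<forall>n\<ge>N. energy \<Omega> (\<lambda>x. f m x - f n x) (\<lambda>x. f m x - f n x)
         + mass \<Omega> (\<lambda>x. f m x - f n x) (\<lambda>x. f m x - f n x) < e" for f
  proof -
    have "\<exists>u\<in>H1 \<Omega>. (\<lambda>n. energy \<Omega> (\<lambda>x. f n x - u x) (\<lambda>x. f n x - u x)) \<longlonglongrightarrow> 0
      \<and> (\<lambda>n. mass \<Omega> (\<lambda>x. f n x - u x) (\<lambda>x. f n x - u x)) \<longlonglongrightarrow> 0"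
      by (rule H1_complete[OF _ c]) (use f W_H1 in blast)
    then obtain u where u: "u \<in> H1 \<Omega>" and l: "(\<lambda>n. energy \<Omega> (\<lambda>x. f n x - u x) (\<lambda>x. f n x - u x)) \<longlonglongrightarrow> 0
      \<and> (\<lambda>n. mass \<Omega> (\<lambda>x. f n x - u x) (\<lambda>x. f n x - u x)) \<longlonglongrightarrow> 0" by (rule bexE)
    have "u \<in> W" by (rule W_closed[OF f u l[THEN conjunct1] l[THEN conjunct2]])
    with l show ?thesis by (rule bexI)
  qed
  show "\<exists>r. strict_mono (r :: nat \<Rightarrow> nat) \<and> (\<forall>e>0. \<exists>N. \<forall>m\<ge>N. \<forall>n\<ge>N.
         mass \<Omega> (\<lambda>x. f (r m) x - f (r n) x) (\<lambda>x. f (r m) x - f (r n) x) < e)"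
    if f: "\<And>n. f n \<in> W" and C: "\<And>n. energy \<Omega> (f n) (f n) + mass \<Omega> (f n) (f n) \<le> C" for f C
    by (rule Rellich[OF _ C]) (use f W_H1 in blast)
  show "\<exists>v. \<forall>i<n. v i \<in> W \<and> (\<forall>j<n. mass \<Omega> (v i) (v j) = of_bool (i = j))" for n :: nat
  proof -
    obtain v where v: "\<forall>i<n. v i \<in> test_functions \<Omega> \<and> (\<forall>j<n. mass \<Omega> (v i) (v j) = of_bool (i = j))"
      using ex_disjoint_tests[of n] by (rule exE)
    show ?thesis by (rule exI[of _ v]) (use v test_W in auto)
  qed
qed

lemma W_L2: "u \<in> W \<Longrightarrow> u \<in> L2 \<Omega>"
  using W_H1 H1_L2 by blast

lemma weak_eigenspace_eq: "weak_eigenspace \<Omega> W t = {u \<in> W. \<forall>v\<in>W. energy \<Omega> u v = t * mass \<Omega> u v}"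
  by (simp add: weak_eigenspace_def energy_def mass_def)

lemma mass_cong_0:
  assumes "AE x in M. u x = 0"
  shows "mass \<Omega> u v = 0"
  unfolding mass_def by (rule integral_eq_zero_AE) (use assms in eventually_elim, simp)

text \<open>Independence modulo null sets comes from pairing with \<open>e (h k)\<close>, spanning
  from \<open>eigenspace_residual\<close>, since a function of mass 0 vanishes almost
  everywhere.\<close>

lemma has_dim_eigenspace:
  assumes e: "D.is_eigenbasis e"
  shows "has_dim_AE \<Omega> (weak_eigenspace \<Omega> W t) (card {j. D.ev e j = t})"
proof -
  define J where "J = {j. D.ev e j = t}"
  have J: "finite J" unfolding J_def by (rule D.finite_ev[OF e])
  obtain h where h: "bij_betw h {0..<card J} J" using ex_bij_betw_nat_finite[OF J] by blast
  then have h: "bij_betw h {..<card J} J" by (simp add: atLeast0LessThan)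
  then have hJ: "h i \<in> J" if "i < card J" for i using that by (auto simp: bij_betw_def)
  have hinj: "h i = h j \<longleftrightarrow> i = j" if "i < card J" "j < card J" for i j
    using h that by (auto simp: bij_betw_def inj_on_def)
  have eW: "e j \<in> W" for j by (rule D.e_in[OF e])
  have E: "e j \<in> weak_eigenspace \<Omega> W t" if "j \<in> J" for j
    using D.eigen[OF e, of _ j] eW that by (auto simp: weak_eigenspace_eq J_def)
  have ind: "\<forall>i<card J. c i = 0" if c: "AE x in M. (\<Sum>i<card J. c i * e (h i) x) = 0" for c
  proof (intro allI impI)
    fix k assume k: "k < card J"
    have "0 = mass \<Omega> (\<lambda>x. \<Sum>i<card J. c i * e (h i) x) (e (h k))" using mass_cong_0[OF c] by simp
    also have "\<dots> = (\<Sum>i<card J. c i * mass \<Omega> (e (h i)) (e (h k)))"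
      by (rule D.B.sum_left) (auto simp: eW)
    also have "\<dots> = (\<Sum>i<card J. if i = k then c i else 0)"
      by (intro sum.cong refl) (use k in \<open>auto simp: D.e_on[OF e] hinj\<close>)
    also have "\<dots> = c k" using k by simp
    finally show "c k = 0" by simp
  qed
  have span: "\<exists>c. AE x in M. u x = (\<Sum>i<card J. c i * e (h i) x)" if u: "u \<in> weak_eigenspace \<Omega> W t" for u
  proof -
    have uW: "u \<in> W" and ue: "\<And>v. v \<in> W \<Longrightarrow> energy \<Omega> u v = t * mass \<Omega> u v"
      using u by (auto simp: weak_eigenspace_eq)
    define r where "r x = u x - (\<Sum>j\<in>J. mass \<Omega> u (e j) * e j x)" for x
    have "mass \<Omega> r r = 0" unfolding r_def[abs_def] J_def by (rule D.eigenspace_residual[OF e uW ue])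
    moreover have "r \<in> W" unfolding r_def[abs_def] by (rule D.residual_in[OF J eW uW])
    ultimately have "AE x in M. r x = 0" using AE_0_if_mass_0 W_L2 by blast
    then have "AE x in M. u x = (\<Sum>i<card J. mass \<Omega> u (e (h i)) * e (h i) x)"
    proof eventually_elim
      case (elim x)
      then show ?case using sum.reindex_bij_betw[OF h, of "\<lambda>j. mass \<Omega> u (e j) * e j x"] by (simp add: r_def)
    qed
    then show ?thesis by (rule exI[where x = "\<lambda>i. mass \<Omega> u (e (h i))"])
  qed
  show ?thesis unfolding has_dim_AE_def J_def[symmetric]
    by (rule exI[where x = "\<lambda>i. e (h i)"]) (intro conjI allI ballI impI E hJ ind span)
qed

text \<open>The definite description is met by the sequence of minima and, as dimensions modulo null
  sets are unique, by nothing else. Thereby the eigenvalues inherit the variational facts.\<close>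

lemma eigenvalue_seq_eq:
  assumes e: "D.is_eigenbasis e"
  shows "eigenvalue_seq \<Omega> W = D.ev e"
  unfolding eigenvalue_seq_def
proof (rule the_equality)
  show l: "mono (D.ev e) \<and> (\<forall>t. finite {j. D.ev e j = t} \<and> has_dim_AE \<Omega> (weak_eigenspace \<Omega> W t) (card {j. D.ev e j = t}))"
    by (intro conjI allI D.mono_ev[OF e] D.finite_ev[OF e] has_dim_eigenspace[OF e])
  fix l' :: "nat \<Rightarrow> real"
  assume l': "mono l' \<and> (\<forall>t. finite {j. l' j = t} \<and> has_dim_AE \<Omega> (weak_eigenspace \<Omega> W t) (card {j. l' j = t}))"
  show "l' = D.ev e"
  proof (rule mono_eqI_card_fibers)
    show "card {j. l' j = t} = card {j. D.ev e j = t}" for t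
      by (rule has_dim_AE_unique[of \<Omega> "weak_eigenspace \<Omega> W t"]) (use l l' in blast)+
  qed (use l l' in auto)
qed

theorem ex_eigenfunctions:
  obtains e where "\<And>j. e j \<in> W" "\<And>i j. mass \<Omega> (e i) (e j) = of_bool (i = j)"
    "\<And>j. energy \<Omega> (e j) (e j) = eigenvalue_seq \<Omega> W j"
proof -
  obtain e where e: "D.is_eigenbasis e" using D.ex_eigenbasis by blast
  show thesis
    by (rule that[of e]) (simp_all add: D.e_in[OF e] D.e_on[OF e] eigenvalue_seq_eq[OF e] D.ev_def[OF e])
qed

theorem sum_eigenvalue_seq_le:
  assumes "\<And>i. i < n \<Longrightarrow> v i \<in> W" "\<And>i j. i < n \<Longrightarrow> j < n \<Longrightarrow> mass \<Omega> (v i) (v j) = of_bool (i = j)"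
  shows "(\<Sum>j<n. eigenvalue_seq \<Omega> W j) \<le> (\<Sum>i<n. energy \<Omega> (v i) (v i))"
proof -
  obtain e where e: "D.is_eigenbasis e" using D.ex_eigenbasis by blast
  show ?thesis unfolding eigenvalue_seq_eq[OF e] by (rule D.sum_ev_le[OF e assms])
qed

end

section \<open>Reflections and tight frames\<close>

lemma inner_transpose_left: "(transpose A *v x) \<bullet> y = x \<bullet> (A *v y)"
  for A :: "real^'n::finite^'n"
  by (metis dot_lmul_matrix transpose_matrix_vector)

lemma orthogonal_matrix_norm: "orthogonal_matrix U \<Longrightarrow> norm (U *v x) = norm x"
  for U :: "real^'n::finite^'n"
  by (metis matrix_of_matrix_vector_mul matrix_vector_mul_linear orthogonal_transformation_matrix
      orthogonal_transformation_norm)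

lemma orthogonal_matrix_invertible: "orthogonal_matrix U \<Longrightarrow> invertible U"
  by (auto simp: orthogonal_matrix_def invertible_def)

lemma orthogonal_matrix_cancel:
  assumes "orthogonal_matrix U"
  shows "U *v (transpose U *v x) = x" "transpose U *v (U *v x) = x"
  using assms by (simp_all add: orthogonal_matrix_def matrix_vector_mul_assoc)

text \<open>The square of the Hilbert-Schmidt norm, that is, the trace of
  \<open>transpose A ** A\<close>.\<close>

definition hs :: "real^'n::finite^'n \<Rightarrow> real" where
  "hs A = (\<Sum>i\<in>UNIV. (norm (A *v axis i 1))\<^sup>2)"

lemma hs_eq: "hs A = (\<Sum>i\<in>UNIV. \<Sum>j\<in>UNIV. (A $ j $ i)\<^sup>2)"
proof -
  have "(norm (A *v axis i 1))\<^sup>2 = (\<Sum>j\<in>UNIV. (A $ j $ i)\<^sup>2)" for i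
    unfolding power2_norm_eq_inner
    by (simp add: inner_vec_def matrix_vector_mult_basis column_def power2_eq_square)
  then show ?thesis by (simp add: hs_def)
qed

lemma hs_transpose: "hs (transpose A) = hs A"
  unfolding hs_eq by (subst sum.swap) (simp add: transpose_def)

lemma hs_orthogonal_left: "orthogonal_matrix U \<Longrightarrow> hs (U ** A) = hs A"
  by (simp add: hs_def orthogonal_matrix_norm flip: matrix_vector_mul_assoc)

lemma hs_orthogonal_right: "orthogonal_matrix U \<Longrightarrow> hs (A ** U) = hs A"
  using hs_orthogonal_left[of "transpose U" "transpose A"]
  by (metis hs_transpose matrix_transpose_mul orthogonal_matrix_transpose)

lemma hs_pos:
  assumes "invertible A"
  shows "hs A > 0"
proof -
  have "A *v axis i 1 \<noteq> 0" for i
  proof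
    assume "A *v axis i 1 = 0"
    then have "matrix_inv A *v (A *v axis i 1) = 0" by simp
    then show False using invertible_matrix_inv(3)[OF assms] by (simp add: matrix_vector_mul_assoc axis_eq_0_iff)
  qed
  then show ?thesis unfolding hs_def by (intro sum_pos) auto
qed

section \<open>Reflections and finite reflection groups\<close>

definition reflection :: "real^'n::finite \<Rightarrow> real^'n^'n" where
  "reflection e = matrix (\<lambda>z. z - (2 * (z \<bullet> e) / (e \<bullet> e)) *\<^sub>R e)"

lemma reflection_linear: "linear (\<lambda>z. z - (2 * (z \<bullet> e) / (e \<bullet> e)) *\<^sub>R e)" for e :: "real^'n::finite"
  by (rule linearI) (auto simp: algebra_simps inner_add_left add_divide_distrib)

lemma reflection_apply: "reflection e *v z = z - (2 * (z \<bullet> e) / (e \<bullet> e)) *\<^sub>R e"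
  unfolding reflection_def by (simp only: matrix_vector_mul(2)[OF reflection_linear])

lemma reflection_self: "reflection e *v e = - e"
  by (cases "e = 0") (simp_all add: reflection_apply scaleR_2)

lemma reflection_orthogonal_eq: "z \<bullet> e = 0 \<Longrightarrow> reflection e *v z = z"
  by (simp add: reflection_apply)

lemma orthogonal_matrix_reflection: "orthogonal_matrix (reflection e)"
proof -
  have "norm (reflection e *v z) = norm z" for z
  proof (cases "e = 0")
    case False
    define t where "t = 2 * (z \<bullet> e) / (e \<bullet> e)"
    have t: "t * (e \<bullet> e) = 2 * (z \<bullet> e)" using False by (simp add: t_def)
    have r: "reflection e *v z = z - t *\<^sub>R e" by (simp add: reflection_apply t_def)
    have "(reflection e *v z) \<bullet> (reflection e *v z) = z \<bullet> z - 2 * t * (z \<bullet> e) + t * (t * (e \<bullet> e))"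
      unfolding r by (simp add: inner_diff_left inner_diff_right inner_commute algebra_simps)
    also have "\<dots> = z \<bullet> z" using t by algebra
    finally show ?thesis by (simp add: norm_eq_sqrt_inner)
  qed (simp add: reflection_apply)
  then have "orthogonal_transformation ((*v) (reflection e))"
    by (simp add: orthogonal_transformation)
  then show ?thesis by (simp add: orthogonal_transformation_matrix)
qed

lemma reflection_involution: "reflection e ** reflection e = mat 1"
proof -
  have "reflection e *v (reflection e *v z) = z" for z
  proof -
    obtain t where t: "reflection e *v z = z - t *\<^sub>R e" using reflection_apply by blast
    have "reflection e *v (reflection e *v z) = reflection e *v z - t *\<^sub>R (reflection e *v e)"
      by (simp only: t matrix_vector_mult_diff_distrib matrix_vector_mult_scaleR)
    then show ?thesis by (simp add: t reflection_self)
  qed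
  then show ?thesis by (simp add: matrix_eq matrix_vector_mul_assoc[symmetric])
qed

text \<open>A line meets a sphere in at most two points: with \<open>f = y - z\<close> and
  \<open>x = y + t f\<close>, equal norms leave only \<open>t = 0\<close> and \<open>t = -1\<close>,
  that is, \<open>x = y\<close> or \<open>x = z\<close>.\<close>

lemma sphere_not_collinear:
  fixes x y z :: "real^'n::finite"
  assumes n: "norm x = norm y" "norm z = norm y" and d: "x \<noteq> y" "y \<noteq> z" "x \<noteq> z"
    and 0: "\<alpha> *\<^sub>R (x - y) + \<beta> *\<^sub>R (y - z) = 0"
  shows "\<alpha> = 0 \<and> \<beta> = 0"
proof (cases "\<alpha> = 0")
  case True
  then show ?thesis using 0 d by simp
next
  case False
  define t where "t = - \<beta> / \<alpha>"
  define f where "f = y - z"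
  have "\<alpha> *\<^sub>R (x - y) = \<alpha> *\<^sub>R (t *\<^sub>R f)" using 0 False by (simp add: t_def f_def eq_neg_iff_add_eq_0)
  then have "x - y = t *\<^sub>R f" by (rule scaleR_left_imp_eq[OF False])
  then have x: "x = y + t *\<^sub>R f" by (simp add: algebra_simps)
  have t0: "t \<noteq> 0" using x d(1) by auto
  have ff: "f \<bullet> f > 0" using d(2) by (simp add: f_def)
  have "z \<bullet> z = y \<bullet> y" using n(2) by (simp add: norm_eq)
  then have yf: "2 * (y \<bullet> f) = f \<bullet> f" by (simp add: f_def inner_commute algebra_simps)
  have "x \<bullet> x = y \<bullet> y" using n(1) by (simp add: norm_eq)
  then have "t * (2 * (y \<bullet> f)) + t * (t * (f \<bullet> f)) = 0" by (simp add: x inner_commute algebra_simps)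
  then have "t * (f \<bullet> f) + t * (t * (f \<bullet> f)) = 0" unfolding yf .
  then have "t * ((1 + t) * (f \<bullet> f)) = 0" by (simp add: algebra_simps)
  then have "t = -1" using t0 ff by simp
  then have "x = z" by (simp add: x f_def)
  then show ?thesis using d(3) by simp
qed

text \<open>The common feature of the vertices of a centred regular simplex and of a cross polytope:
  reflecting in the bisecting hyperplane of any two of them permutes them all. The orthogonal
  symmetries of \<open>X\<close> form the symmetric group in the first case and the hyperoctahedral
  group in the second.\<close>

locale reflection_set =
  fixes X :: "(real^'n::finite) set"
  assumes fin: "finite X"
    and sph: "x \<in> X \<Longrightarrow> y \<in> X \<Longrightarrow> norm x = norm y"
    and spn: "span {x - y |x y. x \<in> X \<and> y \<in> X} = UNIV"
    and reflection_in: "x \<in> X \<Longrightarrow> y \<in> X \<Longrightarrow> x \<noteq> y \<Longrightarrow> z \<in> X \<Longrightarrow> reflection (x - y) *v z \<in> X"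
begin

lemma reflection_image:
  assumes "x \<in> X" "y \<in> X" "x \<noteq> y"
  shows "(*v) (reflection (x - y)) ` X = X"
proof
  show 1: "(*v) (reflection (x - y)) ` X \<subseteq> X" using reflection_in[OF assms] by blast
  show "X \<subseteq> (*v) (reflection (x - y)) ` X"
  proof
    fix z assume "z \<in> X"
    then have "reflection (x - y) *v z \<in> X" using 1 by blast
    then have "reflection (x - y) *v (reflection (x - y) *v z) \<in> (*v) (reflection (x - y)) ` X" by (rule imageI)
    then show "z \<in> (*v) (reflection (x - y)) ` X" by (simp add: matrix_vector_mul_assoc reflection_involution)
  qed
qed

lemma eq_0_if_orthogonal_to_differences:
  assumes "\<And>x y. x \<in> X \<Longrightarrow> y \<in> X \<Longrightarrow> x \<noteq> y \<Longrightarrow> m \<bullet> (x - y) = 0"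
  shows "m = 0"
proof -
  have "m \<in> span {x - y |x y. x \<in> X \<and> y \<in> X}" using spn by simp
  then have "orthogonal m m"
  proof (rule orthogonal_to_span)
    fix e assume "e \<in> {x - y |x y. x \<in> X \<and> y \<in> X}"
    then obtain x y where e: "e = x - y" "x \<in> X" "y \<in> X" by blast
    show "orthogonal m e" unfolding e(1) orthogonal_def using assms[OF e(2,3)] by (cases "x = y") auto
  qed
  then show ?thesis by (simp add: orthogonal_def)
qed

text \<open>An invariant form has every difference \<open>x - y\<close> as an eigenvector.  Any two of the three
  differences of points \<open>x\<close>, \<open>y\<close>, \<open>z\<close> on a sphere are independent, but all three are not, so the
  eigenvalues coincide.\<close>

lemma invariant_form_isotropic:
  fixes B :: "real^'n \<Rightarrow> real^'n \<Rightarrow> real"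
  assumes B: "bilinear B"
    and inv: "\<And>x y v w. x \<in> X \<Longrightarrow> y \<in> X \<Longrightarrow> x \<noteq> y \<Longrightarrow> B (reflection (x - y) *v v) (reflection (x - y) *v w) = B v w"
  shows "\<exists>K. \<forall>v w. B v w = K * (v \<bullet> w)"
proof -
  have B0: "B e w = 0" if xy: "x \<in> X" "y \<in> X" "x \<noteq> y" and e: "e = x - y" and w: "w \<bullet> e = 0" for x y e w
  proof -
    \<comment> \<open>The reflection negates \<open>e\<close> and fixes \<open>w\<close>, so the
      value equals its own negative.\<close>
    have "B e w = B (reflection e *v e) (reflection e *v w)" using inv[OF xy] by (simp add: e)
    also have "\<dots> = - B e w" by (simp add: reflection_self reflection_orthogonal_eq[OF w] bilinear_lneg[OF B])
    finally show ?thesis by simp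
  qed
  define k where "k e = B e e / (e \<bullet> e)" for e
  have eig: "B e w = k e * (e \<bullet> w)" if xy: "x \<in> X" "y \<in> X" "x \<noteq> y" and e: "e = x - y" for x y e w
  proof -
    have ee: "e \<bullet> e \<noteq> 0" using xy e by simp
    define t where "t = (w \<bullet> e) / (e \<bullet> e)"
    have te: "t * (e \<bullet> e) = w \<bullet> e" using ee by (simp add: t_def)
    have "(w - t *\<^sub>R e) \<bullet> e = 0" using te by (simp add: inner_diff_left)
    then have "B e (w - t *\<^sub>R e) = 0" by (rule B0[OF xy e])
    then have "B e w = t * B e e" by (simp add: bilinear_rsub[OF B] bilinear_rmul[OF B])
    then show ?thesis using ee by (simp add: t_def k_def inner_commute)
  qed
  have k_sym: "k (x - y) = k (y - x)" for x y
  proof -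
    have "B (y - x) (y - x) = B (- (x - y)) (- (x - y))" by simp
    also have "\<dots> = B (x - y) (x - y)" by (simp only: bilinear_lneg[OF B] bilinear_rneg[OF B] minus_minus)
    finally show ?thesis by (simp add: k_def inner_commute algebra_simps)
  qed
  have triple: "k (x - y) = k (x - z) \<and> k (y - z) = k (x - z)"
    if xyz: "x \<in> X" "y \<in> X" "z \<in> X" "x \<noteq> y" "y \<noteq> z" "x \<noteq> z" for x y z
  proof -
    \<comment> \<open>Expanding \<open>B (x - z) w\<close> in two ways shows \<open>v\<close> to be
      orthogonal to everything; independence of \<open>x - y\<close> and \<open>y - z\<close> then
      equates the eigenvalues.\<close>
    define v where "v = (k (x - z) - k (x - y)) *\<^sub>R (x - y) + (k (x - z) - k (y - z)) *\<^sub>R (y - z)"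
    have "v \<bullet> w = 0" for w
    proof -
      have "B (x - z) w = B ((x - y) + (y - z)) w" by simp
      also have "\<dots> = B (x - y) w + B (y - z) w" by (rule bilinear_ladd[OF B])
      finally have "k (x - z) * ((x - z) \<bullet> w) = k (x - y) * ((x - y) \<bullet> w) + k (y - z) * ((y - z) \<bullet> w)"
        using eig[OF xyz(1,2,4) refl] eig[OF xyz(2,3,5) refl] eig[OF xyz(1,3,6) refl] by simp
      then show ?thesis by (simp add: v_def algebra_simps)
    qed
    then have "v = 0" using inner_eq_zero_iff by blast
    then show ?thesis
      using sphere_not_collinear[OF sph[OF xyz(1,2)] sph[OF xyz(3,2)] xyz(4-6)] unfolding v_def by fastforce
  qed
  show ?thesis
  proof (cases "\<exists>a b. a \<in> X \<and> b \<in> X \<and> a \<noteq> b")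
    case True
    then obtain a b where ab: "a \<in> X" "b \<in> X" "a \<noteq> b" by blast
    define K where "K = k (a - b)"
    have Ka: "k (x - a) = K" if x: "x \<in> X" "x \<noteq> a" for x
    proof (cases "x = b")
      case True
      then show ?thesis using k_sym[of a b] by (simp add: K_def)
    next
      case False
      have "k (x - a) = k (x - b)" "k (a - b) = k (x - b)" using triple[of x a b] x ab False by auto
      then show ?thesis by (simp add: K_def)
    qed
    have K: "k (x - y) = K" if xy: "x \<in> X" "y \<in> X" "x \<noteq> y" for x y
    proof -
      consider "x = a" | "y = a" | "x \<noteq> a" "y \<noteq> a" by blast
      then show ?thesis
      proof cases
        case 1
        then show ?thesis using Ka[of y] xy k_sym[of x y] by simp
      next
        case 2
        then show ?thesis using Ka[of x] xy by simp
      next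
        case 3
        have "k (x - y) = k (x - a)" using triple[of x y a] xy ab 3 by auto
        then show ?thesis using Ka[of x] xy 3 by simp
      qed
    qed
    have "B v w = K * (v \<bullet> w)" for v w
    proof -
      have "v \<in> span {x - y |x y. x \<in> X \<and> y \<in> X}" using spn by simp
      then show ?thesis
      proof (induction rule: span_induct_alt)
        case base
        show ?case by (simp add: bilinear_lzero[OF B])
      next
        case (step c e v)
        then obtain x y where e: "e = x - y" "x \<in> X" "y \<in> X" by blast
        have "B e w = K * (e \<bullet> w)"
        proof (cases "x = y")
          case False
          then show ?thesis using eig[OF e(2,3) False e(1)] K[OF e(2,3) False] by (simp add: e(1))
        qed (simp add: e(1) bilinear_lzero[OF B])
        then show ?case using step(2)
          by (simp add: bilinear_ladd[OF B] bilinear_lmul[OF B] inner_add_left distrib_left mult.left_commute)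
      qed
    qed
    then show ?thesis by blast
  next
    case False
    \<comment> \<open>With at most one point there are no nonzero differences, and the whole space
      would be trivial.\<close>
    then have "{x - y |x y. x \<in> X \<and> y \<in> X} \<subseteq> {0}" by auto
    then have "span {x - y |x y. x \<in> X \<and> y \<in> X} \<subseteq> span {0}" by (rule span_mono)
    then have z: "v = 0" for v :: "real^'n" using spn by auto
    have "B v w = 0 * (v \<bullet> w)" for v w using z[of v] by (simp add: bilinear_lzero[OF B])
    then show ?thesis by blast
  qed
qed

definition G :: "(real^'n^'n) set" where
  "G = {U. orthogonal_matrix U \<and> (*v) U ` X = X}"

lemma reflection_G: "x \<in> X \<Longrightarrow> y \<in> X \<Longrightarrow> x \<noteq> y \<Longrightarrow> reflection (x - y) \<in> G"
  by (simp add: G_def orthogonal_matrix_reflection reflection_image)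

lemma id_G: "mat 1 \<in> G"
  by (simp add: G_def orthogonal_matrix_id)

lemma mult_G: "U \<in> G \<Longrightarrow> V \<in> G \<Longrightarrow> U ** V \<in> G"
proof -
  assume "U \<in> G" "V \<in> G"
  moreover have "(*v) (U ** V) ` X = (*v) U ` (*v) V ` X"
    by (simp add: image_comp o_def matrix_vector_mul_assoc)
  ultimately show ?thesis by (simp add: G_def orthogonal_matrix_mul)
qed

lemma transpose_G: "U \<in> G \<Longrightarrow> transpose U \<in> G"
proof -
  assume U: "U \<in> G"
  then have o: "orthogonal_matrix U" and im: "(*v) U ` X = X" by (auto simp: G_def)
  have "(*v) (transpose U) ` (*v) U ` X = X"
    by (simp add: image_comp o_def orthogonal_matrix_cancel(2)[OF o] del: transpose_matrix_vector)
  then show ?thesis using o by (simp add: G_def im)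
qed

text \<open>A symmetry is determined by its action on the finite set \<open>X\<close>, whose
  differences span the space.\<close>

lemma finite_G: "finite G"
proof (rule inj_on_finite)
  show "(\<lambda>U. restrict ((*v) U) X) ` G \<subseteq> PiE X (\<lambda>_. X)" by (auto simp: G_def)
  show "finite (PiE X (\<lambda>_. X))" by (intro finite_PiE fin)
  show "inj_on (\<lambda>U. restrict ((*v) U) X) G"
  proof (rule inj_onI)
    fix U V assume "restrict ((*v) U) X = restrict ((*v) V) X"
    then have eq: "U *v x = V *v x" if "x \<in> X" for x using that by (metis restrict_apply')
    have "U *v v = V *v v" for v
    proof (rule linear_eq_on[OF matrix_vector_mul_linear matrix_vector_mul_linear])
      show "v \<in> span {x - y |x y. x \<in> X \<and> y \<in> X}" using spn by simp
      show "U *v e = V *v e" if "e \<in> {x - y |x y. x \<in> X \<and> y \<in> X}" for e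
        using that eq by (auto simp: matrix_vector_mult_diff_distrib)
    qed
    then show "U = V" by (simp add: matrix_eq)
  qed
qed

lemma card_G: "card G > 0"
  using finite_G id_G by (auto simp: card_gt_0_iff)

text \<open>The orbit of a vector under \<open>G\<close> is a tight frame.\<close>

lemma sum_G_norm_square:
  "(\<Sum>U\<in>G. (norm (A *v (U *v w)))\<^sup>2) = card G * hs A / CARD('n) * (norm w)\<^sup>2"
proof -
  define B where "B v w = (\<Sum>U\<in>G. (A *v (U *v v)) \<bullet> (A *v (U *v w)))" for v w
  have bil: "bilinear B"
    unfolding bilinear_def B_def
    by (auto intro!: linearI simp: matrix_vector_right_distrib inner_add_left inner_add_right sum.distrib
        matrix_vector_mult_scaleR sum_distrib_left)
  have inv: "B (reflection (x - y) *v v) (reflection (x - y) *v w) = B v w" if "x \<in> X" "y \<in> X" "x \<noteq> y" for x y v w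
    unfolding B_def
  proof (rule sum.reindex_bij_witness[of _ "\<lambda>U. U ** reflection (x - y)" "\<lambda>U. U ** reflection (x - y)"])
    show "(A *v (U ** reflection (x - y) *v v)) \<bullet> (A *v (U ** reflection (x - y) *v w)) =
       (A *v (U *v (reflection (x - y) *v v))) \<bullet> (A *v (U *v (reflection (x - y) *v w)))" for U
      by (simp add: matrix_vector_mul_assoc)
  qed (use reflection_G[OF that] in \<open>auto intro: mult_G simp: reflection_involution simp flip: matrix_mul_assoc\<close>)
  obtain K where K: "\<And>v w. B v w = K * (v \<bullet> w)" using invariant_form_isotropic[OF bil inv] by blast
  \<comment> \<open>Taking the trace over the standard basis evaluates the constant.\<close>
  have "K * CARD('n) = (\<Sum>i\<in>(UNIV::'n set). B (axis i 1) (axis i 1))"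
    by (simp add: K inner_axis_axis)
  also have "\<dots> = (\<Sum>U\<in>G. hs (A ** U))"
    unfolding B_def hs_def by (subst sum.swap) (simp add: power2_norm_eq_inner matrix_vector_mul_assoc)
  also have "\<dots> = card G * hs A"
    by (simp add: G_def hs_orthogonal_right)
  finally have "K = card G * hs A / CARD('n)" by (simp add: field_simps)
  then show ?thesis using K[of w w] by (simp add: B_def power2_norm_eq_inner)
qed

end

section \<open>Symmetric convex bodies\<close>

lemma convex_open_aff:
  fixes \<Omega> :: "(real^'n::finite) set"
  assumes "convex_open \<Omega>" "invertible A"
  shows "convex_open (aff A b ` \<Omega>)"
proof -
  interpret convex_open \<Omega> by fact
  interpret I: bdd_open "aff A b ` \<Omega>" by (rule bdd_open_aff[OF bdd_open_axioms assms(2)])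
  have "aff A b ` \<Omega> = (+) b ` (*v) A ` \<Omega>" by (auto simp: aff_def image_comp add.commute)
  then have "convex (aff A b ` \<Omega>)"
    using cv by (simp add: convex_translation convex_linear_image)
  then show ?thesis by unfold_locales
qed

lemma mult_matrix_eq_aff: "(*v) T = aff T 0"
  by (auto simp: aff_def)

lemma invertible_mult: "invertible A \<Longrightarrow> invertible B \<Longrightarrow> invertible (A ** B)"
  for A B :: "real^'n::finite^'n"
  by (simp add: invertible_det_nz det_mul)

text \<open>\<open>X\<close> carries the group, and \<open>D\<close> may be any bounded open convex
  set invariant under it. The map \<open>aff U (c - U *v c)\<close> is \<open>U\<close> acting about
  the centre \<open>c\<close>.\<close>

locale symmetric_body = reflection_set X + convex_open D
  for X D :: "(real^'n::finite) set" +
  fixes c :: "real^'n"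
  assumes nonempty: "D \<noteq> {}"
    and symmetric: "U \<in> G \<Longrightarrow> aff U (c - U *v c) ` D = D"
begin

text \<open>For each symmetry \<open>U\<close> of \<open>D\<close> the transplanted eigenfunctions \<open>e j \<circ> U \<circ> T\<^sup>-\<^sup>1\<close> are admissible; averaging
  their energies over \<open>U\<close> replaces \<open>T\<^sup>-\<^sup>1\<close> by a multiple of the identity.\<close>

lemma sum_eigenvalue_seq_le:
  fixes F :: "(real^'n) set \<Rightarrow> (real^'n \<Rightarrow> real) set" and T :: "real^'n^'n"
  assumes T: "invertible T"
    and F: "\<And>\<Omega>. convex_open \<Omega> \<Longrightarrow> \<Omega> \<noteq> {} \<Longrightarrow> form_domain \<Omega> (F \<Omega>)"
    and pullback: "\<And>\<Omega> A b u. bdd_open \<Omega> \<Longrightarrow> invertible A \<Longrightarrow> u \<in> F (aff A b ` \<Omega>) \<Longrightarrow> (\<lambda>x. u (aff A b x)) \<in> F \<Omega>"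
  shows "(\<Sum>j<n. eigenvalue_seq ((*v) T ` D) (F ((*v) T ` D)) j)
    \<le> hs (matrix_inv T) / CARD('n) * (\<Sum>j<n. eigenvalue_seq D (F D) j)"
proof -
  define S where "S = matrix_inv T"
  have S: "invertible S" unfolding S_def by (rule invertible_matrix_inv(1)[OF T])
  define TD where "TD = (*v) T ` D"
  have TDc: "convex_open TD"
    unfolding TD_def mult_matrix_eq_aff by (rule convex_open_aff[OF convex_open_axioms T])
  interpret FD: form_domain D "F D" by (rule F[OF convex_open_axioms nonempty])
  interpret TD: form_domain TD "F TD" by (rule F[OF TDc]) (use nonempty in \<open>simp add: TD_def\<close>)
  obtain e where e: "\<And>j. e j \<in> F D" "\<And>i j. mass D (e i) (e j) = of_bool (i = j)"
    "\<And>j. energy D (e j) (e j) = eigenvalue_seq D (F D) j"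
    using FD.ex_eigenfunctions by blast
  have eH: "e j \<in> H1 D" for j using e(1) FD.W_H1 by blast
  define g where "g j = weak_grad D (e j)" for j
  have gL: "g j \<in> L2 D" for j unfolding g_def by (rule weak_grad(1)[OF eH])
  have one: "(\<Sum>j<n. eigenvalue_seq TD (F TD) j) \<le>
      (\<Sum>j<n. integral\<^sup>L (lebesgue_on D) (\<lambda>x. (norm (transpose S *v (transpose U *v g j x)))\<^sup>2))" if U: "U \<in> G" for U
  proof -
    \<comment> \<open>\<open>A\<close> undoes \<open>T\<close> and then applies \<open>U\<close>, so
      together with the shift \<open>b\<close> it carries \<open>TD\<close> onto
      \<open>D\<close>.\<close>
    define A where "A = U ** S"
    define b where "b = c - U *v c"
    have UO: "orthogonal_matrix U" using U by (simp add: G_def)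
    have A: "invertible A" unfolding A_def by (intro invertible_mult orthogonal_matrix_invertible[OF UO] S)
    have "aff A b ` TD = aff U b ` D"
    proof -
      have "aff A b (T *v x) = aff U b x" for x
      proof -
        have "A ** T = U" using invertible_matrix_inv(3)[OF T] by (simp add: A_def S_def flip: matrix_mul_assoc)
        then show ?thesis by (simp add: aff_def matrix_vector_mul_assoc)
      qed
      then show ?thesis by (simp add: TD_def image_comp o_def)
    qed
    then have im: "aff A b ` TD = D" using symmetric[OF U] by (simp add: b_def)
    define s where "s = vscale A"
    have s: "s > 0" by (simp add: s_def vscale_pos[OF A])
    define w where "w j x = e j (aff A b x)" for j x
    have wF: "w j \<in> F TD" for j
      unfolding w_def[abs_def] by (rule pullback[OF TD.bdd_open_axioms A]) (simp add: im e(1))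
    have wm: "mass TD (w i) (w j) = of_bool (i = j) / s" for i j
      using mass_aff[OF TD.bdd_open_axioms A, of b "e i" "e j"] s
      by (simp add: im e(2) w_def[abs_def] s_def field_simps)
    have we: "energy TD (w j) (w j) = 1 / s * integral\<^sup>L (lebesgue_on D) (\<lambda>x. (norm (transpose A *v g j x))\<^sup>2)" for j
      using H1_aff(2)[OF TD.bdd_open_axioms A, of "e j" b] eH[of j]
      by (simp add: im w_def[abs_def] s_def g_def del: transpose_matrix_vector)
    \<comment> \<open>Composition with the affine map divides masses by \<open>s\<close>; the factor
      \<open>sqrt s\<close> restores orthonormality.\<close>
    define v where "v j x = sqrt s * w j x" for j x
    have "(\<Sum>j<n. eigenvalue_seq TD (F TD) j) \<le> (\<Sum>j<n. energy TD (v j) (v j))"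
    proof (rule TD.sum_eigenvalue_seq_le)
      show "v j \<in> F TD" for j unfolding v_def[abs_def] by (rule TD.D.B.scale_in[OF wF])
      fix i j
      have "mass TD (v i) (v j) = sqrt s * (sqrt s * mass TD (w j) (w i))"
        unfolding v_def[abs_def]
        by (simp only: TD.D.B.scale_left[OF wF TD.D.B.scale_in[OF wF]] TD.D.B.sym[OF wF TD.D.B.scale_in[OF wF]]
            TD.D.B.scale_left[OF wF wF])
      then show "mass TD (v i) (v j) = of_bool (i = j)" using s by (auto simp: wm)
    qed
    also have "\<dots> = (\<Sum>j<n. integral\<^sup>L (lebesgue_on D) (\<lambda>x. (norm (transpose A *v g j x))\<^sup>2))"
      unfolding v_def[abs_def] TD.D.A.scale_square[OF wF] we using s by simp
    also have "\<dots> = (\<Sum>j<n. integral\<^sup>L (lebesgue_on D) (\<lambda>x. (norm (transpose S *v (transpose U *v g j x)))\<^sup>2))"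
      by (simp add: A_def matrix_transpose_mul matrix_vector_mul_assoc del: transpose_matrix_vector)
    finally show ?thesis .
  qed
  have int: "integrable (lebesgue_on D) (\<lambda>x. (norm (transpose S *v (U *v g j x)))\<^sup>2)" for U j
    by (intro L2D(2) L2_matrix gL)
  have "card G * (\<Sum>j<n. eigenvalue_seq TD (F TD) j) = (\<Sum>U\<in>G. \<Sum>j<n. eigenvalue_seq TD (F TD) j)" by simp
  also have "\<dots> \<le> (\<Sum>U\<in>G. \<Sum>j<n. integral\<^sup>L (lebesgue_on D) (\<lambda>x. (norm (transpose S *v (transpose U *v g j x)))\<^sup>2))"
    by (rule sum_mono) (rule one)
  \<comment> \<open>The group is closed under transposition, which brings the sum to the form of the
    tight frame identity.\<close>
  also have "\<dots> = (\<Sum>U\<in>G. \<Sum>j<n. integral\<^sup>L (lebesgue_on D) (\<lambda>x. (norm (transpose S *v (U *v g j x)))\<^sup>2))"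
    by (rule sum.reindex_bij_witness[of _ transpose transpose])
      (auto intro: transpose_G simp del: transpose_matrix_vector)
  also have "\<dots> = (\<Sum>j<n. integral\<^sup>L (lebesgue_on D) (\<lambda>x. \<Sum>U\<in>G. (norm (transpose S *v (U *v g j x)))\<^sup>2))"
    by (subst sum.swap) (simp add: int del: transpose_matrix_vector)
  also have "\<dots> = (\<Sum>j<n. card G * hs S / CARD('n) * energy D (e j) (e j))"
    by (simp add: sum_G_norm_square hs_transpose energy_square g_def del: transpose_matrix_vector)
  also have "\<dots> = card G * (hs S / CARD('n) * (\<Sum>j<n. eigenvalue_seq D (F D) j))"
    by (simp add: e(3) sum_distrib_left mult.assoc)
  finally have le: "real (card G) * (\<Sum>j<n. eigenvalue_seq TD (F TD) j)
    \<le> real (card G) * (hs S / CARD('n) * (\<Sum>j<n. eigenvalue_seq D (F D) j))" .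
  have "0 < real (card G)" using card_G by simp
  from mult_left_le_imp_le[OF le this] show ?thesis by (simp only: TD_def S_def)
qed

section \<open>Centroid, moments and the value of Q on a symmetric body\<close>

lemma vol_pos: "vol D > 0"
proof -
  have "\<not> negligible D" using open_not_negligible[OF op nonempty] .
  then have "vol D \<noteq> 0" using negligible_iff_measure0[OF lm] by simp
  then show ?thesis using measure_nonneg[of lebesgue D] by linarith
qed

lemma continuous_L2:
  fixes f :: "real^'n \<Rightarrow> 'b::euclidean_space"
  assumes "continuous_on UNIV f"
  shows "f \<in> L2 D"
proof -
  have "compact (f ` closure D)"
    using bd by (intro compact_continuous_image continuous_on_subset[OF assms]) (auto simp: compact_closure)
  then have "bounded (f ` closure D)" by (rule compact_imp_bounded)
  then obtain K where "\<forall>y\<in>f ` closure D. norm y \<le> K" unfolding bounded_iff by (rule exE)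
  then have K: "norm (f x) \<le> K" if "x \<in> closure D" for x using that by simp
  show ?thesis
  proof (rule L2_bounded)
    show "f \<in> borel_measurable (lebesgue_on D)"
      by (intro measurable_restrict_space1 measurable_completion) (simp add: borel_measurable_continuous_onI assms)
    show "norm (f x) \<le> K" if "x \<in> D" for x by (rule K[OF subsetD[OF closure_subset that]])
  qed
qed

lemma integral_symmetric:
  fixes f :: "real^'n \<Rightarrow> 'b::{banach, second_countable_topology}"
  assumes "U \<in> G"
  shows "integral\<^sup>L (lebesgue_on D) (\<lambda>x. f (x - c)) = integral\<^sup>L (lebesgue_on D) (\<lambda>x. f (U *v (x - c)))"
proof -
  have UO: "orthogonal_matrix U" using assms by (simp add: G_def)
  have "aff U (c - U *v c) x - c = U *v (x - c)" for x
    by (simp add: aff_def matrix_vector_mult_diff_distrib)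
  then show ?thesis
    using integral_aff[OF orthogonal_matrix_invertible[OF UO] sets_lebesgue, of "c - U *v c" "\<lambda>x. f (x - c)"]
    by (simp add: symmetric[OF assms] vscale_orthogonal[OF UO])
qed

lemma integrable_continuous:
  fixes f :: "real^'n \<Rightarrow> 'b::euclidean_space"
  assumes "continuous_on UNIV f"
  shows "integrable (lebesgue_on D) f"
  by (rule L2_integrable[OF continuous_L2[OF assms]])

text \<open>The first moment about \<open>c\<close> is fixed by each reflection, hence orthogonal to
  every difference of points of \<open>X\<close>, and these span.\<close>

lemma integral_minus_center: "integral\<^sup>L (lebesgue_on D) (\<lambda>x. x - c) = 0"
proof (rule eq_0_if_orthogonal_to_differences)
  fix x y assume xy: "x \<in> X" "y \<in> X" "x \<noteq> y"
  let ?m = "integral\<^sup>L (lebesgue_on D) (\<lambda>x. x - c)" and ?R = "reflection (x - y)"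
  have i: "integrable (lebesgue_on D) (\<lambda>x. x - c)" by (intro integrable_continuous continuous_intros)
  have "?m = integral\<^sup>L (lebesgue_on D) (\<lambda>x. ?R *v (x - c))"
    by (rule integral_symmetric[OF reflection_G[OF xy], of "\<lambda>x. x"])
  also have "\<dots> = ?R *v ?m"
    by (rule integral_bounded_linear[OF matrix_vector_mul_bounded_linear i])
  finally have m: "?m = ?m - (2 * (?m \<bullet> (x - y)) / ((x - y) \<bullet> (x - y))) *\<^sub>R (x - y)"
    by (simp only: reflection_apply)
  have "b = 0" if "a = a - b" for a b :: "real^'n" using that by simp
  from this[OF m] have "(2 * (?m \<bullet> (x - y)) / ((x - y) \<bullet> (x - y))) *\<^sub>R (x - y) = 0" .
  then show "?m \<bullet> (x - y) = 0" using xy by simp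
qed

lemma integral_matrix_id: "integral\<^sup>L (lebesgue_on D) (\<lambda>x. A *v x) = vol D *\<^sub>R (A *v c)"
  for A :: "real^'n^'n"
proof -
  have i: "integrable (lebesgue_on D) (\<lambda>x. x)" "integrable (lebesgue_on D) (\<lambda>x. c)"
    by (intro integrable_continuous continuous_intros)+
  have "integral\<^sup>L (lebesgue_on D) (\<lambda>x. x) = integral\<^sup>L (lebesgue_on D) (\<lambda>x. c)"
    using integral_minus_center i by simp
  also have "\<dots> = vol D *\<^sub>R c" using sets_lebesgue by (simp add: measure_restrict_space)
  finally show ?thesis
    using integral_bounded_linear[OF matrix_vector_mul_bounded_linear i(1), of A] by (simp add: matrix_vector_mult_scaleR)
qed

definition moment :: "real^'n \<Rightarrow> real^'n \<Rightarrow> real" where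
  "moment v w = integral\<^sup>L (lebesgue_on D) (\<lambda>x. (v \<bullet> (x - c)) * (w \<bullet> (x - c)))"

text \<open>The same principle as for the gradients: the inertia form is invariant under the
  reflections, hence a multiple of the inner product.\<close>

lemma ex_moment_constant: "\<exists>K\<ge>0. \<forall>v w. moment v w = K * (v \<bullet> w)"
proof -
  have int: "integrable (lebesgue_on D) (\<lambda>x. (v \<bullet> (x - c)) * (w \<bullet> (x - c)))" for v w
    by (intro integrable_continuous continuous_intros)
  have bil: "bilinear moment"
    unfolding bilinear_def moment_def
    by (auto intro!: linearI simp: inner_add_left distrib_left distrib_right int mult.assoc mult.left_commute)
  have "moment (reflection (x - y) *v v) (reflection (x - y) *v w) = moment v w" if xy: "x \<in> X" "y \<in> X" "x \<noteq> y" for x y v w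
  proof -
    define R where "R = reflection (x - y)"
    have RR: "(R *v a) \<bullet> (R *v b) = a \<bullet> b" for a b
      using orthogonal_matrix_reflection[of "x - y"]
      by (simp add: R_def orthogonal_transformation_def orthogonal_transformation_matrix[of "(*v) (reflection (x - y))", simplified, symmetric])
    have "moment (R *v v) (R *v w) = integral\<^sup>L (lebesgue_on D) (\<lambda>z. ((R *v v) \<bullet> (R *v (z - c))) * ((R *v w) \<bullet> (R *v (z - c))))"
      unfolding moment_def R_def
      by (rule integral_symmetric[OF reflection_G[OF xy], of "\<lambda>z. ((reflection (x - y) *v v) \<bullet> z) * ((reflection (x - y) *v w) \<bullet> z)"])
    also have "\<dots> = moment v w" by (simp only: RR moment_def)
    finally show ?thesis unfolding R_def .
  qed
  then obtain K where K: "\<And>v w. moment v w = K * (v \<bullet> w)"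
    using invariant_form_isotropic[OF bil] by blast
  have "moment (axis undefined 1) (axis undefined 1) \<ge> 0" by (simp add: moment_def)
  then have "K \<ge> 0" by (simp add: K inner_axis_axis)
  then show ?thesis using K by blast
qed

lemma centroid_image:
  fixes A :: "real^'n^'n"
  assumes A: "invertible A"
  shows "centroid ((*v) A ` D) = A *v c"
proof -
  have "integral\<^sup>L (lebesgue_on ((*v) A ` D)) (\<lambda>x. x) = vscale A *\<^sub>R (vol D *\<^sub>R (A *v c))"
    using integral_aff[OF A sets_lebesgue, of 0 "\<lambda>x. x"] by (simp add: aff_def integral_matrix_id)
  moreover have "vol ((*v) A ` D) = vscale A * vol D"
    using vol_aff[OF A sets_lebesgue, of 0] by (simp add: mult_matrix_eq_aff)
  ultimately show ?thesis using vol_pos vscale_pos[OF A] by (simp add: centroid_def)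
qed

text \<open>Row by row, \<open>(norm (A *v y))\<^sup>2\<close> is a sum of squares of linear
  functionals of \<open>y\<close>. Each integrates to a moment of \<open>D\<close>, and together
  these give \<open>K\<close> times \<open>hs\<close> of the transpose.\<close>

lemma second_moment_image:
  fixes A :: "real^'n^'n"
  assumes A: "invertible A" and K: "\<And>v w. moment v w = K * (v \<bullet> w)"
  shows "second_moment ((*v) A ` D) = vscale A * (K * hs A)"
proof -
  have "second_moment ((*v) A ` D) = vscale A * integral\<^sup>L (lebesgue_on D) (\<lambda>x. (norm (A *v (x - c)))\<^sup>2)"
    unfolding second_moment_def centroid_image[OF A]
    using integral_aff[OF A sets_lebesgue, of 0 "\<lambda>x. (norm (x - A *v c))\<^sup>2"]
    by (simp only: mult_matrix_eq_aff[symmetric] real_scaleR_def matrix_vector_mult_diff_distrib)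
  also have "integral\<^sup>L (lebesgue_on D) (\<lambda>x. (norm (A *v (x - c)))\<^sup>2)
     = integral\<^sup>L (lebesgue_on D) (\<lambda>x. \<Sum>i\<in>UNIV. ((transpose A *v axis i 1) \<bullet> (x - c)) * ((transpose A *v axis i 1) \<bullet> (x - c)))"
  proof -
    have "(norm y)\<^sup>2 = (\<Sum>i\<in>UNIV. (axis i 1 \<bullet> y) * (axis i 1 \<bullet> y))" for y :: "real^'n"
      unfolding power2_norm_eq_inner by (simp add: inner_vec_def[of y] inner_axis' )
    then show ?thesis by (simp only: inner_transpose_left)
  qed
  also have "\<dots> = (\<Sum>i\<in>UNIV. moment (transpose A *v axis i 1) (transpose A *v axis i 1))"
    unfolding moment_def
    by (rule Bochner_Integration.integral_sum) (intro integrable_continuous continuous_intros)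
  also have "\<dots> = K * hs (transpose A)"
    by (simp add: K hs_def power2_norm_eq_inner sum_distrib_left del: transpose_matrix_vector)
  finally show ?thesis by (simp add: hs_transpose)
qed

text \<open>With \<open>s = vscale T\<close> the volume powers contribute \<open>s powr p\<close>
  and \<open>s powr (- 1 - p)\<close>, hence \<open>1 / s\<close>, which cancels against the factor
  \<open>1 / s\<close> of the second moment. Up to a constant of \<open>D\<close>, what remains is
  the eigenvalue sum divided by \<open>hs (matrix_inv T)\<close>.\<close>

lemma Q_eq:
  fixes T :: "real^'n^'n"
  assumes T: "invertible T" and K: "\<And>v w. moment v w = K * (v \<bullet> w)"
  shows "Q ev D n T = (\<Sum>j=1..n. ev ((*v) T ` D) j) *
     ((vol D * vol D) powr (2 / CARD('n)) * vol D / K) / hs (matrix_inv T)"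
proof -
  define s where "s = vscale T"
  have s: "s > 0" by (simp add: s_def vscale_pos[OF T])
  define T' where "T' = transpose (matrix_inv T)"
  have T': "invertible T'" unfolding T'_def by (intro transpose_invertible invertible_matrix_inv(1)[OF T])
  have s': "vscale T' = 1 / s"
    by (simp add: T'_def s_def vscale_transpose invertible_matrix_inv(1)[OF T] vscale_matrix_inv[OF T])
  have V: "vol D > 0" by (rule vol_pos)
  have v1: "vol ((*v) T ` D) = s * vol D"
    using vol_aff[OF T sets_lebesgue, of 0] by (simp add: mult_matrix_eq_aff s_def)
  have v2: "vol ((*v) T' ` D) = vol D / s"
    using vol_aff[OF T' sets_lebesgue, of 0] by (simp add: mult_matrix_eq_aff s')
  have m: "second_moment ((*v) T' ` D) = K * hs (matrix_inv T) / s"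
    using second_moment_image[OF T' K] hs_transpose[of "matrix_inv T"] unfolding s' T'_def[symmetric] by simp
  have p: "(s * vol D) powr p * (vol D / s) powr (1 + p) = (vol D * vol D) powr p * (vol D / s)" for p
  proof -
    have "(s * vol D) powr p * (vol D / s) powr (1 + p) = ((s * vol D) powr p * (vol D / s) powr p) * (vol D / s)"
      using s V by (simp add: powr_add)
    also have "(s * vol D) powr p * (vol D / s) powr p = ((s * vol D) * (vol D / s)) powr p"
      by (rule powr_mult[symmetric])
    also have "(s * vol D) * (vol D / s) = vol D * vol D" using s by simp
    finally show ?thesis .
  qed
  have "Q ev D n T = (\<Sum>j=1..n. ev ((*v) T ` D) j) * ((s * vol D) powr (2 / CARD('n)) *
     (vol D / s) powr (1 + 2 / CARD('n))) / (K * hs (matrix_inv T) / s)"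
    unfolding Q_def Let_def T'_def[symmetric] v1 v2 m by simp
  also have "\<dots> = (\<Sum>j=1..n. ev ((*v) T ` D) j) *
     ((vol D * vol D) powr (2 / CARD('n)) * vol D / K) / hs (matrix_inv T)"
    unfolding p using s by simp
  finally show ?thesis .
qed

end

lemma matrix_inv_unique:
  fixes A B :: "real^'n::finite^'n"
  assumes "A ** B = mat 1"
  shows "matrix_inv A = B"
proof -
  have A: "invertible A" using assms by (auto simp: invertible_right_inverse)
  have "matrix_inv A = matrix_inv A ** (A ** B)" by (simp add: assms)
  also have "\<dots> = B" by (simp add: matrix_mul_assoc invertible_matrix_inv(3)[OF A])
  finally show ?thesis .
qed

text \<open>Isotropy of the moments of both bodies makes \<open>T\<^sub>0\<close> a similarity.\<close>

lemma symmetric_body_maximal: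
  fixes D :: "(real^'n::finite) set" and T T\<^sub>0 :: "real^'n^'n"
  assumes "symmetric_body X D c" "symmetric_body X\<^sub>0 ((*v) T\<^sub>0 ` D) c\<^sub>0"
    and T: "invertible T" and T\<^sub>0: "invertible T\<^sub>0"
    and F: "\<And>\<Omega>. convex_open \<Omega> \<Longrightarrow> \<Omega> \<noteq> {} \<Longrightarrow> form_domain \<Omega> (F \<Omega>)"
    and pullback: "\<And>\<Omega> A b u. bdd_open \<Omega> \<Longrightarrow> invertible A \<Longrightarrow> u \<in> F (aff A b ` \<Omega>) \<Longrightarrow> (\<lambda>x. u (aff A b x)) \<in> F \<Omega>"
    and ev: "\<And>\<Omega> j. ev \<Omega> j = eigenvalue_seq \<Omega> (F \<Omega>) (j - 1)"
  shows "Q ev D n T \<le> Q ev D n T\<^sub>0"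
proof -
  interpret D: symmetric_body X D c by fact
  interpret B: symmetric_body X\<^sub>0 "(*v) T\<^sub>0 ` D" c\<^sub>0 by fact
  obtain K where K: "K \<ge> 0" "\<And>v w. D.moment v w = K * (v \<bullet> w)" using D.ex_moment_constant by blast
  obtain K\<^sub>0 where K\<^sub>0: "K\<^sub>0 \<ge> 0" "\<And>v w. B.moment v w = K\<^sub>0 * (v \<bullet> w)" using B.ex_moment_constant by blast
  show ?thesis
  proof (cases "K = 0")
    case True
    \<comment> \<open>\<open>Q_eq\<close> divides by \<open>K\<close>, so here both values are 0;
      this spares a proof that the moment is positive.\<close>
    then show ?thesis by (simp add: D.Q_eq[OF T K(2)] D.Q_eq[OF T\<^sub>0 K(2)])
  next
    case False
    then have Kpos: "K > 0" using K(1) by simp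
    define N where "N = real CARD('n)"
    have N: "N > 0" by (simp add: N_def)
    define S where "S = matrix_inv T"
    define S\<^sub>0 where "S\<^sub>0 = matrix_inv T\<^sub>0"
    have S: "invertible S" unfolding S_def by (rule invertible_matrix_inv(1)[OF T])
    have S\<^sub>0: "invertible S\<^sub>0" unfolding S\<^sub>0_def by (rule invertible_matrix_inv(1)[OF T\<^sub>0])
    have TS: "T\<^sub>0 ** S\<^sub>0 = mat 1" "S\<^sub>0 ** T\<^sub>0 = mat 1"
      unfolding S\<^sub>0_def by (rule invertible_matrix_inv(2)[OF T\<^sub>0], rule invertible_matrix_inv(3)[OF T\<^sub>0])
    \<comment> \<open>The square of the similarity ratio of \<open>T\<^sub>0\<close>, read off by
      comparing the inertia constants of \<open>D\<close> and of its image.\<close>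
    define \<kappa> where "\<kappa> = K\<^sub>0 / (vscale T\<^sub>0 * K)"
    \<comment> \<open>Both sides are the centroid of the image: \<open>centroid_image\<close> at
      \<open>mat 1\<close> identifies the centre of a symmetric body with its centroid.\<close>
    have c\<^sub>0: "c\<^sub>0 = T\<^sub>0 *v c"
      using B.centroid_image[of "mat 1"] D.centroid_image[OF T\<^sub>0] by (simp add: image_comp o_def invertible_det_nz)
    have "B.moment v w = vscale T\<^sub>0 * D.moment (transpose T\<^sub>0 *v v) (transpose T\<^sub>0 *v w)" for v w
      unfolding B.moment_def D.moment_def unfolding c\<^sub>0
      using integral_aff[OF T\<^sub>0 D.sets_lebesgue, of 0 "\<lambda>x. (v \<bullet> (x - T\<^sub>0 *v c)) * (w \<bullet> (x - T\<^sub>0 *v c))"]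
      by (simp only: mult_matrix_eq_aff[symmetric] matrix_vector_mult_diff_distrib[symmetric] inner_transpose_left real_scaleR_def)
    then have "K\<^sub>0 * (v \<bullet> w) = vscale T\<^sub>0 * (K * ((transpose T\<^sub>0 *v v) \<bullet> (transpose T\<^sub>0 *v w)))" for v w
      unfolding K K\<^sub>0 .
    then have con: "(transpose T\<^sub>0 *v v) \<bullet> (transpose T\<^sub>0 *v w) = \<kappa> * (v \<bullet> w)" for v w
      using Kpos vscale_pos[OF T\<^sub>0] by (simp add: \<kappa>_def field_simps del: transpose_matrix_vector)
    have TT: "T\<^sub>0 *v (transpose T\<^sub>0 *v w) = \<kappa> *\<^sub>R w" for w
    proof -
      have "v \<bullet> (T\<^sub>0 *v (transpose T\<^sub>0 *v w)) = v \<bullet> (\<kappa> *\<^sub>R w)" for v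
        using con[of v w] inner_transpose_left[of T\<^sub>0 v "transpose T\<^sub>0 *v w"]
        by (simp del: transpose_matrix_vector)
      then have "\<forall>v. v \<bullet> (T\<^sub>0 *v (transpose T\<^sub>0 *v w)) = v \<bullet> (\<kappa> *\<^sub>R w)" by (rule allI)
      then show ?thesis by (simp only: vector_eq_ldot)
    qed
    have tr: "transpose T\<^sub>0 *v w = \<kappa> *\<^sub>R (S\<^sub>0 *v w)" for w
    proof -
      have "transpose T\<^sub>0 *v w = S\<^sub>0 *v (T\<^sub>0 *v (transpose T\<^sub>0 *v w))"
        by (simp add: matrix_vector_mul_assoc[of S\<^sub>0 T\<^sub>0] TS(2) del: transpose_matrix_vector)
      then show ?thesis unfolding TT matrix_vector_mult_scaleR .
    qed
    have hsT: "hs T\<^sub>0 = \<kappa> * N"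
    proof -
      have "hs T\<^sub>0 = hs (transpose T\<^sub>0)" by (simp add: hs_transpose)
      also have "\<dots> = (\<Sum>i\<in>(UNIV::'n set). \<kappa> * (axis i 1 \<bullet> (axis i 1 :: real^'n)))"
        unfolding hs_def power2_norm_eq_inner con ..
      finally show ?thesis by (simp add: inner_axis_axis N_def)
    qed
    then have \<kappa>: "\<kappa> > 0" using hs_pos[OF T\<^sub>0] N by (simp add: zero_less_mult_iff)
    have "hs T\<^sub>0 = hs (transpose T\<^sub>0)" by (simp add: hs_transpose)
    also have "\<dots> = \<kappa>\<^sup>2 * hs S\<^sub>0"
      unfolding hs_def tr by (simp add: power_mult_distrib sum_distrib_left)
    finally have hsS0: "hs S\<^sub>0 = N / \<kappa>"
      using \<kappa> hsT by (simp add: field_simps power2_eq_square)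
    have nrm: "(norm (T\<^sub>0 *v x))\<^sup>2 = \<kappa> * (norm x)\<^sup>2" for x
    proof -
      have "(norm (T\<^sub>0 *v x))\<^sup>2 = (transpose T\<^sub>0 *v (T\<^sub>0 *v x)) \<bullet> x"
        unfolding power2_norm_eq_inner inner_transpose_left ..
      also have "\<dots> = \<kappa> * (norm x)\<^sup>2"
        unfolding tr by (simp add: matrix_vector_mul_assoc TS(2) power2_norm_eq_inner)
      finally show ?thesis .
    qed
    have hsTS: "hs (T\<^sub>0 ** S) = \<kappa> * hs S"
      unfolding hs_def by (simp add: nrm sum_distrib_left flip: matrix_vector_mul_assoc)
    define L where "L = (\<Sum>j<n. eigenvalue_seq ((*v) T ` D) (F ((*v) T ` D)) j)"
    define L\<^sub>0 where "L\<^sub>0 = (\<Sum>j<n. eigenvalue_seq ((*v) T\<^sub>0 ` D) (F ((*v) T\<^sub>0 ` D)) j)"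
    \<comment> \<open>\<open>T ** S\<^sub>0\<close> takes the image under \<open>T\<^sub>0\<close>
      to the image under \<open>T\<close>. Its inverse \<open>T\<^sub>0 ** S\<close> has squared
      norm \<open>\<kappa> * hs S\<close> because \<open>T\<^sub>0\<close> is a similarity.\<close>
    have le: "L \<le> \<kappa> * hs S / N * L\<^sub>0"
    proof -
      have im: "(*v) (T ** S\<^sub>0) ` (*v) T\<^sub>0 ` D = (*v) T ` D"
        using TS(2) by (simp add: image_comp o_def matrix_vector_mul_assoc flip: matrix_mul_assoc)
      have "(T ** S\<^sub>0) ** (T\<^sub>0 ** S) = T ** ((S\<^sub>0 ** T\<^sub>0) ** S)" by (simp only: matrix_mul_assoc)
      also have "\<dots> = mat 1" using invertible_matrix_inv(2)[OF T] by (simp add: TS S_def)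
      finally have inv: "matrix_inv (T ** S\<^sub>0) = T\<^sub>0 ** S" by (rule matrix_inv_unique)
      have "(\<Sum>j<n. eigenvalue_seq ((*v) (T ** S\<^sub>0) ` (*v) T\<^sub>0 ` D) (F ((*v) (T ** S\<^sub>0) ` (*v) T\<^sub>0 ` D)) j)
        \<le> hs (matrix_inv (T ** S\<^sub>0)) / CARD('n) * (\<Sum>j<n. eigenvalue_seq ((*v) T\<^sub>0 ` D) (F ((*v) T\<^sub>0 ` D)) j)"
      proof (rule B.sum_eigenvalue_seq_le)
        show "invertible (T ** S\<^sub>0)" by (rule invertible_mult[OF T S\<^sub>0])
        show "form_domain \<Omega> (F \<Omega>)" if "convex_open \<Omega>" "\<Omega> \<noteq> {}" for \<Omega> by (rule F[OF that])
        show "(\<lambda>x. u (aff A b x)) \<in> F \<Omega>" if "bdd_open \<Omega>" "invertible A" "u \<in> F (aff A b ` \<Omega>)" for \<Omega> A b u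
          by (rule pullback[OF that])
      qed
      then show ?thesis unfolding im inv hsTS L_def L\<^sub>0_def N_def .
    qed
    define C where "C = (vol D * vol D) powr (2 / CARD('n)) * vol D / K"
    have C: "C \<ge> 0" using Kpos by (simp add: C_def)
    have ev_sum: "(\<Sum>j=1..n. ev \<Omega> j) = (\<Sum>j<n. eigenvalue_seq \<Omega> (F \<Omega>) j)" for \<Omega>
      by (simp add: ev sum.atLeast1_atMost_eq)
    have "Q ev D n T = L * C / hs S"
      unfolding D.Q_eq[OF T K(2)] ev_sum L_def C_def S_def ..
    also have "\<dots> \<le> (\<kappa> * hs S / N * L\<^sub>0) * C / hs S"
      using hs_pos[OF S] by (intro divide_right_mono mult_right_mono le C) simp
    \<comment> \<open>The value \<open>N / \<kappa>\<close> of \<open>hs S\<^sub>0\<close> makes the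
      estimate sharp at \<open>T\<^sub>0\<close>.\<close>
    also have "\<dots> = L\<^sub>0 * C / hs S\<^sub>0" using hs_pos[OF S] \<kappa> N by (simp add: hsS0)
    also have "\<dots> = Q ev D n T\<^sub>0"
      unfolding D.Q_eq[OF T\<^sub>0 K(2)] ev_sum L\<^sub>0_def C_def S\<^sub>0_def ..
    finally show ?thesis .
  qed
qed

section \<open>Balls, hypercubes and regular simplexes\<close>

lemma reflection_swap:
  fixes x y :: "real^'n::finite"
  assumes "norm x = norm y" "x \<noteq> y"
  shows "reflection (x - y) *v x = y" "reflection (x - y) *v y = x"
proof -
  have n: "x \<bullet> x = y \<bullet> y" using assms(1) by (simp add: norm_eq)
  have p: "(x - y) \<bullet> (x - y) \<noteq> 0" using assms(2) by simp
  have "2 * (x \<bullet> (x - y)) = (x - y) \<bullet> (x - y)" "2 * (y \<bullet> (x - y)) = - ((x - y) \<bullet> (x - y))"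
    using n by (simp_all add: inner_diff_left inner_diff_right inner_commute)
  then show "reflection (x - y) *v x = y" "reflection (x - y) *v y = x"
    unfolding reflection_apply using p by simp_all
qed

text \<open>One inclusion for every element of \<open>G\<close> suffices, since the transpose is the
  inverse and again belongs to \<open>G\<close>.\<close>

lemma (in reflection_set) symmetric_image_eqI:
  assumes "\<And>U x. U \<in> G \<Longrightarrow> x \<in> D \<Longrightarrow> c + U *v (x - c) \<in> D" and U: "U \<in> G"
  shows "aff U (c - U *v c) ` D = D"
proof -
  have a: "aff V (c - V *v c) x = c + V *v (x - c)" for V x
    by (simp add: aff_def matrix_vector_mult_diff_distrib)
  have o: "orthogonal_matrix U" using U by (simp add: G_def)
  show ?thesis
  proof
    show "aff U (c - U *v c) ` D \<subseteq> D" using assms by (auto simp: a)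
    show "D \<subseteq> aff U (c - U *v c) ` D"
    proof
      fix x assume "x \<in> D"
      then have "c + transpose U *v (x - c) \<in> D" by (rule assms(1)[OF transpose_G[OF U]])
      moreover have "aff U (c - U *v c) (c + transpose U *v (x - c)) = x"
        by (simp add: a orthogonal_matrix_cancel(1)[OF o] del: transpose_matrix_vector)
      ultimately show "x \<in> aff U (c - U *v c) ` D" by (metis imageI)
    qed
  qed
qed

text \<open>The vertices only, not the solid. For an orthogonal \<open>f\<close> they are the facet
  normals of a cube with edges along the \<open>f (axis i 1)\<close>.\<close>

definition cross_polytope :: "(real^'n \<Rightarrow> real^'n) \<Rightarrow> (real^'n::finite) set" where
  "cross_polytope f = (\<Union>i. {f (axis i 1), - f (axis i 1)})"

text \<open>Two vertices are equal, opposite or orthogonal. So the reflection in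
  \<open>x - y\<close> swaps \<open>x\<close> with \<open>y\<close> and their negatives with each
  other, and fixes every other vertex.\<close>

lemma reflection_set_cross_polytope:
  fixes f :: "real^'n::finite \<Rightarrow> real^'n"
  assumes f: "orthogonal_transformation f"
  shows "reflection_set (cross_polytope f)"
proof
  let ?X = "cross_polytope f"
  have lin: "linear f" using f by (simp add: orthogonal_transformation_def)
  have ff: "f (axis i 1) \<bullet> f (axis j 1) = of_bool (i = j)" for i j
    using f by (simp add: orthogonal_transformation_def inner_axis_axis)
  show fin: "finite ?X" by (simp add: cross_polytope_def)
  have n: "norm x = 1" if "x \<in> ?X" for x
    using that by (auto simp: cross_polytope_def norm_eq_sqrt_inner ff)
  then show "norm x = norm y" if "x \<in> ?X" "y \<in> ?X" for x y using that by simp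
  have neg: "- x \<in> ?X" if "x \<in> ?X" for x using that by (auto simp: cross_polytope_def)
  have cases: "y = x \<or> y = - x \<or> x \<bullet> y = 0" if xy: "x \<in> ?X" "y \<in> ?X" for x y
  proof -
    obtain i where i: "x = f (axis i 1) \<or> x = - f (axis i 1)" using xy(1) unfolding cross_polytope_def by blast
    obtain j where j: "y = f (axis j 1) \<or> y = - f (axis j 1)" using xy(2) unfolding cross_polytope_def by blast
    show ?thesis
    proof (cases "i = j")
      case True
      then show ?thesis using i j by auto
    next
      case False
      then have "f (axis i 1) \<bullet> f (axis j 1) = 0" by (simp add: ff)
      then have "x \<bullet> y = 0" using i j by auto
      then show ?thesis by simp
    qed
  qed
  show "reflection (x - y) *v z \<in> ?X" if xyz: "x \<in> ?X" "y \<in> ?X" "x \<noteq> y" "z \<in> ?X" for x y z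
  proof -
    have nxy: "norm x = norm y" using n xyz by simp
    note swap = reflection_swap[OF nxy xyz(3)]
    have m: "reflection (x - y) *v (- a) = - (reflection (x - y) *v a)" for a
      using matrix_vector_mult_diff_distrib[of "reflection (x - y)" 0 a] by simp
    consider "z = x" | "z = - x" | "z = y" | "z = - y" | "x \<bullet> z = 0" "y \<bullet> z = 0"
      using cases[OF xyz(1,4)] cases[OF xyz(2,4)] by blast
    then show ?thesis
    proof cases
      case 5
      then have "z \<bullet> (x - y) = 0" by (simp add: inner_diff_right inner_commute)
      then show ?thesis by (simp add: reflection_orthogonal_eq xyz(4))
    qed (use swap neg xyz m in simp_all)
  qed
  show "span {x - y |x y. x \<in> ?X \<and> y \<in> ?X} = UNIV" (is "span ?E = UNIV")
  proof -
    have b: "f (axis i 1) \<in> span ?E" for i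
    proof -
      have "f (axis i 1) - (- f (axis i 1)) \<in> ?E" unfolding cross_polytope_def by blast
      then have "(1/2) *\<^sub>R (f (axis i 1) - (- f (axis i 1))) \<in> span ?E" by (intro span_mul span_base)
      also have "f (axis i 1) - (- f (axis i 1)) = 2 *\<^sub>R f (axis i 1)" by (simp add: scaleR_2)
      finally show ?thesis by simp
    qed
    have "x \<in> span ?E" for x
    proof -
      obtain z where x: "x = f z" using orthogonal_transformation_surj[OF f] by (metis surjD)
      have "z = (\<Sum>i\<in>UNIV. (z $ i) *\<^sub>R axis i 1)"
        using basis_expansion[of z] by (simp add: scalar_mult_eq_scaleR)
      then have "x = (\<Sum>i\<in>UNIV. (z $ i) *\<^sub>R f (axis i 1))"
        using x linear_sum[OF lin, of "\<lambda>i. (z $ i) *\<^sub>R axis i 1" UNIV] by (simp add: linear_scale[OF lin])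
      also have "\<dots> \<in> span ?E" by (intro span_sum span_mul b)
      finally show ?thesis .
    qed
    then show ?thesis by blast
  qed
qed

text \<open>The orthogonal group is infinite, but each of its subgroups preserves the ball about its
  centre; the finite group of a cross polytope already averages quadratic forms to multiples of the
  identity.\<close>

lemma symmetric_body_ball:
  fixes D :: "(real^'n::finite) set"
  assumes "solid_ball D"
  shows "\<exists>X c. symmetric_body X D c"
proof -
  obtain c r where r: "r > 0" and D: "D = ball c r" using assms by (auto simp: solid_ball_def)
  interpret reflection_set "cross_polytope (\<lambda>x::real^'n. x)"
    by (rule reflection_set_cross_polytope) (simp add: orthogonal_transformation)
  have "symmetric_body (cross_polytope (\<lambda>x::real^'n. x)) D c"
  proof
    show "open D" "bounded D" "convex D" "D \<noteq> {}" using r by (simp_all add: D)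
    show "aff U (c - U *v c) ` D = D" if "U \<in> G" for U
    proof (rule symmetric_image_eqI[OF _ that])
      fix V x assume "V \<in> G" "x \<in> D"
      then show "c + V *v (x - c) \<in> D"
        by (simp add: D G_def dist_norm orthogonal_matrix_norm norm_minus_commute)
    qed
  qed
  then show ?thesis by blast
qed

text \<open>The cube is written as an intersection of half-spaces indexed by its facet normals, the
  vertices of a cross polytope. Symmetries permute the normals and hence the half-spaces.\<close>

lemma symmetric_body_hypercube:
  fixes D :: "(real^'n::finite) set"
  assumes "hypercube D"
  shows "\<exists>X c. symmetric_body X D c"
proof -
  obtain a f s where f: "orthogonal_transformation f" and s: "s > 0"
    and D: "D = (\<lambda>x. a + f x) ` box (vec 0) (vec s :: real^'n)" using assms by (auto simp: hypercube_def)
  have lin: "linear f" using f by (simp add: orthogonal_transformation_def)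
  interpret reflection_set "cross_polytope f" by (rule reflection_set_cross_polytope[OF f])
  define c where "c = a + f (vec (s / 2))"
  have D': "D = (\<Inter>e\<in>cross_polytope f. {x. e \<bullet> x < s / 2 + e \<bullet> c})"
  proof (rule set_eqI)
    fix x
    obtain z where z: "f z = x - a" using orthogonal_transformation_surj[OF f] by (metis surjD)
    then have x: "x = a + f z" by simp
    have "x \<in> D \<longleftrightarrow> z \<in> box (vec 0) (vec s)"
    proof -
      have "inj (\<lambda>x. a + f x)"
        using orthogonal_transformation_inj[OF f] by (simp add: inj_def)
      then show ?thesis unfolding D x by (rule inj_image_mem_iff)
    qed
    also have "\<dots> \<longleftrightarrow> (\<forall>i. 0 < z $ i \<and> z $ i < s)" by (simp add: mem_box_cart)
    also have "\<dots> \<longleftrightarrow> (\<forall>i. f (axis i 1) \<bullet> (x - c) < s / 2 \<and> - f (axis i 1) \<bullet> (x - c) < s / 2)"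
    proof -
      have "x - c = f (z - vec (s / 2))" by (simp add: x c_def linear_diff[OF lin])
      then have e: "f (axis i 1) \<bullet> (x - c) = z $ i - s / 2" for i
        using f by (simp add: orthogonal_transformation_def inner_axis')
      show ?thesis unfolding inner_minus_left e by (intro iff_allI) auto
    qed
    also have "\<dots> \<longleftrightarrow> x \<in> (\<Inter>e\<in>cross_polytope f. {x. e \<bullet> x < s / 2 + e \<bullet> c})"
    proof -
      have "e \<bullet> (x - c) < s / 2 \<longleftrightarrow> e \<bullet> x < s / 2 + e \<bullet> c" for e by (simp only: inner_diff_right diff_less_eq)
      then show ?thesis unfolding cross_polytope_def by blast
    qed
    finally show "x \<in> D \<longleftrightarrow> x \<in> (\<Inter>e\<in>cross_polytope f. {x. e \<bullet> x < s / 2 + e \<bullet> c})" .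
  qed
  have "symmetric_body (cross_polytope f) D c"
  proof
    show "open D" unfolding D' by (intro open_INT fin ballI open_halfspace_lt)
    show "convex D" unfolding D' by (intro convex_INT convex_halfspace_lt)
    have "D = (+) a ` f ` box (vec 0) (vec s)" by (simp add: D image_comp o_def)
    then show "bounded D"
      using lin by (simp add: bounded_translation bounded_linear_image linear_conv_bounded_linear)
    have "vec (s / 2) \<in> box (vec 0) (vec s :: real^'n)" using s by (simp add: mem_box_cart)
    then show "D \<noteq> {}" unfolding D by blast
    show "aff U (c - U *v c) ` D = D" if "U \<in> G" for U
    proof (rule symmetric_image_eqI[OF _ that])
      fix V x assume V: "V \<in> G" and x: "x \<in> D"
      have "e \<bullet> (c + V *v (x - c)) < s / 2 + e \<bullet> c" if e: "e \<in> cross_polytope f" for e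
      proof -
        have "transpose V *v e \<in> cross_polytope f" using transpose_G[OF V] e unfolding G_def by blast
        then have "(transpose V *v e) \<bullet> x < s / 2 + (transpose V *v e) \<bullet> c" using x unfolding D' by blast
        then have "(transpose V *v e) \<bullet> (x - c) < s / 2" unfolding inner_diff_right by linarith
        then show ?thesis unfolding inner_transpose_left inner_add_right by linarith
      qed
      then show "c + V *v (x - c) \<in> D" unfolding D' by blast
    qed
  qed
  then show ?thesis by blast
qed

text \<open>With the mean \<open>c\<close> of the vertices as centre, equidistance makes
  \<open>r - c\<close> orthogonal to \<open>p - q\<close> for distinct vertices \<open>p\<close>,
  \<open>q\<close>, \<open>r\<close>; thus the reflection swapping two vertices fixes all
  others.\<close>

lemma symmetric_body_simplex:
  fixes D :: "(real^'n::finite) set"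
  assumes "regular_simplex D"
  shows "\<exists>X c. symmetric_body X D c"
proof -
  obtain C s where ind: "\<not> affine_dependent C" and card: "card C = CARD('n) + 1"
    and dist: "\<And>x y. x \<in> C \<Longrightarrow> y \<in> C \<Longrightarrow> x \<noteq> y \<Longrightarrow> dist x y = s"
    and D: "D = interior (convex hull C)" using assms by (auto simp: regular_simplex_def)
  have finC: "finite C" using card by (simp add: card_ge_0_finite)
  define c where "c = (1 / card C) *\<^sub>R \<Sum>C"
  have perp: "2 * (r \<bullet> (p - q)) = p \<bullet> p - q \<bullet> q" if "p \<in> C" "q \<in> C" "r \<in> C" "r \<noteq> p" "r \<noteq> q" for p q r
  proof -
    have "norm (r - p) = norm (r - q)" using dist[of r p] dist[of r q] that by (simp add: dist_norm)
    then have "(r - p) \<bullet> (r - p) = (r - q) \<bullet> (r - q)" by (simp add: norm_eq)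
    then show ?thesis by (simp add: inner_diff_left inner_diff_right inner_commute)
  qed
  have c: "2 * (c \<bullet> (p - q)) = p \<bullet> p - q \<bullet> q" if pq: "p \<in> C" "q \<in> C" "p \<noteq> q" for p q
  proof -
    \<comment> \<open>\<open>g r\<close> vanishes at every vertex other than \<open>p\<close> and
      \<open>q\<close>, and \<open>g p\<close> and \<open>g q\<close> cancel; summing over
      \<open>C\<close> gives the claim for the mean.\<close>
    define g where "g r = 2 * (r \<bullet> (p - q)) - (p \<bullet> p - q \<bullet> q)" for r
    have "sum g C = sum g {p, q}"
      using finC pq perp[OF pq(1,2)] by (intro sum.mono_neutral_right) (auto simp: g_def)
    also have "\<dots> = 0" using pq(3) by (simp add: g_def inner_diff_right inner_commute)
    finally have "sum g C = 0" .
    moreover have "sum g C = 2 * (\<Sum>C \<bullet> (p - q)) - card C * (p \<bullet> p - q \<bullet> q)"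
      by (simp only: g_def[abs_def] sum_subtractf inner_sum_left sum_distrib_left sum_constant right_diff_distrib)
    moreover have k: "real (card C) > 0" using card by simp
    moreover have "\<Sum>C \<bullet> (p - q) = card C * (c \<bullet> (p - q))" using k by (simp add: c_def)
    ultimately have "real (card C) * (2 * (c \<bullet> (p - q))) = real (card C) * (p \<bullet> p - q \<bullet> q)" by linarith
    then show ?thesis using k by simp
  qed
  define X where "X = (\<lambda>p. p - c) ` C"
  have nrm: "norm (p - c) = norm (q - c)" if "p \<in> C" "q \<in> C" for p q
  proof (cases "p = q")
    case False
    show ?thesis
      using c[OF that False] by (simp add: norm_eq inner_diff_left inner_diff_right inner_commute)
  qed simp
  interpret reflection_set X
  proof
    show "finite X" using finC by (simp add: X_def)
    show "norm x = norm y" if "x \<in> X" "y \<in> X" for x y using that nrm by (auto simp: X_def)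
    show "span {x - y |x y. x \<in> X \<and> y \<in> X} = UNIV" (is "span ?E = UNIV")
    proof -
      have "C \<noteq> {}" using card by auto
      then obtain p where p: "p \<in> C" by blast
      \<comment> \<open>Edge vectors from one vertex: independent and as many as the dimension,
        hence a basis.\<close>
      define B where "B = (\<lambda>x. - p + x) ` (C - {p})"
      have "card B = CARD('n)" unfolding B_def using card p finC by (subst card_image) auto
      moreover have "independent B" using affine_dependent_iff_dependent2[OF p] ind by (simp add: B_def)
      ultimately have "UNIV \<subseteq> span B" by (intro card_ge_dim_independent) (simp_all add: dim_UNIV)
      moreover have "B \<subseteq> ?E"
      proof
        fix e assume "e \<in> B"
        then obtain q where "q \<in> C" "e = (q - c) - (p - c)" by (auto simp: B_def)
        then show "e \<in> ?E" using p unfolding X_def by blast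
      qed
      ultimately show ?thesis using span_mono by blast
    qed
    show "reflection (x - y) *v z \<in> X" if xyz: "x \<in> X" "y \<in> X" "x \<noteq> y" "z \<in> X" for x y z
    proof -
      obtain p where p: "x = p - c" "p \<in> C" using xyz(1) unfolding X_def by (rule imageE)
      obtain q where q: "y = q - c" "q \<in> C" using xyz(2) unfolding X_def by (rule imageE)
      obtain r where r: "z = r - c" "r \<in> C" using xyz(4) unfolding X_def by (rule imageE)
      have "norm x = norm y" unfolding p(1) q(1) by (rule nrm[OF p(2) q(2)])
      note swap = reflection_swap[OF this xyz(3)]
      consider "r = p" | "r = q" | "r \<noteq> p" "r \<noteq> q" by blast
      then show ?thesis
      proof cases
        case 1
        then have "z = x" by (simp only: p(1) r(1))
        then show ?thesis by (simp only: swap xyz(2))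
      next
        case 2
        then have "z = y" by (simp only: q(1) r(1))
        then show ?thesis by (simp only: swap xyz(1))
      next
        case 3
        have xy: "x - y = p - q" by (simp add: p(1) q(1))
        have "p \<noteq> q" using xyz(3) by (auto simp only: p(1) q(1))
        then have "z \<bullet> (x - y) = 0"
          using perp[OF p(2) q(2) r(2) 3] c[OF p(2) q(2)] unfolding xy r(1) inner_diff_left by linarith
        then show ?thesis using xyz(4) by (simp only: reflection_orthogonal_eq)
      qed
    qed
  qed
  have "symmetric_body X D c"
  proof
    show "open D" "convex D" by (simp_all add: D convex_interior)
    show "bounded D"
      unfolding D by (intro bounded_interior bounded_convex_hull finite_imp_bounded finC)
    show "D \<noteq> {}" using interior_convex_hull_eq_empty[of C] card ind by (simp add: D)
    show "aff U (c - U *v c) ` D = D" if U: "U \<in> G" for U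
    proof -
      have o: "orthogonal_matrix U" and UX: "(*v) U ` X = X" using U by (simp_all add: G_def)
      define b where "b = c - U *v c"
      have im: "aff U b ` S = (+) b ` (*v) U ` S" for S by (simp add: aff_def image_comp o_def add.commute)
      have inj: "inj ((*v) U)"
        by (rule inj_on_inverseI[where g = "(*v) (transpose U)"]) (rule orthogonal_matrix_cancel(2)[OF o])
      have "aff U b ` C = (\<lambda>x. x + c) ` (*v) U ` X"
        unfolding X_def b_def by (simp add: aff_def image_comp o_def matrix_vector_mult_diff_distrib algebra_simps)
      also have "\<dots> = C" unfolding UX by (simp add: X_def image_comp o_def)
      finally have C: "(+) b ` (*v) U ` C = C" unfolding im .
      have "aff U b ` D = interior (convex hull ((+) b ` (*v) U ` C))"
        unfolding im D convex_hull_translation interior_translation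
          convex_hull_linear_image[OF matrix_vector_mul_linear, symmetric]
          interior_injective_linear_image[OF matrix_vector_mul_linear inj] ..
      then show ?thesis unfolding C b_def[symmetric] D .
    qed
  qed
  then show ?thesis by blast
qed

theorem corollary3p3:
  fixes D :: "(real^'n::finite) set"
    and shape :: "(real^'n) set \<Rightarrow> bool"
    and T T\<^sub>0 :: "real^'n^'n"
    and n :: nat
  assumes "CARD('n) \<ge> 2"
    and "n \<ge> 1"
    and "shape \<in> {regular_simplex, hypercube, solid_ball}"
    and "shape D"
    and "invertible T"
    and "invertible T\<^sub>0"
    and "shape ((*v) T\<^sub>0 ` D)"
  shows "Q dirichlet_eigenvalue D n T \<le> Q dirichlet_eigenvalue D n T\<^sub>0
    \<and> Q neumann_eigenvalue D n T \<le> Q neumann_eigenvalue D n T\<^sub>0"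
proof -
  have shapes: "\<exists>X c. symmetric_body X E c" if "shape E" for E
    using assms(3) that symmetric_body_simplex symmetric_body_hypercube symmetric_body_ball by blast
  obtain X c where D: "symmetric_body X D c" using shapes[OF assms(4)] by (elim exE)
  obtain X\<^sub>0 c\<^sub>0 where D\<^sub>0: "symmetric_body X\<^sub>0 ((*v) T\<^sub>0 ` D) c\<^sub>0" using shapes[OF assms(7)] by (elim exE)
  \<comment> \<open>The boundary condition enters only through the form domain, which has to be a
    closed subspace of \<open>H1\<close> containing the test functions and to be preserved by affine
    substitution.\<close>
  note maximal = symmetric_body_maximal[OF D D\<^sub>0 assms(5,6)]
  show ?thesis
  proof
    show "Q dirichlet_eigenvalue D n T \<le> Q dirichlet_eigenvalue D n T\<^sub>0"
    proof (rule maximal[where F = H10])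
      show "form_domain \<Omega> (H10 \<Omega>)" if "convex_open \<Omega>" "\<Omega> \<noteq> {}" for \<Omega> :: "(real^'n) set"
        by (rule convex_open.form_domain_H10[OF that])
    qed (rule H10_aff, assumption+, rule dirichlet_eigenvalue_def)
    show "Q neumann_eigenvalue D n T \<le> Q neumann_eigenvalue D n T\<^sub>0"
    proof (rule maximal[where F = H1])
      show "form_domain \<Omega> (H1 \<Omega>)" if "convex_open \<Omega>" "\<Omega> \<noteq> {}" for \<Omega> :: "(real^'n) set"
        by (rule convex_open.form_domain_H1[OF that])
    qed (rule H1_aff(1), assumption+, rule neumann_eigenvalue_def)
  qed
qed

end
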